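(* Let $k$ be a field of characteristic zero, and let $A$ be a graded finite dimensional $k$-algebra with $A_0=k$. If $A$ has infinite global dimension, then $\operatorname{hhdim} A=\infty$.
   Context: $k$ is not assumed algebraically closed. Graded means positively graded: $A=A_0\oplus A_1\oplus\cdots\oplus A_s$ with $A_iA_j\subseteq A_{i+j}$. The Hochschild homology of $A$ is $\operatorname{HH}_*(A)=\operatorname{Tor}_*^{A^{e}}(A,A)$, where $A^{e}=A\otimes_k A^{\mathrm{op}}$, and $\operatorname{hhdim}A=\sup\{n\in\mathbb Z\mid \operatorname{HH}_n(A)\ne 0\}$. *)

theory Defs
  imports
    "HOL-Algebra.Module"
    "HOL-Algebra.QuotRing"
    "HOL-Algebra.Generated_Groups"
    "HOL-Algebra.Elementary_Groups"
    "HOL-Algebra.Free_Abelian_Groups"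
    "HOL-Library.Extended_Nat"
begin

section \<open>Algebras over a field and gradings\<close>

text \<open>The library locale \<^verbatim>\<open>algebra\<close> requires a commutative multiplication; here the
  algebra is only a ring, so compatibility of the scalars is needed on both sides.\<close>

locale assoc_algebra = Module.module R M + ring M for R (structure) and M (structure) +
  assumes smult_mult_left:
      "\<lbrakk> a \<in> carrier R; x \<in> carrier M; y \<in> carrier M \<rbrakk> \<Longrightarrow>
       (a \<odot>\<^bsub>M\<^esub> x) \<otimes>\<^bsub>M\<^esub> y = a \<odot>\<^bsub>M\<^esub> (x \<otimes>\<^bsub>M\<^esub> y)"
    and smult_mult_right:
      "\<lbrakk> a \<in> carrier R; x \<in> carrier M; y \<in> carrier M \<rbrakk> \<Longrightarrow>
       x \<otimes>\<^bsub>M\<^esub> (a \<odot>\<^bsub>M\<^esub> y) = a \<odot>\<^bsub>M\<^esub> (x \<otimes>\<^bsub>M\<^esub> y)"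

definition finitely_spanned :: "('k, 'x) ring_scheme \<Rightarrow> ('k, 'a, 'y) module_scheme \<Rightarrow> bool"
  where "finitely_spanned K M \<longleftrightarrow>
    (\<exists>B. finite B \<and> B \<subseteq> carrier M \<and>
      (\<forall>x \<in> carrier M. \<exists>c \<in> B \<rightarrow> carrier K. x = (\<Oplus>\<^bsub>M\<^esub>b\<in>B. c b \<odot>\<^bsub>M\<^esub> b)))"

definition char_zero :: "('k, 'x) ring_scheme \<Rightarrow> bool"
  where "char_zero K \<longleftrightarrow> (\<forall>n::nat. n > 0 \<longrightarrow> [n] \<cdot>\<^bsub>K\<^esub> \<one>\<^bsub>K\<^esub> \<noteq> \<zero>\<^bsub>K\<^esub>)"

text \<open>\<open>A = G 0 \<oplus> \<dots> \<oplus> G s\<close>, with \<open>G i = 0\<close> for \<open>i > s\<close>.\<close>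

definition graded_algebra ::
    "('k, 'x) ring_scheme \<Rightarrow> ('k, 'a, 'y) module_scheme \<Rightarrow> (nat \<Rightarrow> 'a set) \<Rightarrow> nat \<Rightarrow> bool"
  where "graded_algebra K A G s \<longleftrightarrow>
    (\<forall>i. submodule (G i) K A) \<and>
    (\<forall>i > s. G i = {\<zero>\<^bsub>A\<^esub>}) \<and>
    (\<forall>x \<in> carrier A. \<exists>!f. f \<in> (\<Pi>\<^sub>E i\<in>{..s}. G i) \<and> x = (\<Oplus>\<^bsub>A\<^esub>i\<in>{..s}. f i)) \<and>
    (\<forall>i j. \<forall>x \<in> G i. \<forall>y \<in> G j. x \<otimes>\<^bsub>A\<^esub> y \<in> G (i + j))"


section \<open>Modules over noncommutative rings\<close>

text \<open>The library locale \<^verbatim>\<open>module\<close> requires a commutative ring of scalars. The fields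
  \<^verbatim>\<open>mult\<close> and \<^verbatim>\<open>one\<close> of a module record play no role.\<close>

locale left_module = R?: ring R + M?: abelian_group M for R (structure) and M (structure) +
  assumes smult_closed:
      "\<lbrakk> a \<in> carrier R; x \<in> carrier M \<rbrakk> \<Longrightarrow> a \<odot>\<^bsub>M\<^esub> x \<in> carrier M"
    and smult_l_distr:
      "\<lbrakk> a \<in> carrier R; b \<in> carrier R; x \<in> carrier M \<rbrakk> \<Longrightarrow>
       (a \<oplus> b) \<odot>\<^bsub>M\<^esub> x = a \<odot>\<^bsub>M\<^esub> x \<oplus>\<^bsub>M\<^esub> b \<odot>\<^bsub>M\<^esub> x"
    and smult_r_distr:
      "\<lbrakk> a \<in> carrier R; x \<in> carrier M; y \<in> carrier M \<rbrakk> \<Longrightarrow>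
       a \<odot>\<^bsub>M\<^esub> (x \<oplus>\<^bsub>M\<^esub> y) = a \<odot>\<^bsub>M\<^esub> x \<oplus>\<^bsub>M\<^esub> a \<odot>\<^bsub>M\<^esub> y"
    and smult_assoc:
      "\<lbrakk> a \<in> carrier R; b \<in> carrier R; x \<in> carrier M \<rbrakk> \<Longrightarrow>
       (a \<otimes> b) \<odot>\<^bsub>M\<^esub> x = a \<odot>\<^bsub>M\<^esub> (b \<odot>\<^bsub>M\<^esub> x)"
    and smult_one:
      "x \<in> carrier M \<Longrightarrow> \<one> \<odot>\<^bsub>M\<^esub> x = x"

definition op_ring :: "('r, 'x) ring_scheme \<Rightarrow> ('r, 'x) ring_scheme"
  where "op_ring R = R\<lparr>mult := (\<lambda>x y. y \<otimes>\<^bsub>R\<^esub> x)\<rparr>"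

text \<open>A right \<open>R\<close>-module is a left module over \<^term>\<open>op_ring R\<close>: the scalar \<open>r \<odot> x\<close> then
  stands for \<open>x \<cdot> r\<close>.\<close>

definition lmod_hom ::
    "('r, 'x) ring_scheme \<Rightarrow> ('r, 'm, 'y) module_scheme \<Rightarrow> ('r, 'n, 'z) module_scheme \<Rightarrow> ('m \<Rightarrow> 'n) set"
  where "lmod_hom R M N = {f \<in> carrier M \<rightarrow> carrier N.
    (\<forall>x \<in> carrier M. \<forall>y \<in> carrier M. f (x \<oplus>\<^bsub>M\<^esub> y) = f x \<oplus>\<^bsub>N\<^esub> f y) \<and>
    (\<forall>r \<in> carrier R. \<forall>x \<in> carrier M. f (r \<odot>\<^bsub>M\<^esub> x) = r \<odot>\<^bsub>N\<^esub> f x)}"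


section \<open>Projective resolutions and global dimension\<close>

text \<open>HOL cannot quantify over all types, so modules are taken with carrier a subset of a type
  \<open>'u\<close>, a universe. If \<open>'u\<close> is infinite and at least as large as the ring, then the universe is
  closed under forming free modules on its members and every module no larger than \<open>'u\<close> has a
  projective resolution in it; projectivity, projective dimension, global dimension and \<open>Tor\<close>
  then do not depend on \<open>'u\<close>.\<close>

definition projective_module :: "('r, 'x) ring_scheme \<Rightarrow> ('r, 'u) module \<Rightarrow> bool"
  where "projective_module R P \<longleftrightarrow> left_module R P \<and>
    (\<forall>(M :: ('r, 'u) module) (N :: ('r, 'u) module) g f.
      left_module R M \<and> left_module R N \<and>
      g \<in> lmod_hom R M N \<and> g ` carrier M = carrier N \<and> f \<in> lmod_hom R P N \<longrightarrow>
      (\<exists>h \<in> lmod_hom R P M. \<forall>x \<in> carrier P. g (h x) = f x))"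

text \<open>\<open>\<dots> \<rightarrow> P 2 \<rightarrow> P 1 \<rightarrow> P 0 \<rightarrow> M \<rightarrow> 0\<close> with \<open>d n : P (Suc n) \<rightarrow> P n\<close> and augmentation \<open>e\<close>.\<close>

definition projective_resolution ::
    "('r, 'x) ring_scheme \<Rightarrow> ('r, 'm, 'y) module_scheme \<Rightarrow>
     (nat \<Rightarrow> ('r, 'u) module) \<Rightarrow> (nat \<Rightarrow> 'u \<Rightarrow> 'u) \<Rightarrow> ('u \<Rightarrow> 'm) \<Rightarrow> bool"
  where "projective_resolution R M P d e \<longleftrightarrow>
    (\<forall>n. projective_module R (P n)) \<and>
    (\<forall>n. d n \<in> lmod_hom R (P (Suc n)) (P n)) \<and>
    e \<in> lmod_hom R (P 0) M \<and>
    e ` carrier (P 0) = carrier M \<and>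
    d 0 ` carrier (P 1) = {x \<in> carrier (P 0). e x = \<zero>\<^bsub>M\<^esub>} \<and>
    (\<forall>n. d (Suc n) ` carrier (P (Suc (Suc n))) =
      {x \<in> carrier (P (Suc n)). d n x = \<zero>\<^bsub>P n\<^esub>})"

definition projdim :: "('r, 'x) ring_scheme \<Rightarrow> ('r, 'u) module \<Rightarrow> enat"
  where "projdim R M = Inf {enat n | n.
    \<exists>(P :: nat \<Rightarrow> ('r, 'u) module) d e.
      projective_resolution R M P d e \<and> (\<forall>i > n. carrier (P i) = {\<zero>\<^bsub>P i\<^esub>})}"

definition gldim :: "'u itself \<Rightarrow> ('r, 'x) ring_scheme \<Rightarrow> enat"
  where "gldim _ R = Sup {projdim R M | M :: ('r, 'u) module. left_module R M}"


section \<open>Tensor products\<close>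

text \<open>\<open>M \<otimes>\<^sub>R N\<close> for a right module \<open>M\<close> and a left module \<open>N\<close>: the free abelian group on
  \<open>M \<times> N\<close> modulo the subgroup generated by the bilinearity and balancing relations.\<close>

definition tensor_rels ::
    "('r, 'x) ring_scheme \<Rightarrow> ('r, 'm, 'y) module_scheme \<Rightarrow> ('r, 'n, 'z) module_scheme \<Rightarrow>
     ('m \<times> 'n \<Rightarrow>\<^sub>0 int) set"
  where "tensor_rels R M N =
    {frag_of (x \<oplus>\<^bsub>M\<^esub> x', y) - frag_of (x, y) - frag_of (x', y) | x x' y.
       x \<in> carrier M \<and> x' \<in> carrier M \<and> y \<in> carrier N} \<union>
    {frag_of (x, y \<oplus>\<^bsub>N\<^esub> y') - frag_of (x, y) - frag_of (x, y') | x y y'.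
       x \<in> carrier M \<and> y \<in> carrier N \<and> y' \<in> carrier N} \<union>
    {frag_of (r \<odot>\<^bsub>M\<^esub> x, y) - frag_of (x, r \<odot>\<^bsub>N\<^esub> y) | r x y.
       r \<in> carrier R \<and> x \<in> carrier M \<and> y \<in> carrier N}"

definition tensor_null ::
    "('r, 'x) ring_scheme \<Rightarrow> ('r, 'm, 'y) module_scheme \<Rightarrow> ('r, 'n, 'z) module_scheme \<Rightarrow>
     ('m \<times> 'n \<Rightarrow>\<^sub>0 int) set"
  where "tensor_null R M N =
    generate (free_Abelian_group (carrier M \<times> carrier N)) (tensor_rels R M N)"

definition tensor_product ::
    "('r, 'x) ring_scheme \<Rightarrow> ('r, 'm, 'y) module_scheme \<Rightarrow> ('r, 'n, 'z) module_scheme \<Rightarrow>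
     ('m \<times> 'n \<Rightarrow>\<^sub>0 int) set monoid"
  where "tensor_product R M N =
    free_Abelian_group (carrier M \<times> carrier N) Mod tensor_null R M N"

text \<open>The map \<open>M \<otimes>\<^sub>R N \<rightarrow> M \<otimes>\<^sub>R N'\<close> induced by a module homomorphism \<open>f : N \<rightarrow> N'\<close>.\<close>

definition tensor_map ::
    "('r, 'x) ring_scheme \<Rightarrow> ('r, 'm, 'y) module_scheme \<Rightarrow> ('r, 'n', 'z) module_scheme \<Rightarrow>
     ('n \<Rightarrow> 'n') \<Rightarrow> ('m \<times> 'n \<Rightarrow>\<^sub>0 int) set \<Rightarrow> ('m \<times> 'n' \<Rightarrow>\<^sub>0 int) set"
  where "tensor_map R M N' f X =
    the_elem ((\<lambda>p. tensor_null R M N' #>\<^bsub>free_Abelian_group (carrier M \<times> carrier N')\<^esub>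
                    frag_extend (\<lambda>(x, y). frag_of (x, f y)) p) ` X)"


section \<open>Tor\<close>

text \<open>Homology of \<open>\<dots> \<rightarrow> C 2 \<rightarrow> C 1 \<rightarrow> C 0 \<rightarrow> 0\<close> with \<open>\<delta> n : C (Suc n) \<rightarrow> C n\<close>.\<close>

definition cycles :: "(nat \<Rightarrow> 'c monoid) \<Rightarrow> (nat \<Rightarrow> 'c \<Rightarrow> 'c) \<Rightarrow> nat \<Rightarrow> 'c set"
  where "cycles C \<delta> n =
    (case n of 0 \<Rightarrow> carrier (C 0) | Suc m \<Rightarrow> kernel (C (Suc m)) (C m) (\<delta> m))"

definition homology :: "(nat \<Rightarrow> 'c monoid) \<Rightarrow> (nat \<Rightarrow> 'c \<Rightarrow> 'c) \<Rightarrow> nat \<Rightarrow> 'c set monoid"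
  where "homology C \<delta> n =
    (C n)\<lparr>carrier := cycles C \<delta> n\<rparr> Mod (\<delta> n ` carrier (C (Suc n)))"

definition Tor ::
    "'u itself \<Rightarrow> ('r, 'x) ring_scheme \<Rightarrow> ('r, 'm, 'y) module_scheme \<Rightarrow> ('r, 'n, 'z) module_scheme \<Rightarrow>
     nat \<Rightarrow> ('m \<times> 'u \<Rightarrow>\<^sub>0 int) set set monoid"
  where "Tor _ R M N n =
    (let (P, d, e) = (SOME (P, d, e). projective_resolution R N
            (P :: nat \<Rightarrow> ('r, 'u) module) (d :: nat \<Rightarrow> 'u \<Rightarrow> 'u) e)
     in homology (\<lambda>i. tensor_product R M (P i)) (\<lambda>i. tensor_map R M (P i) (d i)) n)"


section \<open>Enveloping algebra and Hochschild homology\<close>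

text \<open>The ring \<open>A \<otimes>\<^sub>K B\<close>, with \<open>(a \<otimes> b) (a' \<otimes> b') = a a' \<otimes> b b'\<close>, is the quotient by
  \<^const>\<open>tensor_null\<close> of the integral monoid ring of the multiplicative monoid of \<open>A \<times> B\<close>.\<close>

definition pair_monoid_ring ::
    "('a, 'x) ring_scheme \<Rightarrow> ('b, 'y) ring_scheme \<Rightarrow> ('a \<times> 'b \<Rightarrow>\<^sub>0 int) ring"
  where "pair_monoid_ring A B =
    \<lparr>carrier = carrier (free_Abelian_group (carrier A \<times> carrier B)),
     mult = (\<lambda>p q. frag_extend (\<lambda>(a, b).
              frag_extend (\<lambda>(a', b'). frag_of (a \<otimes>\<^bsub>A\<^esub> a', b \<otimes>\<^bsub>B\<^esub> b')) q) p),
     one = frag_of (\<one>\<^bsub>A\<^esub>, \<one>\<^bsub>B\<^esub>),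
     ring.zero = 0,
     ring.add = (+)\<rparr>"

definition tensor_algebra ::
    "('k, 'x) ring_scheme \<Rightarrow> ('k, 'a, 'y) module_scheme \<Rightarrow> ('k, 'b, 'z) module_scheme \<Rightarrow>
     ('a \<times> 'b \<Rightarrow>\<^sub>0 int) set ring"
  where "tensor_algebra K A B = pair_monoid_ring A B Quot tensor_null K A B"

definition enveloping_algebra ::
    "('k, 'x) ring_scheme \<Rightarrow> ('k, 'a, 'y) module_scheme \<Rightarrow> ('a \<times> 'a \<Rightarrow>\<^sub>0 int) set ring"
  where "enveloping_algebra K A = tensor_algebra K A (op_ring A)"

text \<open>\<open>A\<close> as a left module over its enveloping algebra, \<open>(a \<otimes> b) \<cdot> x = a x b\<close>, and as a right
  module, \<open>x \<cdot> (a \<otimes> b) = b x a\<close>. The action of an integral combination of pairs depends only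
  on its coset.\<close>

definition env_left_module ::
    "('k, 'a, 'y) module_scheme \<Rightarrow> (('a \<times> 'a \<Rightarrow>\<^sub>0 int) set, 'a) module"
  where "env_left_module A =
    \<lparr>carrier = carrier A, mult = (\<otimes>\<^bsub>A\<^esub>), one = \<one>\<^bsub>A\<^esub>, ring.zero = \<zero>\<^bsub>A\<^esub>, ring.add = (\<oplus>\<^bsub>A\<^esub>),
     smult = (\<lambda>X x. the_elem ((\<lambda>p. finsum A
       (\<lambda>(a, b). [Poly_Mapping.lookup p (a, b)] \<cdot>\<^bsub>A\<^esub> (a \<otimes>\<^bsub>A\<^esub> x \<otimes>\<^bsub>A\<^esub> b)) (Poly_Mapping.keys p)) ` X))\<rparr>"

definition env_right_module ::
    "('k, 'a, 'y) module_scheme \<Rightarrow> (('a \<times> 'a \<Rightarrow>\<^sub>0 int) set, 'a) module"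
  where "env_right_module A =
    \<lparr>carrier = carrier A, mult = (\<otimes>\<^bsub>A\<^esub>), one = \<one>\<^bsub>A\<^esub>, ring.zero = \<zero>\<^bsub>A\<^esub>, ring.add = (\<oplus>\<^bsub>A\<^esub>),
     smult = (\<lambda>X x. the_elem ((\<lambda>p. finsum A
       (\<lambda>(a, b). [Poly_Mapping.lookup p (a, b)] \<cdot>\<^bsub>A\<^esub> (b \<otimes>\<^bsub>A\<^esub> x \<otimes>\<^bsub>A\<^esub> a)) (Poly_Mapping.keys p)) ` X))\<rparr>"

text \<open>For \<open>A\<close> finite dimensional over an infinite field the enveloping algebra is no larger than
  \<open>A\<close>, so a universe that is large enough for \<open>A\<close> also contains a projective resolution of \<open>A\<close>
  over the enveloping algebra.\<close>

definition HH ::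
    "'u itself \<Rightarrow> ('k, 'x) ring_scheme \<Rightarrow> ('k, 'a, 'y) module_scheme \<Rightarrow>
     nat \<Rightarrow> ('a \<times> 'u \<Rightarrow>\<^sub>0 int) set set monoid"
  where "HH U K A n =
    Tor U (enveloping_algebra K A) (env_right_module A) (env_left_module A) n"

text \<open>\<open>HH\<close> vanishes in negative degrees, so the supremum is taken over natural numbers.\<close>

definition hhdim :: "'u itself \<Rightarrow> ('k, 'x) ring_scheme \<Rightarrow> ('k, 'a, 'y) module_scheme \<Rightarrow> enat"
  where "hhdim U K A = Sup {enat n | n. \<not> trivial_group (HH U K A n)}"

end

(* If the Hochschild homology of A vanishes in all large degrees, then, because degrees and weights
   of words in a homogeneous basis bound each other, the normalized Hochschild complex is acyclic in
   every large weight w. In characteristic zero Connes' operator S is then an isomorphism on the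
   cyclic homology of weight w; that homology is bounded, so it vanishes, and the Euler characteristic
   of the cyclic complex of weight w is 0. This complex consists of the signed cyclic words in the
   basis of the augmentation ideal, so counting its basis words gives
     sum over d dividing w of phi(d) L(w/d) = 0   for all large w,
   where L is the logarithmic derivative of 1 + f and f is the Hilbert polynomial of the augmentation
   ideal. This is impossible unless f = 0. Hence A = k, whose global dimension is 0. *)

theory Submission
  imports Defs "HOL-Number_Theory.Totient" "HOL-Computational_Algebra.Formal_Power_Series"
    "HOL-Analysis.Infinite_Sum"
begin

section \<open>Embedding the field in a commutative ring type\<close>

text \<open>\<open>Tor\<close> is the homology of a resolution picked by choice inside a universe,
  and its groups are quotients of quotients. The proof takes from its vanishing only a statement on
  representatives, and carries that along a comparison of resolutions to the normalized bar
  resolution. There everything is finite: a chain is a coefficient function on words, and b, b', t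
  and N are explicit sums over structure constants. To compute with them by ordinary ring
  arithmetic, the field is placed as an ideal in a commutative ring type. The Euler characteristic
  is taken without dimensions: a contracting homotopy of the cyclic complex is built on basis words,
  and commutativity of the trace makes the alternating sum of the traces of N / n vanish.
  Characteristic zero then turns this identity in the ring into one between integers. The last
  contradiction is analytic. The convolution identity bounds L(m) by a power of m, so the Lambert
  series with coefficients phi(d) converges on (0, 1) and is a polynomial there; but near 1 more and
  more of its terms stay above one positive constant.\<close>

definition char_zero_field :: "'k ring \<Rightarrow> bool"
  where "char_zero_field K \<longleftrightarrow> field K \<and> char_zero K"

text \<open>The ring of scalars of the theorem is a record, so its arithmetic is out of reach of the type
  class library. All characteristic zero fields with carrier in a type \<open>'k\<close> embed, as ideals, in
  one commutative \<open>\<rat>\<close>-algebra that is a type: their product. The factor \<open>rat\<close> only ensures that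
  \<open>1 \<noteq> 0\<close>.\<close>

typedef 'k field_product =
  "{F :: ('k ring \<Rightarrow> 'k) \<times> rat. \<forall>K. if char_zero_field K then fst F K \<in> carrier K else fst F K = undefined}"
proof (intro exI CollectI allI)
  fix K :: "'k ring"
  show "if char_zero_field K
    then fst ((\<lambda>K. if char_zero_field K then \<zero>\<^bsub>K\<^esub> else undefined), 0 :: rat) K \<in> carrier K
    else fst ((\<lambda>K. if char_zero_field K then \<zero>\<^bsub>K\<^esub> else undefined), 0 :: rat) K = undefined"
    by (auto simp: char_zero_field_def field_def domain_def cring_def intro: ring.ring_simprules)
qed

definition factor :: "'k field_product \<Rightarrow> 'k ring \<Rightarrow> 'k"
  where "factor x K = fst (Rep_field_product x) K"

definition rat_factor :: "'k field_product \<Rightarrow> rat"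
  where "rat_factor x = snd (Rep_field_product x)"

definition from_factors :: "('k ring \<Rightarrow> 'k) \<Rightarrow> rat \<Rightarrow> 'k field_product"
  where "from_factors f q = Abs_field_product (\<lambda>K. if char_zero_field K then f K else undefined, q)"

lemma factor_closed: "char_zero_field K \<Longrightarrow> factor x K \<in> carrier K"
  using Rep_field_product[of x] by (auto simp: factor_def split: if_splits)

lemma factor_from_factors:
  assumes "\<And>K. char_zero_field K \<Longrightarrow> f K \<in> carrier K"
  shows "char_zero_field K \<Longrightarrow> factor (from_factors f q) K = f K" "rat_factor (from_factors f q) = q"
  using assms by (simp_all add: factor_def rat_factor_def from_factors_def Abs_field_product_inverse)

text \<open>Outside the fields of characteristic zero the typedef pins the component to
  \<open>undefined\<close>, so those components cannot distinguish two elements.\<close>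

lemma field_product_eqI:
  assumes "\<And>K. char_zero_field K \<Longrightarrow> factor x K = factor y K" "rat_factor x = rat_factor y"
  shows "x = y"
proof -
  have "fst (Rep_field_product x) K = fst (Rep_field_product y) K" for K
    using assms(1)[of K] Rep_field_product[of x] Rep_field_product[of y]
    by (cases "char_zero_field K") (auto simp: factor_def dest: spec[of _ K])
  then have "Rep_field_product x = Rep_field_product y"
    using assms(2) by (auto simp: rat_factor_def prod_eq_iff)
  then show ?thesis by (simp add: Rep_field_product_inject)
qed

lemma char_zero_field_cring: "char_zero_field K \<Longrightarrow> cring K"
  by (simp add: char_zero_field_def field_def domain_def)

instantiation field_product :: (type) comm_ring_1
begin

definition zero_field_product :: "'a field_product"
  where "zero_field_product = from_factors (\<lambda>K. \<zero>\<^bsub>K\<^esub>) 0"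
definition one_field_product :: "'a field_product"
  where "one_field_product = from_factors (\<lambda>K. \<one>\<^bsub>K\<^esub>) 1"
definition plus_field_product :: "'a field_product \<Rightarrow> 'a field_product \<Rightarrow> 'a field_product"
  where "plus_field_product x y = from_factors (\<lambda>K. factor x K \<oplus>\<^bsub>K\<^esub> factor y K) (rat_factor x + rat_factor y)"
definition uminus_field_product :: "'a field_product \<Rightarrow> 'a field_product"
  where "uminus_field_product x = from_factors (\<lambda>K. \<ominus>\<^bsub>K\<^esub> factor x K) (- rat_factor x)"
definition minus_field_product :: "'a field_product \<Rightarrow> 'a field_product \<Rightarrow> 'a field_product"
  where "minus_field_product x y = from_factors (\<lambda>K. factor x K \<ominus>\<^bsub>K\<^esub> factor y K) (rat_factor x - rat_factor y)"
definition times_field_product :: "'a field_product \<Rightarrow> 'a field_product \<Rightarrow> 'a field_product"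
  where "times_field_product x y = from_factors (\<lambda>K. factor x K \<otimes>\<^bsub>K\<^esub> factor y K) (rat_factor x * rat_factor y)"

lemma factor_simps:
  assumes "char_zero_field K"
  shows "factor 0 K = \<zero>\<^bsub>K\<^esub>" "factor 1 K = \<one>\<^bsub>K\<^esub>" "factor (x + y) K = factor x K \<oplus>\<^bsub>K\<^esub> factor y K"
    "factor (- x) K = \<ominus>\<^bsub>K\<^esub> factor x K" "factor (x - y) K = factor x K \<ominus>\<^bsub>K\<^esub> factor y K"
    "factor (x * y) K = factor x K \<otimes>\<^bsub>K\<^esub> factor y K"
  unfolding zero_field_product_def one_field_product_def plus_field_product_def uminus_field_product_def
    minus_field_product_def times_field_product_def
  by (rule factor_from_factors(1)[OF _ assms],
      simp add: cring.cring_simprules[OF char_zero_field_cring] factor_closed)+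

lemma rat_factor_simps:
  "rat_factor 0 = 0" "rat_factor 1 = 1" "rat_factor (x + y) = rat_factor x + rat_factor y"
  "rat_factor (- x) = - rat_factor x" "rat_factor (x - y) = rat_factor x - rat_factor y"
  "rat_factor (x * y) = rat_factor x * rat_factor y"
  unfolding zero_field_product_def one_field_product_def plus_field_product_def uminus_field_product_def
    minus_field_product_def times_field_product_def
  by (rule factor_from_factors(2),
      simp add: cring.cring_simprules[OF char_zero_field_cring] factor_closed)+

instance
proof
  fix x y z :: "'a field_product"
  note s = factor_simps rat_factor_simps factor_closed
  note c = cring.cring_simprules[OF char_zero_field_cring]
  show "x + y + z = x + (y + z)" "x + y = y + x" "0 + x = x" "- x + x = 0" "x - y = x + - y"
    "x * y * z = x * (y * z)" "x * y = y * x" "1 * x = x" "(x + y) * z = x * z + y * z"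
    by (rule field_product_eqI; simp add: s c algebra_simps; fail)+
  show "(0 :: 'a field_product) \<noteq> 1" using rat_factor_simps(1,2) by (metis zero_neq_one)
qed

end

lemma rat_factor_of_nat: "rat_factor (of_nat n) = of_nat n"
  by (induction n) (simp_all add: rat_factor_simps)

lemma factor_of_nat:
  assumes K: "char_zero_field K"
  shows "factor (of_nat n) K = [n] \<cdot>\<^bsub>K\<^esub> \<one>\<^bsub>K\<^esub>"
proof -
  interpret cring K by (rule char_zero_field_cring[OF K])
  show ?thesis by (induction n) (simp_all add: factor_simps[OF K] add.nat_pow_Suc a_comm)
qed

text \<open>Inverses are taken factor by factor, which is why only fields of characteristic zero
  enter the product. They supply the divisions by word lengths in the cyclic theory.\<close>

lemma of_nat_invertible:
  assumes "0 < n"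
  shows "\<exists>x :: 'k field_product. of_nat n * x = 1"
proof
  define f :: "'k ring \<Rightarrow> 'k" where "f K = inv\<^bsub>K\<^esub> ([n] \<cdot>\<^bsub>K\<^esub> \<one>\<^bsub>K\<^esub>)" for K
  have u: "[n] \<cdot>\<^bsub>K\<^esub> \<one>\<^bsub>K\<^esub> \<in> Units K" if K: "char_zero_field K" for K :: "'k ring"
  proof -
    interpret field K using K by (simp add: char_zero_field_def)
    show ?thesis using K assms by (simp add: char_zero_field_def char_zero_def field_Units)
  qed
  have f: "f K \<in> carrier K" if K: "char_zero_field K" for K :: "'k ring"
  proof -
    interpret field K using K by (simp add: char_zero_field_def)
    show ?thesis using u[OF K] by (simp add: f_def)
  qed
  show "of_nat n * from_factors f (1 / of_nat n) = 1"
  proof (rule field_product_eqI)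
    fix K :: "'k ring" assume K: "char_zero_field K"
    interpret field K using K by (simp add: char_zero_field_def)
    show "factor (of_nat n * from_factors f (1 / of_nat n)) K = factor 1 K"
      using u[OF K] by (simp add: factor_simps[OF K] factor_of_nat[OF K] factor_from_factors(1)[OF f K]) (simp add: f_def)
  qed (use assms in \<open>simp add: rat_factor_simps rat_factor_of_nat factor_from_factors(2)[OF f]\<close>)
qed

text \<open>The inclusion of one factor, zero in all others and in the rational one. It respects
  sums and products but sends 1 to an idempotent, so the field appears as the ideal cut out by that
  idempotent.\<close>

definition inj_field :: "'k ring \<Rightarrow> 'k \<Rightarrow> 'k field_product"
  where "inj_field K a = from_factors (\<lambda>L. if L = K then a else \<zero>\<^bsub>L\<^esub>) 0"

locale scalars =
  fixes K :: "'k ring"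
  assumes K: "char_zero_field K"
begin

sublocale K: field K
  using K by (simp add: char_zero_field_def)

abbreviation \<iota> :: "'k \<Rightarrow> 'k field_product" where "\<iota> \<equiv> inj_field K"

lemma factor_inj:
  assumes "a \<in> carrier K"
  shows "char_zero_field L \<Longrightarrow> factor (\<iota> a) L = (if L = K then a else \<zero>\<^bsub>L\<^esub>)" "rat_factor (\<iota> a) = 0"
proof -
  have c: "(if L = K then a else \<zero>\<^bsub>L\<^esub>) \<in> carrier L" if "char_zero_field L" for L
    using assms cring.cring_simprules(2)[OF char_zero_field_cring[OF that]] by simp
  show "char_zero_field L \<Longrightarrow> factor (\<iota> a) L = (if L = K then a else \<zero>\<^bsub>L\<^esub>)" "rat_factor (\<iota> a) = 0"
    unfolding inj_field_def using factor_from_factors[OF c] by simp_all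
qed

lemma inj_add: "a \<in> carrier K \<Longrightarrow> b \<in> carrier K \<Longrightarrow> \<iota> (a \<oplus>\<^bsub>K\<^esub> b) = \<iota> a + \<iota> b"
  and inj_mult: "a \<in> carrier K \<Longrightarrow> b \<in> carrier K \<Longrightarrow> \<iota> (a \<otimes>\<^bsub>K\<^esub> b) = \<iota> a * \<iota> b"
  and inj_zero: "\<iota> \<zero>\<^bsub>K\<^esub> = 0"
  by (rule field_product_eqI;
      simp add: factor_inj factor_simps rat_factor_simps cring.cring_simprules[OF char_zero_field_cring])+

lemma inj_inject: "a \<in> carrier K \<Longrightarrow> b \<in> carrier K \<Longrightarrow> \<iota> a = \<iota> b \<Longrightarrow> a = b"
  using factor_inj(1)[OF _ K] by metis

definition unit :: "'k field_product" where "unit = \<iota> \<one>\<^bsub>K\<^esub>"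

definition pr :: "'k field_product \<Rightarrow> 'k" where "pr x = factor x K"

lemma pr_closed [simp]: "pr x \<in> carrier K"
  by (simp add: pr_def factor_closed[OF K])

lemma pr_inj: "a \<in> carrier K \<Longrightarrow> pr (\<iota> a) = a"
  by (simp add: pr_def factor_inj K)

text \<open>Projecting to the factor and including it back kills all other factors. Ring elements
  fixed by \<open>unit\<close> therefore correspond to scalars of the field.\<close>

lemma inj_pr: "\<iota> (pr x) = unit * x"
  by (rule field_product_eqI)
    (simp_all add: unit_def pr_def factor_inj factor_simps rat_factor_simps factor_closed K
      cring.cring_simprules[OF char_zero_field_cring])

lemma unit_inj: "a \<in> carrier K \<Longrightarrow> unit * \<iota> a = \<iota> a"
  by (simp add: unit_def flip: inj_mult)

text \<open>Only the component at the given field counts, and there characteristic zero applies.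
  Hence an integer whose multiple of \<open>unit\<close> vanishes is zero; this carries the Euler
  characteristic from the ambient ring to the integers.\<close>

lemma unit_of_nat: "0 < n \<Longrightarrow> of_nat n * unit \<noteq> 0"
proof
  assume n: "0 < n" "of_nat n * unit = 0"
  then have "factor (of_nat n * unit) K = \<zero>\<^bsub>K\<^esub>" by (simp add: factor_simps[OF K])
  then have "[n] \<cdot>\<^bsub>K\<^esub> \<one>\<^bsub>K\<^esub> = \<zero>\<^bsub>K\<^esub>"
    by (simp add: factor_simps[OF K] factor_of_nat[OF K] unit_def factor_inj K)
  with K n show False by (simp add: char_zero_field_def char_zero_def)
qed

end

section \<open>Homogeneous bases\<close>

locale graded_local_algebra =
  fixes K :: "'k ring" and A :: "('k, 'a) module" and G :: "nat \<Rightarrow> 'a set" and s :: nat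
  assumes field: "field K" and char0: "char_zero K"
    and alg: "assoc_algebra K A" and fin: "finitely_spanned K A"
    and graded: "graded_algebra K A G s"
    and G0: "G 0 = {c \<odot>\<^bsub>A\<^esub> \<one>\<^bsub>A\<^esub> | c. c \<in> carrier K}" and one_nonzero: "\<one>\<^bsub>A\<^esub> \<noteq> \<zero>\<^bsub>A\<^esub>"
begin

sublocale scalars K
  by unfold_locales (simp add: char_zero_field_def field char0)

sublocale A: assoc_algebra K A
  by (rule alg)

lemma G_submodule: "submodule (G i) K A"
  and G_large: "s < i \<Longrightarrow> G i = {\<zero>\<^bsub>A\<^esub>}"
  and G_decomp: "x \<in> carrier A \<Longrightarrow> \<exists>!f. f \<in> (\<Pi>\<^sub>E i\<in>{..s}. G i) \<and> x = (\<Oplus>\<^bsub>A\<^esub>i\<in>{..s}. f i)"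
  and G_mult: "x \<in> G i \<Longrightarrow> y \<in> G j \<Longrightarrow> x \<otimes>\<^bsub>A\<^esub> y \<in> G (i + j)"
  using graded by (auto simp: graded_algebra_def)

lemma submodule_zero: "submodule N K A \<Longrightarrow> \<zero>\<^bsub>A\<^esub> \<in> N"
  using subgroup.one_closed[OF submodule.axioms(1)] by force

lemma submodule_sum:
  assumes "submodule N K A" "f \<in> I \<rightarrow> N"
  shows "(\<Oplus>\<^bsub>A\<^esub>i\<in>I. f i) \<in> N"
  using assms(2)
proof (induction I rule: infinite_finite_induct)
  case (insert i I)
  then have "f \<in> I \<rightarrow> carrier A" "f i \<in> carrier A" using A.submoduleE(1)[OF assms(1)] by auto
  with insert show ?case using A.submoduleE(5)[OF assms(1)] by auto
qed (simp_all add: submodule_zero[OF assms(1)])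

text \<open>The span as an intersection, suited to minimality arguments. For finite sets
  \<open>combs\<close> is the same span by explicit combinations, from which coordinates are
  obtained.\<close>

definition hull_of :: "'a set \<Rightarrow> 'a set"
  where "hull_of S = \<Inter>{N. submodule N K A \<and> S \<subseteq> N}"

definition combs :: "'a set \<Rightarrow> 'a set"
  where "combs S = {(\<Oplus>\<^bsub>A\<^esub>x\<in>S. c x \<odot>\<^bsub>A\<^esub> x) | c. c \<in> S \<rightarrow> carrier K}"

lemma combs_submodule:
  assumes "S \<subseteq> carrier A" shows "submodule (combs S) K A"
proof (rule A.submoduleI)
  have cl: "(\<lambda>x. c x \<odot>\<^bsub>A\<^esub> x) \<in> S \<rightarrow> carrier A" if "c \<in> S \<rightarrow> carrier K" for c
    using that assms by auto
  show "combs S \<subseteq> carrier A" using cl by (auto simp: combs_def intro!: A.finsum_closed)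
  have z: "(\<Oplus>\<^bsub>A\<^esub>x\<in>S. \<zero>\<^bsub>K\<^esub> \<odot>\<^bsub>A\<^esub> x) = \<zero>\<^bsub>A\<^esub>"
    using assms by (subst A.finsum_cong'[of _ _ "\<lambda>_. \<zero>\<^bsub>A\<^esub>"]) (auto simp: subset_iff)
  then show "\<zero>\<^bsub>A\<^esub> \<in> combs S" unfolding combs_def by (auto intro!: exI[of _ "\<lambda>_. \<zero>\<^bsub>K\<^esub>"])
  show sm: "k \<odot>\<^bsub>A\<^esub> x \<in> combs S" if k: "k \<in> carrier K" and x: "x \<in> combs S" for k x
  proof -
    obtain c where c: "c \<in> S \<rightarrow> carrier K" "x = (\<Oplus>\<^bsub>A\<^esub>x\<in>S. c x \<odot>\<^bsub>A\<^esub> x)" using x by (auto simp: combs_def)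
    have "k \<odot>\<^bsub>A\<^esub> x = (\<Oplus>\<^bsub>A\<^esub>x\<in>S. k \<odot>\<^bsub>A\<^esub> (c x \<odot>\<^bsub>A\<^esub> x))"
    proof (cases "finite S")
      case True
      then show ?thesis unfolding c(2) by (rule A.finsum_smult_ldistr[OF _ k cl[OF c(1)]])
    qed (use k in \<open>simp add: c(2)\<close>)
    also have "\<dots> = (\<Oplus>\<^bsub>A\<^esub>x\<in>S. (k \<otimes>\<^bsub>K\<^esub> c x) \<odot>\<^bsub>A\<^esub> x)"
      using assms k c(1) by (intro A.finsum_cong') (auto simp: A.smult_assoc1 subset_iff Pi_iff)
    finally show ?thesis using k c(1) by (auto simp: combs_def Pi_iff intro!: exI[of _ "\<lambda>x. k \<otimes>\<^bsub>K\<^esub> c x"])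
  qed
  show "x \<oplus>\<^bsub>A\<^esub> y \<in> combs S" if xy: "x \<in> combs S" "y \<in> combs S" for x y
  proof -
    obtain c c' where c: "c \<in> S \<rightarrow> carrier K" "x = (\<Oplus>\<^bsub>A\<^esub>x\<in>S. c x \<odot>\<^bsub>A\<^esub> x)"
      and c': "c' \<in> S \<rightarrow> carrier K" "y = (\<Oplus>\<^bsub>A\<^esub>x\<in>S. c' x \<odot>\<^bsub>A\<^esub> x)"
      using xy by (auto simp: combs_def)
    have "x \<oplus>\<^bsub>A\<^esub> y = (\<Oplus>\<^bsub>A\<^esub>x\<in>S. c x \<odot>\<^bsub>A\<^esub> x \<oplus>\<^bsub>A\<^esub> c' x \<odot>\<^bsub>A\<^esub> x)"
      unfolding c(2) c'(2) by (rule A.finsum_addf[symmetric]) (use cl c c' in auto)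
    also have "\<dots> = (\<Oplus>\<^bsub>A\<^esub>x\<in>S. (c x \<oplus>\<^bsub>K\<^esub> c' x) \<odot>\<^bsub>A\<^esub> x)"
      using assms c(1) c'(1) by (intro A.finsum_cong') (auto simp: A.smult_l_distr subset_iff Pi_iff)
    finally show ?thesis
      using c(1) c'(1) by (auto simp: combs_def Pi_iff intro!: exI[of _ "\<lambda>x. c x \<oplus>\<^bsub>K\<^esub> c' x"])
  qed
  show "\<ominus>\<^bsub>A\<^esub> x \<in> combs S" if "x \<in> combs S" for x
  proof -
    have "x \<in> carrier A" using that cl by (auto simp: combs_def intro!: A.finsum_closed)
    then have "\<ominus>\<^bsub>A\<^esub> x = (\<ominus>\<^bsub>K\<^esub> \<one>\<^bsub>K\<^esub>) \<odot>\<^bsub>A\<^esub> x"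
      by (simp add: A.smult_l_minus A.smult_one)
    with sm[OF _ that] show ?thesis by simp
  qed
qed

lemma combs_contains:
  assumes "S \<subseteq> carrier A" "finite S" "x \<in> S" shows "x \<in> combs S"
proof -
  have "(\<Oplus>\<^bsub>A\<^esub>y\<in>S. (if x = y then \<one>\<^bsub>K\<^esub> else \<zero>\<^bsub>K\<^esub>) \<odot>\<^bsub>A\<^esub> y) = (\<Oplus>\<^bsub>A\<^esub>y\<in>S. if x = y then y else \<zero>\<^bsub>A\<^esub>)"
    using assms by (intro A.finsum_cong') (auto simp: A.smult_one subset_iff)
  also have "\<dots> = x" using assms by (intro A.finsum_singleton) auto
  finally show ?thesis unfolding combs_def
    by (intro CollectI exI[of _ "\<lambda>y. if x = y then \<one>\<^bsub>K\<^esub> else \<zero>\<^bsub>K\<^esub>"]) auto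
qed

lemma hull_of_submodule: "S \<subseteq> carrier A \<Longrightarrow> submodule (hull_of S) K A"
proof (rule A.submoduleI)
  assume S: "S \<subseteq> carrier A"
  then show "hull_of S \<subseteq> carrier A" unfolding hull_of_def using A.carrier_is_submodule by blast
qed (auto simp: hull_of_def submodule_zero A.submoduleE)

lemma hull_of_least: "submodule N K A \<Longrightarrow> S \<subseteq> N \<Longrightarrow> hull_of S \<subseteq> N"
  by (auto simp: hull_of_def)

lemma hull_of_incl: "S \<subseteq> hull_of S"
  by (auto simp: hull_of_def)

text \<open>The element 1 is kept apart because it spans the degree zero part; all other members
  come from positive degrees.\<close>

definition generating :: "'a set \<Rightarrow> bool"
  where "generating S \<longleftrightarrow> finite S \<and> S \<subseteq> (\<Union>i\<in>{1..s}. G i) \<and> hull_of (insert \<one>\<^bsub>A\<^esub> S) = carrier A"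

lemma G_carrier: "x \<in> G i \<Longrightarrow> x \<in> carrier A"
  using A.submoduleE(1)[OF G_submodule] by blast

lemma generating_carrier: "generating S \<Longrightarrow> insert \<one>\<^bsub>A\<^esub> S \<subseteq> carrier A"
  using G_carrier by (auto simp: generating_def)

text \<open>The homogeneous components of the members of a finite spanning set span; those of degree
  zero are multiples of 1 and can be left out.\<close>

lemma generating_exists: "\<exists>S. generating S"
proof -
  obtain B where B: "finite B" "B \<subseteq> carrier A"
    "\<And>x. x \<in> carrier A \<Longrightarrow> \<exists>c \<in> B \<rightarrow> carrier K. x = (\<Oplus>\<^bsub>A\<^esub>b\<in>B. c b \<odot>\<^bsub>A\<^esub> b)"
    using fin by (auto simp: finitely_spanned_def)
  have "\<forall>x\<in>B. \<exists>f. f \<in> (\<Pi>\<^sub>E i\<in>{..s}. G i) \<and> x = (\<Oplus>\<^bsub>A\<^esub>i\<in>{..s}. f i)"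
    using G_decomp B(2) by blast
  then obtain f where f: "\<And>x. x \<in> B \<Longrightarrow> f x \<in> (\<Pi>\<^sub>E i\<in>{..s}. G i) \<and> x = (\<Oplus>\<^bsub>A\<^esub>i\<in>{..s}. f x i)"
    by metis
  define S where "S = (\<Union>x\<in>B. f x ` {1..s})"
  have S: "finite S" "S \<subseteq> (\<Union>i\<in>{1..s}. G i)"
    using B(1) f by (fastforce simp: S_def)+
  let ?T = "insert \<one>\<^bsub>A\<^esub> S"
  have T: "?T \<subseteq> carrier A" using S G_carrier by auto
  note sub = hull_of_submodule[OF T]
  have comp: "f x i \<in> hull_of ?T" if "x \<in> B" "i \<in> {..s}" for x i
  proof (cases "i = 0")
    case True
    then have "f x i \<in> G 0" using f[OF that(1)] that(2) by auto
    then obtain c where "c \<in> carrier K" "f x i = c \<odot>\<^bsub>A\<^esub> \<one>\<^bsub>A\<^esub>" using G0 by auto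
    then show ?thesis using A.submoduleE(4)[OF sub] hull_of_incl[of ?T] by auto
  next
    case False
    then have "f x i \<in> S" using that unfolding S_def by (intro UN_I[of x] imageI) auto
    then show ?thesis using hull_of_incl[of ?T] by auto
  qed
  have BH: "x \<in> hull_of ?T" if "x \<in> B" for x
    using f[OF that] submodule_sum[OF sub, of "f x" "{..s}"] comp[OF that] by auto
  have "x \<in> hull_of ?T" if x: "x \<in> carrier A" for x
  proof -
    obtain c where c: "c \<in> B \<rightarrow> carrier K" "x = (\<Oplus>\<^bsub>A\<^esub>b\<in>B. c b \<odot>\<^bsub>A\<^esub> b)" using B(3)[OF x] by blast
    then show ?thesis using submodule_sum[OF sub, of "\<lambda>b. c b \<odot>\<^bsub>A\<^esub> b" B] BH A.submoduleE(4)[OF sub] by auto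
  qed
  then have "hull_of ?T = carrier A" using A.submoduleE(1)[OF sub] by blast
  with S show ?thesis unfolding generating_def by blast
qed

text \<open>Least cardinality forces linear independence, and thereby a homogeneous basis of A that
  contains 1.\<close>

definition gens :: "'a set"
  where "gens = (SOME S. generating S \<and> (\<forall>S'. generating S' \<longrightarrow> card S \<le> card S'))"

lemma gens: "generating gens" "generating S' \<Longrightarrow> card gens \<le> card S'"
proof -
  have "\<exists>S. generating S \<and> (\<forall>S'. generating S' \<longrightarrow> card S \<le> card S')"
    using generating_exists ex_has_least_nat[of generating _ card] by metis
  from someI_ex[OF this] show "generating gens" "generating S' \<Longrightarrow> card gens \<le> card S'"
    by (auto simp: gens_def)
qed

lemma gens_finite: "finite gens" and gens_carrier: "insert \<one>\<^bsub>A\<^esub> gens \<subseteq> carrier A"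
  using gens(1) generating_carrier by (auto simp: generating_def)

lemma gens_irredundant:
  assumes "x \<in> gens" shows "x \<notin> hull_of (insert \<one>\<^bsub>A\<^esub> (gens - {x}))"
proof
  assume x: "x \<in> hull_of (insert \<one>\<^bsub>A\<^esub> (gens - {x}))"
  have T: "insert \<one>\<^bsub>A\<^esub> (gens - {x}) \<subseteq> carrier A" using gens_carrier by auto
  have "hull_of (insert \<one>\<^bsub>A\<^esub> gens) \<subseteq> hull_of (insert \<one>\<^bsub>A\<^esub> (gens - {x}))"
    by (rule hull_of_least[OF hull_of_submodule[OF T]]) (use x hull_of_incl[of "insert \<one>\<^bsub>A\<^esub> (gens - {x})"] in auto)
  then have "generating (gens - {x})"
    using gens(1) A.submoduleE(1)[OF hull_of_submodule[OF T]] by (auto simp: generating_def)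
  from gens(2)[OF this] card_Diff1_less[OF gens_finite assms] show False by linarith
qed

lemma one_notin_gens: "\<one>\<^bsub>A\<^esub> \<notin> gens"
proof
  assume "\<one>\<^bsub>A\<^esub> \<in> gens"
  from gens_irredundant[OF this] show False using hull_of_incl by blast
qed

text \<open>A nonzero coefficient at a generator could be divided by, which puts that generator into
  the span of the others, against minimality. Then only a multiple of 1 is left, and 1 is
  nonzero.\<close>

lemma gens_independent:
  assumes c: "c \<in> insert \<one>\<^bsub>A\<^esub> gens \<rightarrow> carrier K"
    and z: "(\<Oplus>\<^bsub>A\<^esub>x\<in>insert \<one>\<^bsub>A\<^esub> gens. c x \<odot>\<^bsub>A\<^esub> x) = \<zero>\<^bsub>A\<^esub>" and x: "x \<in> insert \<one>\<^bsub>A\<^esub> gens"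
  shows "c x = \<zero>\<^bsub>K\<^esub>"
proof -
  let ?T = "insert \<one>\<^bsub>A\<^esub> gens"
  have split: "c y \<odot>\<^bsub>A\<^esub> y \<oplus>\<^bsub>A\<^esub> (\<Oplus>\<^bsub>A\<^esub>x\<in>?T - {y}. c x \<odot>\<^bsub>A\<^esub> x) = \<zero>\<^bsub>A\<^esub>" if "y \<in> ?T" for y
  proof -
    have "(\<Oplus>\<^bsub>A\<^esub>x\<in>insert y (?T - {y}). c x \<odot>\<^bsub>A\<^esub> x) = c y \<odot>\<^bsub>A\<^esub> y \<oplus>\<^bsub>A\<^esub> (\<Oplus>\<^bsub>A\<^esub>x\<in>?T - {y}. c x \<odot>\<^bsub>A\<^esub> x)"
      using c gens_carrier gens_finite that by (intro A.finsum_insert) (auto simp: Pi_iff)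
    moreover have "insert y (?T - {y}) = ?T" using that by auto
    ultimately show ?thesis using z by simp
  qed
  have g: "c y = \<zero>\<^bsub>K\<^esub>" if y: "y \<in> gens" for y
  proof (rule ccontr)
    assume nz: "c y \<noteq> \<zero>\<^bsub>K\<^esub>"
    let ?U = "insert \<one>\<^bsub>A\<^esub> (gens - {y})"
    have U: "?T - {y} = ?U" using y one_notin_gens by auto
    have UA: "?U \<subseteq> carrier A" using gens_carrier by auto
    note sub = hull_of_submodule[OF UA]
    have cy: "c y \<in> carrier K" "y \<in> carrier A" using c y gens_carrier by auto
    let ?r = "\<Oplus>\<^bsub>A\<^esub>x\<in>?U. c x \<odot>\<^bsub>A\<^esub> x"
    have r: "?r \<in> hull_of ?U"
      using submodule_sum[OF sub, of "\<lambda>x. c x \<odot>\<^bsub>A\<^esub> x" ?U] A.submoduleE(4)[OF sub] c hull_of_incl[of ?U]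
      by (auto simp: Pi_iff)
    have rc: "?r \<in> carrier A" using r A.submoduleE(1)[OF sub] by blast
    have "c y \<odot>\<^bsub>A\<^esub> y \<oplus>\<^bsub>A\<^esub> ?r = \<zero>\<^bsub>A\<^esub>" using split[of y, unfolded U] y by blast
    then have "\<ominus>\<^bsub>A\<^esub> ?r = c y \<odot>\<^bsub>A\<^esub> y" by (rule A.minus_equality) (use rc cy in simp_all)
    then have h: "c y \<odot>\<^bsub>A\<^esub> y \<in> hull_of ?U" using A.submoduleE(3)[OF sub r] by metis
    have u: "c y \<in> Units K" using nz cy by (simp add: K.field_Units)
    have "inv\<^bsub>K\<^esub> c y \<odot>\<^bsub>A\<^esub> (c y \<odot>\<^bsub>A\<^esub> y) = y"
      using u cy by (simp add: A.smult_one flip: A.smult_assoc1)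
    then have "y \<in> hull_of ?U" using A.submoduleE(4)[OF sub _ h] u by (metis K.Units_inv_closed)
    with gens_irredundant[OF y] show False by blast
  qed
  have "c \<one>\<^bsub>A\<^esub> = \<zero>\<^bsub>K\<^esub>"
  proof (rule ccontr)
    assume nz: "c \<one>\<^bsub>A\<^esub> \<noteq> \<zero>\<^bsub>K\<^esub>"
    have c1: "c \<one>\<^bsub>A\<^esub> \<in> carrier K" using c by auto
    have "(\<Oplus>\<^bsub>A\<^esub>x\<in>?T - {\<one>\<^bsub>A\<^esub>}. c x \<odot>\<^bsub>A\<^esub> x) = (\<Oplus>\<^bsub>A\<^esub>x\<in>?T - {\<one>\<^bsub>A\<^esub>}. \<zero>\<^bsub>A\<^esub>)"
      using g gens_carrier by (intro A.finsum_cong') auto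
    then have "c \<one>\<^bsub>A\<^esub> \<odot>\<^bsub>A\<^esub> \<one>\<^bsub>A\<^esub> = \<zero>\<^bsub>A\<^esub>" using split[of "\<one>\<^bsub>A\<^esub>"] c1 by simp
    moreover have u: "c \<one>\<^bsub>A\<^esub> \<in> Units K" using nz c1 by (simp add: K.field_Units)
    moreover have "inv\<^bsub>K\<^esub> c \<one>\<^bsub>A\<^esub> \<odot>\<^bsub>A\<^esub> (c \<one>\<^bsub>A\<^esub> \<odot>\<^bsub>A\<^esub> \<one>\<^bsub>A\<^esub>) = \<one>\<^bsub>A\<^esub>"
      using u c1 by (simp add: A.smult_one flip: A.smult_assoc1)
    ultimately show False using one_nonzero by simp
  qed
  with g x show ?thesis by blast
qed

definition D :: nat where "D = card gens"

text \<open>Index 0 is the unit and the indices 1 to \<open>D\<close> enumerate a basis of the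
  augmentation ideal, which fixes the letters of all words below.\<close>

definition basis :: "nat \<Rightarrow> 'a"
  where "basis = (SOME b. b 0 = \<one>\<^bsub>A\<^esub> \<and> bij_betw b {1..D} gens)"

lemma basis: "basis 0 = \<one>\<^bsub>A\<^esub>" "bij_betw basis {1..D} gens"
proof -
  obtain h where h: "bij_betw h {1..D} gens"
    using ex_bij_betw_nat_finite_1[OF gens_finite] unfolding D_def by blast
  then have "bij_betw (h(0 := \<one>\<^bsub>A\<^esub>)) {1..D} gens"
    by (subst bij_betw_cong[of _ _ h]) auto
  then have "\<exists>b. b 0 = \<one>\<^bsub>A\<^esub> \<and> bij_betw b {1..D} gens" by (intro exI[of _ "h(0 := \<one>\<^bsub>A\<^esub>)"]) simp
  from someI_ex[OF this, folded basis_def]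
  show "basis 0 = \<one>\<^bsub>A\<^esub>" "bij_betw basis {1..D} gens" by blast+
qed

lemma basis_bij: "bij_betw basis {..D} (insert \<one>\<^bsub>A\<^esub> gens)"
proof -
  have "bij_betw basis ({0} \<union> {1..D}) ({\<one>\<^bsub>A\<^esub>} \<union> gens)"
    by (rule bij_betw_combine) (use basis one_notin_gens in auto)
  moreover have "{0} \<union> {1..D} = {..D}" by auto
  ultimately show ?thesis by simp
qed

lemma basis_closed [simp]: "i \<le> D \<Longrightarrow> basis i \<in> carrier A"
  using bij_betwE[OF basis_bij] gens_carrier by blast

lemma finsum_basis:
  assumes "f \<in> {..D} \<rightarrow> carrier A"
  shows "(\<Oplus>\<^bsub>A\<^esub>i\<in>{..D}. f i) = (\<Oplus>\<^bsub>A\<^esub>x\<in>insert \<one>\<^bsub>A\<^esub> gens. f (inv_into {..D} basis x))"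
proof -
  have im: "basis ` {..D} = insert \<one>\<^bsub>A\<^esub> gens" and inj: "inj_on basis {..D}"
    using basis_bij by (auto simp: bij_betw_def)
  have "(\<Oplus>\<^bsub>A\<^esub>x\<in>basis ` {..D}. f (inv_into {..D} basis x)) = (\<Oplus>\<^bsub>A\<^esub>i\<in>{..D}. f (inv_into {..D} basis (basis i)))"
    by (rule A.finsum_reindex) (use assms inj in \<open>auto simp: inv_into_f_f[OF inj]\<close>)
  also have "\<dots> = (\<Oplus>\<^bsub>A\<^esub>i\<in>{..D}. f i)"
    using assms by (intro A.finsum_cong') (auto simp: inv_into_f_f[OF inj])
  finally show ?thesis by (simp add: im)
qed

definition comb :: "(nat \<Rightarrow> 'k) \<Rightarrow> 'a"
  where "comb c = (\<Oplus>\<^bsub>A\<^esub>i\<in>{..D}. c i \<odot>\<^bsub>A\<^esub> basis i)"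

lemma comb_closed: "c \<in> {..D} \<rightarrow> carrier K \<Longrightarrow> comb c \<in> carrier A"
  unfolding comb_def by (rule A.finsum_closed) auto

lemma comb_zero_imp:
  assumes c: "c \<in> {..D} \<rightarrow> carrier K" and z: "comb c = \<zero>\<^bsub>A\<^esub>" and i: "i \<le> D"
  shows "c i = \<zero>\<^bsub>K\<^esub>"
proof -
  let ?j = "inv_into {..D} basis"
  have inj: "inj_on basis {..D}" and im: "basis ` {..D} = insert \<one>\<^bsub>A\<^esub> gens"
    using basis_bij by (auto simp: bij_betw_def)
  have j: "?j x \<in> {..D}" "basis (?j x) = x" if "x \<in> insert \<one>\<^bsub>A\<^esub> gens" for x
    using that inv_into_into[of x basis "{..D}"] f_inv_into_f[of x basis "{..D}"] im by auto
  have "(\<Oplus>\<^bsub>A\<^esub>x\<in>insert \<one>\<^bsub>A\<^esub> gens. c (?j x) \<odot>\<^bsub>A\<^esub> x)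
    = (\<Oplus>\<^bsub>A\<^esub>x\<in>insert \<one>\<^bsub>A\<^esub> gens. c (?j x) \<odot>\<^bsub>A\<^esub> basis (?j x))"
    using j c gens_carrier by (intro A.finsum_cong') (auto simp: Pi_iff)
  also have "\<dots> = comb c"
    unfolding comb_def by (rule finsum_basis[symmetric]) (use c in auto)
  also note z
  finally have "c (?j (basis i)) = \<zero>\<^bsub>K\<^esub>"
    by (intro gens_independent[of "\<lambda>x. c (?j x)"]) (use c j im i in auto)
  then show ?thesis using i by (simp add: inv_into_f_f[OF inj])
qed

lemma comb_add:
  assumes "c \<in> {..D} \<rightarrow> carrier K" "c' \<in> {..D} \<rightarrow> carrier K"
  shows "comb (\<lambda>i. c i \<oplus>\<^bsub>K\<^esub> c' i) = comb c \<oplus>\<^bsub>A\<^esub> comb c'"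
proof -
  have "comb (\<lambda>i. c i \<oplus>\<^bsub>K\<^esub> c' i) = (\<Oplus>\<^bsub>A\<^esub>i\<in>{..D}. c i \<odot>\<^bsub>A\<^esub> basis i \<oplus>\<^bsub>A\<^esub> c' i \<odot>\<^bsub>A\<^esub> basis i)"
    unfolding comb_def using assms by (intro A.finsum_cong') (auto simp: A.smult_l_distr Pi_iff)
  also have "\<dots> = comb c \<oplus>\<^bsub>A\<^esub> comb c'"
    unfolding comb_def using assms by (intro A.finsum_addf) (auto simp: Pi_iff)
  finally show ?thesis .
qed

lemma comb_smult:
  assumes "c \<in> {..D} \<rightarrow> carrier K" "k \<in> carrier K"
  shows "comb (\<lambda>i. k \<otimes>\<^bsub>K\<^esub> c i) = k \<odot>\<^bsub>A\<^esub> comb c"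
proof -
  have "comb (\<lambda>i. k \<otimes>\<^bsub>K\<^esub> c i) = (\<Oplus>\<^bsub>A\<^esub>i\<in>{..D}. k \<odot>\<^bsub>A\<^esub> (c i \<odot>\<^bsub>A\<^esub> basis i))"
    unfolding comb_def using assms by (intro A.finsum_cong') (auto simp: A.smult_assoc1 Pi_iff)
  also have "\<dots> = k \<odot>\<^bsub>A\<^esub> comb c"
    unfolding comb_def using assms by (intro A.finsum_smult_ldistr[symmetric]) (auto simp: Pi_iff)
  finally show ?thesis .
qed

lemma comb_inject:
  assumes c: "c \<in> {..D} \<rightarrow> carrier K" "c' \<in> {..D} \<rightarrow> carrier K" and eq: "comb c = comb c'" and i: "i \<le> D"
  shows "c i = c' i"
proof -
  have m: "(\<lambda>i. (\<ominus>\<^bsub>K\<^esub> \<one>\<^bsub>K\<^esub>) \<otimes>\<^bsub>K\<^esub> c' i) \<in> {..D} \<rightarrow> carrier K" using c by auto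
  have "comb (\<lambda>i. c i \<oplus>\<^bsub>K\<^esub> (\<ominus>\<^bsub>K\<^esub> \<one>\<^bsub>K\<^esub>) \<otimes>\<^bsub>K\<^esub> c' i) = comb c \<oplus>\<^bsub>A\<^esub> (\<ominus>\<^bsub>K\<^esub> \<one>\<^bsub>K\<^esub>) \<odot>\<^bsub>A\<^esub> comb c'"
    using c m by (simp add: comb_add comb_smult)
  also have "\<dots> = \<zero>\<^bsub>A\<^esub>"
    using comb_closed[OF c(1)] by (simp add: eq[symmetric] A.smult_l_minus A.smult_one A.r_neg)
  finally have "c i \<oplus>\<^bsub>K\<^esub> (\<ominus>\<^bsub>K\<^esub> \<one>\<^bsub>K\<^esub>) \<otimes>\<^bsub>K\<^esub> c' i = \<zero>\<^bsub>K\<^esub>"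
    by (intro comb_zero_imp) (use c i in auto)
  moreover have "c i \<in> carrier K" "c' i \<in> carrier K" using c i by auto
  ultimately show ?thesis
    using K.minus_equality[of "c i" "(\<ominus>\<^bsub>K\<^esub> \<one>\<^bsub>K\<^esub>) \<otimes>\<^bsub>K\<^esub> c' i"] by (simp add: K.l_minus)
qed

lemma comb_surj:
  assumes "x \<in> carrier A"
  shows "\<exists>c \<in> {..D} \<rightarrow> carrier K. x = comb c"
proof -
  let ?T = "insert \<one>\<^bsub>A\<^esub> gens"
  have "hull_of ?T \<subseteq> combs ?T"
    using combs_submodule[OF gens_carrier] combs_contains[OF gens_carrier] gens_finite
    by (intro hull_of_least) auto
  then have "x \<in> combs ?T" using assms gens(1) by (auto simp: generating_def)
  then obtain c where c: "c \<in> ?T \<rightarrow> carrier K" "x = (\<Oplus>\<^bsub>A\<^esub>y\<in>?T. c y \<odot>\<^bsub>A\<^esub> y)" by (auto simp: combs_def)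
  have im: "basis ` {..D} = ?T" using basis_bij by (auto simp: bij_betw_def)
  have j: "basis (inv_into {..D} basis x) = x" if "x \<in> ?T" for x
    using that f_inv_into_f[of x basis "{..D}"] im by auto
  have cb: "(\<lambda>i. c (basis i)) \<in> {..D} \<rightarrow> carrier K"
    using c(1) bij_betwE[OF basis_bij] by (intro Pi_I) blast
  have "comb (\<lambda>i. c (basis i)) = (\<Oplus>\<^bsub>A\<^esub>y\<in>?T. c (basis (inv_into {..D} basis y)) \<odot>\<^bsub>A\<^esub> basis (inv_into {..D} basis y))"
    unfolding comb_def by (rule finsum_basis) (use cb in auto)
  also have "\<dots> = (\<Oplus>\<^bsub>A\<^esub>y\<in>?T. c y \<odot>\<^bsub>A\<^esub> y)"
    using c gens_carrier by (intro A.finsum_cong') (auto simp: j Pi_iff)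
  finally show ?thesis using cb c(2) by metis
qed

definition crd :: "'a \<Rightarrow> nat \<Rightarrow> 'k"
  where "crd x = (SOME c. c \<in> {..D} \<rightarrow> carrier K \<and> x = comb c)"

lemma crd:
  assumes "x \<in> carrier A" shows "crd x \<in> {..D} \<rightarrow> carrier K" "comb (crd x) = x"
proof -
  have "\<exists>c. c \<in> {..D} \<rightarrow> carrier K \<and> x = comb c" using comb_surj[OF assms] by blast
  from someI_ex[OF this, folded crd_def]
  show "crd x \<in> {..D} \<rightarrow> carrier K" "comb (crd x) = x" by simp_all
qed

lemma crd_comb: "c \<in> {..D} \<rightarrow> carrier K \<Longrightarrow> i \<le> D \<Longrightarrow> crd (comb c) i = c i"
  using comb_inject crd comb_closed by metis


text \<open>The degree of a basis element. With weight zero for the unit, the sum of the weights of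
  the letters is the degree of a basis tensor.\<close>

definition gwt :: "nat \<Rightarrow> nat"
  where "gwt i = (if i = 0 then 0 else SOME k. k \<in> {1..s} \<and> basis i \<in> G k)"

lemma gwt_pos:
  assumes "i \<in> {1..D}" shows "gwt i \<in> {1..s} \<and> basis i \<in> G (gwt i)"
proof -
  have "basis i \<in> gens" using assms basis(2) by (auto simp: bij_betw_def)
  then have "\<exists>k. k \<in> {1..s} \<and> basis i \<in> G k" using gens(1) unfolding generating_def by blast
  from someI_ex[OF this] show ?thesis using assms by (simp add: gwt_def)
qed

lemma basis_G: "i \<le> D \<Longrightarrow> basis i \<in> G (gwt i)"
proof (cases "i = 0")
  case True
  have "\<one>\<^bsub>K\<^esub> \<odot>\<^bsub>A\<^esub> \<one>\<^bsub>A\<^esub> \<in> G 0" unfolding G0 by blast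
  then show ?thesis by (simp add: True gwt_def basis(1) A.smult_one)
qed (use gwt_pos[of i] in auto)

lemma gwt_le: "i \<le> D \<Longrightarrow> gwt i \<le> s"
  using gwt_pos[of i] by (cases "i = 0") (auto simp: gwt_def)

lemma finsum_regroup:
  assumes "finite I" "g \<in> I \<rightarrow> carrier A" "\<And>i. i \<in> I \<Longrightarrow> w i \<le> s"
  shows "(\<Oplus>\<^bsub>A\<^esub>k\<in>{..s}. \<Oplus>\<^bsub>A\<^esub>i\<in>I. if w i = k then g i else \<zero>\<^bsub>A\<^esub>) = (\<Oplus>\<^bsub>A\<^esub>i\<in>I. g i)"
  using assms
proof (induction I rule: finite_induct)
  case (insert j I)
  have gj: "g j \<in> carrier A" "g \<in> I \<rightarrow> carrier A" using insert.prems by auto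
  have c: "(\<lambda>i. if w i = k then g i else \<zero>\<^bsub>A\<^esub>) \<in> I \<rightarrow> carrier A" for k using gj by auto
  have "(\<Oplus>\<^bsub>A\<^esub>k\<in>{..s}. \<Oplus>\<^bsub>A\<^esub>i\<in>insert j I. if w i = k then g i else \<zero>\<^bsub>A\<^esub>)
    = (\<Oplus>\<^bsub>A\<^esub>k\<in>{..s}. (if w j = k then g j else \<zero>\<^bsub>A\<^esub>) \<oplus>\<^bsub>A\<^esub> (\<Oplus>\<^bsub>A\<^esub>i\<in>I. if w i = k then g i else \<zero>\<^bsub>A\<^esub>))"
    using insert gj c A.finsum_closed[OF c] by (intro A.finsum_cong' A.finsum_insert) auto
  also have "\<dots> = (\<Oplus>\<^bsub>A\<^esub>k\<in>{..s}. if w j = k then g j else \<zero>\<^bsub>A\<^esub>)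
      \<oplus>\<^bsub>A\<^esub> (\<Oplus>\<^bsub>A\<^esub>k\<in>{..s}. \<Oplus>\<^bsub>A\<^esub>i\<in>I. if w i = k then g i else \<zero>\<^bsub>A\<^esub>)"
    using gj A.finsum_closed[OF c] by (intro A.finsum_addf) auto
  also have "(\<Oplus>\<^bsub>A\<^esub>k\<in>{..s}. if w j = k then g j else \<zero>\<^bsub>A\<^esub>) = g j"
    using insert.prems gj by (intro A.finsum_singleton[of "w j" "{..s}" "\<lambda>_. g j"]) auto
  finally show ?case using insert gj by simp
qed simp

text \<open>Grouping the coordinates of x by weight gives a homogeneous decomposition next to the
  one with x alone in degree m; uniqueness kills the components of all other degrees.\<close>

lemma crd_homogeneous:
  assumes x: "x \<in> G m" and i: "i \<le> D" and nz: "crd x i \<noteq> \<zero>\<^bsub>K\<^esub>"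
  shows "gwt i = m"
proof (rule ccontr)
  assume ne: "gwt i \<noteq> m"
  have xA: "x \<in> carrier A" by (rule G_carrier[OF x])
  note cx = crd[OF xA]
  define f where "f k = (\<Oplus>\<^bsub>A\<^esub>i\<in>{..D}. if gwt i = k then crd x i \<odot>\<^bsub>A\<^esub> basis i else \<zero>\<^bsub>A\<^esub>)" for k
  have fG: "f k \<in> G k" for k
    unfolding f_def
  proof (rule submodule_sum[OF G_submodule], rule Pi_I)
    fix i assume "i \<in> {..D}"
    then have "crd x i \<odot>\<^bsub>A\<^esub> basis i \<in> G (gwt i)"
      using cx(1) by (intro A.submoduleE(4)[OF G_submodule] basis_G) auto
    then show "(if gwt i = k then crd x i \<odot>\<^bsub>A\<^esub> basis i else \<zero>\<^bsub>A\<^esub>) \<in> G k"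
      using submodule_zero[OF G_submodule] by auto
  qed
  have fx: "(\<Oplus>\<^bsub>A\<^esub>k\<in>{..s}. f k) = x"
    unfolding f_def using cx gwt_le by (subst finsum_regroup) (auto simp: comb_def)
  let ?f = "\<lambda>k\<in>{..s}. f k" and ?h = "\<lambda>k\<in>{..s}. if k = m then x else \<zero>\<^bsub>A\<^esub>"
  have "?f \<in> (\<Pi>\<^sub>E i\<in>{..s}. G i) \<and> x = (\<Oplus>\<^bsub>A\<^esub>i\<in>{..s}. ?f i)"
  proof
    have "(\<Oplus>\<^bsub>A\<^esub>i\<in>{..s}. ?f i) = (\<Oplus>\<^bsub>A\<^esub>k\<in>{..s}. f k)"
      using fG G_carrier by (intro A.finsum_cong') auto
    then show "x = (\<Oplus>\<^bsub>A\<^esub>i\<in>{..s}. ?f i)" by (simp only: fx)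
  qed (use fG in auto)
  moreover have "?h \<in> (\<Pi>\<^sub>E i\<in>{..s}. G i) \<and> x = (\<Oplus>\<^bsub>A\<^esub>i\<in>{..s}. ?h i)"
  proof
    show "?h \<in> (\<Pi>\<^sub>E i\<in>{..s}. G i)" using x submodule_zero[OF G_submodule] by auto
    have "(\<Oplus>\<^bsub>A\<^esub>i\<in>{..s}. ?h i) = (\<Oplus>\<^bsub>A\<^esub>i\<in>{..s}. if m = i then x else \<zero>\<^bsub>A\<^esub>)"
      using xA by (intro A.finsum_cong') auto
    also have "\<dots> = x"
    proof (cases "m \<le> s")
      case True
      then show ?thesis using xA by (intro A.finsum_singleton[of m "{..s}" "\<lambda>_. x"]) auto
    next
      \<comment> \<open>Beyond degree s there is only zero, so the family in which x does not occur
        still sums to x.\<close>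
      case False
      then have "x = \<zero>\<^bsub>A\<^esub>" using x G_large[of m] by auto
      then show ?thesis by (simp cong: if_cong)
    qed
    finally show "x = (\<Oplus>\<^bsub>A\<^esub>i\<in>{..s}. ?h i)" ..
  qed
  ultimately have "?f = ?h" using G_decomp[OF xA] by blast
  from fun_cong[OF this, of "gwt i"] have "f (gwt i) = \<zero>\<^bsub>A\<^esub>"
    using gwt_le[OF i] ne by simp
  moreover have "f k = comb (\<lambda>j. if gwt j = k then crd x j else \<zero>\<^bsub>K\<^esub>)" for k
    unfolding f_def comb_def using cx(1) by (intro A.finsum_cong') (auto simp: Pi_iff)
  ultimately have "comb (\<lambda>j. if gwt j = gwt i then crd x j else \<zero>\<^bsub>K\<^esub>) = \<zero>\<^bsub>A\<^esub>" by simp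
  moreover have "(\<lambda>j. if gwt j = gwt i then crd x j else \<zero>\<^bsub>K\<^esub>) \<in> {..D} \<rightarrow> carrier K"
    using cx(1) by (auto simp: Pi_iff)
  ultimately show False using comb_zero_imp[OF _ _ i] nz by fastforce
qed

section \<open>Coordinates in the ambient ring and structure constants\<close>

definition \<alpha> :: "'a \<Rightarrow> nat \<Rightarrow> 'k field_product"
  where "\<alpha> x k = (if k \<le> D then \<iota> (crd x k) else 0)"

text \<open>The inverse of \<alpha>; it forgets the components of the coefficients in all factors
  but the given field.\<close>

definition el :: "(nat \<Rightarrow> 'k field_product) \<Rightarrow> 'a"
  where "el c = comb (\<lambda>i. pr (c i))"

lemma el_closed [simp]: "el c \<in> carrier A"
  unfolding el_def by (rule comb_closed) simp

lemma crd_closed [simp]: "x \<in> carrier A \<Longrightarrow> i \<le> D \<Longrightarrow> crd x i \<in> carrier K"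
  using crd(1)[of x] by auto

lemma unit_\<alpha>: "x \<in> carrier A \<Longrightarrow> unit * \<alpha> x k = \<alpha> x k"
  by (simp add: \<alpha>_def unit_inj)

lemma \<alpha>_el: "\<alpha> (el c) k = (if k \<le> D then unit * c k else 0)"
  by (simp add: \<alpha>_def el_def crd_comb inj_pr)

lemma comb_cong: "(\<And>i. i \<le> D \<Longrightarrow> c i = c' i) \<Longrightarrow> c' \<in> {..D} \<rightarrow> carrier K \<Longrightarrow> comb c = comb c'"
  unfolding comb_def by (intro A.finsum_cong') (auto simp: Pi_iff)

lemma el_\<alpha>: "x \<in> carrier A \<Longrightarrow> el (\<alpha> x) = x"
  unfolding el_def using comb_cong[of "\<lambda>i. pr (\<alpha> x i)" "crd x"] crd by (simp add: \<alpha>_def pr_inj)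

lemma \<alpha>_inject:
  assumes "x \<in> carrier A" "y \<in> carrier A" "\<And>k. k \<le> D \<Longrightarrow> \<alpha> x k = \<alpha> y k"
  shows "x = y"
proof -
  have "\<alpha> x = \<alpha> y" using assms(3) by (auto simp: \<alpha>_def)
  then show ?thesis using el_\<alpha>[OF assms(1)] el_\<alpha>[OF assms(2)] by metis
qed

lemma crd_add: "x \<in> carrier A \<Longrightarrow> y \<in> carrier A \<Longrightarrow> i \<le> D \<Longrightarrow> crd (x \<oplus>\<^bsub>A\<^esub> y) i = crd x i \<oplus>\<^bsub>K\<^esub> crd y i"
  using comb_add[of "crd x" "crd y"] crd[of x] crd[of y] crd_comb[of "\<lambda>i. crd x i \<oplus>\<^bsub>K\<^esub> crd y i" i]
  by (auto simp: Pi_iff)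

lemma crd_smult: "x \<in> carrier A \<Longrightarrow> k \<in> carrier K \<Longrightarrow> i \<le> D \<Longrightarrow> crd (k \<odot>\<^bsub>A\<^esub> x) i = k \<otimes>\<^bsub>K\<^esub> crd x i"
  using comb_smult[of "crd x" k] crd[of x] crd_comb[of "\<lambda>i. k \<otimes>\<^bsub>K\<^esub> crd x i" i]
  by (auto simp: Pi_iff)

lemma \<alpha>_add: "x \<in> carrier A \<Longrightarrow> y \<in> carrier A \<Longrightarrow> \<alpha> (x \<oplus>\<^bsub>A\<^esub> y) k = \<alpha> x k + \<alpha> y k"
  by (simp add: \<alpha>_def crd_add inj_add)

lemma \<alpha>_smult: "x \<in> carrier A \<Longrightarrow> a \<in> carrier K \<Longrightarrow> \<alpha> (a \<odot>\<^bsub>A\<^esub> x) k = \<iota> a * \<alpha> x k"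
  by (simp add: \<alpha>_def crd_smult inj_mult)

lemma \<alpha>_zero: "\<alpha> \<zero>\<^bsub>A\<^esub> k = 0"
  using \<alpha>_add[of "\<zero>\<^bsub>A\<^esub>" "\<zero>\<^bsub>A\<^esub>" k] by simp

lemma \<alpha>_minus: "x \<in> carrier A \<Longrightarrow> \<alpha> (\<ominus>\<^bsub>A\<^esub> x) k = - \<alpha> x k"
  using \<alpha>_add[of "\<ominus>\<^bsub>A\<^esub> x" x k] by (simp add: A.l_neg \<alpha>_zero eq_neg_iff_add_eq_0)

lemma \<alpha>_sum: "finite I \<Longrightarrow> f \<in> I \<rightarrow> carrier A \<Longrightarrow> \<alpha> (\<Oplus>\<^bsub>A\<^esub>i\<in>I. f i) k = (\<Sum>i\<in>I. \<alpha> (f i) k)"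
proof (induction I rule: finite_induct)
  case (insert i I)
  then have "f i \<in> carrier A" "f \<in> I \<rightarrow> carrier A" by auto
  with insert show ?case by (simp add: \<alpha>_add)
qed (simp add: \<alpha>_zero)

text \<open>Structure constants of the basis, extended by zero to all indices so that letters above
  \<open>D\<close> never contribute.\<close>

definition sc :: "nat \<Rightarrow> nat \<Rightarrow> nat \<Rightarrow> 'k field_product"
  where "sc i j k = (if i \<le> D \<and> j \<le> D then \<alpha> (basis i \<otimes>\<^bsub>A\<^esub> basis j) k else 0)"

lemma \<alpha>_basis: "i \<le> D \<Longrightarrow> \<alpha> (basis i) k = (if i = k then unit else 0)"
proof -
  assume i: "i \<le> D"
  have "comb (\<lambda>j. if i = j then \<one>\<^bsub>K\<^esub> else \<zero>\<^bsub>K\<^esub>) = (\<Oplus>\<^bsub>A\<^esub>j\<in>{..D}. if i = j then basis j else \<zero>\<^bsub>A\<^esub>)"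
    unfolding comb_def by (intro A.finsum_cong') (auto simp: A.smult_one)
  also have "\<dots> = basis i" using i by (intro A.finsum_singleton) auto
  finally have "crd (basis i) k = (if i = k then \<one>\<^bsub>K\<^esub> else \<zero>\<^bsub>K\<^esub>)" if "k \<le> D"
    using crd_comb[of "\<lambda>j. if i = j then \<one>\<^bsub>K\<^esub> else \<zero>\<^bsub>K\<^esub>" k] that by simp
  then show ?thesis using i by (cases "k \<le> D") (auto simp: \<alpha>_def unit_def inj_zero)
qed

lemma \<alpha>_expand_left:
  assumes x: "x \<in> carrier A" and y: "y \<in> carrier A"
  shows "\<alpha> (x \<otimes>\<^bsub>A\<^esub> y) k = (\<Sum>i\<le>D. \<alpha> x i * \<alpha> (basis i \<otimes>\<^bsub>A\<^esub> y) k)"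
proof -
  have "x \<otimes>\<^bsub>A\<^esub> y = (\<Oplus>\<^bsub>A\<^esub>i\<in>{..D}. (crd x i \<odot>\<^bsub>A\<^esub> basis i) \<otimes>\<^bsub>A\<^esub> y)"
    using A.finsum_ldistr[of "{..D}" y "\<lambda>i. crd x i \<odot>\<^bsub>A\<^esub> basis i"] crd(2)[OF x] x y
    by (simp add: comb_def)
  then have "\<alpha> (x \<otimes>\<^bsub>A\<^esub> y) k = (\<Sum>i\<le>D. \<alpha> ((crd x i \<odot>\<^bsub>A\<^esub> basis i) \<otimes>\<^bsub>A\<^esub> y) k)"
    using x y by (simp add: \<alpha>_sum)
  also have "\<dots> = (\<Sum>i\<le>D. \<alpha> x i * \<alpha> (basis i \<otimes>\<^bsub>A\<^esub> y) k)"
    using x y by (intro sum.cong refl) (simp add: A.smult_mult_left \<alpha>_smult, simp add: \<alpha>_def)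
  finally show ?thesis .
qed

lemma \<alpha>_expand_right:
  assumes x: "x \<in> carrier A" and y: "y \<in> carrier A"
  shows "\<alpha> (x \<otimes>\<^bsub>A\<^esub> y) k = (\<Sum>j\<le>D. \<alpha> y j * \<alpha> (x \<otimes>\<^bsub>A\<^esub> basis j) k)"
proof -
  have "x \<otimes>\<^bsub>A\<^esub> y = (\<Oplus>\<^bsub>A\<^esub>i\<in>{..D}. x \<otimes>\<^bsub>A\<^esub> (crd y i \<odot>\<^bsub>A\<^esub> basis i))"
    using A.finsum_rdistr[of "{..D}" x "\<lambda>i. crd y i \<odot>\<^bsub>A\<^esub> basis i"] crd(2)[OF y] x y
    by (simp add: comb_def)
  then have "\<alpha> (x \<otimes>\<^bsub>A\<^esub> y) k = (\<Sum>i\<le>D. \<alpha> (x \<otimes>\<^bsub>A\<^esub> (crd y i \<odot>\<^bsub>A\<^esub> basis i)) k)"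
    using x y by (simp add: \<alpha>_sum)
  also have "\<dots> = (\<Sum>i\<le>D. \<alpha> y i * \<alpha> (x \<otimes>\<^bsub>A\<^esub> basis i) k)"
    using x y by (intro sum.cong refl) (simp add: A.smult_mult_right \<alpha>_smult, simp add: \<alpha>_def)
  finally show ?thesis .
qed

lemma \<alpha>_mult:
  assumes x: "x \<in> carrier A" and y: "y \<in> carrier A"
  shows "\<alpha> (x \<otimes>\<^bsub>A\<^esub> y) k = (\<Sum>i\<le>D. \<Sum>j\<le>D. \<alpha> x i * \<alpha> y j * sc i j k)"
  unfolding \<alpha>_expand_left[OF x y]
  by (rule sum.cong[OF refl]) (simp add: \<alpha>_expand_right[OF _ y] sc_def sum_distrib_left mult_ac)

lemma sc_0: "sc 0 j k = (if j = k \<and> j \<le> D then unit else 0)" "sc j 0 k = (if j = k \<and> j \<le> D then unit else 0)"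
  by (auto simp: sc_def basis(1) \<alpha>_basis)

text \<open>Both sides are a coordinate of the same product of three basis elements, bracketed in
  the two ways.\<close>

lemma sc_assoc: "(\<Sum>x\<le>D. sc p q x * sc x r k) = (\<Sum>x\<le>D. sc q r x * sc p x k)"
proof (cases "p \<le> D \<and> q \<le> D \<and> r \<le> D")
  case True
  then have b: "basis p \<in> carrier A" "basis q \<in> carrier A" "basis r \<in> carrier A" by auto
  have 1: "(\<Sum>i\<le>D. \<Sum>j\<le>D. \<alpha> (basis p \<otimes>\<^bsub>A\<^esub> basis q) i * \<alpha> (basis r) j * sc i j k)
    = (\<Sum>i\<le>D. \<Sum>j\<le>D. \<alpha> (basis p) i * \<alpha> (basis q \<otimes>\<^bsub>A\<^esub> basis r) j * sc i j k)"
    using \<alpha>_mult[of "basis p \<otimes>\<^bsub>A\<^esub> basis q" "basis r" k] \<alpha>_mult[of "basis p" "basis q \<otimes>\<^bsub>A\<^esub> basis r" k] b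
    by (simp add: A.m_assoc)
  have 2: "(\<Sum>j\<le>D. \<alpha> (basis p \<otimes>\<^bsub>A\<^esub> basis q) i * \<alpha> (basis r) j * sc i j k) = sc p q i * sc i r k" for i
  proof -
    have "(\<Sum>j\<le>D. \<alpha> (basis p \<otimes>\<^bsub>A\<^esub> basis q) i * \<alpha> (basis r) j * sc i j k)
      = (\<Sum>j\<le>D. if r = j then \<alpha> (basis p \<otimes>\<^bsub>A\<^esub> basis q) i * unit * sc i r k else 0)"
      using True by (intro sum.cong refl) (auto simp: \<alpha>_basis)
    also have "\<dots> = sc p q i * sc i r k"
      using True b unit_\<alpha>[of "basis p \<otimes>\<^bsub>A\<^esub> basis q" i] by (simp add: sc_def mult.commute)
    finally show ?thesis .
  qed
  have 3: "(\<Sum>i\<le>D. \<Sum>j\<le>D. \<alpha> (basis p) i * \<alpha> (basis q \<otimes>\<^bsub>A\<^esub> basis r) j * sc i j k)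
     = (\<Sum>j\<le>D. sc q r j * sc p j k)"
  proof -
    have "(\<Sum>i\<le>D. \<Sum>j\<le>D. \<alpha> (basis p) i * \<alpha> (basis q \<otimes>\<^bsub>A\<^esub> basis r) j * sc i j k)
      = (\<Sum>i\<le>D. if p = i then (\<Sum>j\<le>D. unit * \<alpha> (basis q \<otimes>\<^bsub>A\<^esub> basis r) j * sc p j k) else 0)"
      using True by (intro sum.cong refl) (auto simp: \<alpha>_basis)
    also have "\<dots> = (\<Sum>j\<le>D. sc q r j * sc p j k)"
      using True b by (simp add: unit_\<alpha> sc_def)
    finally show ?thesis .
  qed
  show ?thesis using 1 unfolding 2 3 .
qed (auto simp: sc_def)

lemma unit_sc: "unit * sc i j k = sc i j k"
  by (simp add: sc_def unit_\<alpha>)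

text \<open>The product of two basis elements is homogeneous, so only basis elements of the summed
  weight can occur in it.\<close>

lemma sc_weight:
  assumes "sc i j k \<noteq> 0" shows "i \<le> D \<and> j \<le> D \<and> k \<le> D \<and> gwt k = gwt i + gwt j"
proof -
  have ijk: "i \<le> D" "j \<le> D" "k \<le> D" "crd (basis i \<otimes>\<^bsub>A\<^esub> basis j) k \<noteq> \<zero>\<^bsub>K\<^esub>"
    using assms inj_zero by (auto simp: sc_def \<alpha>_def split: if_splits)
  then have "gwt k = gwt i + gwt j"
    by (intro crd_homogeneous[OF G_mult[OF basis_G basis_G]]) auto
  with ijk show ?thesis by blast
qed

end

section \<open>Projective resolutions\<close>

lemma left_moduleD:
  assumes "left_module R M"
  shows "ring R" "abelian_group M"
  using assms by (simp_all add: left_module_def)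

lemma lmod_homI:
  assumes "\<And>x. x \<in> carrier M \<Longrightarrow> f x \<in> carrier N"
    and "\<And>x y. x \<in> carrier M \<Longrightarrow> y \<in> carrier M \<Longrightarrow> f (x \<oplus>\<^bsub>M\<^esub> y) = f x \<oplus>\<^bsub>N\<^esub> f y"
    and "\<And>r x. r \<in> carrier R \<Longrightarrow> x \<in> carrier M \<Longrightarrow> f (r \<odot>\<^bsub>M\<^esub> x) = r \<odot>\<^bsub>N\<^esub> f x"
  shows "f \<in> lmod_hom R M N"
  using assms by (auto simp: lmod_hom_def)

lemma lmod_homD:
  assumes "f \<in> lmod_hom R M N"
  shows "x \<in> carrier M \<Longrightarrow> f x \<in> carrier N"
    and "x \<in> carrier M \<Longrightarrow> y \<in> carrier M \<Longrightarrow> f (x \<oplus>\<^bsub>M\<^esub> y) = f x \<oplus>\<^bsub>N\<^esub> f y"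
    and "r \<in> carrier R \<Longrightarrow> x \<in> carrier M \<Longrightarrow> f (r \<odot>\<^bsub>M\<^esub> x) = r \<odot>\<^bsub>N\<^esub> f x"
  using assms by (auto simp: lmod_hom_def)

lemma lmod_hom_comp:
  assumes "f \<in> lmod_hom R L M" "g \<in> lmod_hom R M N"
  shows "(\<lambda>x. g (f x)) \<in> lmod_hom R L N"
  by (rule lmod_homI) (simp_all add: lmod_homD[OF assms(1)] lmod_homD[OF assms(2)])

context left_module
begin

lemma smult_r_null: "a \<in> carrier R \<Longrightarrow> a \<odot>\<^bsub>M\<^esub> \<zero>\<^bsub>M\<^esub> = \<zero>\<^bsub>M\<^esub>"
  by (metis M.add.l_cancel_one' M.zero_closed M.l_zero smult_closed smult_r_distr)

lemma smult_l_null: "x \<in> carrier M \<Longrightarrow> \<zero> \<odot>\<^bsub>M\<^esub> x = \<zero>\<^bsub>M\<^esub>"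
  by (metis M.add.l_cancel_one' R.l_zero R.zero_closed smult_closed smult_l_distr)

lemma smult_minus_one: "x \<in> carrier M \<Longrightarrow> (\<ominus> \<one>) \<odot>\<^bsub>M\<^esub> x = \<ominus>\<^bsub>M\<^esub> x"
  by (metis M.minus_equality R.l_neg R.add.inv_closed R.one_closed smult_closed smult_l_distr smult_l_null
      smult_one)

lemma smult_r_minus:
  assumes "a \<in> carrier R" "x \<in> carrier M"
  shows "a \<odot>\<^bsub>M\<^esub> (\<ominus>\<^bsub>M\<^esub> x) = \<ominus>\<^bsub>M\<^esub> (a \<odot>\<^bsub>M\<^esub> x)"
  by (metis M.minus_equality M.l_neg M.add.inv_closed assms smult_closed smult_r_distr smult_r_null)

end

lemma lmod_hom_zero:
  assumes "left_module R M" "left_module R N" "f \<in> lmod_hom R M N"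
  shows "f \<zero>\<^bsub>M\<^esub> = \<zero>\<^bsub>N\<^esub>"
proof -
  interpret M: left_module R M by (rule assms)
  interpret N: left_module R N by (rule assms)
  have "f \<zero>\<^bsub>M\<^esub> \<oplus>\<^bsub>N\<^esub> f \<zero>\<^bsub>M\<^esub> = f \<zero>\<^bsub>M\<^esub>"
    using lmod_homD(2)[OF assms(3), of "\<zero>\<^bsub>M\<^esub>" "\<zero>\<^bsub>M\<^esub>"] by simp
  then show ?thesis using lmod_homD(1)[OF assms(3), of "\<zero>\<^bsub>M\<^esub>"] by simp
qed

lemma lmod_hom_minus:
  assumes "left_module R M" "left_module R N" "f \<in> lmod_hom R M N" "x \<in> carrier M"
  shows "f (\<ominus>\<^bsub>M\<^esub> x) = \<ominus>\<^bsub>N\<^esub> f x"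
proof -
  interpret M: left_module R M by (rule assms)
  interpret N: left_module R N by (rule assms)
  have "f (\<ominus>\<^bsub>M\<^esub> x) \<oplus>\<^bsub>N\<^esub> f x = \<zero>\<^bsub>N\<^esub>"
    using lmod_homD(2)[OF assms(3), of "\<ominus>\<^bsub>M\<^esub> x" x] assms lmod_hom_zero[OF assms(1-3)]
    by (simp add: M.M.l_neg)
  then show ?thesis using lmod_homD(1)[OF assms(3)] assms
    by (metis M.M.add.inv_closed N.M.minus_equality)
qed

lemma lmod_hom_diff:
  assumes "left_module R M" "left_module R N" "f \<in> lmod_hom R M N" "x \<in> carrier M" "y \<in> carrier M"
  shows "f (x \<ominus>\<^bsub>M\<^esub> y) = f x \<ominus>\<^bsub>N\<^esub> f y"
proof -
  interpret M: left_module R M by (rule assms)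
  show ?thesis
    unfolding a_minus_def
    using assms lmod_hom_minus[OF assms(1-3)] lmod_homD(2)[OF assms(3)] by simp
qed

lemma lmod_hom_sum:
  assumes "left_module R M" "left_module R N" "f \<in> lmod_hom R M N" "finite I" "x \<in> I \<rightarrow> carrier M"
  shows "f (\<Oplus>\<^bsub>M\<^esub>i\<in>I. x i) = (\<Oplus>\<^bsub>N\<^esub>i\<in>I. f (x i))"
  using assms(4,5)
proof (induction I rule: finite_induct)
  interpret M: left_module R M by (rule assms)
  interpret N: left_module R N by (rule assms)
  case empty
  then show ?case using lmod_hom_zero[OF assms(1-3)] by simp
next
  interpret M: left_module R M by (rule assms)
  interpret N: left_module R N by (rule assms)
  case (insert i I)
  then have "x \<in> I \<rightarrow> carrier M" "x i \<in> carrier M" by auto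
  moreover from this have "(\<lambda>i. f (x i)) \<in> I \<rightarrow> carrier N" "f (x i) \<in> carrier N"
    using lmod_homD(1)[OF assms(3)] by auto
  ultimately show ?case using insert lmod_homD(2)[OF assms(3)] by simp
qed

section \<open>Submodules, and modules moved into the universe\<close>

lemma left_module_sub:
  assumes "left_module R M" and S: "S \<subseteq> carrier M" "\<zero>\<^bsub>M\<^esub> \<in> S"
    and add: "\<And>x y. x \<in> S \<Longrightarrow> y \<in> S \<Longrightarrow> x \<oplus>\<^bsub>M\<^esub> y \<in> S"
    and smult: "\<And>r x. r \<in> carrier R \<Longrightarrow> x \<in> S \<Longrightarrow> r \<odot>\<^bsub>M\<^esub> x \<in> S"
  shows "left_module R (M\<lparr>carrier := S\<rparr>)"
proof -
  interpret M: left_module R M by (rule assms)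
  have neg: "\<ominus>\<^bsub>M\<^esub> x \<in> S" if "x \<in> S" for x
    using smult[of "\<ominus>\<^bsub>R\<^esub> \<one>\<^bsub>R\<^esub>" x] that S M.smult_minus_one[of x] by auto
  have "abelian_group (M\<lparr>carrier := S\<rparr>)"
  proof (rule abelian_groupI)
    fix x assume "x \<in> carrier (M\<lparr>carrier := S\<rparr>)"
    then show "\<exists>y\<in>carrier (M\<lparr>carrier := S\<rparr>). y \<oplus>\<^bsub>M\<lparr>carrier := S\<rparr>\<^esub> x = \<zero>\<^bsub>M\<lparr>carrier := S\<rparr>\<^esub>"
      using neg S by (auto intro!: bexI[of _ "\<ominus>\<^bsub>M\<^esub> x"] simp: M.M.l_neg subsetD)
  qed (use S add in \<open>auto simp: M.M.a_ac subset_iff\<close>)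
  with M.R.ring_axioms show ?thesis
    unfolding left_module_def left_module_axioms_def using S smult
    by (auto simp: subset_iff M.smult_l_distr M.smult_r_distr M.smult_assoc M.smult_one)
qed

text \<open>The modules of a resolution must have their carriers in the universe type, whereas the
  bar modules consist of functions on words. An injection J carries them over.\<close>

definition transport_module ::
    "('m \<Rightarrow> 'u) \<Rightarrow> ('r, 'm, 'y) module_scheme \<Rightarrow> ('r, 'u) module"
  where "transport_module J M = (let j = inv_into (carrier M) J in
    \<lparr>carrier = J ` carrier M, monoid.mult = (\<lambda>x y. x), one = J \<zero>\<^bsub>M\<^esub>, ring.zero = J \<zero>\<^bsub>M\<^esub>,
     ring.add = (\<lambda>x y. J (j x \<oplus>\<^bsub>M\<^esub> j y)), smult = (\<lambda>r x. J (r \<odot>\<^bsub>M\<^esub> j x))\<rparr>)"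

lemma transport_module_simps:
  shows "carrier (transport_module J M) = J ` carrier M"
    and "\<zero>\<^bsub>transport_module J M\<^esub> = J \<zero>\<^bsub>M\<^esub>"
    and "inj_on J (carrier M) \<Longrightarrow> x \<in> carrier M \<Longrightarrow> y \<in> carrier M \<Longrightarrow>
      J x \<oplus>\<^bsub>transport_module J M\<^esub> J y = J (x \<oplus>\<^bsub>M\<^esub> y)"
    and "inj_on J (carrier M) \<Longrightarrow> x \<in> carrier M \<Longrightarrow>
      r \<odot>\<^bsub>transport_module J M\<^esub> J x = J (r \<odot>\<^bsub>M\<^esub> x)"
  by (simp_all add: transport_module_def Let_def)

lemma left_module_transport:
  assumes "left_module R M" "inj_on J (carrier M)"
  shows "left_module R (transport_module J M)"
proof -
  interpret M: left_module R M by (rule assms)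
  note [simp] = transport_module_simps(1,2) transport_module_simps(3,4)[OF assms(2)]
  have "abelian_group (transport_module J M)"
  proof (rule abelian_groupI)
    fix x assume "x \<in> carrier (transport_module J M)"
    then obtain y where "x = J y" "y \<in> carrier M" by auto
    then show "\<exists>y\<in>carrier (transport_module J M).
        y \<oplus>\<^bsub>transport_module J M\<^esub> x = \<zero>\<^bsub>transport_module J M\<^esub>"
      by (auto intro!: bexI[of _ "\<ominus>\<^bsub>M\<^esub> y"] simp: M.M.l_neg)
  qed (auto simp: M.M.a_ac)
  with M.R.ring_axioms show ?thesis
    unfolding left_module_def left_module_axioms_def
    by (auto simp: M.smult_closed M.smult_l_distr M.smult_r_distr M.smult_assoc M.smult_one)
qed

lemma transport_hom:
  assumes "inj_on J (carrier M)"
  shows "J \<in> lmod_hom R M (transport_module J M)"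
  by (rule lmod_homI) (simp_all add: transport_module_simps assms)

lemma transport_hom_inv:
  assumes "left_module R M" "inj_on J (carrier M)"
  shows "inv_into (carrier M) J \<in> lmod_hom R (transport_module J M) M"
proof -
  interpret M: left_module R M by (rule assms)
  show ?thesis
    by (rule lmod_homI)
      (auto simp: transport_module_simps assms(2) inv_into_f_f[OF assms(2)] M.smult_closed)
qed

text \<open>The lifting property in \<open>projective_module\<close> concerns a surjection onto a
  module in the universe. Here the target is cut down to the image of g and that image is moved into
  the universe; f factors through it by assumption.\<close>

lemma projective_lift:
  fixes P M :: "('r, 'u) module" and N :: "('r, 'n, 'z) module_scheme"
  assumes P: "projective_module R P" and M: "left_module R M" and N: "left_module R N"
    and univ: "carrier N \<lesssim> (UNIV :: 'u set)"
    and g: "g \<in> lmod_hom R M N" and f: "f \<in> lmod_hom R P N"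
    and im: "f ` carrier P \<subseteq> g ` carrier M"
  obtains h where "h \<in> lmod_hom R P M" "\<And>x. x \<in> carrier P \<Longrightarrow> g (h x) = f x"
proof -
  interpret M: left_module R M by (rule M)
  interpret N: left_module R N by (rule N)
  obtain J :: "'n \<Rightarrow> 'u" where J: "inj_on J (carrier N)" using univ by (auto simp: lepoll_def)
  define N' where "N' = N\<lparr>carrier := g ` carrier M\<rparr>"
  have N': "left_module R N'"
    unfolding N'_def
  proof (rule left_module_sub[OF N])
    show "g ` carrier M \<subseteq> carrier N" using lmod_homD(1)[OF g] by auto
    show "\<zero>\<^bsub>N\<^esub> \<in> g ` carrier M" using lmod_hom_zero[OF M N g] by (metis M.M.zero_closed imageI)
  qed (auto simp: M.smult_closed lmod_homD(2,3)[OF g, symmetric])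
  have J': "inj_on J (carrier N')" using J lmod_homD(1)[OF g] by (auto simp: N'_def inj_on_def)
  let ?T = "transport_module J N'"
  have g': "g \<in> lmod_hom R M N'" using g by (auto simp: lmod_hom_def N'_def)
  have f': "f \<in> lmod_hom R P N'" using f im by (auto simp: lmod_hom_def N'_def)
  have "\<exists>h \<in> lmod_hom R P M. \<forall>x \<in> carrier P. J (g (h x)) = J (f x)"
    using P[unfolded projective_module_def, THEN conjunct2, rule_format, of M ?T "\<lambda>x. J (g x)" "\<lambda>x. J (f x)"]
      M left_module_transport[OF N' J'] lmod_hom_comp[OF g' transport_hom[OF J']]
      lmod_hom_comp[OF f' transport_hom[OF J']]
    by (auto simp: transport_module_simps N'_def)
  then obtain h where h: "h \<in> lmod_hom R P M" "\<And>x. x \<in> carrier P \<Longrightarrow> J (g (h x)) = J (f x)" by blast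
  moreover have "g (h x) = f x" if "x \<in> carrier P" for x
    using h(2)[OF that] J' lmod_homD(1)[OF g' lmod_homD(1)[OF h(1) that]] lmod_homD(1)[OF f' that]
    by (auto dest: inj_onD)
  ultimately show thesis using that by blast
qed

section \<open>Comparison of projective resolutions\<close>

locale resolution =
  fixes R :: "('r, 'x) ring_scheme" and X :: "('r, 'm, 'y) module_scheme"
    and P :: "nat \<Rightarrow> ('r, 'u) module" and d :: "nat \<Rightarrow> 'u \<Rightarrow> 'u" and e :: "'u \<Rightarrow> 'm"
  assumes res: "projective_resolution R X P d e"
    and X: "left_module R X" and univ: "carrier X \<lesssim> (UNIV :: 'u set)"
begin

lemma proj: "projective_module R (P n)"
  and d_hom: "d n \<in> lmod_hom R (P (Suc n)) (P n)"
  and e_hom: "e \<in> lmod_hom R (P 0) X"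
  and e_surj: "e ` carrier (P 0) = carrier X"
  using res by (auto simp: projective_resolution_def)

lemma mod: "left_module R (P n)"
  using proj by (simp add: projective_module_def)

text \<open>The augmentation counts as the differential leaving degree 0, so that exactness has the
  same form in all degrees.\<close>

definition cyc :: "nat \<Rightarrow> 'u \<Rightarrow> bool"
  where "cyc n x \<longleftrightarrow> x \<in> carrier (P n) \<and> (case n of 0 \<Rightarrow> e x = \<zero>\<^bsub>X\<^esub> | Suc m \<Rightarrow> d m x = \<zero>\<^bsub>P m\<^esub>)"

lemma im_d: "d n ` carrier (P (Suc n)) = {x. cyc n x}"
  using res by (cases n) (auto simp: projective_resolution_def cyc_def)

lemma cyc_d: "x \<in> carrier (P (Suc n)) \<Longrightarrow> cyc n (d n x)"
  using im_d[of n] by auto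

lemma univ': "carrier (P n) \<lesssim> (UNIV :: 'u set)"
  by (auto simp: lepoll_def intro!: exI[of _ id])

end

text \<open>The comparison theorem. Each component is a lift of the previous one along the
  differential of Q, possible because cycles of Q are boundaries.\<close>

lemma chain_map_exists:
  fixes P Q :: "nat \<Rightarrow> ('r, 'u) module"
  assumes "resolution R X P d e" "resolution R X Q d' e'"
  obtains F where "\<And>n. F n \<in> lmod_hom R (P n) (Q n)"
    and "\<And>x. x \<in> carrier (P 0) \<Longrightarrow> e' (F 0 x) = e x"
    and "\<And>n x. x \<in> carrier (P (Suc n)) \<Longrightarrow> d' n (F (Suc n) x) = F n (d n x)"
proof -
  interpret P: resolution R X P d e by (rule assms)
  interpret Q: resolution R X Q d' e' by (rule assms)
  \<comment> \<open>The invariant records that cycles go to cycles: this puts the next composite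
    into the image of the differential of Q.\<close>
  let ?I = "\<lambda>n F. F \<in> lmod_hom R (P n) (Q n) \<and> (\<forall>x. P.cyc n x \<longrightarrow> Q.cyc n (F x)) \<and>
     (n = 0 \<longrightarrow> (\<forall>x \<in> carrier (P 0). e' (F x) = e x))"
  have "\<exists>F. \<forall>n. ?I n (F n) \<and> (\<forall>x \<in> carrier (P (Suc n)). d' n (F (Suc n) x) = F n (d n x))"
  proof (rule dependent_nat_choice)
    obtain h where h: "h \<in> lmod_hom R (P 0) (Q 0)" "\<And>x. x \<in> carrier (P 0) \<Longrightarrow> e' (h x) = e x"
    proof (rule projective_lift[OF P.proj Q.mod P.X P.univ Q.e_hom P.e_hom])
      show "e ` carrier (P 0) \<subseteq> e' ` carrier (Q 0)" by (simp add: P.e_surj Q.e_surj)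
    qed blast
    then show "\<exists>F. ?I 0 F"
      using lmod_homD(1)[OF h(1)] by (intro exI[of _ h]) (auto simp: P.cyc_def Q.cyc_def)
  next
    fix F n assume F: "?I n F"
    then have Fh: "F \<in> lmod_hom R (P n) (Q n)" by blast
    obtain h where h: "h \<in> lmod_hom R (P (Suc n)) (Q (Suc n))"
      "\<And>x. x \<in> carrier (P (Suc n)) \<Longrightarrow> d' n (h x) = F (d n x)"
    proof (rule projective_lift[OF P.proj Q.mod Q.mod Q.univ' Q.d_hom lmod_hom_comp[OF P.d_hom Fh]])
      show "(\<lambda>x. F (d n x)) ` carrier (P (Suc n)) \<subseteq> d' n ` carrier (Q (Suc n))"
        using F P.cyc_d by (auto simp: Q.im_d)
    qed blast
    have "Q.cyc (Suc n) (h x)" if "P.cyc (Suc n) x" for x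
      using that h lmod_homD(1)[OF h(1)] lmod_hom_zero[OF P.mod Q.mod Fh]
      by (auto simp: P.cyc_def Q.cyc_def)
    with h show "\<exists>F'. ?I (Suc n) F' \<and> (\<forall>x \<in> carrier (P (Suc n)). d' n (F' x) = F (d n x))"
      by auto
  qed
  then obtain F where "\<And>n. ?I n (F n) \<and> (\<forall>x \<in> carrier (P (Suc n)). d' n (F (Suc n) x) = F n (d n x))"
    by blast
  then show thesis by (intro that[of F]) blast+
qed

context resolution
begin

lemma lmod_hom_minus_hom:
  assumes "left_module R M" "left_module R N" "f \<in> lmod_hom R M N" "g \<in> lmod_hom R M N"
  shows "(\<lambda>x. f x \<ominus>\<^bsub>N\<^esub> g x) \<in> lmod_hom R M N"
proof -
  interpret M: left_module R M by (rule assms)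
  interpret N: left_module R N by (rule assms)
  note [simp] = lmod_homD[OF assms(3)] lmod_homD[OF assms(4)]
  show ?thesis
  proof (rule lmod_homI)
    fix x y assume "x \<in> carrier M" "y \<in> carrier M"
    then show "f (x \<oplus>\<^bsub>M\<^esub> y) \<ominus>\<^bsub>N\<^esub> g (x \<oplus>\<^bsub>M\<^esub> y) = f x \<ominus>\<^bsub>N\<^esub> g x \<oplus>\<^bsub>N\<^esub> (f y \<ominus>\<^bsub>N\<^esub> g y)"
      by (simp add: a_minus_def N.M.minus_add N.M.a_ac)
  next
    fix r x assume "r \<in> carrier R" "x \<in> carrier M"
    then show "f (r \<odot>\<^bsub>M\<^esub> x) \<ominus>\<^bsub>N\<^esub> g (r \<odot>\<^bsub>M\<^esub> x) = r \<odot>\<^bsub>N\<^esub> (f x \<ominus>\<^bsub>N\<^esub> g x)"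
      by (simp add: a_minus_def N.smult_r_distr N.smult_r_minus)
  qed simp
qed

lemma lmod_hom_id: "(\<lambda>x. x) \<in> lmod_hom R M M"
  by (rule lmod_homI) simp_all

text \<open>T and the identity are two lifts of the identity of X, so their difference is
  null-homotopic. The next component of the homotopy lifts T - id - H d, whose values are
  cycles.\<close>

lemma homotopy_to_id:
  assumes T: "\<And>n. T n \<in> lmod_hom R (P n) (P n)"
    and e: "\<And>x. x \<in> carrier (P 0) \<Longrightarrow> e (T 0 x) = e x"
    and c: "\<And>n x. x \<in> carrier (P (Suc n)) \<Longrightarrow> d n (T (Suc n) x) = T n (d n x)"
  obtains H where "\<And>n. H n \<in> lmod_hom R (P n) (P (Suc n))"
    and "\<And>n x. x \<in> carrier (P (Suc n)) \<Longrightarrow>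
      T (Suc n) x = x \<oplus>\<^bsub>P (Suc n)\<^esub> (d (Suc n) (H (Suc n) x) \<oplus>\<^bsub>P (Suc n)\<^esub> H n (d n x))"
proof -
  have M: "left_module R (P n)" for n by (rule mod)
  have ag: "abelian_group (P n)" for n using left_moduleD(2)[OF mod] .
  \<comment> \<open>On cycles the term H d vanishes, which leaves d H = T - id. Applied to d x, this
    shows that T - id - H d has values in cycles one degree up.\<close>
  let ?I = "\<lambda>n H. H \<in> lmod_hom R (P n) (P (Suc n)) \<and> (\<forall>x. cyc n x \<longrightarrow> d n (H x) = T n x \<ominus>\<^bsub>P n\<^esub> x)"
  have "\<exists>H. \<forall>n. ?I n (H n) \<and> (\<forall>x \<in> carrier (P (Suc n)).
      d (Suc n) (H (Suc n) x) = (T (Suc n) x \<ominus>\<^bsub>P (Suc n)\<^esub> x) \<ominus>\<^bsub>P (Suc n)\<^esub> H n (d n x))"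
  proof (rule dependent_nat_choice)
    interpret X: left_module R X by (rule X)
    interpret P0: left_module R "P 0" by (rule mod)
    note T0 = lmod_hom_minus_hom[OF mod mod T lmod_hom_id, of 0]
    obtain h where "h \<in> lmod_hom R (P 0) (P (Suc 0))"
      "\<And>x. x \<in> carrier (P 0) \<Longrightarrow> d 0 (h x) = T 0 x \<ominus>\<^bsub>P 0\<^esub> x"
    proof (rule projective_lift[OF proj mod mod univ' d_hom T0])
      show "(\<lambda>x. T 0 x \<ominus>\<^bsub>P 0\<^esub> x) ` carrier (P 0) \<subseteq> d 0 ` carrier (P (Suc 0))"
      proof (unfold im_d, clarify)
        fix x assume x: "x \<in> carrier (P 0)"
        have "e (T 0 x \<ominus>\<^bsub>P 0\<^esub> x) = \<zero>\<^bsub>X\<^esub>"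
          using x e lmod_hom_diff[OF mod X e_hom lmod_homD(1)[OF T x] x] lmod_homD(1)[OF e_hom x]
          by (simp add: X.M.r_neg a_minus_def)
        then show "cyc 0 (T 0 x \<ominus>\<^bsub>P 0\<^esub> x)" using lmod_homD(1)[OF T0 x] by (simp add: cyc_def)
      qed
    qed blast
    then show "\<exists>H. ?I 0 H" by (auto simp: cyc_def)
  next
    fix H n assume H: "?I n H"
    then have Hh: "H \<in> lmod_hom R (P n) (P (Suc n))" by blast
    interpret S: left_module R "P (Suc n)" by (rule mod)
    interpret N: left_module R "P n" by (rule mod)
    note Hd = lmod_hom_comp[OF d_hom[of n] Hh]
    note T1 = lmod_hom_minus_hom[OF mod mod T lmod_hom_id, of "Suc n"]
    note U = lmod_hom_minus_hom[OF mod mod T1 Hd]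
    obtain h where h: "h \<in> lmod_hom R (P (Suc n)) (P (Suc (Suc n)))"
      "\<And>x. x \<in> carrier (P (Suc n)) \<Longrightarrow>
        d (Suc n) (h x) = (T (Suc n) x \<ominus>\<^bsub>P (Suc n)\<^esub> x) \<ominus>\<^bsub>P (Suc n)\<^esub> H (d n x)"
    proof (rule projective_lift[OF proj mod mod univ' d_hom U])
      show "(\<lambda>x. (T (Suc n) x \<ominus>\<^bsub>P (Suc n)\<^esub> x) \<ominus>\<^bsub>P (Suc n)\<^esub> H (d n x)) ` carrier (P (Suc n))
          \<subseteq> d (Suc n) ` carrier (P (Suc (Suc n)))"
      proof (unfold im_d, clarify)
        fix x assume x: "x \<in> carrier (P (Suc n))"
        have "d n ((T (Suc n) x \<ominus>\<^bsub>P (Suc n)\<^esub> x) \<ominus>\<^bsub>P (Suc n)\<^esub> H (d n x))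
          = (d n (T (Suc n) x) \<ominus>\<^bsub>P n\<^esub> d n x) \<ominus>\<^bsub>P n\<^esub> d n (H (d n x))"
          by (simp add: x lmod_hom_diff[OF mod mod d_hom] lmod_homD(1)[OF T1] lmod_homD(1)[OF Hd]
             lmod_homD(1)[OF T])
        also have "d n (H (d n x)) = T n (d n x) \<ominus>\<^bsub>P n\<^esub> d n x" using H cyc_d[OF x] by blast
        finally have "d n ((T (Suc n) x \<ominus>\<^bsub>P (Suc n)\<^esub> x) \<ominus>\<^bsub>P (Suc n)\<^esub> H (d n x)) = \<zero>\<^bsub>P n\<^esub>"
          using x c[OF x] lmod_homD(1)[OF T lmod_homD(1)[OF d_hom x]] lmod_homD(1)[OF d_hom x]
          by (simp add: a_minus_def N.M.r_neg)
        then show "cyc (Suc n) ((T (Suc n) x \<ominus>\<^bsub>P (Suc n)\<^esub> x) \<ominus>\<^bsub>P (Suc n)\<^esub> H (d n x))"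
          using lmod_homD(1)[OF U x] by (simp add: cyc_def)
      qed
    qed blast
    have "d (Suc n) (h x) = T (Suc n) x \<ominus>\<^bsub>P (Suc n)\<^esub> x" if "cyc (Suc n) x" for x
    proof -
      have x: "x \<in> carrier (P (Suc n))" "d n x = \<zero>\<^bsub>P n\<^esub>" using that by (auto simp: cyc_def)
      then show ?thesis
        using h(2)[of x] lmod_hom_zero[OF mod mod Hh] lmod_homD(1)[OF T1 x(1)]
        by (simp add: a_minus_def)
    qed
    with h show "\<exists>H'. ?I (Suc n) H' \<and> (\<forall>x \<in> carrier (P (Suc n)).
      d (Suc n) (H' x) = (T (Suc n) x \<ominus>\<^bsub>P (Suc n)\<^esub> x) \<ominus>\<^bsub>P (Suc n)\<^esub> H (d n x))"
      by blast
  qed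
  then obtain H where H: "\<And>n. ?I n (H n)"
    "\<And>n x. x \<in> carrier (P (Suc n)) \<Longrightarrow>
      d (Suc n) (H (Suc n) x) = (T (Suc n) x \<ominus>\<^bsub>P (Suc n)\<^esub> x) \<ominus>\<^bsub>P (Suc n)\<^esub> H n (d n x)"
    by blast
  show thesis
  proof (rule that[of H])
    show "H n \<in> lmod_hom R (P n) (P (Suc n))" for n using H(1) by blast
    fix n x assume x: "x \<in> carrier (P (Suc n))"
    interpret S: left_module R "P (Suc n)" by (rule mod)
    have cl: "T (Suc n) x \<in> carrier (P (Suc n))" "H n (d n x) \<in> carrier (P (Suc n))"
      using lmod_homD(1)[OF T x] H(1)[of n] lmod_homD(1)[OF d_hom x] by (auto dest: lmod_homD(1))
    then show "T (Suc n) x = x \<oplus>\<^bsub>P (Suc n)\<^esub> (d (Suc n) (H (Suc n) x) \<oplus>\<^bsub>P (Suc n)\<^esub> H n (d n x))"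
      unfolding H(2)[OF x] using x
      by (simp add: a_minus_def S.M.a_assoc S.M.l_neg S.M.r_neg S.M.r_neg2 S.M.r_neg1 S.M.a_lcomm[of x])
  qed
qed

end

section \<open>Tensor products\<close>

text \<open>The map 1 \<otimes> f on representatives. Computations with tensors stay in the free
  abelian group, modulo \<open>tensor_null\<close>; cosets appear only where \<open>Tor\<close> is
  unfolded.\<close>

definition frag_map :: "('n \<Rightarrow> 'p) \<Rightarrow> ('m \<times> 'n \<Rightarrow>\<^sub>0 int) \<Rightarrow> 'm \<times> 'p \<Rightarrow>\<^sub>0 int"
  where "frag_map f = frag_extend (\<lambda>(x, y). frag_of (x, f y))"

lemma frag_map_simps [simp]:
  "frag_map f 0 = 0" "frag_map f (frag_of (x, y)) = frag_of (x, f y)"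
  "frag_map f (p + q) = frag_map f p + frag_map f q" "frag_map f (p - q) = frag_map f p - frag_map f q"
  "frag_map f (- p) = - frag_map f p"
  by (simp_all add: frag_map_def frag_extend_add frag_extend_diff frag_extend_minus)

lemma frag_map_comp: "frag_map g (frag_map f p) = frag_map (\<lambda>x. g (f x)) p"
proof -
  have "Poly_Mapping.keys p \<subseteq> UNIV" by simp
  then show ?thesis by (induction p rule: frag_induction) auto
qed

abbreviation frag_carrier :: "'m set \<Rightarrow> 'n set \<Rightarrow> ('m \<times> 'n \<Rightarrow>\<^sub>0 int) set"
  where "frag_carrier S T \<equiv> carrier (free_Abelian_group (S \<times> T))"

lemma frag_carrier_add:
  "p \<in> frag_carrier S T \<Longrightarrow> q \<in> frag_carrier S T \<Longrightarrow> p + q \<in> frag_carrier S T"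
  "p \<in> frag_carrier S T \<Longrightarrow> q \<in> frag_carrier S T \<Longrightarrow> p - q \<in> frag_carrier S T"
  "p \<in> frag_carrier S T \<Longrightarrow> - p \<in> frag_carrier S T" "0 \<in> frag_carrier S T"
  using keys_add[of p q] keys_diff[of p q] by auto

lemma frag_carrier_induct [consumes 1, case_names zero one diff]:
  assumes "p \<in> frag_carrier S T" "P 0" "\<And>x y. x \<in> S \<Longrightarrow> y \<in> T \<Longrightarrow> P (frag_of (x, y))"
    and "\<And>p q. p \<in> frag_carrier S T \<Longrightarrow> q \<in> frag_carrier S T \<Longrightarrow> P p \<Longrightarrow> P q \<Longrightarrow> P (p - q)"
  shows "P p"
proof -
  have "Poly_Mapping.keys p \<subseteq> S \<times> T" using assms by simp
  then have "p \<in> frag_carrier S T \<and> P p"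
  proof (induction p rule: frag_induction)
    case (diff p q)
    then show ?case using frag_carrier_add(2)[of p S T q] assms(4) by blast
  qed (use assms frag_carrier_add in auto)
  then show ?thesis by blast
qed

lemma frag_map_carrier:
  assumes "p \<in> frag_carrier S T" "\<And>y. y \<in> T \<Longrightarrow> f y \<in> T'"
  shows "frag_map f p \<in> frag_carrier S T'"
  using assms(1)
proof (induction rule: frag_carrier_induct)
  case (diff p q)
  then show ?case using frag_carrier_add(2)[of "frag_map f p" S T' "frag_map f q"] by simp
qed (use assms(2) in auto)

lemma frag_map_cong:
  assumes "p \<in> frag_carrier S T" "\<And>y. y \<in> T \<Longrightarrow> f y = g y"
  shows "frag_map f p = frag_map g p"
  using assms(1) by (induction rule: frag_carrier_induct) (use assms(2) in auto)

text \<open>Instantiated twice: with A over the field, to describe the enveloping algebra, and with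
  A as a right module over that algebra, to compute \<open>Tor\<close>.\<close>

locale tensor_left =
  fixes R :: "('r, 'x) ring_scheme" and M :: "('r, 'm, 'y) module_scheme"
  assumes M_add: "\<And>x y. x \<in> carrier M \<Longrightarrow> y \<in> carrier M \<Longrightarrow> x \<oplus>\<^bsub>M\<^esub> y \<in> carrier M"
    and M_smult: "\<And>r x. r \<in> carrier R \<Longrightarrow> x \<in> carrier M \<Longrightarrow> r \<odot>\<^bsub>M\<^esub> x \<in> carrier M"
begin

lemma rels_carrier:
  assumes "left_module R N"
  shows "tensor_rels R M N \<subseteq> frag_carrier (carrier M) (carrier N)"
proof -
  interpret N: left_module R N by (rule assms)
  show ?thesis
    unfolding tensor_rels_def
    by (auto simp: M_add M_smult N.smult_closed dest!: subsetD[OF keys_diff])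
qed

lemma null_carrier: "left_module R N \<Longrightarrow> tensor_null R M N \<subseteq> frag_carrier (carrier M) (carrier N)"
  unfolding tensor_null_def by (rule group.generate_incl[OF group_free_Abelian_group rels_carrier])

lemma null_add:
  "p \<in> tensor_null R M N \<Longrightarrow> q \<in> tensor_null R M N \<Longrightarrow> p + q \<in> tensor_null R M N"
  unfolding tensor_null_def by (metis generate.eng mult_free_Abelian_group)

lemma null_zero: "0 \<in> tensor_null R M N"
  unfolding tensor_null_def by (metis generate.one one_free_Abelian_group)

lemma null_minus:
  assumes N: "left_module R N" and p: "p \<in> tensor_null R M N"
  shows "- p \<in> tensor_null R M N"
proof -
  have "inv\<^bsub>free_Abelian_group (carrier M \<times> carrier N)\<^esub> p \<in> tensor_null R M N"
    using group.generate_m_inv_closed[OF group_free_Abelian_group rels_carrier[OF N]] p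
    by (simp add: tensor_null_def)
  then show ?thesis using null_carrier[OF N] p by (auto simp: subset_iff)
qed

lemma null_diff:
  "left_module R N \<Longrightarrow> p \<in> tensor_null R M N \<Longrightarrow> q \<in> tensor_null R M N \<Longrightarrow> p - q \<in> tensor_null R M N"
  using null_add[OF _ null_minus, of p N q] by simp

lemma null_induct [consumes 2, case_names zero rel add minus]:
  assumes N: "left_module R N" and p: "p \<in> tensor_null R M N"
    and "P 0" "\<And>p. p \<in> tensor_rels R M N \<Longrightarrow> P p" "\<And>p q. P p \<Longrightarrow> P q \<Longrightarrow> P (p + q)" "\<And>p. P p \<Longrightarrow> P (- p)"
  shows "P p"
  using p unfolding tensor_null_def
proof (induction rule: generate.induct)
  case (inv h)
  then show ?case using rels_carrier[OF N] assms(4,6) by (auto simp: subset_iff)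
qed (use assms in auto)

lemma null_rel:
  "p \<in> tensor_rels R M N \<Longrightarrow> p \<in> tensor_null R M N"
  unfolding tensor_null_def by (rule generate.incl)

lemma null_rel_intros:
  "x \<in> carrier M \<Longrightarrow> x' \<in> carrier M \<Longrightarrow> y \<in> carrier N \<Longrightarrow>
    frag_of (x \<oplus>\<^bsub>M\<^esub> x', y) - frag_of (x, y) - frag_of (x', y) \<in> tensor_null R M N"
  "x \<in> carrier M \<Longrightarrow> y \<in> carrier N \<Longrightarrow> y' \<in> carrier N \<Longrightarrow>
    frag_of (x, y \<oplus>\<^bsub>N\<^esub> y') - frag_of (x, y) - frag_of (x, y') \<in> tensor_null R M N"
  "r \<in> carrier R \<Longrightarrow> x \<in> carrier M \<Longrightarrow> y \<in> carrier N \<Longrightarrow>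
    frag_of (r \<odot>\<^bsub>M\<^esub> x, y) - frag_of (x, r \<odot>\<^bsub>N\<^esub> y) \<in> tensor_null R M N"
  by (intro null_rel, unfold tensor_rels_def, blast)+

lemma frag_map_null:
  assumes N: "left_module R N" and N': "left_module R N'" and f: "f \<in> lmod_hom R N N'"
    and p: "p \<in> tensor_null R M N"
  shows "frag_map f p \<in> tensor_null R M N'"
  using N p
proof (induction rule: null_induct)
  case (rel p)
  then show ?case
    unfolding tensor_rels_def
    by (auto simp: lmod_homD(2,3)[OF f] intro!: null_rel_intros lmod_homD(1)[OF f])
next
  case (minus p)
  then show ?case by (simp add: null_minus[OF N'])
qed (simp_all add: null_zero null_add)

lemma coset_eq_iff:
  assumes N: "left_module R N"
  shows "tensor_null R M N #>\<^bsub>free_Abelian_group (carrier M \<times> carrier N)\<^esub> p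
    = tensor_null R M N #>\<^bsub>free_Abelian_group (carrier M \<times> carrier N)\<^esub> q \<longleftrightarrow> p - q \<in> tensor_null R M N"
    (is "?C p = ?C q \<longleftrightarrow> _")
proof -
  have C: "?C p = {h + p | h. h \<in> tensor_null R M N}" for p
    by (auto simp: r_coset_def)
  show ?thesis
  proof
    assume "?C p = ?C q"
    moreover have "p \<in> ?C p" unfolding C using null_zero by force
    ultimately show "p - q \<in> tensor_null R M N" unfolding C by force
  next
    assume pq: "p - q \<in> tensor_null R M N"
    have "h + p \<in> ?C q" if "h \<in> tensor_null R M N" for h
      unfolding C using null_add[OF that pq] by (intro CollectI exI[of _ "h + (p - q)"]) simp
    moreover have "h + q \<in> ?C p" if "h \<in> tensor_null R M N" for h
      unfolding C using null_diff[OF N that pq] by (intro CollectI exI[of _ "h - (p - q)"]) simp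
    ultimately show "?C p = ?C q" unfolding C by auto
  qed
qed

text \<open>1 \<otimes> f sends null elements to null elements, so all representatives of one coset
  give the same target coset, and \<open>the_elem\<close> picks it.\<close>

lemma tensor_map_coset:
  assumes N: "left_module R N" and N': "left_module R N'" and f: "f \<in> lmod_hom R N N'"
  shows "tensor_map R M N' f (tensor_null R M N #>\<^bsub>free_Abelian_group (carrier M \<times> carrier N)\<^esub> p)
    = tensor_null R M N' #>\<^bsub>free_Abelian_group (carrier M \<times> carrier N')\<^esub> frag_map f p"
proof -
  let ?C = "\<lambda>p. tensor_null R M N #>\<^bsub>free_Abelian_group (carrier M \<times> carrier N)\<^esub> p"
  let ?C' = "\<lambda>p. tensor_null R M N' #>\<^bsub>free_Abelian_group (carrier M \<times> carrier N')\<^esub> p"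
  have eq: "?C' (frag_map f q) = ?C' (frag_map f p)" if q: "q \<in> ?C p" for q
  proof -
    obtain h where "h \<in> tensor_null R M N" "q = h + p" using q by (auto simp: r_coset_def)
    then show ?thesis
      unfolding coset_eq_iff[OF N'] using frag_map_null[OF N N' f] by simp
  qed
  have "?C p \<noteq> {}" using null_zero by (auto simp: r_coset_def)
  then have "the_elem ((\<lambda>q. ?C' (frag_map f q)) ` ?C p) = ?C' (frag_map f p)"
    using eq by (rule the_elem_image_unique)
  then show ?thesis unfolding tensor_map_def frag_map_def .
qed

text \<open>The bridge from quotients of quotient groups to congruences in free abelian groups. A
  cycle determines a coset of the boundaries, and triviality makes it the coset of the boundaries
  themselves.\<close>

lemma exact_if_trivial:
  assumes P: "\<And>n. left_module R (P n)" and d: "\<And>n. d n \<in> lmod_hom R (P (Suc n)) (P n)"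
    and triv: "trivial_group (homology (\<lambda>i. tensor_product R M (P i)) (\<lambda>i. tensor_map R M (P i) (d i)) (Suc n))"
    and p: "p \<in> frag_carrier (carrier M) (carrier (P (Suc n)))"
    and dp: "frag_map (d n) p \<in> tensor_null R M (P n)"
  obtains q where "q \<in> frag_carrier (carrier M) (carrier (P (Suc (Suc n))))"
    and "p - frag_map (d (Suc n)) q \<in> tensor_null R M (P (Suc n))"
proof -
  define cs where "cs = (\<lambda>i p. tensor_null R M (P i) #>\<^bsub>free_Abelian_group (carrier M \<times> carrier (P i))\<^esub> p)"
  define C where "C = (\<lambda>i. tensor_product R M (P i))"
  define \<delta> where "\<delta> = (\<lambda>i. tensor_map R M (P i) (d i))"
  have carC: "carrier (C i) = cs i ` frag_carrier (carrier M) (carrier (P i))" for i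
    by (auto simp: C_def cs_def tensor_product_def FactGroup_def RCOSETS_def)
  have oneC: "\<one>\<^bsub>C i\<^esub> = tensor_null R M (P i)" for i
    by (simp add: C_def tensor_product_def FactGroup_def)
  have cs0: "cs i p = tensor_null R M (P i) \<longleftrightarrow> p \<in> tensor_null R M (P i)" for i p
  proof -
    have "cs i 0 = tensor_null R M (P i)" by (auto simp: cs_def r_coset_def)
    then show ?thesis using coset_eq_iff[OF P, of i p 0] by (simp add: cs_def)
  qed
  have \<delta>cs: "\<delta> i (cs (Suc i) p) = cs i (frag_map (d i) p)" for i p
    unfolding \<delta>_def cs_def by (rule tensor_map_coset[OF P P d])
  have mulC: "tensor_null R M (P i) \<otimes>\<^bsub>C i\<^esub> cs i p = cs i p" for i p
  proof -
    have "tensor_null R M (P i) \<otimes>\<^bsub>C i\<^esub> cs i p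
      = {h + (k + p) | h k. h \<in> tensor_null R M (P i) \<and> k \<in> tensor_null R M (P i)}"
      by (auto simp: C_def tensor_product_def FactGroup_def set_mult_def cs_def r_coset_def)
    also have "\<dots> = {h + p | h. h \<in> tensor_null R M (P i)}"
    proof safe
      fix h k assume "h \<in> tensor_null R M (P i)" "k \<in> tensor_null R M (P i)"
      then show "\<exists>h'. h + (k + p) = h' + p \<and> h' \<in> tensor_null R M (P i)"
        using null_add by (intro exI[of _ "h + k"]) (simp add: add.assoc)
    next
      fix h assume "h \<in> tensor_null R M (P i)"
      then show "\<exists>h' k. h + p = h' + (k + p) \<and> h' \<in> tensor_null R M (P i) \<and> k \<in> tensor_null R M (P i)"
        using null_zero by (intro exI[of _ h] exI[of _ 0]) simp
    qed
    finally show ?thesis by (auto simp: cs_def r_coset_def)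
  qed
  define B where "B = \<delta> (Suc n) ` carrier (C (Suc (Suc n)))"
  define Z where "Z = (C (Suc n))\<lparr>carrier := cycles C \<delta> (Suc n)\<rparr>"
  have hom: "homology C \<delta> (Suc n) = Z Mod B" by (simp add: homology_def Z_def B_def)
  have "trivial_group (Z Mod B)" using triv by (simp add: hom[symmetric] C_def \<delta>_def)
  then have triv': "rcosets\<^bsub>Z\<^esub> B = {B}" by (simp add: trivial_group_def FactGroup_def)
  have "cs (Suc n) p \<in> carrier Z"
    using p dp by (auto simp: Z_def cycles_def kernel_def carC \<delta>cs oneC cs0)
  then have eq: "B #>\<^bsub>Z\<^esub> cs (Suc n) p = B" using triv' by (auto simp: RCOSETS_def)
  \<comment> \<open>With the neutral element among the boundaries, equality of the translate of
    \<open>B\<close> with \<open>B\<close> puts the translating class itself into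
    \<open>B\<close>.\<close>
  have "tensor_null R M (P (Suc n)) \<in> B"
  proof -
    have "cs (Suc (Suc n)) 0 \<in> carrier (C (Suc (Suc n)))"
      unfolding carC using frag_carrier_add(4) by blast
    moreover have "\<delta> (Suc n) (cs (Suc (Suc n)) 0) = tensor_null R M (P (Suc n))"
      using cs0[of "Suc n" 0] by (simp add: \<delta>cs null_zero)
    ultimately show ?thesis unfolding B_def by (metis imageI)
  qed
  then have "cs (Suc n) p \<in> B"
    using eq mulC[of "Suc n" p] by (force simp: r_coset_def Z_def)
  then obtain q where q: "q \<in> frag_carrier (carrier M) (carrier (P (Suc (Suc n))))"
    "cs (Suc n) p = cs (Suc n) (frag_map (d (Suc n)) q)"
    by (auto simp: B_def carC \<delta>cs)
  then show thesis using that coset_eq_iff[OF P] by (simp add: cs_def)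
qed

text \<open>On a pair this is the additivity relation in the second variable, so f and g may be
  arbitrary maps into N.\<close>

lemma frag_map_add_null:
  assumes N: "left_module R N" and p: "p \<in> frag_carrier (carrier M) S"
    and f: "\<And>x. x \<in> S \<Longrightarrow> f x \<in> carrier N" and g: "\<And>x. x \<in> S \<Longrightarrow> g x \<in> carrier N"
  shows "frag_map (\<lambda>x. f x \<oplus>\<^bsub>N\<^esub> g x) p - frag_map f p - frag_map g p \<in> tensor_null R M N"
  using p
proof (induction rule: frag_carrier_induct)
  case (diff p q)
  then show ?case using null_diff[OF N diff.IH] by (simp add: algebra_simps)
qed (simp_all add: null_zero null_rel_intros f g)

text \<open>\<open>Tor\<close> does not depend on the resolution, in the weak form needed here: if the homology of
  \<open>M \<otimes> P\<close> vanishes in some degree for one resolution, then it does for every other.\<close>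

lemma exact_transfer:
  fixes P B :: "nat \<Rightarrow> ('r, 'u) module"
  assumes P: "resolution R X P d e" and B: "resolution R X B d' e'"
    and triv: "trivial_group (homology (\<lambda>i. tensor_product R M (P i)) (\<lambda>i. tensor_map R M (P i) (d i)) (Suc n))"
    and p: "p \<in> frag_carrier (carrier M) (carrier (B (Suc n)))"
    and dp: "frag_map (d' n) p \<in> tensor_null R M (B n)"
  obtains q where "q \<in> frag_carrier (carrier M) (carrier (B (Suc (Suc n))))"
    and "p - frag_map (d' (Suc n)) q \<in> tensor_null R M (B (Suc n))"
proof -
  interpret P: resolution R X P d e by (rule P)
  interpret B: resolution R X B d' e' by (rule B)
  obtain F where F: "\<And>n. F n \<in> lmod_hom R (B n) (P n)" "\<And>x. x \<in> carrier (B 0) \<Longrightarrow> e (F 0 x) = e' x"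
    "\<And>n x. x \<in> carrier (B (Suc n)) \<Longrightarrow> d n (F (Suc n) x) = F n (d' n x)"
    using chain_map_exists[OF B P] by blast
  obtain G where G: "\<And>n. G n \<in> lmod_hom R (P n) (B n)" "\<And>x. x \<in> carrier (P 0) \<Longrightarrow> e' (G 0 x) = e x"
    "\<And>n x. x \<in> carrier (P (Suc n)) \<Longrightarrow> d' n (G (Suc n) x) = G n (d n x)"
    using chain_map_exists[OF P B] by blast
  obtain H where H: "\<And>n. H n \<in> lmod_hom R (B n) (B (Suc n))"
    "\<And>n x. x \<in> carrier (B (Suc n)) \<Longrightarrow>
      G (Suc n) (F (Suc n) x) = x \<oplus>\<^bsub>B (Suc n)\<^esub> (d' (Suc n) (H (Suc n) x) \<oplus>\<^bsub>B (Suc n)\<^esub> H n (d' n x))"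
  proof (rule B.homotopy_to_id[of "\<lambda>n x. G n (F n x)"])
    show "(\<lambda>x. G n (F n x)) \<in> lmod_hom R (B n) (B n)" for n by (rule lmod_hom_comp[OF F(1) G(1)])
  qed (use lmod_homD(1)[OF F(1)] F(2,3) G(2,3) in auto)
  let ?b = "Suc n"
  have Fp: "frag_map (F ?b) p \<in> frag_carrier (carrier M) (carrier (P ?b))"
    using p by (rule frag_map_carrier) (rule lmod_homD(1)[OF F(1)])
  have "frag_map (d n) (frag_map (F ?b) p) = frag_map (F n) (frag_map (d' n) p)"
    unfolding frag_map_comp by (rule frag_map_cong[OF p]) (rule F(3))
  also have "\<dots> \<in> tensor_null R M (P n)" by (rule frag_map_null[OF B.mod P.mod F(1) dp])
  finally obtain q where q: "q \<in> frag_carrier (carrier M) (carrier (P (Suc ?b)))"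
    "frag_map (F ?b) p - frag_map (d ?b) q \<in> tensor_null R M (P ?b)"
    using exact_if_trivial[OF P.mod P.d_hom triv Fp] by blast
  \<comment> \<open>From G F = id + d H + H d, and F p = d q up to null tensors, one gets p = d (G q
    - H p) up to null tensors, since H d p is null.\<close>
  define r where "r = frag_map (G (Suc ?b)) q - frag_map (H ?b) p"
  have r: "r \<in> frag_carrier (carrier M) (carrier (B (Suc ?b)))"
    unfolding r_def using q(1) p
    by (intro frag_carrier_add(2) frag_map_carrier[where T = "carrier (P (Suc ?b))"]
        frag_map_carrier[where T = "carrier (B ?b)"] lmod_homD(1)[OF G(1)] lmod_homD(1)[OF H(1)])
  let ?N = "tensor_null R M (B ?b)"
  have 1: "frag_map (G ?b) (frag_map (F ?b) p) - frag_map (d' ?b) (frag_map (G (Suc ?b)) q) \<in> ?N"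
  proof -
    have "frag_map (d' ?b) (frag_map (G (Suc ?b)) q) = frag_map (G ?b) (frag_map (d ?b) q)"
      unfolding frag_map_comp by (rule frag_map_cong[OF q(1)]) (rule G(3))
    then show ?thesis using frag_map_null[OF P.mod B.mod G(1) q(2)] by simp
  qed
  let ?u = "\<lambda>x. d' ?b (H ?b x)" and ?v = "\<lambda>x. H n (d' n x)"
  have cl: "?u x \<in> carrier (B ?b)" "?v x \<in> carrier (B ?b)" if "x \<in> carrier (B ?b)" for x
    using that lmod_homD(1)[OF H(1)] lmod_homD(1)[OF B.d_hom] by auto
  have ag: "x \<oplus>\<^bsub>B ?b\<^esub> y \<in> carrier (B ?b)" if "x \<in> carrier (B ?b)" "y \<in> carrier (B ?b)" for x y
    using that left_moduleD(2)[OF B.mod] by (simp add: abelian_groupE(1))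
  have "frag_map (G ?b) (frag_map (F ?b) p) = frag_map (\<lambda>x. x \<oplus>\<^bsub>B ?b\<^esub> (?u x \<oplus>\<^bsub>B ?b\<^esub> ?v x)) p"
    unfolding frag_map_comp by (rule frag_map_cong[OF p]) (rule H(2))
  then have 2: "frag_map (G ?b) (frag_map (F ?b) p) - frag_map (\<lambda>x. x) p
      - frag_map (\<lambda>x. ?u x \<oplus>\<^bsub>B ?b\<^esub> ?v x) p \<in> ?N"
    using frag_map_add_null[OF B.mod p, of "\<lambda>x. x" ?b "\<lambda>x. ?u x \<oplus>\<^bsub>B ?b\<^esub> ?v x"] cl ag by auto
  have 3: "frag_map (\<lambda>x. ?u x \<oplus>\<^bsub>B ?b\<^esub> ?v x) p - frag_map ?u p - frag_map ?v p \<in> ?N"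
    by (rule frag_map_add_null[OF B.mod p]) (use cl in auto)
  have 4: "frag_map ?v p \<in> ?N"
    using frag_map_null[OF B.mod B.mod H(1) dp] by (simp add: frag_map_comp)
  have id: "frag_map (\<lambda>x. x) p = p"
    using p by (induction rule: frag_carrier_induct) auto
  have "p - frag_map (d' ?b) r
    = (frag_map (G ?b) (frag_map (F ?b) p) - frag_map (d' ?b) (frag_map (G (Suc ?b)) q))
     - (frag_map (G ?b) (frag_map (F ?b) p) - frag_map (\<lambda>x. x) p - frag_map (\<lambda>x. ?u x \<oplus>\<^bsub>B ?b\<^esub> ?v x) p)
     - (frag_map (\<lambda>x. ?u x \<oplus>\<^bsub>B ?b\<^esub> ?v x) p - frag_map ?u p - frag_map ?v p) - frag_map ?v p"
    unfolding r_def frag_map_simps id frag_map_comp by simp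
  also have "\<dots> \<in> ?N" by (intro null_diff B.mod 1 2 3 4)
  finally show thesis by (rule that[OF r])
qed

end

section \<open>The bar and Hochschild differentials in coordinates\<close>

lemma sum_swap_in2:
  "(\<Sum>x\<in>A. \<Sum>p\<in>B. \<Sum>q\<in>C. g x p q) = (\<Sum>p\<in>B. \<Sum>q\<in>C. \<Sum>x\<in>A. g x p q)"
  by (subst sum.swap, rule sum.cong[OF refl], rule sum.swap)

lemma sum2_linear:
  "(\<Sum>x\<in>A. \<Sum>y\<in>B. k x y * (f x y - g x y - s * h x y)) = (\<Sum>x\<in>A. \<Sum>y\<in>B. k x y * f x y)
    - (\<Sum>x\<in>A. \<Sum>y\<in>B. k x y * g x y) - s * (\<Sum>x\<in>A. \<Sum>y\<in>B. k x y * h x y)"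
  for s :: "'r::comm_ring"
  by (simp add: algebra_simps sum_subtractf sum.distrib sum_distrib_left)

text \<open>Letter \<open>0\<close> is the unit of the algebra and the letters \<open>1, \<dots>, D\<close> are a basis of the
  augmentation ideal. A chain is given by the coefficient \<open>f w\<close> of each basis tensor \<open>w\<close>, so the
  differentials appear in transposed form. The idempotent \<open>e\<close> is the unit of the field inside the
  ambient ring.\<close>

locale structure_constants =
  fixes D :: nat and wt :: "nat \<Rightarrow> nat" and c :: "nat \<Rightarrow> nat \<Rightarrow> nat \<Rightarrow> 'r::comm_ring_1"
    and e :: 'r
  assumes assoc: "(\<Sum>x\<le>D. c p q x * c x r k) = (\<Sum>x\<le>D. c q r x * c p x k)"
    and e_c: "e * c i j k = c i j k"
    and unit_left: "c 0 j k = (if j = k \<and> j \<le> D then e else 0)"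
    and unit_right: "c j 0 k = (if j = k \<and> j \<le> D then e else 0)"
    and wt_0: "wt 0 = 0"
    and wt_pos: "0 < i \<Longrightarrow> i \<le> D \<Longrightarrow> 0 < wt i"
    and wt_c: "c i j k \<noteq> 0 \<Longrightarrow> i \<le> D \<and> j \<le> D \<and> k \<le> D \<and> wt k = wt i + wt j"
begin

section \<open>The operators b', b, t and N on coefficient functions\<close>

definition mul0 :: "(nat list \<Rightarrow> 'r) \<Rightarrow> nat \<Rightarrow> nat list \<Rightarrow> 'r"
  where "mul0 f k v = (\<Sum>x\<le>D. \<Sum>y\<le>D. c x y k * f (x # y # v))"

text \<open>The bar differential b'. Splitting off the first letter produces the alternating signs:
  the faces further right are those of the tail with one more sign.\<close>

fun bar_d :: "(nat list \<Rightarrow> 'r) \<Rightarrow> nat list \<Rightarrow> 'r" where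
  "bar_d f [] = 0"
| "bar_d f (k # v) = mul0 f k v - bar_d (\<lambda>u. f (k # u)) v"

text \<open>The Hochschild differential b: b' together with the cyclic face, in which the last
  letter x multiplies the first letter y from the left.\<close>

definition hoch_d :: "(nat list \<Rightarrow> 'r) \<Rightarrow> nat list \<Rightarrow> 'r"
  where "hoch_d f w = bar_d f w +
    (case w of [] \<Rightarrow> 0 | k # v \<Rightarrow> (-1) ^ Suc (length v) * (\<Sum>x\<le>D. \<Sum>y\<le>D. c x y k * f (y # v @ [x])))"

text \<open>The j-th power of the signed cyclic operator t; on words of length n a single rotation
  carries the sign (-1)^(n-1).\<close>

definition rot :: "nat \<Rightarrow> (nat list \<Rightarrow> 'r) \<Rightarrow> nat list \<Rightarrow> 'r"
  where "rot j f w = (-1) ^ ((length w - 1) * j) * f (rotate j w)"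

text \<open>The norm N = 1 + t + ... + t^(n-1) on words of length n.\<close>

definition cyc :: "(nat list \<Rightarrow> 'r) \<Rightarrow> nat list \<Rightarrow> 'r"
  where "cyc f w = (\<Sum>j<length w. rot j f w)"

lemma mul0_add: "mul0 (\<lambda>u. f u + g u) k v = mul0 f k v + mul0 g k v"
  by (simp add: mul0_def distrib_left sum.distrib)

lemma mul0_diff: "mul0 (\<lambda>u. f u - g u) k v = mul0 f k v - mul0 g k v"
  by (simp add: mul0_def right_diff_distrib sum_subtractf)

lemma mul0_scale: "mul0 (\<lambda>u. a * f u) k v = a * mul0 f k v"
  by (simp add: mul0_def sum_distrib_left mult.left_commute)

lemma bar_d_cong:
  "(\<And>u. length u = Suc (length v) \<Longrightarrow> f u = g u) \<Longrightarrow> bar_d f v = bar_d g v"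
proof (induction v arbitrary: f g)
  case (Cons k v)
  have "mul0 f k v = mul0 g k v"
    unfolding mul0_def by (intro sum.cong refl) (simp add: Cons.prems)
  moreover have "bar_d (\<lambda>u. f (k # u)) v = bar_d (\<lambda>u. g (k # u)) v"
    by (rule Cons.IH) (simp add: Cons.prems)
  ultimately show ?case by simp
qed simp

lemma bar_d_add: "bar_d (\<lambda>u. f u + g u) v = bar_d f v + bar_d g v"
  by (induction v arbitrary: f g) (simp_all add: mul0_add)

lemma bar_d_diff: "bar_d (\<lambda>u. f u - g u) v = bar_d f v - bar_d g v"
  by (induction v arbitrary: f g) (simp_all add: mul0_diff)

lemma bar_d_scale: "bar_d (\<lambda>u. a * f u) v = a * bar_d f v"
  by (induction v arbitrary: f) (simp_all add: mul0_scale right_diff_distrib)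

lemma bar_d_zero [simp]: "bar_d (\<lambda>u. 0) v = 0"
  using bar_d_scale[of 0 "\<lambda>u. 0"] by simp

lemma bar_d_sum: "bar_d (\<lambda>u. \<Sum>i\<in>I. f i u) v = (\<Sum>i\<in>I. bar_d (f i) v)"
  by (induction I rule: infinite_finite_induct) (simp_all add: bar_d_add)

lemma hoch_d_add: "hoch_d (\<lambda>u. f u + g u) v = hoch_d f v + hoch_d g v"
  by (auto simp: hoch_d_def bar_d_add sum.distrib distrib_left split: list.split)

lemma hoch_d_scale: "hoch_d (\<lambda>u. a * f u) v = a * hoch_d f v"
  by (auto simp: hoch_d_def bar_d_scale sum_distrib_left distrib_left mult.left_commute
      split: list.split)

lemma hoch_d_diff: "hoch_d (\<lambda>u. f u - g u) v = hoch_d f v - hoch_d g v"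
  using hoch_d_add[of f "\<lambda>u. (-1) * g u" v] hoch_d_scale[of "-1" g v] by simp

lemma hoch_d_zero [simp]: "hoch_d (\<lambda>u. 0) v = 0"
  using hoch_d_scale[of 0 "\<lambda>u. 0"] by simp

lemma rot_0 [simp]: "rot 0 f w = f w"
  by (simp add: rot_def)

lemma rot_add: "rot j (\<lambda>u. f u + g u) v = rot j f v + rot j g v"
  by (simp add: rot_def distrib_left)

lemma rot_scale: "rot j (\<lambda>u. a * f u) v = a * rot j f v"
  by (simp add: rot_def)

lemma cyc_add: "cyc (\<lambda>u. f u + g u) v = cyc f v + cyc g v"
  by (simp add: cyc_def rot_add sum.distrib)

lemma cyc_scale: "cyc (\<lambda>u. a * f u) v = a * cyc f v"
  by (simp add: cyc_def rot_scale sum_distrib_left)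

lemma cyc_diff: "cyc (\<lambda>u. f u - g u) v = cyc f v - cyc g v"
  using cyc_add[of f "\<lambda>u. (-1) * g u" v] cyc_scale[of "-1" g v] by simp

lemma cyc_zero [simp]: "cyc (\<lambda>u. 0) v = 0"
  using cyc_scale[of 0 "\<lambda>u. 0"] by simp

text \<open>Associativity at the first letter gives \<open>B\<close>, by which the two mixed terms
  of the recursion cancel; what is left is the square of b' on the tail.\<close>

lemma bar_d_bar_d: "bar_d (bar_d f) v = 0"
proof (induction v arbitrary: f)
  case (Cons k v)
  have A: "(\<Sum>x\<le>D. \<Sum>y\<le>D. c x y k * mul0 f x (y # v)) =
        (\<Sum>x\<le>D. \<Sum>y\<le>D. c x y k * mul0 (\<lambda>u. f (x # u)) y v)" (is "?l = ?r")
  proof -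
    have "?l = (\<Sum>x\<le>D. \<Sum>y\<le>D. \<Sum>p\<le>D. \<Sum>q\<le>D. (c p q x * c x y k) * f (p # q # y # v))"
      by (simp add: mul0_def sum_distrib_left mult_ac)
    also have "\<dots> = (\<Sum>y\<le>D. \<Sum>x\<le>D. \<Sum>p\<le>D. \<Sum>q\<le>D. (c p q x * c x y k) * f (p # q # y # v))"
      by (rule sum.swap)
    also have "\<dots> = (\<Sum>y\<le>D. \<Sum>p\<le>D. \<Sum>q\<le>D. \<Sum>x\<le>D. (c p q x * c x y k) * f (p # q # y # v))"
      by (rule sum.cong[OF refl], rule sum_swap_in2)
    also have "\<dots> = (\<Sum>p\<le>D. \<Sum>q\<le>D. \<Sum>y\<le>D. \<Sum>x\<le>D. (c p q x * c x y k) * f (p # q # y # v))"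
      by (rule sum_swap_in2)
    also have "\<dots> = (\<Sum>p\<le>D. \<Sum>q\<le>D. \<Sum>y\<le>D. (\<Sum>x\<le>D. c q y x * c p x k) * f (p # q # y # v))"
      by (simp add: assoc flip: sum_distrib_right)
    also have "\<dots> = (\<Sum>p\<le>D. \<Sum>x\<le>D. \<Sum>q\<le>D. \<Sum>y\<le>D. (c q y x * c p x k) * f (p # q # y # v))"
      unfolding sum_distrib_right by (rule sum.cong[OF refl], rule sum_swap_in2[symmetric])
    also have "\<dots> = ?r"
      by (simp add: mul0_def sum_distrib_left mult_ac)
    finally show ?thesis .
  qed
  have "mul0 (bar_d f) k v = (\<Sum>x\<le>D. \<Sum>y\<le>D. c x y k * bar_d (\<lambda>u. f (x # y # u)) v)"
    using A by (simp add: mul0_def[of "bar_d f"] algebra_simps sum_subtractf sum.distrib)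
  also have "\<dots> = bar_d (\<lambda>u. mul0 f k u) v"
    by (simp add: mul0_def bar_d_sum bar_d_scale)
  finally have B: "mul0 (bar_d f) k v = bar_d (\<lambda>u. mul0 f k u) v" .
  show ?case using B Cons.IH[of "\<lambda>u. f (k # u)"] by (simp add: bar_d_diff)
qed simp

lemma bar_d_snoc:
  "bar_d f (v @ [k]) = bar_d (\<lambda>u. f (u @ [k])) v + (-1) ^ length v * (\<Sum>x\<le>D. \<Sum>y\<le>D. c x y k * f (v @ [x, y]))"
  by (induction v arbitrary: f) (simp_all add: mul0_def)

text \<open>The identity b (1 - t) = (1 - t) b' of the cyclic bicomplex. Up to signs, the first face
  of t f is the cyclic face of f, and the cyclic face of t f is the last face of f.\<close>

lemma hoch_d_rot:
  "hoch_d (\<lambda>u. f u - rot 1 f u) w = bar_d f w - rot 1 (bar_d f) w"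
proof (cases w)
  case (Cons k v)
  have 1: "rot 1 (bar_d f) w = (-1) ^ length v * (bar_d (\<lambda>u. f (u @ [k])) v
      + (-1) ^ length v * (\<Sum>x\<le>D. \<Sum>y\<le>D. c x y k * f (v @ [x, y])))"
    by (simp add: Cons rot_def bar_d_snoc)
  have "bar_d (\<lambda>u. rot 1 f (k # u)) v = bar_d (\<lambda>u. (-1) ^ Suc (length v) * f (u @ [k])) v"
    by (rule bar_d_cong) (simp add: rot_def)
  then have 2: "bar_d (rot 1 f) w = (-1) ^ Suc (length v) * (\<Sum>x\<le>D. \<Sum>y\<le>D. c x y k * f (y # v @ [x]))
     - (-1) ^ Suc (length v) * bar_d (\<lambda>u. f (u @ [k])) v"
    using bar_d_scale[of "(-1) ^ Suc (length v)" "\<lambda>u. f (u @ [k])" v]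
    by (simp add: Cons mul0_def rot_def sum_distrib_left mult_ac sum_negf)
  define S T where "S = (\<Sum>x\<le>D. \<Sum>y\<le>D. c x y k * f (y # v @ [x]))"
    and "T = (\<Sum>x\<le>D. \<Sum>y\<le>D. c x y k * f (v @ [x, y]))"
  have m: "(-1) ^ length v * ((-1) ^ length v * z) = (z :: 'r)" for z
    by (simp flip: mult.assoc power_mult_distrib)
  have 3: "(\<Sum>x\<le>D. \<Sum>y\<le>D. c x y k * rot 1 f (y # v @ [x])) = (-1) ^ Suc (length v) * T"
    by (simp add: T_def rot_def sum_distrib_left mult_ac sum_negf)
  have 4: "hoch_d f w = bar_d f w + (-1) ^ Suc (length v) * S"
    by (simp add: hoch_d_def Cons S_def)
  have 5: "hoch_d (rot 1 f) w = bar_d (rot 1 f) w + T"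
    unfolding hoch_d_def Cons list.case 3 by (simp add: m)
  show ?thesis
    unfolding hoch_d_diff 4 5 1 2 S_def[symmetric] T_def[symmetric] by (simp add: distrib_left m)
qed (simp add: hoch_d_def rot_def)


section \<open>Faces as rotations of the first face, and the identity b' N = N b\<close>

lemma rot_cong:
  "(\<And>u. length u = length w \<Longrightarrow> f u = g u) \<Longrightarrow> rot j f w = rot j g w"
  by (simp add: rot_def)

lemma cyc_cong:
  "(\<And>u. length u = length w \<Longrightarrow> f u = g u) \<Longrightarrow> cyc f w = cyc g w"
  unfolding cyc_def by (intro sum.cong refl rot_cong) auto

lemma rot_rot: "rot i (rot j f) w = rot (i + j) f w"
  by (simp add: rot_def rotate_rotate power_add distrib_left mult.assoc add.commute[of i j])

lemma rot_length [simp]: "rot (length w) f w = f w"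
proof -
  have "even ((length w - 1) * length w)" by (cases "length w") auto
  then show ?thesis by (simp add: rot_def)
qed

lemma sum_rot_shift: "(\<Sum>j<length w. rot (j + i) f w) = cyc f w"
proof (induction i)
  case (Suc i)
  have "(\<Sum>j<length w. rot (j + Suc i) f w) = (\<Sum>j<length w. rot (Suc j) (rot i f) w)"
    by (simp add: rot_rot)
  also have "\<dots> = (\<Sum>j<length w. rot j (rot i f) w)"
    using sum.lessThan_Suc_shift[of "\<lambda>j. rot j (rot i f) w" "length w"]
      sum.lessThan_Suc[of "\<lambda>j. rot j (rot i f) w" "length w"] by (simp add: add.commute)
  finally show ?case using Suc by (simp add: rot_rot)
qed (simp add: cyc_def)

lemma rot_cyc: "rot i (cyc f) w = cyc f w"
proof -
  have "rot i (cyc f) w = (\<Sum>j<length w. rot i (rot j f) w)"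
    by (simp add: rot_def cyc_def sum_distrib_left)
  then show ?thesis using sum_rot_shift[of i f w] by (simp add: rot_rot add.commute)
qed

lemma cyc_rot: "cyc (rot i f) w = cyc f w"
  using sum_rot_shift[of i f w] by (simp add: cyc_def rot_rot)

lemma cyc_cyc: "cyc (cyc f) w = of_nat (length w) * cyc f w"
  by (subst cyc_def) (simp add: rot_cyc)

text \<open>The face that multiplies the first two letters. All other faces are conjugates of it by
  rotations.\<close>

definition mul_hd :: "(nat list \<Rightarrow> 'r) \<Rightarrow> nat list \<Rightarrow> 'r"
  where "mul_hd f w = (case w of [] \<Rightarrow> 0 | k # v \<Rightarrow> mul0 f k v)"

lemma mul_hd_sum: "mul_hd (\<lambda>u. \<Sum>i\<in>I. f i u) w = (\<Sum>i\<in>I. mul_hd (f i) w)"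
proof (cases w)
  case (Cons k v)
  have "mul0 (\<lambda>u. \<Sum>i\<in>I. f i u) k v = (\<Sum>i\<in>I. mul0 (f i) k v)"
    by (induction I rule: infinite_finite_induct) (simp_all add: mul0_add, simp_all add: mul0_def)
  then show ?thesis by (simp add: mul_hd_def Cons)
qed (simp add: mul_hd_def)

lemma mul_hd_cong:
  "(\<And>u. length u = Suc (length w) \<Longrightarrow> f u = g u) \<Longrightarrow> mul_hd f w = mul_hd g w"
  unfolding mul_hd_def mul0_def by (auto split: list.split intro!: sum.cong)

lemma bar_d_eq_sum:
  "bar_d f w = (\<Sum>i<length w. (-1) ^ i *
     mul0 (\<lambda>u. f (take i w @ u)) (w ! i) (drop (Suc i) w))"
proof (induction w arbitrary: f)
  case (Cons k v)
  show ?case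
    unfolding list.size add_0_right add_Suc_right sum.lessThan_Suc_shift bar_d.simps Cons.IH
    by (simp add: sum_negf)
qed simp

text \<open>Bring position i to the front, multiply there and rotate back. As t^(n+1) = 1 on words
  of length n + 1, rotating back is a rotation by n + 1 - i, and the signs combine to
  (-1)^i.\<close>

lemma bar_d_eq_rot:
  "bar_d f w = (\<Sum>i<length w. rot i (mul_hd (rot (Suc (length w) - i) f)) w)"
  unfolding bar_d_eq_sum
proof (rule sum.cong[OF refl])
  fix i assume "i \<in> {..<length w}"
  then have i: "i < length w" by simp
  have r: "rotate i w = w ! i # drop (Suc i) w @ take i w"
    using i by (simp add: rotate_drop_take Cons_nth_drop_Suc flip: append_Cons)
  have l: "length (drop (Suc i) w) = length w - Suc i" by simp
  have q: "rotate (Suc (length w) - i) (x # y # drop (Suc i) w @ take i w)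
      = take i w @ x # y # drop (Suc i) w" for x y
  proof -
    have "Suc (length w) - i = length (x # y # drop (Suc i) w)" using i by simp
    then show ?thesis using rotate_append[of "x # y # drop (Suc i) w" "take i w"] by simp
  qed
  have s: "(-1) ^ ((length w - 1) * i) * ((-1) ^ (length w * (Suc (length w) - i)) * z)
      = (-1) ^ i * (z :: 'r)" for z
  proof -
    have "even ((length w - 1) * i + length w * (Suc (length w) - i)) = even i"
      using i by (cases "length w") (auto simp: Suc_diff_le even_diff_nat)
    then have "(-1 :: 'r) ^ ((length w - 1) * i + length w * (Suc (length w) - i)) = (-1) ^ i"
      by (metis neg_one_even_power neg_one_odd_power)
    then show ?thesis by (metis mult.assoc power_add)
  qed
  have len: "length (x # y # drop (Suc i) w @ take i w) - 1 = length w" for x y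
    using i by simp
  have "rot (Suc (length w) - i) f (x # y # drop (Suc i) w @ take i w)
     = (-1) ^ (length w * (Suc (length w) - i)) * f (take i w @ x # y # drop (Suc i) w)" for x y
    unfolding rot_def q len ..
  then have m: "mul0 (rot (Suc (length w) - i) f) (w ! i) (drop (Suc i) w @ take i w) =
     (-1) ^ (length w * (Suc (length w) - i)) * mul0 (\<lambda>u. f (take i w @ u)) (w ! i) (drop (Suc i) w)"
    by (simp only: mul0_def sum_distrib_left mult.left_commute)
  show "(-1) ^ i * mul0 (\<lambda>u. f (take i w @ u)) (w ! i) (drop (Suc i) w) =
    rot i (mul_hd (rot (Suc (length w) - i) f)) w"
    by (simp only: rot_def[of i] mul_hd_def r list.case m s)
qed

lemma hoch_d_eq: "w \<noteq> [] \<Longrightarrow> hoch_d f w = bar_d f w + mul_hd (rot 1 f) w"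
  by (cases w) (simp_all add: hoch_d_def mul_hd_def mul0_def rot_def sum_distrib_left mult_ac)

lemma rot_sum: "rot j (\<lambda>u. \<Sum>i\<in>I. f i u) w = (\<Sum>i\<in>I. rot j (f i) w)"
  by (simp add: rot_def sum_distrib_left)

lemma cyc_sum: "cyc (\<lambda>u. \<Sum>i\<in>I. f i u) w = (\<Sum>i\<in>I. cyc (f i) w)"
  unfolding cyc_def rot_sum by (rule sum.swap)

text \<open>N f is invariant under t, so in the rotated form of b' only the outer rotations remain,
  and they add up to N.\<close>

lemma bar_d_cyc: "bar_d (cyc f) w = cyc (mul_hd (cyc f)) w"
  unfolding bar_d_eq_rot cyc_def[of "mul_hd (cyc f)"] rot_cyc[abs_def] by simp

text \<open>N absorbs the outer rotations. The cyclic face supplies the one inner rotation missing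
  in b', so the inner ones run through all n + 1 rotations of words of length n + 1 and add up to
  N.\<close>

lemma cyc_hoch_d: "cyc (hoch_d f) w = cyc (mul_hd (cyc f)) w"
proof (cases "w = []")
  case False
  define m where "m = length w"
  have "cyc (hoch_d f) w = cyc (\<lambda>u. (\<Sum>i<m. rot i (mul_hd (rot (Suc m - i) f)) u)
      + mul_hd (rot 1 f) u) w"
  proof (rule cyc_cong)
    fix u :: "nat list" assume "length u = length w"
    with False have "length u = m" "u \<noteq> []" by (auto simp: m_def)
    then show "hoch_d f u = (\<Sum>i<m. rot i (mul_hd (rot (Suc m - i) f)) u) + mul_hd (rot 1 f) u"
      unfolding hoch_d_eq[OF \<open>u \<noteq> []\<close>] bar_d_eq_rot[of f u] by simp
  qed
  also have "\<dots> = (\<Sum>i<m. cyc (mul_hd (rot (Suc m - i) f)) w) + cyc (mul_hd (rot 1 f)) w"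
    by (simp add: cyc_add cyc_sum cyc_rot)
  also have "\<dots> = (\<Sum>i<Suc m. cyc (mul_hd (rot (Suc m - i) f)) w)"
    by simp
  also have "\<dots> = (\<Sum>i<Suc m. cyc (mul_hd (rot (Suc i) f)) w)"
    by (subst sum.nat_diff_reindex[symmetric]) simp
  also have "\<dots> = cyc (mul_hd (\<lambda>u. \<Sum>i<Suc m. rot (Suc i) f u)) w"
    by (simp only: mul_hd_sum[abs_def] cyc_sum)
  also have "\<dots> = cyc (mul_hd (cyc f)) w"
  proof (rule cyc_cong, rule mul_hd_cong)
    fix u v :: "nat list" assume "length u = length w" "length v = Suc (length u)"
    then show "(\<Sum>i<Suc m. rot (Suc i) f v) = cyc f v"
      using sum_rot_shift[of 1 f v] by (simp add: m_def)
  qed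
  finally show ?thesis .
qed (simp add: cyc_def)

text \<open>Both sides are the norm of the first face of N f.\<close>

lemma bar_d_cyc_hoch_d: "bar_d (cyc f) w = cyc (hoch_d f) w"
  by (simp add: bar_d_cyc cyc_hoch_d)


text \<open>Write b = b' + l, with l the cyclic face. In b' l + l b' + l l the contributions cancel
  in three groups: \<open>A\<close> multiplies the last letter into the first two, \<open>C\<close>
  the last two letters into the first, and \<open>B\<close> combines the cyclic face with an inner
  one.\<close>

lemma hoch_d_hoch_d: "hoch_d (hoch_d f) w = 0"
proof (cases w)
  case (Cons k v)
  define l where "l = (\<lambda>g w. case w of [] \<Rightarrow> 0
    | k # v \<Rightarrow> (-1) ^ Suc (length v) * (\<Sum>x\<le>D. \<Sum>y\<le>D. c x y k * g (y # v @ [x])))"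
  have h: "hoch_d g = (\<lambda>u. bar_d g u + l g u)" for g
    by (auto simp: hoch_d_def l_def fun_eq_iff split: list.split)
  have ladd: "l (\<lambda>u. g u + g' u) u = l g u + l g' u" for g g' u
    by (auto simp: l_def distrib_left sum.distrib split: list.split)
  define s where "s = (-1 :: 'r) ^ length v"
  have ss: "s * (s * z) = z" for z by (simp add: s_def flip: power_mult_distrib mult.assoc)
  define A where "A = (\<Sum>x\<le>D. \<Sum>y\<le>D. \<Sum>q\<le>D. (\<Sum>p\<le>D. c x y p * c p q k) * f (y # q # v @ [x]))"
  define B where "B = (\<Sum>x\<le>D. \<Sum>y\<le>D. c x y k * bar_d (\<lambda>u. f (y # u @ [x])) v)"
  define C where "C = (\<Sum>p\<le>D. \<Sum>q\<le>D. \<Sum>y\<le>D. (\<Sum>x\<le>D. c p q x * c x y k) * f (y # v @ [p, q]))"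
  have 1: "bar_d (l f) w = s * A - s * B"
  proof -
    have "bar_d (\<lambda>u. l f (k # u)) v
      = bar_d (\<lambda>u. s * (\<Sum>x\<le>D. \<Sum>y\<le>D. c x y k * f (y # u @ [x]))) v"
      by (rule bar_d_cong) (simp add: l_def s_def)
    then have "bar_d (\<lambda>u. l f (k # u)) v = s * B"
      by (simp add: bar_d_scale bar_d_sum B_def)
    moreover have "mul0 (l f) k v = s * A"
    proof -
      have "mul0 (l f) k v = s * (\<Sum>p\<le>D. \<Sum>q\<le>D. \<Sum>x\<le>D. \<Sum>y\<le>D. c x y p * c p q k * f (y # q # v @ [x]))"
        by (simp add: mul0_def l_def s_def sum_distrib_left mult_ac)
      also have "(\<Sum>p\<le>D. \<Sum>q\<le>D. \<Sum>x\<le>D. \<Sum>y\<le>D. c x y p * c p q k * f (y # q # v @ [x]))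
         = (\<Sum>p\<le>D. \<Sum>x\<le>D. \<Sum>y\<le>D. \<Sum>q\<le>D. c x y p * c p q k * f (y # q # v @ [x]))"
        by (rule sum.cong[OF refl], rule sum_swap_in2)
      also have "\<dots> = (\<Sum>x\<le>D. \<Sum>y\<le>D. \<Sum>p\<le>D. \<Sum>q\<le>D. c x y p * c p q k * f (y # q # v @ [x]))"
        by (rule sum_swap_in2)
      also have "\<dots> = A"
        unfolding A_def sum_distrib_right
        by (rule sum.cong[OF refl], rule sum.cong[OF refl], rule sum.swap)
      finally show ?thesis .
    qed
    ultimately show ?thesis by (simp add: Cons)
  qed
  have 2: "l (bar_d f) w = - s * A + s * B + C"
  proof -
    have b: "bar_d f (y # v @ [x]) = mul0 f y (v @ [x]) - bar_d (\<lambda>u. f (y # u @ [x])) v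
        - s * (\<Sum>p\<le>D. \<Sum>q\<le>D. c p q x * f (y # v @ [p, q]))" for x y
      by (simp add: bar_d_snoc s_def)
    have a: "(\<Sum>x\<le>D. \<Sum>y\<le>D. c x y k * mul0 f y (v @ [x])) = A"
    proof -
      have "(\<Sum>x\<le>D. \<Sum>y\<le>D. c x y k * mul0 f y (v @ [x]))
        = (\<Sum>x\<le>D. \<Sum>y\<le>D. \<Sum>p\<le>D. \<Sum>q\<le>D. c p q y * c x y k * f (p # q # v @ [x]))"
        by (simp add: mul0_def sum_distrib_left mult_ac)
      also have "\<dots> = (\<Sum>x\<le>D. \<Sum>p\<le>D. \<Sum>q\<le>D. \<Sum>y\<le>D. c p q y * c x y k * f (p # q # v @ [x]))"
        by (rule sum.cong[OF refl], rule sum_swap_in2)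
      also have "\<dots> = A"
        unfolding A_def by (simp add: assoc flip: sum_distrib_right)
      finally show ?thesis .
    qed
    have cc: "(\<Sum>x\<le>D. \<Sum>y\<le>D. c x y k * (\<Sum>p\<le>D. \<Sum>q\<le>D. c p q x * f (y # v @ [p, q]))) = C"
    proof -
      have "(\<Sum>x\<le>D. \<Sum>y\<le>D. c x y k * (\<Sum>p\<le>D. \<Sum>q\<le>D. c p q x * f (y # v @ [p, q])))
        = (\<Sum>x\<le>D. \<Sum>y\<le>D. \<Sum>p\<le>D. \<Sum>q\<le>D. c p q x * c x y k * f (y # v @ [p, q]))"
        by (simp add: sum_distrib_left mult_ac)
      also have "\<dots> = (\<Sum>x\<le>D. \<Sum>p\<le>D. \<Sum>q\<le>D. \<Sum>y\<le>D. c p q x * c x y k * f (y # v @ [p, q]))"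
        by (rule sum.cong[OF refl], rule sum_swap_in2)
      also have "\<dots> = (\<Sum>p\<le>D. \<Sum>q\<le>D. \<Sum>x\<le>D. \<Sum>y\<le>D. c p q x * c x y k * f (y # v @ [p, q]))"
        by (rule sum_swap_in2)
      also have "\<dots> = C"
        unfolding C_def sum_distrib_right
        by (rule sum.cong[OF refl], rule sum.cong[OF refl], rule sum.swap)
      finally show ?thesis .
    qed
    have "l (bar_d f) w = - s * ((\<Sum>x\<le>D. \<Sum>y\<le>D. c x y k * mul0 f y (v @ [x])) - B
      - s * (\<Sum>x\<le>D. \<Sum>y\<le>D. c x y k * (\<Sum>p\<le>D. \<Sum>q\<le>D. c p q x * f (y # v @ [p, q]))))"
      unfolding l_def Cons list.case b sum2_linear by (simp add: s_def B_def)
    then show ?thesis by (simp add: a cc right_diff_distrib ss)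
  qed
  have 3: "l (l f) w = - C"
  proof -
    have "l (l f) w = - s * (\<Sum>x\<le>D. \<Sum>y\<le>D. c x y k * (s * (\<Sum>p\<le>D. \<Sum>q\<le>D. c p q y * f (q # v @ [x, p]))))"
      by (simp add: l_def Cons s_def)
    also have "\<dots> = - (s * (s * (\<Sum>x\<le>D. \<Sum>y\<le>D. \<Sum>p\<le>D. \<Sum>q\<le>D. c p q y * c x y k * f (q # v @ [x, p]))))"
      by (simp add: sum_distrib_left mult_ac sum_negf)
    also have "\<dots> = - (\<Sum>x\<le>D. \<Sum>p\<le>D. \<Sum>q\<le>D. \<Sum>y\<le>D. c p q y * c x y k * f (q # v @ [x, p]))"
      unfolding ss by (rule arg_cong[of _ _ uminus], rule sum.cong[OF refl], rule sum_swap_in2)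
    also have "\<dots> = - C"
      unfolding C_def by (simp add: assoc flip: sum_distrib_right)
    finally show ?thesis .
  qed
  have "hoch_d (hoch_d f) w = bar_d (bar_d f) w + bar_d (l f) w + l (bar_d f) w + l (l f) w"
    by (simp add: h bar_d_add ladd)
  then show ?thesis by (simp add: bar_d_bar_d 1 2 3)
qed (simp add: hoch_d_def)

section \<open>Weights, and chains over the field\<close>

definition wt_word :: "nat list \<Rightarrow> nat"
  where "wt_word u = sum_list (map wt u)"

text \<open>The basis in weight W of the n-fold tensor power of the augmentation ideal.
  \<open>hoch_words\<close> is its analogue for normalized Hochschild chains, whose first letter may
  be the unit.\<close>

definition pos_words :: "nat \<Rightarrow> nat \<Rightarrow> nat list set"
  where "pos_words n W = {u. length u = n \<and> set u \<subseteq> {1..D} \<and> wt_word u = W}"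

definition hoch_words :: "nat \<Rightarrow> nat \<Rightarrow> nat list set"
  where "hoch_words n W = {k # v | k v. k \<le> D \<and> length v = n \<and> set v \<subseteq> {1..D} \<and> wt k + wt_word v = W}"

text \<open>Besides vanishing off S, the values must be fixed by the idempotent, that is, lie in the
  copy of the field inside the ambient ring.\<close>

definition supported :: "nat list set \<Rightarrow> (nat list \<Rightarrow> 'r) \<Rightarrow> bool"
  where "supported S f \<longleftrightarrow> (\<forall>u. u \<notin> S \<longrightarrow> f u = 0) \<and> (\<forall>u. e * f u = f u)"

lemma supported_0: "supported S f \<Longrightarrow> u \<notin> S \<Longrightarrow> f u = 0"
  and supported_e: "supported S f \<Longrightarrow> e * f u = f u"
  by (auto simp: supported_def)

lemma wt_word_simps [simp]:
  "wt_word [] = 0" "wt_word (k # v) = wt k + wt_word v" "wt_word (u @ v) = wt_word u + wt_word v"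
  by (simp_all add: wt_word_def)

lemma wt_word_rotate: "wt_word (rotate i w) = wt_word w"
proof (induction i)
  case (Suc i)
  have "wt_word (rotate1 u) = wt_word u" for u by (cases u) simp_all
  with Suc show ?case by simp
qed simp

lemma length_le_wt_word: "set u \<subseteq> {1..D} \<Longrightarrow> length u \<le> wt_word u"
  by (induction u) (auto dest!: wt_pos[rotated])

lemma finite_pos_words: "finite (pos_words n W)"
  by (rule finite_subset[OF _ finite_lists_length_eq[of "{1..D}" n]]) (auto simp: pos_words_def)

lemma bar_d_nonzero:
  assumes "bar_d f w \<noteq> 0"
  obtains i x y where "i < length w" "c x y (w ! i) \<noteq> 0"
    "f (take i w @ x # y # drop (Suc i) w) \<noteq> 0"
proof -
  obtain i where i: "i < length w" "mul0 (\<lambda>u. f (take i w @ u)) (w ! i) (drop (Suc i) w) \<noteq> 0"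
    using assms unfolding bar_d_eq_sum by (metis (no_types, lifting) lessThan_iff mult_zero_right sum.neutral)
  then obtain x y where "c x y (w ! i) * f (take i w @ x # y # drop (Suc i) w) \<noteq> 0"
    unfolding mul0_def by (metis (no_types, lifting) sum.neutral)
  with i that show ?thesis by (metis mult_zero_left mult_zero_right)
qed

lemma hoch_d_nonzero:
  assumes "hoch_d f w \<noteq> 0" "bar_d f w = 0"
  obtains k v x y where "w = k # v" "c x y k \<noteq> 0" "f (y # v @ [x]) \<noteq> 0"
proof (cases w)
  case (Cons k v)
  with assms have "(\<Sum>x\<le>D. \<Sum>y\<le>D. c x y k * f (y # v @ [x])) \<noteq> 0"
    by (auto simp: hoch_d_def)
  then obtain x y where "c x y k * f (y # v @ [x]) \<noteq> 0"
    by (metis (no_types, lifting) sum.neutral)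
  with Cons that show ?thesis by (metis mult_zero_left mult_zero_right)
qed (use assms in \<open>auto simp: hoch_d_def\<close>)

text \<open>A product with a factor of positive weight has positive weight, hence no component at
  the unit. In this form the augmentation ideal is an ideal.\<close>

lemma c_pos:
  assumes "c x y k \<noteq> 0" "x \<in> {1..D} \<or> y \<in> {1..D}"
  shows "k \<in> {1..D}"
proof -
  have k: "k \<le> D" "wt k = wt x + wt y" using wt_c[OF assms(1)] by auto
  then have "wt k > 0" using assms(2) wt_pos[of x] wt_pos[of y] by auto
  then have "k \<noteq> 0" using wt_0 by (metis less_numeral_extra(3))
  with k show ?thesis by auto
qed

lemma set_split_nth:
  assumes "i < length w"
  shows "set w = insert (w ! i) (set (take i w) \<union> set (drop (Suc i) w))"
    and "wt_word w = wt_word (take i w) + wt (w ! i) + wt_word (drop (Suc i) w)"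
  by (subst id_take_nth_drop[OF assms], simp)+

lemma supported_bar_d:
  assumes f: "supported (pos_words (Suc n) W) f"
  shows "supported (pos_words n W) (bar_d f)"
proof -
  have "w \<in> pos_words n W" if "bar_d f w \<noteq> 0" for w
  proof -
    from that obtain i x y where i: "i < length w" "c x y (w ! i) \<noteq> 0"
      "f (take i w @ x # y # drop (Suc i) w) \<noteq> 0" by (rule bar_d_nonzero)
    then have m: "take i w @ x # y # drop (Suc i) w \<in> pos_words (Suc n) W"
      using supported_0[OF f] by blast
    have "w ! i \<in> {1..D}" by (rule c_pos[OF i(2)]) (use m in \<open>auto simp: pos_words_def\<close>)
    moreover have "wt (w ! i) = wt x + wt y" using wt_c[OF i(2)] by auto
    ultimately show ?thesis
      using m i(1) unfolding pos_words_def mem_Collect_eq set_split_nth[OF i(1)] by auto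
  qed
  moreover have "e * bar_d f w = bar_d f w" for w
    unfolding bar_d_scale[symmetric] by (simp add: supported_e[OF f])
  ultimately show ?thesis by (auto simp: supported_def)
qed

lemma supported_hoch_d:
  assumes f: "supported (pos_words (Suc n) W) f"
  shows "supported (pos_words n W) (hoch_d f)"
proof -
  have "w \<in> pos_words n W" if "hoch_d f w \<noteq> 0" for w
  proof (cases "bar_d f w = 0")
    case True
    with that obtain k v x y where i: "w = k # v" "c x y k \<noteq> 0" "f (y # v @ [x]) \<noteq> 0"
      by (rule hoch_d_nonzero)
    then have m: "y # v @ [x] \<in> pos_words (Suc n) W"
      using supported_0[OF f] by blast
    have "k \<in> {1..D}" by (rule c_pos[OF i(2)]) (use m in \<open>auto simp: pos_words_def\<close>)
    moreover have "wt k = wt x + wt y" using wt_c[OF i(2)] by auto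
    ultimately show ?thesis
      using m i(1) by (auto simp: pos_words_def)
  next
    case False
    with supported_bar_d[OF f] show ?thesis by (auto simp: supported_def)
  qed
  moreover have "e * hoch_d f w = hoch_d f w" for w
    unfolding hoch_d_scale[symmetric] by (simp add: supported_e[OF f])
  ultimately show ?thesis by (auto simp: supported_def)
qed

lemma supported_rot:
  assumes f: "supported (pos_words n W) f"
  shows "supported (pos_words n W) (rot j f)"
proof -
  have "rotate j w \<in> pos_words n W \<longleftrightarrow> w \<in> pos_words n W" for w
    by (simp add: pos_words_def wt_word_rotate)
  then show ?thesis using f by (auto simp: supported_def rot_def mult.left_commute[of e])
qed

lemma supported_add:
  "supported S f \<Longrightarrow> supported S g \<Longrightarrow> supported S (\<lambda>u. f u + g u)"
  and supported_diff: "supported S f \<Longrightarrow> supported S g \<Longrightarrow> supported S (\<lambda>u. f u - g u)"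
  and supported_zero: "supported S (\<lambda>u. 0)"
  by (auto simp: supported_def algebra_simps)

lemma supported_scale: "supported S f \<Longrightarrow> supported S (\<lambda>u. a u * f u)"
  by (simp add: supported_def mult.left_commute[of e])

lemma supported_sum: "(\<And>i. i \<in> I \<Longrightarrow> supported S (f i)) \<Longrightarrow> supported S (\<lambda>u. \<Sum>i\<in>I. f i u)"
  by (induction I rule: infinite_finite_induct) (simp_all add: supported_add supported_zero)

lemma supported_cyc:
  assumes f: "supported (pos_words n W) f"
  shows "supported (pos_words n W) (cyc f)"
  using supported_rot[OF f] unfolding supported_def cyc_def
  by (auto simp: sum_distrib_left)

text \<open>The splitting of the first tensor factor into the augmentation ideal and the line of the
  unit: f holds the words starting in the ideal, g the tails of those starting with the
  unit.\<close>

definition glue :: "(nat list \<Rightarrow> 'r) \<Rightarrow> (nat list \<Rightarrow> 'r) \<Rightarrow> nat list \<Rightarrow> 'r"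
  where "glue f g u = (case u of [] \<Rightarrow> 0 | k # v \<Rightarrow> if k = 0 then g v else f u)"

lemma supported_glue:
  assumes "supported (pos_words (Suc n) W) f" "supported (pos_words n W) g"
  shows "supported (hoch_words n W) (glue f g)"
proof -
  have "u \<in> hoch_words n W" if "glue f g u \<noteq> 0" for u
  proof -
    obtain k v where u: "u = k # v" using \<open>glue f g u \<noteq> 0\<close> by (cases u) (auto simp: glue_def)
    show ?thesis
    proof (cases "k = 0")
      case True
      with that u have "v \<in> pos_words n W" using supported_0[OF assms(2)] by (auto simp: glue_def)
      with True u show ?thesis by (auto simp: hoch_words_def pos_words_def wt_0)
    next
      case False
      with that u have "k # v \<in> pos_words (Suc n) W"
        using supported_0[OF assms(1)] by (auto simp: glue_def)
      with u show ?thesis by (auto simp: hoch_words_def pos_words_def)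
    qed
  qed
  then show ?thesis using assms unfolding supported_def glue_def by (auto split: list.split)
qed

lemma unglue:
  assumes g: "supported (hoch_words n W) g"
  obtains x y where "g = glue x y" "supported (pos_words (Suc n) W) x" "supported (pos_words n W) y"
proof
  let ?x = "\<lambda>u. if u \<in> pos_words (Suc n) W then g u else 0" and ?y = "\<lambda>u. g (0 # u)"
  show "supported (pos_words (Suc n) W) ?x" using g by (auto simp: supported_def)
  have "u \<in> pos_words n W" if "g (0 # u) \<noteq> 0" for u
  proof -
    have "0 # u \<in> hoch_words n W" using that supported_0[OF g] by blast
    then show ?thesis by (auto simp: hoch_words_def pos_words_def wt_0)
  qed
  then show "supported (pos_words n W) ?y" using g by (auto simp: supported_def)
  show "g = glue ?x ?y"
  proof
    fix u
    show "g u = glue ?x ?y u"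
    proof (cases u)
      case Nil
      then show ?thesis using supported_0[OF g, of "[]"] by (auto simp: glue_def hoch_words_def)
    next
      case (Cons k v)
      have "g u = 0" if "k \<noteq> 0" "u \<notin> pos_words (Suc n) W"
        by (rule supported_0[OF g]) (use that Cons in \<open>auto simp: hoch_words_def pos_words_def\<close>)
      then show ?thesis by (auto simp: glue_def Cons)
    qed
  qed
qed

text \<open>The normalized Hochschild complex is the cone of \<open>1 - t\<close>, from the bar complex of the
  augmentation ideal to its Hochschild complex.\<close>

lemma hoch_d_glue:
  assumes f: "supported (pos_words (Suc n) W) f" and g: "supported (pos_words n W) g"
  shows "hoch_d (glue f g) = glue (\<lambda>u. hoch_d f u + (g u - rot 1 g u)) (\<lambda>u. - bar_d g u)"
proof
  fix w
  show "hoch_d (glue f g) w = glue (\<lambda>u. hoch_d f u + (g u - rot 1 g u)) (\<lambda>u. - bar_d g u) w"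
  proof (cases w)
    case Nil
    then show ?thesis by (simp add: glue_def hoch_d_def)
  next
    case (Cons k v)
    \<comment> \<open>The part starting with the unit. Its first face returns g and its cyclic face
      - t g, by multiplication with the unit; the other faces keep the unit in front and give - b'
      g.\<close>
    define G where "G = glue (\<lambda>u. 0) g"
    have f0: "f (0 # u) = 0" for u
      by (rule supported_0[OF f]) (auto simp: pos_words_def)
    have gs: "g u = 0" if "\<not> set u \<subseteq> {1..D}" for u
      by (rule supported_0[OF g]) (use that in \<open>auto simp: pos_words_def\<close>)
    have eq: "glue f g = (\<lambda>u. f u + G u)"
      using f0 supported_0[OF f, of "[]"] by (auto simp: G_def glue_def fun_eq_iff pos_words_def split: list.split)
    have hf: "hoch_d f w = 0" if "k = 0"
      by (rule supported_0[OF supported_hoch_d[OF f]]) (use that in \<open>auto simp: pos_words_def Cons\<close>)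
    have 1: "mul0 G k v = g (k # v)"
    proof -
      have "mul0 G k v = (\<Sum>x\<le>D. if x = 0 then (\<Sum>y\<le>D. c x y k * g (y # v)) else 0)"
        unfolding mul0_def by (rule sum.cong[OF refl]) (simp add: G_def glue_def)
      also have "\<dots> = (\<Sum>y\<le>D. c 0 y k * g (y # v))"
        by (simp add: sum.delta)
      also have "\<dots> = (\<Sum>y\<le>D. if y = k then e * g (k # v) else 0)"
        by (rule sum.cong[OF refl]) (auto simp: unit_left)
      also have "\<dots> = g (k # v)"
        using gs[of "k # v"] supported_e[OF g] by (auto simp: sum.delta)
      finally show ?thesis .
    qed
    have 2: "bar_d (\<lambda>u. G (k # u)) v = (if k = 0 then bar_d g v else 0)"
      by (simp add: G_def glue_def)
    have 3: "(\<Sum>x\<le>D. \<Sum>y\<le>D. c x y k * G (y # v @ [x])) = g (v @ [k])"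
    proof -
      have "(\<Sum>x\<le>D. \<Sum>y\<le>D. c x y k * G (y # v @ [x])) =
        (\<Sum>x\<le>D. \<Sum>y\<le>D. if y = 0 then c x 0 k * g (v @ [x]) else 0)"
        by (intro sum.cong refl) (simp add: G_def glue_def)
      also have "\<dots> = (\<Sum>x\<le>D. c x 0 k * g (v @ [x]))"
        by (simp add: sum.delta)
      also have "\<dots> = (\<Sum>x\<le>D. if x = k then e * g (v @ [k]) else 0)"
        by (rule sum.cong[OF refl]) (auto simp: unit_right)
      also have "\<dots> = g (v @ [k])"
        using gs[of "v @ [k]"] supported_e[OF g] by (auto simp: sum.delta)
      finally show ?thesis .
    qed
    have r: "rot 1 g w = (-1) ^ length v * g (v @ [k])" by (simp add: rot_def Cons)
    have "hoch_d G w = g w - (if k = 0 then bar_d g v else 0) - rot 1 g w"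
      unfolding hoch_d_def Cons list.case bar_d.simps 1 2 3 r[unfolded Cons] by simp
    moreover have "g w = 0" "rot 1 g w = 0" if "k = 0"
      using that gs[of w] gs[of "v @ [k]"] by (auto simp: Cons rot_def)
    ultimately show ?thesis
      unfolding eq hoch_d_add using hf by (auto simp: glue_def Cons)
  qed
qed

end

section \<open>The Euler characteristic of the cyclic complex\<close>

locale rational_structure_constants = structure_constants D wt c e
  for D wt and c :: "nat \<Rightarrow> nat \<Rightarrow> nat \<Rightarrow> 'r::comm_ring_1" and e +
  fixes rinv :: "nat \<Rightarrow> 'r"
  assumes rinv: "0 < n \<Longrightarrow> of_nat n * rinv n = 1"
begin

lemma pos_words_length: "u \<in> pos_words n W \<Longrightarrow> length u = n"
  by (simp add: pos_words_def)

lemma rinv': "0 < n \<Longrightarrow> rinv n * (of_nat n * a) = a"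
  by (metis mult.assoc mult.commute mult_1 rinv)

text \<open>Summation by parts. For h j = t^j f on words of length n one has h n = h 0, and the
  right side becomes N f - n f.\<close>

lemma sum_nat_rot:
  assumes "0 < n"
  shows "(\<Sum>j<n. of_nat j * (h j - h (Suc j) :: 'r)) = (\<Sum>j<n. h j) - of_nat n * h n + (h n - h 0)"
  using assms
proof (induction n rule: nat_induct_non_zero)
  case (Suc n)
  then show ?case by (simp add: algebra_simps)
qed simp

text \<open>Since \<open>(1 - t) (\<Sum>j<n. j t\<^sup>j) = N - n\<close> on words of length \<open>n\<close>, the kernel of \<open>N\<close> is the
  image of \<open>1 - t\<close>.\<close>

lemma cyc_kernel:
  assumes f: "supported (pos_words n W) f" and z: "\<And>w. cyc f w = 0" and n: "0 < n"
  obtains g where "supported (pos_words n W) g" "f = (\<lambda>u. g u - rot 1 g u)"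
proof
  let ?g = "\<lambda>u. - rinv n * (\<Sum>j<n. of_nat j * rot j f u)"
  show g: "supported (pos_words n W) ?g"
    by (intro supported_scale supported_sum supported_rot f)
  show "f = (\<lambda>u. ?g u - rot 1 ?g u)"
  proof
    fix u
    show "f u = ?g u - rot 1 ?g u"
    proof (cases "length u = n")
      case True
      have "rot 1 ?g u = - rinv n * (\<Sum>j<n. of_nat j * rot (Suc j) f u)"
        by (simp add: rot_scale[of 1 "- rinv n", simplified] rot_sum rot_scale rot_rot)
      then have "?g u - rot 1 ?g u = - rinv n * (\<Sum>j<n. of_nat j * (rot j f u - rot (Suc j) f u))"
        by (simp add: right_diff_distrib sum_subtractf)
      also have "\<dots> = - rinv n * (cyc f u - of_nat n * f u)"
        using sum_nat_rot[OF n, of "\<lambda>j. rot j f u"] True rot_length[of u f] by (simp add: cyc_def)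
      finally show ?thesis using z n by (simp add: rinv')
    next
      case False
      have "f u = 0"
        by (rule supported_0[OF f]) (use False in \<open>auto dest: pos_words_length\<close>)
      moreover have "?g u - rot 1 ?g u = 0"
        by (rule supported_0[OF supported_diff[OF g supported_rot[OF g, of 1]]])
          (use False in \<open>auto dest: pos_words_length\<close>)
      ultimately show ?thesis by (simp only:)
    qed
  qed
qed

text \<open>On functions invariant under t the norm is multiplication by the word length, which is
  invertible.\<close>

lemma rot_kernel:
  assumes f: "supported (pos_words n W) f" and z: "\<And>w. rot 1 f w = f w" and n: "0 < n"
  shows "f = cyc (\<lambda>u. rinv n * f u)"
proof
  fix w
  have "rot j f w = f w" for j
  proof (induction j)
    case (Suc j)
    have "rot (Suc j) f w = rot 1 (rot j f) w" by (simp add: rot_rot)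
    also have "\<dots> = rot j (rot 1 f) w" by (simp add: rot_rot)
    also have "\<dots> = rot j f w" by (rule rot_cong) (rule z)
    finally show ?case using Suc by simp
  qed simp
  then have "cyc f w = of_nat (length w) * f w" by (simp add: cyc_def)
  then show "f w = cyc (\<lambda>u. rinv n * f u) w"
    using supported_0[OF f, of w] n by (cases "w \<in> pos_words n W") (auto simp: cyc_scale rinv' dest: pos_words_length)
qed

section \<open>Vanishing of cyclic homology in an acyclic weight\<close>

definition hoch_acyclic :: "nat \<Rightarrow> bool"
  where "hoch_acyclic W \<longleftrightarrow> (\<forall>n f. supported (hoch_words n W) f \<and> hoch_d f = (\<lambda>_. 0) \<longrightarrow>
    (\<exists>g. supported (hoch_words (Suc n) W) g \<and> hoch_d g = f))"

lemma pos_words_empty: "W < n \<Longrightarrow> pos_words n W = {}"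
  using length_le_wt_word by (fastforce simp: pos_words_def)

lemma glue_inject:
  assumes "glue x y = glue x' y'"
    and "supported (pos_words (Suc n) W) x" "supported (pos_words (Suc n) W) x'"
  shows "x = x'" "y = y'"
proof -
  show "y = y'"
    using assms(1) by (auto simp: glue_def fun_eq_iff dest: spec[of _ "0 # _"])
  show "x = x'"
  proof
    fix u
    show "x u = x' u"
    proof (cases "u \<in> pos_words (Suc n) W")
      case True
      then obtain k v where "u = k # v" "k \<noteq> 0" by (cases u) (auto simp: pos_words_def)
      with fun_cong[OF assms(1), of u] show ?thesis by (simp add: glue_def)
    qed (use assms supported_0 in \<open>metis\<close>)
  qed
qed

text \<open>The argument below says that Connes' operator \<open>S\<close> is onto: the class of \<open>z\<close> is the image of
  that of \<open>x\<close>, two degrees higher. Each weight involves only finitely many degrees.\<close>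

lemma cyclic_acyclic:
  assumes H: "hoch_acyclic W" and W: "0 < W"
    and z: "supported (pos_words n W) z" and cz: "\<And>w. cyc (hoch_d z) w = 0"
  shows "\<exists>y. supported (pos_words (Suc n) W) y \<and> (\<forall>w. cyc (hoch_d y) w = cyc z w)"
  using z cz
\<comment> \<open>Downward induction on the word length: letters have positive weight, so no word of
  weight W is longer than W.\<close>
proof (induction "Suc W - n" arbitrary: n z rule: less_induct)
  case less
  note z = less.prems(1) and cz = less.prems(2)
  show ?case
  proof (cases "W < n")
    case True
    then have "z = (\<lambda>_. 0)" using supported_0[OF z] by (auto simp: pos_words_empty)
    then show ?thesis by (intro exI[of _ "\<lambda>_. 0"]) (simp add: supported_zero hoch_d_zero[abs_def])
  next
    case False
    have Nz: "supported (pos_words n W) (cyc z)" by (rule supported_cyc[OF z])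
    \<comment> \<open>The pair (0, N z) is a cycle of the cone because (1 - t) N = 0 and b' N z = N
      b z = 0. Acyclicity makes it the boundary of a pair (x, y).\<close>
    have "hoch_d (glue (\<lambda>_. 0) (cyc z)) = (\<lambda>_. 0)"
    proof -
      have "hoch_d (glue (\<lambda>_. 0) (cyc z))
          = glue (\<lambda>u. hoch_d (\<lambda>_. 0) u + (cyc z u - rot 1 (cyc z) u)) (\<lambda>u. - bar_d (cyc z) u)"
        by (rule hoch_d_glue[OF supported_zero Nz])
      then show ?thesis
        by (simp add: rot_cyc bar_d_cyc_hoch_d cz glue_def fun_eq_iff split: list.split)
    qed
    then obtain g where g: "supported (hoch_words (Suc n) W) g" "hoch_d g = glue (\<lambda>_. 0) (cyc z)"
      using H supported_glue[OF supported_zero Nz] unfolding hoch_acyclic_def by blast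
    from g(1) obtain x y where gxy: "g = glue x y" and x: "supported (pos_words (Suc (Suc n)) W) x"
      and y: "supported (pos_words (Suc n) W) y" by (rule unglue)
    have eq: "glue (\<lambda>u. hoch_d x u + (y u - rot 1 y u)) (\<lambda>u. - bar_d y u) = glue (\<lambda>_. 0) (cyc z)"
      using g(2) hoch_d_glue[OF x y] by (simp add: gxy)
    have "supported (pos_words (Suc n) W) (\<lambda>u. hoch_d x u + (y u - rot 1 y u))"
      by (intro supported_add supported_diff supported_hoch_d[OF x] supported_rot y)
    note eq12 = glue_inject[OF eq this supported_zero]
    have e1: "hoch_d x u + (y u - rot 1 y u) = 0" and e2: "- bar_d y u = cyc z u" for u
      using fun_cong[OF eq12(1), of u] fun_cong[OF eq12(2), of u] by simp_all
    have "cyc (hoch_d x) w = 0" for w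
    proof -
      have "hoch_d x = (\<lambda>u. rot 1 y u - y u)" using e1 by (auto simp: fun_eq_iff add_eq_0_iff2)
      then show ?thesis by (simp add: cyc_diff cyc_rot)
    qed
    \<comment> \<open>As b x = - (1 - t) y has norm zero, x is a cyclic cycle on words two letters
      longer than those of z, and the induction hypothesis gives N x = N b v.\<close>
    then obtain v where v: "supported (pos_words (Suc (Suc (Suc n))) W) v"
      "\<And>w. cyc (hoch_d v) w = cyc x w"
      using less.hyps[of "Suc (Suc n)" x, OF _ x] False by force
    have "supported (pos_words (Suc (Suc n)) W) (\<lambda>u. x u - hoch_d v u)"
      by (intro supported_diff x supported_hoch_d[OF v(1)])
    moreover have "cyc (\<lambda>u. x u - hoch_d v u) w = 0" for w by (simp add: cyc_diff v(2))
    ultimately obtain r where r: "supported (pos_words (Suc (Suc n)) W) r"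
      "(\<lambda>u. x u - hoch_d v u) = (\<lambda>u. r u - rot 1 r u)" by (rule cyc_kernel) simp
    \<comment> \<open>From x - b v = (1 - t) r follows b x = (1 - t) b' r. So y + b' r is invariant
      under t and hence a norm, written - N p below. Then N z = - b' y = b' N p = N b p, and p is
      the witness.\<close>
    define q where "q = (\<lambda>u. y u + bar_d r u)"
    have q: "supported (pos_words (Suc n) W) q"
      unfolding q_def by (intro supported_add y supported_bar_d[OF r(1)])
    have "rot 1 q u = q u" for u
    proof -
      have "hoch_d x u = hoch_d (\<lambda>u. x u - hoch_d v u) u" by (simp add: hoch_d_diff hoch_d_hoch_d)
      also have "\<dots> = bar_d r u - rot 1 (bar_d r) u" unfolding r(2) by (rule hoch_d_rot)
      finally have a: "hoch_d x u = bar_d r u - rot 1 (bar_d r) u" .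
      have "rot 1 q u - q u = - (hoch_d x u + (y u - rot 1 y u))"
        unfolding q_def rot_add a by simp
      then show ?thesis unfolding e1 by simp
    qed
    from rot_kernel[OF q this] have qc: "q = cyc (\<lambda>u. rinv (Suc n) * q u)" by simp
    define p where "p = (\<lambda>u. - rinv (Suc n) * q u)"
    have p: "supported (pos_words (Suc n) W) p" unfolding p_def by (rule supported_scale[OF q])
    have qp: "q = (\<lambda>u. - cyc p u)"
    proof
      fix u
      show "q u = - cyc p u" using fun_cong[OF qc, of u] by (simp add: p_def cyc_scale[of "- rinv (Suc n)", simplified] cyc_scale)
    qed
    have "cyc z w = cyc (hoch_d p) w" for w
    proof -
      have "bar_d q w = - bar_d (cyc p) w" unfolding qp using bar_d_scale[of "-1" "cyc p" w] by simp
      moreover have "bar_d q w = bar_d y w" unfolding q_def bar_d_add by (simp add: bar_d_bar_d)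
      ultimately show ?thesis using e2[of w] by (simp add: bar_d_cyc_hoch_d)
    qed
    with p show ?thesis by metis
  qed
qed

section \<open>The cyclic complex as the image of the projector N / n\<close>

definition cyc_proj :: "(nat list \<Rightarrow> 'r) \<Rightarrow> nat list \<Rightarrow> 'r"
  where "cyc_proj f w = rinv (length w) * cyc f w"

text \<open>Cyclic chains are modelled by invariants of t instead of coinvariants, with b followed
  by the projector as differential. All maps are defined on arbitrary words, so that traces are sums
  over all words.\<close>

definition cyc_d :: "(nat list \<Rightarrow> 'r) \<Rightarrow> nat list \<Rightarrow> 'r"
  where "cyc_d f = cyc_proj (hoch_d f)"

lemma cyc_len: "cyc (\<lambda>u. h (length u) * f u) w = h (length w) * cyc f w"
  by (simp add: cyc_def rot_def sum_distrib_left mult_ac)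

lemma cyc_cyc_proj: "cyc (cyc_proj f) w = cyc f w"
  unfolding cyc_proj_def[abs_def] cyc_len
  by (cases "w = []") (simp_all add: cyc_cyc rinv', simp add: cyc_def)

lemma cyc_hoch_d_cong:
  assumes "\<And>u. cyc f u = cyc g u"
  shows "cyc (hoch_d f) w = cyc (hoch_d g) w"
proof -
  have "cyc f = cyc g" using assms by auto
  then show ?thesis by (simp add: cyc_hoch_d)
qed

text \<open>N b f depends on f only through N f, and the projector does not change N f.\<close>

lemma cyc_d_cyc_proj: "cyc_d (cyc_proj f) = cyc_d f"
  unfolding cyc_d_def cyc_proj_def using cyc_hoch_d_cong[OF cyc_cyc_proj, unfolded cyc_proj_def[abs_def]] by simp

lemma cyc_cyc_d: "cyc (cyc_d f) w = cyc (hoch_d f) w"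
  by (simp add: cyc_d_def cyc_cyc_proj)

lemma cyc_d_cyc_d: "cyc_d (cyc_d f) w = 0"
proof -
  have "cyc (hoch_d (cyc_d f)) w = cyc (hoch_d (hoch_d f)) w"
    by (rule cyc_hoch_d_cong) (rule cyc_cyc_d)
  then show ?thesis by (simp add: cyc_d_def[of "cyc_d f"] cyc_proj_def hoch_d_hoch_d[abs_def])
qed

lemma cyc_proj_lin:
  "cyc_proj (\<lambda>u. f u + g u) w = cyc_proj f w + cyc_proj g w"
  "cyc_proj (\<lambda>u. f u - g u) w = cyc_proj f w - cyc_proj g w"
  "cyc_proj (\<lambda>u. a * f u) w = a * cyc_proj f w"
  "cyc_proj (\<lambda>u. 0) w = 0"
  by (simp_all add: cyc_proj_def cyc_add cyc_diff cyc_scale algebra_simps)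

lemma cyc_d_lin:
  "cyc_d (\<lambda>u. f u + g u) w = cyc_d f w + cyc_d g w"
  "cyc_d (\<lambda>u. f u - g u) w = cyc_d f w - cyc_d g w"
  "cyc_d (\<lambda>u. a * f u) w = a * cyc_d f w"
  "cyc_d (\<lambda>u. 0) w = 0"
  unfolding cyc_d_def cyc_proj_def
  by (simp_all add: hoch_d_add[abs_def] hoch_d_diff[abs_def] hoch_d_scale[abs_def] hoch_d_zero[abs_def]
     cyc_add cyc_diff cyc_scale algebra_simps del: hoch_d_zero)

lemma cyc_proj_sum: "cyc_proj (\<lambda>u. \<Sum>i\<in>I. a i * f i u) w = (\<Sum>i\<in>I. a i * cyc_proj (f i) w)"
  and cyc_d_sum: "cyc_d (\<lambda>u. \<Sum>i\<in>I. a i * f i u) w = (\<Sum>i\<in>I. a i * cyc_d (f i) w)"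
  by (induction I rule: infinite_finite_induct) (simp_all add: cyc_proj_lin cyc_d_lin)

lemma supported_cyc_proj:
  assumes "supported (pos_words n W) f" shows "supported (pos_words n W) (cyc_proj f)"
  unfolding cyc_proj_def[abs_def] by (rule supported_scale[OF supported_cyc[OF assms]])

lemma supported_cyc_d:
  assumes "supported (pos_words (Suc n) W) f" shows "supported (pos_words n W) (cyc_d f)"
  unfolding cyc_d_def by (intro supported_cyc_proj supported_hoch_d assms)

section \<open>A contracting homotopy and its trace\<close>

definition delta :: "nat list \<Rightarrow> nat list \<Rightarrow> 'r"
  where "delta u w = (if w = u then e else 0)"

lemma e_idem: "e * e = e"
  using e_c[of 0 0 0] unit_left[of 0 0] by simp

lemma supported_delta: "u \<in> S \<Longrightarrow> supported S (delta u)"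
  by (auto simp: supported_def delta_def e_idem)

lemma supported_expand:
  assumes f: "supported S f" and S: "finite S"
  shows "f = (\<lambda>w. \<Sum>u\<in>S. f u * delta u w)"
proof
  fix w
  have "(\<Sum>u\<in>S. f u * delta u w) = (\<Sum>u\<in>S. if w = u then e * f w else 0)"
    by (rule sum.cong) (auto simp: delta_def mult.commute)
  then show "f w = (\<Sum>u\<in>S. f u * delta u w)"
    using S supported_0[OF f, of w] supported_e[OF f] by simp
qed

definition lin_ext :: "nat list set \<Rightarrow> (nat list \<Rightarrow> nat list \<Rightarrow> 'r) \<Rightarrow> (nat list \<Rightarrow> 'r) \<Rightarrow> nat list \<Rightarrow> 'r"
  where "lin_ext S h f w = (\<Sum>u\<in>S. f u * h u w)"

text \<open>Two consecutive components of a contracting homotopy, given by their values on basis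
  words. The projector P takes the place of the identity: d h' + P h d = P.\<close>

definition homotopy_step ::
    "nat \<Rightarrow> nat \<Rightarrow> (nat list \<Rightarrow> nat list \<Rightarrow> 'r) \<Rightarrow> (nat list \<Rightarrow> nat list \<Rightarrow> 'r) \<Rightarrow> bool"
  where "homotopy_step W n h h' \<longleftrightarrow>
    (\<forall>u \<in> pos_words n W. supported (pos_words (Suc n) W) (h u)) \<and>
    (\<forall>u \<in> pos_words (Suc n) W. supported (pos_words (Suc (Suc n)) W) (h' u) \<and>
      (\<forall>w. cyc_d (h' u) w + cyc_proj (lin_ext (pos_words n W) h (cyc_d (delta u))) w = cyc_proj (delta u) w))"

lemma homotopy_step_ext:
  assumes h: "homotopy_step W n h h'" and f: "supported (pos_words (Suc n) W) f"
  shows "cyc_d (lin_ext (pos_words (Suc n) W) h' f) w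
    + cyc_proj (lin_ext (pos_words n W) h (cyc_d f)) w = cyc_proj f w"
proof -
  let ?S = "pos_words (Suc n) W" and ?T = "pos_words n W"
  note ex = supported_expand[OF f finite_pos_words]
  have d: "cyc_d f v = (\<Sum>u\<in>?S. f u * cyc_d (delta u) v)" for v
    by (subst ex) (rule cyc_d_sum)
  have p: "cyc_proj f v = (\<Sum>u\<in>?S. f u * cyc_proj (delta u) v)" for v
    by (subst ex) (rule cyc_proj_sum)
  have "lin_ext ?T h (cyc_d f) = (\<lambda>v. \<Sum>u\<in>?S. f u * lin_ext ?T h (cyc_d (delta u)) v)"
    unfolding lin_ext_def d sum_distrib_left sum_distrib_right fun_eq_iff
    by (subst sum.swap) (simp add: mult.assoc)
  then have "cyc_proj (lin_ext ?T h (cyc_d f)) w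
      = (\<Sum>u\<in>?S. f u * cyc_proj (lin_ext ?T h (cyc_d (delta u))) w)"
    by (simp add: cyc_proj_sum)
  moreover have "cyc_d (lin_ext ?S h' f) w = (\<Sum>u\<in>?S. f u * cyc_d (h' u) w)"
    unfolding lin_ext_def[abs_def] by (rule cyc_d_sum)
  ultimately show ?thesis
    using h by (simp add: p homotopy_step_def flip: sum.distrib distrib_left)
qed

text \<open>By the previous step, a basis word minus h' of its differential is a cyclic cycle.
  Vanishing of cyclic homology bounds it, and the bounding chain is the next value of the
  homotopy.\<close>

lemma homotopy_next:
  assumes H: "hoch_acyclic W" and W: "0 < W" and h: "homotopy_step W n h h'"
  shows "\<exists>h''. homotopy_step W (Suc n) h' h''"
proof -
  let ?S = "pos_words (Suc n) W"
  have "\<exists>y. supported (pos_words (Suc (Suc (Suc n))) W) y \<and>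
      (\<forall>w. cyc_d y w + cyc_proj (lin_ext ?S h' (cyc_d (delta u))) w = cyc_proj (delta u) w)"
    if u: "u \<in> pos_words (Suc (Suc n)) W" for u
  proof -
    note du = supported_delta[OF u]
    note ddu = supported_cyc_d[OF du]
    let ?k = "lin_ext ?S h' (cyc_d (delta u))"
    have k: "supported (pos_words (Suc (Suc n)) W) ?k"
      unfolding lin_ext_def using h
      by (intro supported_sum supported_scale) (auto simp: homotopy_step_def)
    let ?z = "\<lambda>w. delta u w - ?k w"
    have z: "supported (pos_words (Suc (Suc n)) W) ?z" by (intro supported_diff du k)
    have "cyc_d ?z w = 0" for w
    proof -
      have "cyc_d ?k w + cyc_proj (lin_ext (pos_words n W) h (cyc_d (cyc_d (delta u)))) w
          = cyc_proj (cyc_d (delta u)) w"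
        by (rule homotopy_step_ext[OF h ddu])
      moreover have "lin_ext (pos_words n W) h (cyc_d (cyc_d (delta u))) = (\<lambda>_. 0)"
        by (simp add: lin_ext_def cyc_d_cyc_d fun_eq_iff)
      moreover have "cyc_proj (cyc_d (delta u)) w = cyc_d (delta u) w"
        by (simp add: cyc_proj_def cyc_cyc_d) (simp add: cyc_d_def cyc_proj_def)
      ultimately show "cyc_d ?z w = 0" by (simp add: cyc_d_lin cyc_proj_lin)
    qed
    then have "cyc_d ?z = (\<lambda>_. 0)" by auto
    then have "cyc (hoch_d ?z) w = 0" for w using cyc_cyc_d[of ?z w] by simp
    from cyclic_acyclic[OF H W z this] obtain y where
      y: "supported (pos_words (Suc (Suc (Suc n))) W) y" "\<And>w. cyc (hoch_d y) w = cyc ?z w" by blast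
    have "cyc_d y w + cyc_proj ?k w = cyc_proj (delta u) w" for w
      by (simp add: cyc_d_def cyc_proj_def y(2) cyc_diff right_diff_distrib)
    with y(1) show ?thesis by blast
  qed
  then obtain h'' where "\<forall>u \<in> pos_words (Suc (Suc n)) W.
      supported (pos_words (Suc (Suc (Suc n))) W) (h'' u) \<and>
      (\<forall>w. cyc_d (h'' u) w + cyc_proj (lin_ext ?S h' (cyc_d (delta u))) w = cyc_proj (delta u) w)"
    by metis
  then show ?thesis using h unfolding homotopy_step_def by blast
qed

lemma homotopy_exists:
  assumes H: "hoch_acyclic W" and W: "0 < W"
  obtains h where "\<And>n. homotopy_step W n (h n) (h (Suc n))"
proof -
  have "\<exists>f :: nat \<Rightarrow> (nat list \<Rightarrow> nat list \<Rightarrow> 'r) \<times> (nat list \<Rightarrow> nat list \<Rightarrow> 'r).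
     \<forall>n. homotopy_step W n (fst (f n)) (snd (f n)) \<and> fst (f (Suc n)) = snd (f n)"
  proof (rule dependent_nat_choice)
    \<comment> \<open>In positive weight there is no empty word, so all words of length one are
      cycles and the homotopy can start from zero.\<close>
    have e: "pos_words 0 W = {}" using W by (auto simp: pos_words_def)
    have "\<exists>y. supported (pos_words (Suc (Suc 0)) W) y \<and> (\<forall>w. cyc_d y w = cyc_proj (delta u) w)"
      if u: "u \<in> pos_words (Suc 0) W" for u
    proof -
      note z = supported_delta[OF u]
      have "hoch_d (delta u) w = 0" for w
        using supported_0[OF supported_hoch_d[OF z], of w] e by simp
      then have "hoch_d (delta u) = (\<lambda>_. 0)" by auto
      then have "\<And>w. cyc (hoch_d (delta u)) w = 0" by simp
      from cyclic_acyclic[OF H W z this] show ?thesis by (auto simp: cyc_d_def cyc_proj_def)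
    qed
    then obtain h where "\<forall>u \<in> pos_words (Suc 0) W. supported (pos_words (Suc (Suc 0)) W) (h u) \<and>
       (\<forall>w. cyc_d (h u) w = cyc_proj (delta u) w)" by metis
    then show "\<exists>x. homotopy_step W 0 (fst x) (snd x)"
      by (intro exI[of _ "(\<lambda>_ _. 0, h)"])
        (simp add: homotopy_step_def e lin_ext_def[abs_def] cyc_proj_lin)
  next
    fix x n assume "homotopy_step W n (fst x) (snd x)"
    from homotopy_next[OF H W this]
    show "\<exists>y. homotopy_step W (Suc n) (fst y) (snd y) \<and> fst y = snd x" by auto
  qed
  then obtain f where f: "\<And>n. homotopy_step W n (fst (f n)) (snd (f n)) \<and> fst (f (Suc n)) = snd (f n)"
    by blast
  show thesis by (rule that[of "\<lambda>n. fst (f n)"]) (use f in simp)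
qed

text \<open>The Euler characteristic of a contractible complex vanishes, by commutativity of the trace.\<close>

theorem cyclic_euler:
  assumes H: "hoch_acyclic W" and W: "0 < W"
  shows "(\<Sum>n\<le>W. (-1) ^ n * (\<Sum>u\<in>pos_words (Suc n) W. cyc_proj (delta u) u)) = 0"
proof -
  obtain h where h: "\<And>n. homotopy_step W n (h n) (h (Suc n))" using homotopy_exists[OF H W] by blast
  \<comment> \<open>\<tau> n is the trace of d h on words of length n. Under the trace factors may
    be moved round, so h d in length n + 1 also has trace \<tau> n. Hence P has trace \<tau> (n + 1)
    + \<tau> n there, and the alternating sum telescopes.\<close>
  define \<tau> where "\<tau> n = (\<Sum>u\<in>pos_words n W. cyc_d (h n u) u)" for n
  have tr: "(\<Sum>u\<in>pos_words (Suc n) W. cyc_proj (delta u) u) = \<tau> (Suc n) + \<tau> n" for n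
  proof -
    let ?S = "pos_words (Suc n) W" and ?T = "pos_words n W"
    have "(\<Sum>u\<in>?S. cyc_proj (lin_ext ?T (h n) (cyc_d (delta u))) u)
        = (\<Sum>u\<in>?S. \<Sum>v\<in>?T. cyc_d (delta u) v * cyc_proj (h n v) u)"
      unfolding lin_ext_def[abs_def] by (simp add: cyc_proj_sum)
    also have "\<dots> = (\<Sum>v\<in>?T. \<Sum>u\<in>?S. cyc_proj (h n v) u * cyc_d (delta u) v)"
      by (subst sum.swap) (simp add: mult.commute)
    also have "\<dots> = (\<Sum>v\<in>?T. cyc_d (cyc_proj (h n v)) v)"
    proof (rule sum.cong[OF refl])
      fix v assume "v \<in> ?T"
      then have "supported ?S (cyc_proj (h n v))"
        using h[of n] by (intro supported_cyc_proj) (auto simp: homotopy_step_def)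
      from supported_expand[OF this finite_pos_words]
      show "(\<Sum>u\<in>?S. cyc_proj (h n v) u * cyc_d (delta u) v) = cyc_d (cyc_proj (h n v)) v"
        using cyc_d_sum[of "cyc_proj (h n v)" delta ?S v] by metis
    qed
    also have "\<dots> = \<tau> n" by (simp add: \<tau>_def cyc_d_cyc_proj)
    finally have "(\<Sum>u\<in>?S. cyc_proj (lin_ext ?T (h n) (cyc_d (delta u))) u) = \<tau> n" .
    moreover have "(\<Sum>u\<in>?S. cyc_proj (delta u) u) =
       (\<Sum>u\<in>?S. cyc_d (h (Suc n) u) u + cyc_proj (lin_ext ?T (h n) (cyc_d (delta u))) u)"
      using h[of n] by (intro sum.cong refl) (auto simp: homotopy_step_def)
    ultimately show ?thesis by (simp add: sum.distrib \<tau>_def)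
  qed
  have \<tau>0: "\<tau> 0 = 0" using W by (auto simp: \<tau>_def pos_words_def intro!: sum.neutral)
  have "(\<Sum>n\<le>m. (-1) ^ n * (\<tau> (Suc n) + \<tau> n)) = (-1) ^ m * \<tau> (Suc m)" for m
    by (induction m) (simp_all add: \<tau>0 algebra_simps)
  moreover have "\<tau> (Suc W) = 0" by (simp add: \<tau>_def pos_words_empty)
  ultimately show ?thesis by (simp add: tr)
qed

end

context structure_constants
begin

section \<open>The bimodule structure and the contraction of the bar complex\<close>

definition lmul :: "nat \<Rightarrow> (nat list \<Rightarrow> 'r) \<Rightarrow> nat list \<Rightarrow> 'r"
  where "lmul p f w = (case w of [] \<Rightarrow> 0 | k # v \<Rightarrow> (\<Sum>x\<le>D. c p x k * f (x # v)))"

definition rmul :: "nat \<Rightarrow> (nat list \<Rightarrow> 'r) \<Rightarrow> nat list \<Rightarrow> 'r"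
  where "rmul q f w = (if w = [] then 0 else (\<Sum>x\<le>D. c x q (last w) * f (butlast w @ [x])))"

lemma lmul_Cons: "lmul p f (k # v) = (\<Sum>x\<le>D. c p x k * f (x # v))"
  and rmul_snoc: "rmul q f (v @ [k]) = (\<Sum>x\<le>D. c x q k * f (v @ [x]))"
  and rmul_Cons_snoc: "rmul q f (i # v @ [k]) = (\<Sum>x\<le>D. c x q k * f (i # v @ [x]))"
  by (simp_all add: lmul_def rmul_def flip: append_Cons)

lemma lmul_add: "lmul p (\<lambda>u. f u + g u) w = lmul p f w + lmul p g w"
  and rmul_add: "rmul p (\<lambda>u. f u + g u) w = rmul p f w + rmul p g w"
  and lmul_scale: "lmul p (\<lambda>u. a * f u) w = a * lmul p f w"
  and rmul_scale: "rmul p (\<lambda>u. a * f u) w = a * rmul p f w"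
  by (simp_all add: lmul_def rmul_def distrib_left sum.distrib sum_distrib_left mult.left_commute
      split: list.split)

lemma lmul_zero [simp]: "lmul p (\<lambda>u. 0) w = 0" and rmul_zero [simp]: "rmul p (\<lambda>u. 0) w = 0"
  by (simp_all add: lmul_def rmul_def split: list.split)

lemma lmul_sum: "lmul p (\<lambda>u. \<Sum>i\<in>I. f i u) w = (\<Sum>i\<in>I. lmul p (f i) w)"
  and rmul_sum: "rmul p (\<lambda>u. \<Sum>i\<in>I. f i u) w = (\<Sum>i\<in>I. rmul p (f i) w)"
  by (induction I rule: infinite_finite_induct) (simp_all add: lmul_add rmul_add)

lemma sum_swap_assoc:
  "(\<Sum>x\<in>X. a x * (\<Sum>y\<in>Y. b y x * g y)) = (\<Sum>y\<in>Y. (\<Sum>x\<in>X. b y x * a x) * g y)"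
  "(\<Sum>x\<in>X. a x * (\<Sum>y\<in>Y. b y x * g y)) = (\<Sum>y\<in>Y. (\<Sum>x\<in>X. a x * b y x) * g y)"
  for g :: "'b \<Rightarrow> 'r"
  unfolding sum_distrib_left sum_distrib_right by (subst sum.swap, simp add: mult_ac)+

text \<open>The transposed form of p (y q) = (p y) q: left and right multiplications
  commute.\<close>

lemma sum_c_c: "(\<Sum>x\<le>D. c p x k * (\<Sum>y\<le>D. c y q x * g y)) = (\<Sum>x\<le>D. c x q k * (\<Sum>y\<le>D. c p y x * g y))"
proof -
  have "(\<Sum>x\<le>D. c p x k * (\<Sum>y\<le>D. c y q x * g y)) = (\<Sum>y\<le>D. (\<Sum>x\<le>D. c y q x * c p x k) * g y)"
    by (rule sum_swap_assoc(1))
  also have "\<dots> = (\<Sum>y\<le>D. (\<Sum>x\<le>D. c p y x * c x q k) * g y)" by (simp add: assoc)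
  also have "\<dots> = (\<Sum>x\<le>D. c x q k * (\<Sum>y\<le>D. c p y x * g y))"
    by (rule sum_swap_assoc(1)[symmetric])
  finally show ?thesis .
qed

lemma lmul_rmul: "lmul p (rmul q f) w = rmul q (lmul p f) w"
proof (cases w rule: rev_cases)
  case (snoc v k)
  show ?thesis
  proof (cases v)
    case Nil
    have "lmul p (rmul q f) [k] = rmul q (lmul p f) [k]"
      using sum_c_c[of p k q "\<lambda>y. f [y]"] by (simp add: lmul_def rmul_def)
    then show ?thesis by (simp add: snoc Nil)
  next
    case (Cons i u)
    have "lmul p (rmul q f) (i # u @ [k]) = rmul q (lmul p f) (i # u @ [k])"
      unfolding lmul_Cons rmul_Cons_snoc sum_distrib_left
      by (subst sum.swap) (simp add: mult.left_commute)
    then show ?thesis by (simp add: snoc Cons)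
  qed
qed (simp add: lmul_def rmul_def)

lemma lmul_lmul: "lmul p (lmul q f) w = (\<Sum>r\<le>D. c p q r * lmul r f w)"
proof (cases w)
  case (Cons k v)
  have "lmul p (lmul q f) w = (\<Sum>y\<le>D. (\<Sum>x\<le>D. c q y x * c p x k) * f (y # v))"
    unfolding Cons lmul_Cons by (rule sum_swap_assoc(1))
  also have "\<dots> = (\<Sum>y\<le>D. (\<Sum>x\<le>D. c p q x * c x y k) * f (y # v))" by (simp add: assoc)
  also have "\<dots> = (\<Sum>r\<le>D. c p q r * lmul r f w)"
    unfolding Cons lmul_Cons by (rule sum_swap_assoc(2)[symmetric])
  finally show ?thesis .
qed (simp add: lmul_def)

lemma rmul_rmul: "rmul p (rmul q f) w = (\<Sum>r\<le>D. c q p r * rmul r f w)"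
proof (cases w rule: rev_cases)
  case (snoc v k)
  have "rmul p (rmul q f) w = (\<Sum>y\<le>D. (\<Sum>x\<le>D. c y q x * c x p k) * f (v @ [y]))"
    unfolding snoc rmul_snoc by (rule sum_swap_assoc(1))
  also have "\<dots> = (\<Sum>y\<le>D. (\<Sum>x\<le>D. c q p x * c y x k) * f (v @ [y]))" by (simp add: assoc)
  also have "\<dots> = (\<Sum>r\<le>D. c q p r * rmul r f w)"
    unfolding snoc rmul_snoc by (rule sum_swap_assoc(2)[symmetric])
  finally show ?thesis .
qed (simp add: rmul_def)

lemma bar_d_lmul: "w \<noteq> [] \<Longrightarrow> bar_d (lmul p f) w = lmul p (bar_d f) w"
proof -
  assume "w \<noteq> []"
  then obtain k v where w: "w = k # v" by (cases w) auto
  have m: "mul0 (lmul p f) k v = (\<Sum>z\<le>D. c p z k * mul0 f z v)"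
  proof -
    have "mul0 (lmul p f) k v = (\<Sum>y\<le>D. \<Sum>x\<le>D. c x y k * (\<Sum>z\<le>D. c p z x * f (z # y # v)))"
      unfolding mul0_def lmul_Cons by (rule sum.swap)
    also have "\<dots> = (\<Sum>y\<le>D. \<Sum>x\<le>D. c p x k * (\<Sum>z\<le>D. c z y x * f (z # y # v)))"
      by (simp only: sum_c_c)
    also have "\<dots> = (\<Sum>z\<le>D. c p z k * mul0 f z v)"
      unfolding mul0_def sum_distrib_left
      by (subst sum.swap, rule sum.cong[OF refl], rule sum.swap)
    finally show ?thesis .
  qed
  have "bar_d (\<lambda>u. lmul p f (k # u)) v = (\<Sum>z\<le>D. c p z k * bar_d (\<lambda>u. f (z # u)) v)"
    unfolding lmul_Cons by (simp add: bar_d_sum bar_d_scale)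
  then show ?thesis
    unfolding w lmul_Cons bar_d.simps m by (simp add: right_diff_distrib sum_subtractf)
qed

lemma bar_d_rmul: "w \<noteq> [] \<Longrightarrow> bar_d (rmul q f) w = rmul q (bar_d f) w"
proof -
  assume "w \<noteq> []"
  then obtain k v where w: "w = v @ [k]" by (cases w rule: rev_cases) auto
  have m: "(\<Sum>x\<le>D. \<Sum>y\<le>D. c x y k * rmul q f (v @ [x, y]))
    = (\<Sum>z\<le>D. c z q k * (\<Sum>x\<le>D. \<Sum>y\<le>D. c x y z * f (v @ [x, y])))"
  proof -
    have "(\<Sum>x\<le>D. \<Sum>y\<le>D. c x y k * rmul q f (v @ [x, y]))
      = (\<Sum>x\<le>D. \<Sum>y\<le>D. c x y k * (\<Sum>z\<le>D. c z q y * f (v @ [x, z])))"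
      using rmul_snoc[of q f "v @ [_]"] by simp
    also have "\<dots> = (\<Sum>x\<le>D. \<Sum>y\<le>D. c y q k * (\<Sum>z\<le>D. c x z y * f (v @ [x, z])))"
      by (simp only: sum_c_c)
    also have "\<dots> = (\<Sum>z\<le>D. c z q k * (\<Sum>x\<le>D. \<Sum>y\<le>D. c x y z * f (v @ [x, y])))"
      by (subst sum.swap) (simp add: sum_distrib_left)
    finally show ?thesis .
  qed
  have "bar_d (\<lambda>u. rmul q f (u @ [k])) v = (\<Sum>z\<le>D. c z q k * bar_d (\<lambda>u. f (u @ [z])) v)"
    unfolding rmul_snoc by (simp add: bar_d_sum bar_d_scale)
  then show ?thesis
    unfolding w rmul_snoc bar_d_snoc m
    by (simp add: distrib_left sum.distrib sum_distrib_left mult.left_commute)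
qed

text \<open>The action of the element of the enveloping algebra with coordinates g: the first letter
  is multiplied from the left, the last one from the right.\<close>

definition act :: "(nat \<Rightarrow> nat \<Rightarrow> 'r) \<Rightarrow> (nat list \<Rightarrow> 'r) \<Rightarrow> nat list \<Rightarrow> 'r"
  where "act g f w = (\<Sum>i\<le>D. \<Sum>j\<le>D. g i j * lmul i (rmul j f) w)"

lemma act_add: "act g (\<lambda>u. f u + f' u) w = act g f w + act g f' w"
  and act_add_left: "act (\<lambda>i j. g i j + g' i j) f w = act g f w + act g' f w"
  and act_diff_left: "act (\<lambda>i j. g i j - g' i j) f w = act g f w - act g' f w"
  and act_scale: "act g (\<lambda>u. a * f u) w = a * act g f w"
  and act_zero_left: "act (\<lambda>i j. 0) f w = 0"
  by (simp_all add: act_def rmul_add[abs_def] lmul_add rmul_scale[abs_def] lmul_scale algebra_simps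
      sum.distrib sum_subtractf sum_distrib_left)

lemma act_zero [simp]: "act g (\<lambda>u. 0) w = 0"
  using act_scale[of g 0 "\<lambda>u. 0" w] by simp

lemma act_cong: "(\<And>i j. i \<le> D \<Longrightarrow> j \<le> D \<Longrightarrow> g i j = g' i j) \<Longrightarrow> act g f w = act g' f w"
  by (simp add: act_def)

lemma bar_d_act: "w \<noteq> [] \<Longrightarrow> bar_d (act g f) w = act g (bar_d f) w"
proof -
  assume w: "w \<noteq> []"
  have "lmul i (bar_d (rmul j f)) w = lmul i (rmul j (bar_d f)) w" for i j
  proof -
    obtain k v where "w = k # v" using w by (cases w) auto
    then show ?thesis by (simp only: lmul_Cons bar_d_rmul[OF list.distinct(2)])
  qed
  then show ?thesis
    unfolding act_def[abs_def] by (simp add: bar_d_sum bar_d_scale bar_d_lmul w)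
qed

text \<open>Degrees are shifted by one: \<open>bar_words (Suc n)\<close> indexes A \<otimes> V
  \<otimes> A, with V the n-fold tensor power of the augmentation ideal, and
  \<open>bar_words 0\<close> indexes A, the target of the augmentation.\<close>

definition bar_words :: "nat \<Rightarrow> nat list set"
  where "bar_words n = {w. length w = Suc n \<and> set w \<subseteq> {..D} \<and> set (butlast (tl w)) \<subseteq> {1..D}}"

lemma finite_bar_words: "finite (bar_words n)"
  by (rule finite_subset[OF _ finite_lists_length_eq[of "{..D}" "Suc n"]]) (auto simp: bar_words_def)

lemma bar_words_0: "w \<in> bar_words 0 \<longleftrightarrow> (\<exists>k\<le>D. w = [k])"
  by (auto simp: bar_words_def length_Suc_conv)

lemma bar_words_Suc: "i # u @ [j] \<in> bar_words (Suc n) \<longleftrightarrow> i \<le> D \<and> j \<le> D \<and> length u = n \<and> set u \<subseteq> {1..D}"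
  by (auto simp: bar_words_def)

lemma bar_words_SucE:
  assumes "w \<in> bar_words (Suc n)"
  obtains i u j where "w = i # u @ [j]" "i \<le> D" "j \<le> D" "length u = n" "set u \<subseteq> {1..D}"
proof -
  obtain i v where w: "w = i # v" using assms by (cases w) (auto simp: bar_words_def)
  then obtain u j where "v = u @ [j]" using assms by (cases v rule: rev_cases) (auto simp: bar_words_def)
  with w assms that show ?thesis by (auto simp: bar_words_Suc)
qed

text \<open>A product formed at the first position may be anything. One formed at a later position
  involves an inner letter, and \<open>c_pos\<close> keeps the unit out of the result.\<close>

lemma supported_bar_words_d:
  assumes f: "supported (bar_words (Suc n)) f"
  shows "supported (bar_words n) (bar_d f)"
proof -
  have "w \<in> bar_words n" if "bar_d f w \<noteq> 0" for w
  proof -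
    from that obtain i x y where i: "i < length w" "c x y (w ! i) \<noteq> 0"
      "f (take i w @ x # y # drop (Suc i) w) \<noteq> 0" by (rule bar_d_nonzero)
    then have m: "take i w @ x # y # drop (Suc i) w \<in> bar_words (Suc n)"
      using supported_0[OF f] by blast
    define k v where "k = w ! i" and "v = drop (Suc i) w"
    have w: "w = take i w @ k # v" using i(1) by (simp add: k_def v_def id_take_nth_drop)
    have k: "k \<le> D" using wt_c[OF i(2)] by (simp add: k_def)
    have "length (take i w @ x # y # drop (Suc i) w) = Suc (length w)" using i(1) by simp
    then have len: "length w = Suc n" using m by (simp only: bar_words_def mem_Collect_eq nat.inject)
    show ?thesis
    proof (cases "take i w")
      case Nil
      have m': "x # y # v \<in> bar_words (Suc n)" using m by (simp add: Nil v_def)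
      have "w = k # v" using w Nil by simp
      moreover have "set (butlast v) \<subseteq> {1..D}" "set v \<subseteq> {..D}"
        using m' by (cases "v = []"; auto simp: bar_words_def)+
      ultimately show ?thesis using k len by (auto simp: bar_words_def)
    next
      case (Cons a t)
      have m': "a # t @ x # y # v \<in> bar_words (Suc n)" using m by (simp add: Cons v_def)
      have w': "w = a # t @ k # v" using w Cons by simp
      have x: "x \<in> {1..D}" "set t \<subseteq> {1..D}" "a \<le> D" "set v \<subseteq> {..D}"
        using m' by (auto simp: bar_words_def butlast_append split: if_splits)
      have "k \<in> {1..D}" using c_pos[OF i(2)] x(1) by (simp add: k_def)
      moreover have "set (butlast v) \<subseteq> {1..D}"
        using m' by (cases "v = []") (auto simp: bar_words_def butlast_append)
      ultimately show ?thesis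
        using w' x len by (auto simp: bar_words_def butlast_append split: if_splits)
    qed
  qed
  moreover have "e * bar_d f w = bar_d f w" for w
    unfolding bar_d_scale[symmetric] by (simp add: supported_e[OF f])
  ultimately show ?thesis by (auto simp: supported_def)
qed

text \<open>The contraction x \<mapsto> 1 \<otimes> x, transposed. Words that start with the unit go
  to zero, since that letter would become an inner one.\<close>

definition bar_contract :: "(nat list \<Rightarrow> 'r) \<Rightarrow> nat list \<Rightarrow> 'r"
  where "bar_contract f w = (case w of a # j # v \<Rightarrow> if a = 0 \<and> 0 < j then f (j # v) else 0 | _ \<Rightarrow> 0)"

lemma supported_bar_contract:
  assumes f: "supported (bar_words (Suc n)) f"
  shows "supported (bar_words (Suc (Suc n))) (bar_contract f)"
proof -
  have "w \<in> bar_words (Suc (Suc n))" if nz: "bar_contract f w \<noteq> 0" for w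
  proof -
    obtain j v where w: "w = 0 # j # v" "0 < j" "f (j # v) \<noteq> 0"
      using nz by (auto simp: bar_contract_def split: list.splits if_splits)
    then have "j # v \<in> bar_words (Suc n)" using supported_0[OF f] by blast
    then show ?thesis using w by (cases "v = []") (auto simp: bar_words_def)
  qed
  then show ?thesis using f by (auto simp: supported_def bar_contract_def split: list.splits)
qed

lemma sum_unit_left: "(\<Sum>y\<le>D. c 0 y k * g y) = (if k \<le> D then e * g k else 0)"
proof -
  have "(\<Sum>y\<le>D. c 0 y k * g y) = (\<Sum>y\<le>D. if y = k then e * g k else 0)"
    by (rule sum.cong) (auto simp: unit_left)
  then show ?thesis by simp
qed

lemma sum_unit_right: "(\<Sum>x\<le>D. c x 0 k * g x) = (if k \<le> D then e * g k else 0)"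
proof -
  have "(\<Sum>y\<le>D. c y 0 k * g y) = (\<Sum>y\<le>D. if y = k then e * g k else 0)"
    by (rule sum.cong) (auto simp: unit_right)
  then show ?thesis by simp
qed

text \<open>At a word not starting with the unit the first face alone returns f. At a word starting
  with the unit the coefficient of f is recovered from the cycle condition at its tail.\<close>

lemma bar_contract_homotopy:
  assumes f: "supported (bar_words (Suc n)) f" and z: "bar_d f = (\<lambda>_. 0)"
  shows "bar_d (bar_contract f) = f"
proof
  fix w
  have fe: "e * f u = f u" for u by (rule supported_e[OF f])
  have fD: "f (i # k # v) = 0" if "\<not> i \<le> D \<or> \<not> k \<le> D" for i k v
    by (rule supported_0[OF f]) (use that in \<open>auto simp: bar_words_def\<close>)
  show "bar_d (bar_contract f) w = f w"
  proof (cases w)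
    case Nil
    then show ?thesis using supported_0[OF f, of "[]"] by (simp add: bar_words_def)
  next
    case (Cons k v)
    have m: "mul0 (bar_contract f) k v = (if 0 < k then f (k # v) else 0)"
    proof -
      have "mul0 (bar_contract f) k v = (\<Sum>x\<le>D. if x = 0 then (\<Sum>y\<le>D. c 0 y k * (if 0 < y then f (y # v) else 0)) else 0)"
        unfolding mul0_def by (intro sum.cong refl) (auto simp: bar_contract_def)
      also have "\<dots> = (\<Sum>y\<le>D. c 0 y k * (if 0 < y then f (y # v) else 0))" by simp
      also have "\<dots> = (if 0 < k then f (k # v) else 0)"
        unfolding sum_unit_left using fe supported_0[OF f, of "k # v"] by (auto simp: bar_words_def)
      finally show ?thesis .
    qed
    show ?thesis
    proof (cases "k = 0")
      case False
      then have "(\<lambda>u. bar_contract f (k # u)) = (\<lambda>_. 0)"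
        by (auto simp: bar_contract_def split: list.split)
      with False show ?thesis by (simp add: Cons m)
    next
      case True
      define g where "g = (\<lambda>u. bar_contract f (0 # u))"
      have g: "g (j # u) = (if 0 < j then f (j # u) else 0)" for j u
        by (simp add: g_def bar_contract_def)
      have "bar_d (bar_contract f) w = - bar_d g v" by (simp add: Cons True m[unfolded True] g_def)
      also have "\<dots> = f (0 # v)"
      proof (cases v)
        case Nil
        then show ?thesis using supported_0[OF f, of "[0]"] by (simp add: bar_words_def)
      next
        case (Cons k' v')
        have m': "mul0 g k' v' = mul0 f k' v' - f (0 # k' # v')"
        proof -
          have "mul0 f k' v' - mul0 g k' v' = (\<Sum>x\<le>D. \<Sum>y\<le>D. c x y k' * (f (x # y # v') - g (x # y # v')))"
            by (simp add: mul0_def right_diff_distrib sum_subtractf)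
          also have "\<dots> = (\<Sum>x\<le>D. if x = 0 then (\<Sum>y\<le>D. c 0 y k' * f (0 # y # v')) else 0)"
            by (intro sum.cong refl) (auto simp: g)
          also have "\<dots> = f (0 # k' # v')"
            using fe fD[of 0 k' v'] by (simp add: sum_unit_left)
          finally show ?thesis by (simp add: algebra_simps)
        qed
        have zf: "mul0 f k' v' = bar_d (\<lambda>u. f (k' # u)) v'"
          using fun_cong[OF z, of "k' # v'"] by simp
        show ?thesis
        proof (cases "k' = 0")
          case False
          then have "bar_d g v = mul0 g k' v' - bar_d (\<lambda>u. f (k' # u)) v'" by (simp add: Cons g)
          then show ?thesis by (simp add: m' zf Cons)
        next
          \<comment> \<open>Two leading units occur in a normalized word only if nothing follows.
            Then the cycle condition at the unit applies: by weight only 1 times 1 contributes to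
            it, so f vanishes on that word.\<close>
          case True
          have "mul0 f 0 v' = (\<Sum>x\<le>D. if x = 0 then e * f (0 # 0 # v') else 0)"
            unfolding mul0_def
          proof (intro sum.cong refl)
            fix x assume x: "x \<in> {..D}"
            have "c x y 0 = 0" if "x \<noteq> 0" for y
              using c_pos[of x y 0] that x by fastforce
            then show "(\<Sum>y\<le>D. c x y 0 * f (x # y # v')) = (if x = 0 then e * f (0 # 0 # v') else 0)"
              using sum_unit_left[of 0 "\<lambda>y. f (0 # y # v')"] by simp
          qed
          then have mz: "mul0 f 0 v' = f (0 # 0 # v')" by (simp add: fe)
          have "f (0 # 0 # v') = 0"
          proof (cases "v' = []")
            case True
            then show ?thesis using zf mz \<open>k' = 0\<close> by simp
          next
            case False
            then show ?thesis by (intro supported_0[OF f]) (auto simp: bar_words_def)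
          qed
          moreover have "bar_d g v = mul0 g 0 v'"
            by (simp add: Cons True g)
          ultimately show ?thesis using m' mz by (simp add: Cons True)
        qed
      qed
      finally show ?thesis by (simp add: Cons True)
    qed
  qed
qed

text \<open>The witness is the section x \<mapsto> 1 \<otimes> x of the multiplication A \<otimes> A
  \<rightarrow> A.\<close>

lemma bar_d_surj:
  assumes f: "supported (bar_words 0) f"
  shows "\<exists>g. supported (bar_words (Suc 0)) g \<and> bar_d g = f"
proof (intro exI conjI)
  let ?g = "\<lambda>w. if length w = 2 \<and> hd w = 0 then f [last w] else 0"
  show s: "supported (bar_words (Suc 0)) ?g"
  proof -
    have "w \<in> bar_words (Suc 0)" if w: "?g w \<noteq> 0" for w
    proof -
      obtain j where "w = [0, j]" "f [j] \<noteq> 0" using w by (auto simp: length_Suc_conv numeral_2_eq_2 split: if_splits)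
      then show ?thesis using supported_0[OF f, of "[j]"] by (auto simp: bar_words_def)
    qed
    then show ?thesis using f by (auto simp: supported_def)
  qed
  show "bar_d ?g = f"
  proof
    fix w
    show "bar_d ?g w = f w"
    proof (cases "w \<in> bar_words 0")
      case True
      then obtain k where k: "k \<le> D" "w = [k]" by (auto simp: bar_words_0)
      have "bar_d ?g [k] = (\<Sum>x\<le>D. if x = 0 then (\<Sum>y\<le>D. c 0 y k * f [y]) else 0)"
        unfolding bar_d.simps mul0_def diff_0_right by (intro sum.cong refl) auto
      also have "\<dots> = f [k]" using k supported_e[OF f] by (simp add: sum_unit_left)
      finally show ?thesis by (simp add: k)
    next
      case False
      then show ?thesis using supported_0[OF f] supported_0[OF supported_bar_words_d[OF s]] by simp
    qed
  qed
qed

lemma supported_act: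
  assumes f: "supported (bar_words n) f"
  shows "supported (bar_words n) (act g f)"
proof -
  have "w \<in> bar_words n" if nz: "act g f w \<noteq> 0" for w
  proof -
    obtain i j where ij: "lmul i (rmul j f) w \<noteq> 0"
      using nz unfolding act_def by (metis (no_types, lifting) mult_zero_right sum.neutral)
    obtain k v where w: "w = k # v" using ij by (cases w) (auto simp: lmul_def)
    obtain x where x: "c i x k \<noteq> 0" "rmul j f (x # v) \<noteq> 0"
      using ij unfolding w lmul_Cons by (metis (no_types, lifting) mult_zero_right mult_zero_left sum.neutral)
    then obtain y where y: "c y j (last (x # v)) \<noteq> 0" "f (butlast (x # v) @ [y]) \<noteq> 0"
      unfolding rmul_def by (metis (no_types, lifting) list.discI mult_zero_right mult_zero_left sum.neutral)
    have m: "butlast (x # v) @ [y] \<in> bar_words n" using y supported_0[OF f] by blast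
    have k: "k \<le> D" using wt_c[OF x(1)] by blast
    show ?thesis
    proof (cases v rule: rev_cases)
      case Nil
      then show ?thesis using m k by (auto simp: bar_words_def w)
    next
      case (snoc u b)
      have "b \<le> D" using wt_c[OF y(1)] by (simp add: snoc)
      then show ?thesis using m k by (auto simp: bar_words_def w snoc)
    qed
  qed
  moreover have "e * act g f w = act g f w" for w
    unfolding act_scale[symmetric] by (simp add: supported_e[OF f])
  ultimately show ?thesis by (auto simp: supported_def)
qed

end

section \<open>The enveloping algebra and the bar resolution\<close>

definition frag_lift :: "('b \<Rightarrow> 'r::comm_ring_1) \<Rightarrow> ('b \<Rightarrow>\<^sub>0 int) \<Rightarrow> 'r"
  where "frag_lift \<phi> p = (\<Sum>k\<in>Poly_Mapping.keys p. of_int (Poly_Mapping.lookup p k) * \<phi> k)"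

lemma frag_lift_superset:
  assumes "finite S" "Poly_Mapping.keys p \<subseteq> S"
  shows "frag_lift \<phi> p = (\<Sum>k\<in>S. of_int (Poly_Mapping.lookup p k) * \<phi> k)"
  unfolding frag_lift_def using assms by (intro sum.mono_neutral_left) (auto simp: in_keys_iff)

lemma frag_lift_add: "frag_lift \<phi> (p + q) = frag_lift \<phi> p + frag_lift \<phi> q"
proof -
  let ?S = "Poly_Mapping.keys p \<union> Poly_Mapping.keys q"
  have "Poly_Mapping.keys (p + q) \<subseteq> ?S" by (rule keys_add)
  then show ?thesis
    by (simp add: frag_lift_superset[of ?S] lookup_add distrib_right sum.distrib)
qed

lemma frag_lift_simps [simp]:
  "frag_lift \<phi> 0 = 0" "frag_lift \<phi> (frag_of k) = \<phi> k"
  by (simp_all add: frag_lift_def)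

lemma frag_lift_minus [simp]: "frag_lift \<phi> (- p) = - frag_lift \<phi> p"
  using frag_lift_add[of \<phi> p "- p"] by (simp add: eq_neg_iff_add_eq_0 add.commute)

lemma frag_lift_diff: "frag_lift \<phi> (p - q) = frag_lift \<phi> p - frag_lift \<phi> q"
  using frag_lift_add[of \<phi> p "- q"] by simp

context tensor_left
begin

lemma null_sum: "(\<And>i. i \<in> I \<Longrightarrow> p i \<in> tensor_null R M N) \<Longrightarrow> (\<Sum>i\<in>I. p i) \<in> tensor_null R M N"
  by (induction I rule: infinite_finite_induct) (simp_all add: null_zero null_add)

lemma null_trans: "p - q \<in> tensor_null R M N \<Longrightarrow> q - r \<in> tensor_null R M N \<Longrightarrow> p - r \<in> tensor_null R M N"
  using null_add[of "p - q" N "q - r"] by simp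

lemma null_zero_left:
  assumes "left_module R N" "abelian_group M" "y \<in> carrier N"
  shows "frag_of (\<zero>\<^bsub>M\<^esub>, y) \<in> tensor_null R M N"
proof -
  interpret M: abelian_group M by (rule assms)
  have "frag_of (\<zero>\<^bsub>M\<^esub> \<oplus>\<^bsub>M\<^esub> \<zero>\<^bsub>M\<^esub>, y) - frag_of (\<zero>\<^bsub>M\<^esub>, y) - frag_of (\<zero>\<^bsub>M\<^esub>, y) \<in> tensor_null R M N"
    by (intro null_rel_intros) (use assms in auto)
  then show ?thesis using null_minus[OF assms(1)] by force
qed

lemma null_zero_right:
  assumes "left_module R N" "x \<in> carrier M"
  shows "frag_of (x, \<zero>\<^bsub>N\<^esub>) \<in> tensor_null R M N"
proof -
  interpret N: left_module R N by (rule assms)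
  have "frag_of (x, \<zero>\<^bsub>N\<^esub> \<oplus>\<^bsub>N\<^esub> \<zero>\<^bsub>N\<^esub>) - frag_of (x, \<zero>\<^bsub>N\<^esub>) - frag_of (x, \<zero>\<^bsub>N\<^esub>) \<in> tensor_null R M N"
    by (intro null_rel_intros) (use assms in auto)
  then show ?thesis using null_minus[OF assms(1)] by force
qed

lemma null_sum_left:
  assumes "left_module R N" "abelian_group M" "y \<in> carrier N" "finite I" "f \<in> I \<rightarrow> carrier M"
  shows "frag_of (\<Oplus>\<^bsub>M\<^esub>i\<in>I. f i, y) - (\<Sum>i\<in>I. frag_of (f i, y)) \<in> tensor_null R M N"
  using assms(4,5)
proof (induction I rule: finite_induct)
  interpret M: abelian_group M by (rule assms)
  case empty
  then show ?case using null_zero_left[OF assms(1-3)] by simp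
next
  interpret M: abelian_group M by (rule assms)
  case (insert i I)
  then have f: "f i \<in> carrier M" "f \<in> I \<rightarrow> carrier M" by auto
  have "frag_of (f i \<oplus>\<^bsub>M\<^esub> (\<Oplus>\<^bsub>M\<^esub>i\<in>I. f i), y) - frag_of (f i, y) - frag_of (\<Oplus>\<^bsub>M\<^esub>i\<in>I. f i, y) \<in> tensor_null R M N"
    using f assms(3) by (intro null_rel_intros) auto
  from null_add[OF this insert.IH[OF f(2)]] show ?case using insert f by (simp add: algebra_simps)
qed

lemma null_sum_right:
  assumes "left_module R N" "x \<in> carrier M" "finite I" "f \<in> I \<rightarrow> carrier N"
  shows "frag_of (x, \<Oplus>\<^bsub>N\<^esub>i\<in>I. f i) - (\<Sum>i\<in>I. frag_of (x, f i)) \<in> tensor_null R M N"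
  using assms(3,4)
proof (induction I rule: finite_induct)
  interpret N: left_module R N by (rule assms)
  case empty
  then show ?case using null_zero_right[OF assms(1,2)] by simp
next
  interpret N: left_module R N by (rule assms)
  case (insert i I)
  then have f: "f i \<in> carrier N" "f \<in> I \<rightarrow> carrier N" by auto
  have "frag_of (x, f i \<oplus>\<^bsub>N\<^esub> (\<Oplus>\<^bsub>N\<^esub>i\<in>I. f i)) - frag_of (x, f i) - frag_of (x, \<Oplus>\<^bsub>N\<^esub>i\<in>I. f i) \<in> tensor_null R M N"
    using f assms(2) by (intro null_rel_intros) auto
  from null_add[OF this insert.IH[OF f(2)]] show ?case using insert f by (simp add: algebra_simps)
qed

end

context graded_local_algebra
begin

definition rinv :: "nat \<Rightarrow> 'k field_product"
  where "rinv n = (SOME x. of_nat n * x = 1)"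

sublocale W: rational_structure_constants D gwt sc unit rinv
proof
  fix p q r k
  show "(\<Sum>x\<le>D. sc p q x * sc x r k) = (\<Sum>x\<le>D. sc q r x * sc p x k)" by (rule sc_assoc)
  show "0 < n \<Longrightarrow> of_nat n * rinv n = 1" for n
    unfolding rinv_def by (rule someI_ex[OF of_nat_invertible])
  show "gwt 0 = 0" by (simp add: gwt_def)
  show "0 < gwt i" if "0 < i" "i \<le> D" for i using gwt_pos[of i] that by auto
qed (rule sc_0 unit_sc sc_weight, assumption?)+

abbreviation Aop :: "('k, 'a) module" where "Aop \<equiv> op_ring A"

lemma Aop_simps [simp]:
  "carrier Aop = carrier A" "x \<oplus>\<^bsub>Aop\<^esub> y = x \<oplus>\<^bsub>A\<^esub> y" "\<zero>\<^bsub>Aop\<^esub> = \<zero>\<^bsub>A\<^esub>" "c \<odot>\<^bsub>Aop\<^esub> x = c \<odot>\<^bsub>A\<^esub> x"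
  "x \<otimes>\<^bsub>Aop\<^esub> y = y \<otimes>\<^bsub>A\<^esub> x" "\<one>\<^bsub>Aop\<^esub> = \<one>\<^bsub>A\<^esub>"
  by (simp_all add: op_ring_def)

lemma left_module_Aop: "left_module K Aop"
proof -
  have "abelian_group Aop"
    by (rule abelian_groupI) (auto simp: A.a_ac intro!: bexI[of _ "\<ominus>\<^bsub>A\<^esub> _"] A.l_neg)
  then show ?thesis
    using K.ring_axioms unfolding left_module_def left_module_axioms_def
    by (auto simp: A.smult_l_distr A.smult_r_distr A.smult_assoc1 A.smult_one)
qed

sublocale T: tensor_left K A
  by unfold_locales auto

lemma finsum_Aop: "(\<Oplus>\<^bsub>Aop\<^esub>i\<in>I. f i) = (\<Oplus>\<^bsub>A\<^esub>i\<in>I. f i)"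
  by (simp add: finsum_def op_ring_def)

section \<open>Coordinates on the tensor square of A\<close>

definition nullE :: "('a \<times> 'a \<Rightarrow>\<^sub>0 int) set" where "nullE = tensor_null K A Aop"

abbreviation PC :: "('a \<times> 'a \<Rightarrow>\<^sub>0 int) set" where "PC \<equiv> frag_carrier (carrier A) (carrier A)"

text \<open>Coordinates of a formal sum of pairs as an element of A \<otimes> A. In the other
  direction \<open>rho\<close> writes down a normal form for given coordinates.\<close>

definition \<Psi> :: "('a \<times> 'a \<Rightarrow>\<^sub>0 int) \<Rightarrow> nat \<Rightarrow> nat \<Rightarrow> 'k field_product"
  where "\<Psi> p i j = frag_lift (\<lambda>(a, b). \<alpha> a i * \<alpha> b j) p"

lemma \<Psi>_simps [simp]:
  "\<Psi> 0 i j = 0" "\<Psi> (frag_of (a, b)) i j = \<alpha> a i * \<alpha> b j" "\<Psi> (p + q) i j = \<Psi> p i j + \<Psi> q i j"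
  "\<Psi> (p - q) i j = \<Psi> p i j - \<Psi> q i j" "\<Psi> (- p) i j = - \<Psi> p i j"
  by (simp_all add: \<Psi>_def frag_lift_add frag_lift_diff)

lemma \<Psi>_null: "p \<in> nullE \<Longrightarrow> \<Psi> p i j = 0"
  unfolding nullE_def using left_module_Aop
proof (induction rule: T.null_induct)
  case (rel p)
  then show ?case by (auto simp: tensor_rels_def \<alpha>_add \<alpha>_smult distrib_left distrib_right mult_ac)
qed simp_all

definition rho :: "(nat \<Rightarrow> nat \<Rightarrow> 'k field_product) \<Rightarrow> 'a \<times> 'a \<Rightarrow>\<^sub>0 int"
  where "rho g = (\<Sum>i\<le>D. \<Sum>j\<le>D. frag_of (pr (g i j) \<odot>\<^bsub>A\<^esub> basis i, basis j))"

lemma PC_sum: "(\<And>i. i \<in> I \<Longrightarrow> p i \<in> PC) \<Longrightarrow> (\<Sum>i\<in>I. p i) \<in> PC"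
proof (induction I rule: infinite_finite_induct)
  case (insert i I)
  then have "p i \<in> PC" "(\<Sum>i\<in>I. p i) \<in> PC" by blast+
  then show ?case using insert.hyps frag_carrier_add(1) by (metis sum.insert)
qed (simp_all add: frag_carrier_add)

lemma rho_closed: "rho g \<in> PC"
  unfolding rho_def by (intro PC_sum) simp

lemma pr_simps: "pr (x + y) = pr x \<oplus>\<^bsub>K\<^esub> pr y" "pr (x - y) = pr x \<ominus>\<^bsub>K\<^esub> pr y" "pr (x * y) = pr x \<otimes>\<^bsub>K\<^esub> pr y"
  "pr 0 = \<zero>\<^bsub>K\<^esub>" "pr unit = \<one>\<^bsub>K\<^esub>"
  by (simp_all add: pr_def factor_simps[OF K] unit_def factor_inj K)

lemma \<Psi>_sum: "\<Psi> (\<Sum>k\<in>I. p k) i j = (\<Sum>k\<in>I. \<Psi> (p k) i j)"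
  by (induction I rule: infinite_finite_induct) simp_all

lemma unit_unit: "unit * (unit * x) = unit * x"
  by (simp add: W.e_idem flip: mult.assoc)

lemma \<Psi>_rho: "i \<le> D \<Longrightarrow> j \<le> D \<Longrightarrow> \<Psi> (rho g) i j = unit * g i j"
proof -
  assume ij: "i \<le> D" "j \<le> D"
  have "\<Psi> (rho g) i j = (\<Sum>i'\<le>D. \<Sum>j'\<le>D. if j' = j then (if i' = i then unit * g i j else 0) else 0)"
    unfolding rho_def \<Psi>_sum
    by (intro sum.cong refl) (auto simp: \<alpha>_smult \<alpha>_basis inj_pr unit_unit mult_ac)
  then show ?thesis using ij by simp
qed

text \<open>Bilinearity and balancing bring every formal sum into normal form. Hence
  \<open>nullE\<close> contains the whole kernel of the coordinate map, and equality in the quotient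
  can be tested on coordinates.\<close>

lemma rho_retract: "p \<in> PC \<Longrightarrow> p - rho (\<Psi> p) \<in> nullE"
proof (induction rule: frag_carrier_induct)
  case zero
  have "frag_of (\<zero>\<^bsub>A\<^esub>, basis j) \<in> nullE" if "j \<le> D" for j
    unfolding nullE_def using that
    by (intro T.null_zero_left left_module_Aop A.abelian_group_axioms) simp
  then have "rho (\<Psi> 0) \<in> nullE"
    unfolding rho_def nullE_def by (intro T.null_sum) (simp add: pr_simps)
  then have "- rho (\<Psi> 0) \<in> nullE" unfolding nullE_def by (rule T.null_minus[OF left_module_Aop])
  then show ?case by (simp only: diff_0)
next
  case (one a b)
  note ca = crd[OF one(1)] and cb = crd[OF one(2)]
  have i1: "frag_of (a, b) - (\<Sum>i\<le>D. frag_of (crd a i \<odot>\<^bsub>A\<^esub> basis i, b)) \<in> nullE"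
    using T.null_sum_left[OF left_module_Aop A.abelian_group_axioms, of b "{..D}" "\<lambda>i. crd a i \<odot>\<^bsub>A\<^esub> basis i"]
      one ca by (auto simp: nullE_def comb_def)
  have i2: "frag_of (crd a i \<odot>\<^bsub>A\<^esub> basis i, b) - (\<Sum>j\<le>D. frag_of (crd a i \<odot>\<^bsub>A\<^esub> basis i, crd b j \<odot>\<^bsub>A\<^esub> basis j)) \<in> nullE"
    if "i \<le> D" for i
    using T.null_sum_right[OF left_module_Aop, of "crd a i \<odot>\<^bsub>A\<^esub> basis i" "{..D}" "\<lambda>j. crd b j \<odot>\<^bsub>A\<^esub> basis j"]
      one ca cb that by (auto simp: nullE_def comb_def finsum_Aop)
  have i3: "frag_of (crd a i \<odot>\<^bsub>A\<^esub> basis i, crd b j \<odot>\<^bsub>A\<^esub> basis j)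
      - frag_of (pr (\<Psi> (frag_of (a, b)) i j) \<odot>\<^bsub>A\<^esub> basis i, basis j) \<in> nullE" if ij: "i \<le> D" "j \<le> D" for i j
  proof -
    have "pr (\<Psi> (frag_of (a, b)) i j) = crd b j \<otimes>\<^bsub>K\<^esub> crd a i"
      using ij one by (simp add: pr_simps \<alpha>_def pr_inj K.m_comm)
    then have eq: "pr (\<Psi> (frag_of (a, b)) i j) \<odot>\<^bsub>A\<^esub> basis i = crd b j \<odot>\<^bsub>A\<^esub> (crd a i \<odot>\<^bsub>A\<^esub> basis i)"
      using ij one by (simp add: A.smult_assoc1)
    have "frag_of (crd b j \<odot>\<^bsub>A\<^esub> (crd a i \<odot>\<^bsub>A\<^esub> basis i), basis j)
       - frag_of (crd a i \<odot>\<^bsub>A\<^esub> basis i, crd b j \<odot>\<^bsub>Aop\<^esub> basis j) \<in> nullE"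
      unfolding nullE_def using ij one by (intro T.null_rel_intros) auto
    from T.null_minus[OF left_module_Aop this[unfolded nullE_def]] show ?thesis
      unfolding eq nullE_def by simp
  qed
  have "(\<Sum>i\<le>D. frag_of (crd a i \<odot>\<^bsub>A\<^esub> basis i, b)) - rho (\<Psi> (frag_of (a, b))) \<in> nullE"
    unfolding rho_def sum_subtractf[symmetric]
  proof (unfold nullE_def, rule T.null_sum, fold nullE_def)
    fix i assume "i \<in> {..D}"
    then have i: "i \<le> D" by simp
    have "(\<Sum>j\<le>D. frag_of (crd a i \<odot>\<^bsub>A\<^esub> basis i, crd b j \<odot>\<^bsub>A\<^esub> basis j))
      - (\<Sum>j\<le>D. frag_of (pr (\<Psi> (frag_of (a, b)) i j) \<odot>\<^bsub>A\<^esub> basis i, basis j)) \<in> nullE"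
      unfolding sum_subtractf[symmetric] nullE_def
      by (rule T.null_sum, fold nullE_def) (use i3 i in auto)
    then show "frag_of (crd a i \<odot>\<^bsub>A\<^esub> basis i, b)
       - (\<Sum>j\<le>D. frag_of (pr (\<Psi> (frag_of (a, b)) i j) \<odot>\<^bsub>A\<^esub> basis i, basis j)) \<in> nullE"
      using i2[OF i] unfolding nullE_def by (rule T.null_trans[rotated])
  qed
  with i1 show ?case unfolding nullE_def by (rule T.null_trans)
next
  case (diff p q)
  have "rho (\<Psi> p) - rho (\<Psi> (p - q)) - rho (\<Psi> q) \<in> nullE"
    unfolding rho_def sum_subtractf[symmetric]
  proof (unfold nullE_def, intro T.null_sum)
    fix i j assume ij: "i \<in> {..D}" "j \<in> {..D}"
    have "pr (\<Psi> p i j) = pr (\<Psi> (p - q) i j) \<oplus>\<^bsub>K\<^esub> pr (\<Psi> q i j)" by (simp flip: pr_simps)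
    then have eq: "pr (\<Psi> p i j) \<odot>\<^bsub>A\<^esub> basis i
        = pr (\<Psi> (p - q) i j) \<odot>\<^bsub>A\<^esub> basis i \<oplus>\<^bsub>A\<^esub> pr (\<Psi> q i j) \<odot>\<^bsub>A\<^esub> basis i"
      using ij by (simp add: A.smult_l_distr)
    show "frag_of (pr (\<Psi> p i j) \<odot>\<^bsub>A\<^esub> basis i, basis j) - frag_of (pr (\<Psi> (p - q) i j) \<odot>\<^bsub>A\<^esub> basis i, basis j)
      - frag_of (pr (\<Psi> q i j) \<odot>\<^bsub>A\<^esub> basis i, basis j) \<in> tensor_null K A Aop"
      unfolding eq using ij by (intro T.null_rel_intros) auto
  qed
  from T.null_add[OF T.null_diff[OF left_module_Aop diff.IH[unfolded nullE_def]] this[unfolded nullE_def]]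
  have "(p - rho (\<Psi> p)) - (q - rho (\<Psi> q)) + (rho (\<Psi> p) - rho (\<Psi> (p - q)) - rho (\<Psi> q)) \<in> nullE"
    unfolding nullE_def .
  moreover have "(p - rho (\<Psi> p)) - (q - rho (\<Psi> q)) + (rho (\<Psi> p) - rho (\<Psi> (p - q)) - rho (\<Psi> q))
     = p - q - rho (\<Psi> (p - q))" by (simp add: algebra_simps)
  ultimately show ?case by (simp only:)
qed

lemma null_iff_\<Psi>:
  assumes p: "p \<in> PC" shows "p \<in> nullE \<longleftrightarrow> (\<forall>i\<le>D. \<forall>j\<le>D. \<Psi> p i j = 0)"
proof
  assume z: "\<forall>i\<le>D. \<forall>j\<le>D. \<Psi> p i j = 0"
  have "frag_of (\<zero>\<^bsub>A\<^esub>, basis j) \<in> nullE" if "j \<le> D" for j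
    unfolding nullE_def using that
    by (intro T.null_zero_left left_module_Aop A.abelian_group_axioms) simp
  then have "rho (\<Psi> p) \<in> nullE"
    unfolding rho_def nullE_def by (intro T.null_sum) (simp add: pr_simps z)
  from T.null_add[OF rho_retract[OF p, unfolded nullE_def] this[unfolded nullE_def]]
  show "p \<in> nullE" by (simp add: nullE_def)
qed (simp add: \<Psi>_null)

section \<open>The enveloping algebra as a quotient ring\<close>

abbreviation PR :: "('a \<times> 'a \<Rightarrow>\<^sub>0 int) ring" where "PR \<equiv> pair_monoid_ring A Aop"

lemma PR_simps [simp]:
  "carrier PR = PC" "p \<oplus>\<^bsub>PR\<^esub> q = p + q" "\<zero>\<^bsub>PR\<^esub> = 0" "\<one>\<^bsub>PR\<^esub> = frag_of (\<one>\<^bsub>A\<^esub>, \<one>\<^bsub>A\<^esub>)"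
  by (simp_all add: pair_monoid_ring_def)

abbreviation pm (infixl "\<star>" 70) where "p \<star> q \<equiv> p \<otimes>\<^bsub>PR\<^esub> q"

lemma pm_def': "p \<star> q = frag_extend (\<lambda>(a, b). frag_extend (\<lambda>(a', b'). frag_of (a \<otimes>\<^bsub>A\<^esub> a', b' \<otimes>\<^bsub>A\<^esub> b)) q) p"
  by (simp add: pair_monoid_ring_def)

lemma pm_simps:
  "frag_of (a, b) \<star> frag_of (a', b') = frag_of (a \<otimes>\<^bsub>A\<^esub> a', b' \<otimes>\<^bsub>A\<^esub> b)"
  "(p + p') \<star> q = p \<star> q + p' \<star> q" "(p - p') \<star> q = p \<star> q - p' \<star> q" "0 \<star> q = 0" "(- p) \<star> q = - (p \<star> q)"
  by (simp_all add: pm_def' frag_extend_add frag_extend_diff frag_extend_minus)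

lemma pm_simps_right:
  "p \<star> (q + q') = p \<star> q + p \<star> q'" "p \<star> (q - q') = p \<star> q - p \<star> q'" "p \<star> 0 = 0" "p \<star> (- q) = - (p \<star> q)"
proof -
  have add: "frag_extend (\<lambda>x. f x + g x) p = frag_extend f p + frag_extend g p" for f g :: "'a \<times> 'a \<Rightarrow> 'a \<times> 'a \<Rightarrow>\<^sub>0 int"
  proof -
    have "Poly_Mapping.keys p \<subseteq> UNIV" by simp
    then show ?thesis by (induction p rule: frag_induction) (simp_all add: frag_extend_diff)
  qed
  show a: "p \<star> (q + q') = p \<star> q + p \<star> q'" for q q'
    by (simp add: pm_def' frag_extend_add case_prod_unfold add)
  show z: "p \<star> 0 = 0" using a[of 0 0] by simp
  show m: "p \<star> (- q) = - (p \<star> q)" for q using a[of q "- q"] z by (simp add: eq_neg_iff_add_eq_0 add.commute)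
  show "p \<star> (q - q') = p \<star> q - p \<star> q'" using a[of q "- q'"] m by simp
qed

lemma pm_closed: "p \<in> PC \<Longrightarrow> q \<in> PC \<Longrightarrow> p \<star> q \<in> PC"
proof (induction p rule: frag_carrier_induct)
  case (one a b)
  from one(3) show ?case
  proof (induction q rule: frag_carrier_induct)
    case (diff p q)
    then show ?case unfolding pm_simps_right by (intro frag_carrier_add(2))
  qed (use one in \<open>simp_all add: pm_simps pm_simps_right\<close>)
next
  case (diff p q)
  then show ?case unfolding pm_simps by (intro frag_carrier_add(2)) auto
qed (simp add: pm_simps)

lemma pm_assoc: "p \<in> PC \<Longrightarrow> q \<in> PC \<Longrightarrow> r \<in> PC \<Longrightarrow> p \<star> q \<star> r = p \<star> (q \<star> r)"
proof (induction p rule: frag_carrier_induct)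
  case p: (one a b)
  from p(3) show ?case
  proof (induction q rule: frag_carrier_induct)
    case q: (one a' b')
    from p(4) show ?case
      by (induction r rule: frag_carrier_induct) (use p q in \<open>simp_all add: pm_simps pm_simps_right A.m_assoc\<close>)
  qed (simp_all add: pm_simps pm_simps_right)
qed (simp_all add: pm_simps)

lemma ring_PR: "ring PR"
proof (rule ringI)
  show "abelian_group PR"
  proof (rule abelian_groupI)
    fix p assume "p \<in> carrier PR"
    then show "\<exists>q\<in>carrier PR. q \<oplus>\<^bsub>PR\<^esub> p = \<zero>\<^bsub>PR\<^esub>"
      using frag_carrier_add(3) unfolding PR_simps by (intro bexI[of _ "- p"]) simp_all
  qed (unfold PR_simps, auto simp: frag_carrier_add add_ac simp del: carrier_free_Abelian_group_iff)
  have one: "frag_of (\<one>\<^bsub>A\<^esub>, \<one>\<^bsub>A\<^esub>) \<star> p = p" "p \<star> frag_of (\<one>\<^bsub>A\<^esub>, \<one>\<^bsub>A\<^esub>) = p" if "p \<in> PC" for p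
    using that by (induction p rule: frag_carrier_induct) (simp_all add: pm_simps pm_simps_right)
  show "Group.monoid PR"
    by (rule monoidI; unfold PR_simps; (rule pm_closed pm_assoc one; assumption)?; simp)
qed (simp_all add: pm_simps pm_simps_right)

text \<open>A defining relation multiplied by a pair, on either side, is a relation of the same
  kind; for the scalar relation this is because scalars can be pulled out of both factors of a
  product in A.\<close>

lemma ideal_nullE: "ideal nullE PR"
proof (rule idealI[OF ring_PR])
  have sub: "nullE \<subseteq> PC" using T.null_carrier[OF left_module_Aop] by (simp add: nullE_def)
  interpret R: ring PR by (rule ring_PR)
  show "subgroup nullE (add_monoid PR)"
  proof (rule group.subgroupI[OF abelian_group.a_group[OF R.abelian_group_axioms]])
    show "nullE \<subseteq> carrier (add_monoid PR)" using sub by simp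
    show "nullE \<noteq> {}" using T.null_zero by (auto simp: nullE_def)
    fix p assume p: "p \<in> nullE"
    have "inv\<^bsub>add_monoid PR\<^esub> p = - p"
      using p sub frag_carrier_add(3)[of p "carrier A" "carrier A"] R.minus_equality[of "- p" p]
      by (auto simp: a_inv_def subset_iff simp del: carrier_free_Abelian_group_iff)
    then show "inv\<^bsub>add_monoid PR\<^esub> p \<in> nullE"
      using T.null_minus[OF left_module_Aop] p by (simp add: nullE_def)
  next
    fix p q assume "p \<in> nullE" "q \<in> nullE"
    then show "p \<otimes>\<^bsub>add_monoid PR\<^esub> q \<in> nullE" using T.null_add by (simp add: nullE_def)
  qed
  fix p q assume p: "p \<in> nullE" and q: "q \<in> carrier PR"
  show "q \<star> p \<in> nullE"
    using q[simplified PR_simps]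
  proof (induction q rule: frag_carrier_induct)
    case (one a b)
    show ?case
      using left_module_Aop p[unfolded nullE_def]
    proof (induction rule: T.null_induct)
      case (rel p)
      show ?case
      proof -
        have l: "frag_of (a \<otimes>\<^bsub>A\<^esub> (x \<oplus>\<^bsub>A\<^esub> x'), y \<otimes>\<^bsub>A\<^esub> b) - frag_of (a \<otimes>\<^bsub>A\<^esub> x, y \<otimes>\<^bsub>A\<^esub> b) - frag_of (a \<otimes>\<^bsub>A\<^esub> x', y \<otimes>\<^bsub>A\<^esub> b) \<in> nullE"
          if "x \<in> carrier A" "x' \<in> carrier A" "y \<in> carrier A" for x x' y
          using T.null_rel_intros(1)[of "a \<otimes>\<^bsub>A\<^esub> x" "a \<otimes>\<^bsub>A\<^esub> x'" "y \<otimes>\<^bsub>A\<^esub> b" Aop] that one by (simp add: nullE_def A.r_distr)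
        have r: "frag_of (a \<otimes>\<^bsub>A\<^esub> x, (y \<oplus>\<^bsub>A\<^esub> y') \<otimes>\<^bsub>A\<^esub> b) - frag_of (a \<otimes>\<^bsub>A\<^esub> x, y \<otimes>\<^bsub>A\<^esub> b) - frag_of (a \<otimes>\<^bsub>A\<^esub> x, y' \<otimes>\<^bsub>A\<^esub> b) \<in> nullE"
          if "x \<in> carrier A" "y' \<in> carrier A" "y \<in> carrier A" for x y' y
          using T.null_rel_intros(2)[of "a \<otimes>\<^bsub>A\<^esub> x" "y \<otimes>\<^bsub>A\<^esub> b" Aop "y' \<otimes>\<^bsub>A\<^esub> b"] that one by (simp add: nullE_def A.l_distr)
        have s: "frag_of (a \<otimes>\<^bsub>A\<^esub> (c \<odot>\<^bsub>A\<^esub> x), y \<otimes>\<^bsub>A\<^esub> b) - frag_of (a \<otimes>\<^bsub>A\<^esub> x, (c \<odot>\<^bsub>A\<^esub> y) \<otimes>\<^bsub>A\<^esub> b) \<in> nullE"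
          if "x \<in> carrier A" "c \<in> carrier K" "y \<in> carrier A" for x c y
          using T.null_rel_intros(3)[of c "a \<otimes>\<^bsub>A\<^esub> x" "y \<otimes>\<^bsub>A\<^esub> b" Aop] that one
          by (simp add: nullE_def A.smult_mult_left A.smult_mult_right)
        show ?thesis using rel l r s by (auto simp: tensor_rels_def pm_simps pm_simps_right)
      qed
    qed (use T.null_zero T.null_add T.null_minus[OF left_module_Aop] in
        \<open>auto simp: nullE_def pm_simps pm_simps_right\<close>)
  next
    case (diff p q)
    then show ?case unfolding pm_simps nullE_def by (intro T.null_diff left_module_Aop)
  qed (use T.null_zero in \<open>simp add: pm_simps nullE_def\<close>)
  show "p \<star> q \<in> nullE"
    using q[simplified PR_simps]
  proof (induction q rule: frag_carrier_induct)
    case (one a b)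
    show ?case
      using left_module_Aop p[unfolded nullE_def]
    proof (induction rule: T.null_induct)
      case (rel p)
      show ?case
      proof -
        have l: "frag_of ((x \<oplus>\<^bsub>A\<^esub> x') \<otimes>\<^bsub>A\<^esub> a, b \<otimes>\<^bsub>A\<^esub> y) - frag_of (x \<otimes>\<^bsub>A\<^esub> a, b \<otimes>\<^bsub>A\<^esub> y) - frag_of (x' \<otimes>\<^bsub>A\<^esub> a, b \<otimes>\<^bsub>A\<^esub> y) \<in> nullE"
          if "x \<in> carrier A" "x' \<in> carrier A" "y \<in> carrier A" for x x' y
          using T.null_rel_intros(1)[of "x \<otimes>\<^bsub>A\<^esub> a" "x' \<otimes>\<^bsub>A\<^esub> a" "b \<otimes>\<^bsub>A\<^esub> y" Aop] that one by (simp add: nullE_def A.l_distr)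
        have r: "frag_of (x \<otimes>\<^bsub>A\<^esub> a, b \<otimes>\<^bsub>A\<^esub> (y \<oplus>\<^bsub>A\<^esub> y')) - frag_of (x \<otimes>\<^bsub>A\<^esub> a, b \<otimes>\<^bsub>A\<^esub> y) - frag_of (x \<otimes>\<^bsub>A\<^esub> a, b \<otimes>\<^bsub>A\<^esub> y') \<in> nullE"
          if "x \<in> carrier A" "y' \<in> carrier A" "y \<in> carrier A" for x y' y
          using T.null_rel_intros(2)[of "x \<otimes>\<^bsub>A\<^esub> a" "b \<otimes>\<^bsub>A\<^esub> y" Aop "b \<otimes>\<^bsub>A\<^esub> y'"] that one by (simp add: nullE_def A.r_distr)
        have s: "frag_of ((c \<odot>\<^bsub>A\<^esub> x) \<otimes>\<^bsub>A\<^esub> a, b \<otimes>\<^bsub>A\<^esub> y) - frag_of (x \<otimes>\<^bsub>A\<^esub> a, b \<otimes>\<^bsub>A\<^esub> (c \<odot>\<^bsub>A\<^esub> y)) \<in> nullE"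
          if "x \<in> carrier A" "c \<in> carrier K" "y \<in> carrier A" for x c y
          using T.null_rel_intros(3)[of c "x \<otimes>\<^bsub>A\<^esub> a" "b \<otimes>\<^bsub>A\<^esub> y" Aop] that one
          by (simp add: nullE_def A.smult_mult_left A.smult_mult_right)
        show ?thesis using rel l r s by (auto simp: tensor_rels_def pm_simps pm_simps_right)
      qed
    qed (use T.null_zero T.null_add T.null_minus[OF left_module_Aop] in
        \<open>auto simp: nullE_def pm_simps pm_simps_right\<close>)
  next
    case (diff p q)
    then show ?case unfolding pm_simps_right nullE_def by (intro T.null_diff left_module_Aop)
  qed (use T.null_zero in \<open>simp add: pm_simps_right nullE_def\<close>)
qed

abbreviation E :: "('a \<times> 'a \<Rightarrow>\<^sub>0 int) set ring" where "E \<equiv> enveloping_algebra K A"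

lemma E_def: "E = PR Quot nullE"
  by (simp add: enveloping_algebra_def tensor_algebra_def nullE_def)

lemma ring_E: "ring E"
  unfolding E_def by (rule ideal.quotient_is_ring[OF ideal_nullE])

definition cl :: "('a \<times> 'a \<Rightarrow>\<^sub>0 int) \<Rightarrow> ('a \<times> 'a \<Rightarrow>\<^sub>0 int) set"
  where "cl p = nullE +>\<^bsub>PR\<^esub> p"

lemma cl_eq: "cl p = {h + p | h. h \<in> nullE}"
  by (auto simp: cl_def a_r_coset_def')

lemma carrier_E: "carrier E = cl ` PC"
  by (auto simp: E_def FactRing_def A_RCOSETS_def' cl_def a_r_coset_def' simp del: carrier_free_Abelian_group_iff)

lemma cl_closed [simp]: "p \<in> PC \<Longrightarrow> cl p \<in> carrier E"
  unfolding carrier_E by (rule imageI)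

lemma E_ops:
  assumes "p \<in> PC" "q \<in> PC"
  shows "cl p \<oplus>\<^bsub>E\<^esub> cl q = cl (p + q)" "cl p \<otimes>\<^bsub>E\<^esub> cl q = cl (p \<star> q)"
  using abelian_subgroup.a_rcos_sum[OF abelian_subgroupI3[OF ideal.axioms(1)[OF ideal_nullE] ring.is_abelian_group[OF ring_PR]], of p q]
    ideal.rcoset_mult_add[OF ideal_nullE, of p q] assms
  by (simp_all add: E_def FactRing_def cl_def del: carrier_free_Abelian_group_iff)

lemma E_one: "\<one>\<^bsub>E\<^esub> = cl (frag_of (\<one>\<^bsub>A\<^esub>, \<one>\<^bsub>A\<^esub>))"
  by (simp add: E_def FactRing_def cl_def)

lemma self_in_cl: "p \<in> cl p"
  unfolding cl_eq using T.null_zero by (auto simp: nullE_def intro!: exI[of _ 0])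

text \<open>Coordinates of a class, through an arbitrary representative; null elements have
  coordinates zero, so the choice does not matter.\<close>

definition \<psi> :: "('a \<times> 'a \<Rightarrow>\<^sub>0 int) set \<Rightarrow> nat \<Rightarrow> nat \<Rightarrow> 'k field_product"
  where "\<psi> X = \<Psi> (SOME p. p \<in> X)"

lemma \<Psi>_cl: "q \<in> cl p \<Longrightarrow> \<Psi> q i j = \<Psi> p i j"
  by (auto simp: cl_eq \<Psi>_null)

lemma \<psi>_cl: "\<psi> (cl p) = \<Psi> p"
proof -
  have "(SOME q. q \<in> cl p) \<in> cl p" using self_in_cl by (rule someI)
  then show ?thesis by (auto simp: \<psi>_def fun_eq_iff \<Psi>_cl)
qed

lemma cl_eqI:
  assumes "p \<in> PC" "q \<in> PC" "\<And>i j. i \<le> D \<Longrightarrow> j \<le> D \<Longrightarrow> \<Psi> p i j = \<Psi> q i j"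
  shows "cl p = cl q"
proof -
  have pq: "p - q \<in> nullE" "q - p \<in> nullE"
    using assms null_iff_\<Psi>[OF frag_carrier_add(2)[OF assms(1,2)]] null_iff_\<Psi>[OF frag_carrier_add(2)[OF assms(2,1)]]
    by auto
  have "h + p \<in> cl q" if "h \<in> nullE" for h
    unfolding cl_eq using T.null_add[of h Aop "p - q"] that pq by (intro CollectI exI[of _ "h + (p - q)"]) (simp add: nullE_def)
  moreover have "h + q \<in> cl p" if "h \<in> nullE" for h
    unfolding cl_eq using T.null_add[of h Aop "q - p"] that pq by (intro CollectI exI[of _ "h + (q - p)"]) (simp add: nullE_def)
  ultimately show ?thesis unfolding cl_eq by auto
qed

lemma E_eqI:
  assumes "X \<in> carrier E" "Y \<in> carrier E" "\<And>i j. i \<le> D \<Longrightarrow> j \<le> D \<Longrightarrow> \<psi> X i j = \<psi> Y i j"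
  shows "X = Y"
proof -
  obtain p q where "p \<in> PC" "q \<in> PC" "X = cl p" "Y = cl q" using assms(1,2) unfolding carrier_E by blast
  then show ?thesis using assms(3) cl_eqI[of p q] by (simp only: \<psi>_cl)
qed

lemma \<psi>_add: "X \<in> carrier E \<Longrightarrow> Y \<in> carrier E \<Longrightarrow> \<psi> (X \<oplus>\<^bsub>E\<^esub> Y) i j = \<psi> X i j + \<psi> Y i j"
  unfolding carrier_E by (auto simp: E_ops \<psi>_cl simp del: carrier_free_Abelian_group_iff)

end

text \<open>The module laws are checked after the injection. In this way A gets its structure over
  the enveloping algebra from the bar module in degree 0, where the laws are already known.\<close>

lemma left_module_pullback:
  assumes N: "left_module R N" and inj: "inj_on \<phi> (carrier M)"
    and maps: "\<And>x. x \<in> carrier M \<Longrightarrow> \<phi> x \<in> carrier N"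
    and zero: "\<zero>\<^bsub>M\<^esub> \<in> carrier M" "\<phi> \<zero>\<^bsub>M\<^esub> = \<zero>\<^bsub>N\<^esub>"
    and add: "\<And>x y. x \<in> carrier M \<Longrightarrow> y \<in> carrier M \<Longrightarrow> x \<oplus>\<^bsub>M\<^esub> y \<in> carrier M \<and> \<phi> (x \<oplus>\<^bsub>M\<^esub> y) = \<phi> x \<oplus>\<^bsub>N\<^esub> \<phi> y"
    and smult: "\<And>r x. r \<in> carrier R \<Longrightarrow> x \<in> carrier M \<Longrightarrow> r \<odot>\<^bsub>M\<^esub> x \<in> carrier M \<and> \<phi> (r \<odot>\<^bsub>M\<^esub> x) = r \<odot>\<^bsub>N\<^esub> \<phi> x"
  shows "left_module R M"
proof -
  interpret N: left_module R N by (rule N)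
  have eqI: "x = y" if "x \<in> carrier M" "y \<in> carrier M" "\<phi> x = \<phi> y" for x y
    using inj that by (auto dest: inj_onD)
  have "abelian_group M"
  proof (rule abelian_groupI)
    fix x assume x: "x \<in> carrier M"
    show "\<exists>y\<in>carrier M. y \<oplus>\<^bsub>M\<^esub> x = \<zero>\<^bsub>M\<^esub>"
    proof (intro bexI eqI)
      let ?y = "(\<ominus>\<^bsub>R\<^esub> \<one>\<^bsub>R\<^esub>) \<odot>\<^bsub>M\<^esub> x"
      show y: "?y \<in> carrier M" using smult x by simp
      show "\<phi> (?y \<oplus>\<^bsub>M\<^esub> x) = \<phi> \<zero>\<^bsub>M\<^esub>"
        using add[OF y x] smult[of "\<ominus>\<^bsub>R\<^esub> \<one>\<^bsub>R\<^esub>" x] x maps[OF x] by (simp add: N.smult_minus_one zero N.M.l_neg)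
      show "?y \<oplus>\<^bsub>M\<^esub> x \<in> carrier M" using add[OF y x] by simp
    qed (rule zero)
  qed (use zero add maps in \<open>auto intro!: eqI simp: N.M.a_ac\<close>)
  then show ?thesis
    using N.R.ring_axioms smult add maps unfolding left_module_def left_module_axioms_def
    by (auto intro!: eqI simp: N.smult_l_distr N.smult_r_distr N.smult_assoc N.smult_one)
qed

context graded_local_algebra
begin

section \<open>The bar modules and their free generators\<close>

definition La :: "'a \<Rightarrow> (nat list \<Rightarrow> 'k field_product) \<Rightarrow> nat list \<Rightarrow> 'k field_product"
  where "La a f w = (\<Sum>i\<le>D. \<alpha> a i * W.lmul i f w)"

definition Ra :: "'a \<Rightarrow> (nat list \<Rightarrow> 'k field_product) \<Rightarrow> nat list \<Rightarrow> 'k field_product"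
  where "Ra b f w = (\<Sum>j\<le>D. \<alpha> b j * W.rmul j f w)"

lemma act_pair: "W.act (\<Psi> (frag_of (a, b))) f w = La a (Ra b f) w"
  unfolding W.act_def La_def Ra_def
  by (simp add: Ra_def[abs_def] W.lmul_sum W.lmul_scale sum_distrib_left mult_ac)

lemma La_mult:
  assumes "a \<in> carrier A" "a' \<in> carrier A"
  shows "La (a \<otimes>\<^bsub>A\<^esub> a') f w = La a (La a' f) w"
proof -
  have "La (a \<otimes>\<^bsub>A\<^esub> a') f w = (\<Sum>r\<le>D. \<Sum>p\<le>D. \<Sum>q\<le>D. \<alpha> a p * \<alpha> a' q * sc p q r * W.lmul r f w)"
    by (simp add: La_def \<alpha>_mult assms sum_distrib_right)
  also have "\<dots> = (\<Sum>p\<le>D. \<Sum>q\<le>D. \<Sum>r\<le>D. \<alpha> a p * \<alpha> a' q * sc p q r * W.lmul r f w)"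
    by (rule sum_swap_in2)
  also have "\<dots> = La a (La a' f) w"
    unfolding La_def[of a] by (simp add: La_def[abs_def] W.lmul_sum W.lmul_scale W.lmul_lmul sum_distrib_left mult_ac)
  finally show ?thesis .
qed

lemma Ra_mult:
  assumes "b \<in> carrier A" "b' \<in> carrier A"
  shows "Ra (b' \<otimes>\<^bsub>A\<^esub> b) f w = Ra b (Ra b' f) w"
proof -
  have "Ra (b' \<otimes>\<^bsub>A\<^esub> b) f w = (\<Sum>r\<le>D. \<Sum>q\<le>D. \<Sum>p\<le>D. \<alpha> b' q * \<alpha> b p * sc q p r * W.rmul r f w)"
    by (simp add: Ra_def \<alpha>_mult assms sum_distrib_right)
  also have "\<dots> = (\<Sum>r\<le>D. \<Sum>p\<le>D. \<Sum>q\<le>D. \<alpha> b' q * \<alpha> b p * sc q p r * W.rmul r f w)"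
    by (rule sum.cong[OF refl], rule sum.swap)
  also have "\<dots> = (\<Sum>p\<le>D. \<Sum>q\<le>D. \<Sum>r\<le>D. \<alpha> b' q * \<alpha> b p * sc q p r * W.rmul r f w)"
    by (rule sum_swap_in2)
  also have "\<dots> = Ra b (Ra b' f) w"
    unfolding Ra_def[of b] by (simp add: Ra_def[abs_def] W.rmul_sum W.rmul_scale W.rmul_rmul sum_distrib_left mult_ac)
  finally show ?thesis .
qed

lemma La_Ra: "La a (Ra b f) w = Ra b (La a f) w"
proof -
  have "La a (Ra b f) w = (\<Sum>i\<le>D. \<Sum>j\<le>D. \<alpha> a i * \<alpha> b j * W.lmul i (W.rmul j f) w)"
    by (simp add: La_def Ra_def[abs_def] W.lmul_sum W.lmul_scale sum_distrib_left mult_ac)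
  also have "\<dots> = (\<Sum>j\<le>D. \<Sum>i\<le>D. \<alpha> a i * \<alpha> b j * W.rmul j (W.lmul i f) w)"
    unfolding W.lmul_rmul by (rule sum.swap)
  also have "\<dots> = Ra b (La a f) w"
    by (simp add: Ra_def La_def[abs_def] W.rmul_sum W.rmul_scale sum_distrib_left mult_ac)
  finally show ?thesis .
qed

lemma act_\<Psi>_diff: "W.act (\<Psi> (p - q)) f w = W.act (\<Psi> p) f w - W.act (\<Psi> q) f w"
  unfolding W.act_diff_left[symmetric] by (rule W.act_cong) simp

text \<open>By additivity both scalars may be taken to be pairs. It then remains to interchange a
  left and a right multiplication.\<close>

lemma act_mult:
  "p \<in> PC \<Longrightarrow> q \<in> PC \<Longrightarrow> W.act (\<Psi> (p \<star> q)) f w = W.act (\<Psi> p) (W.act (\<Psi> q) f) w"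
proof (induction p arbitrary: w rule: frag_carrier_induct)
  case p: (one a b)
  from p(3) show ?case
  proof (induction q arbitrary: w rule: frag_carrier_induct)
    case q: (one a' b')
    have "W.act (\<Psi> (frag_of (a, b) \<star> frag_of (a', b'))) f w = La a (La a' (Ra b (Ra b' f))) w"
      unfolding pm_simps act_pair La_mult[OF p(1) q(1)] Ra_mult[OF p(2) q(2), abs_def] ..
    also have "La a' (Ra b (Ra b' f)) = Ra b (La a' (Ra b' f))" by (rule ext) (rule La_Ra)
    finally show ?case unfolding act_pair act_pair[abs_def] .
  next
    case zero
    then show ?case by (simp add: pm_simps_right W.act_zero_left \<Psi>_simps(1)[abs_def] W.act_zero_left[abs_def])
  next
    case (diff p q)
    have e: "W.act (\<Psi> (p - q)) f = (\<lambda>u. W.act (\<Psi> p) f u + (-1) * W.act (\<Psi> q) f u)"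
      by (simp add: fun_eq_iff act_\<Psi>_diff)
    show ?case
      unfolding e W.act_add W.act_scale pm_simps_right act_\<Psi>_diff diff.IH by simp
  qed
next
  case zero
  then show ?case by (simp add: pm_simps \<Psi>_simps(1)[abs_def] W.act_zero_left)
next
  case (diff p p')
  then show ?case by (simp only: pm_simps act_\<Psi>_diff)
qed

text \<open>\<open>B (Suc n)\<close> is the n-th module of the normalized bar resolution, and
  \<open>B 0\<close> is a copy of A.\<close>

definition B :: "nat \<Rightarrow> (('a \<times> 'a \<Rightarrow>\<^sub>0 int) set, nat list \<Rightarrow> 'k field_product) module"
  where "B n = \<lparr>carrier = {f. W.supported (W.bar_words n) f}, monoid.mult = (\<lambda>f g. f), one = (\<lambda>w. 0),
    ring.zero = (\<lambda>w. 0), ring.add = (\<lambda>f g w. f w + g w), smult = (\<lambda>X f. W.act (\<psi> X) f)\<rparr>"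

lemma B_simps [simp]:
  "f \<in> carrier (B n) \<longleftrightarrow> W.supported (W.bar_words n) f" "\<zero>\<^bsub>B n\<^esub> = (\<lambda>w. 0)"
  "f \<oplus>\<^bsub>B n\<^esub> g = (\<lambda>w. f w + g w)" "X \<odot>\<^bsub>B n\<^esub> f = W.act (\<psi> X) f"
  by (simp_all add: B_def)

lemma \<alpha>_one: "\<alpha> \<one>\<^bsub>A\<^esub> i = (if i = 0 then unit else 0)"
  using \<alpha>_basis[of 0 i] by (auto simp: basis(1))

lemma act_one:
  assumes f: "W.supported (W.bar_words n) f"
  shows "W.act (\<Psi> (frag_of (\<one>\<^bsub>A\<^esub>, \<one>\<^bsub>A\<^esub>))) f w = f w"
proof -
  have r: "Ra \<one>\<^bsub>A\<^esub> f w = f w" for w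
  proof -
    have "Ra \<one>\<^bsub>A\<^esub> f w = (\<Sum>j\<le>D. if j = 0 then unit * W.rmul 0 f w else 0)"
      unfolding Ra_def by (rule sum.cong) (auto simp: \<alpha>_one)
    also have "\<dots> = unit * W.rmul 0 f w" by simp
    also have "W.rmul 0 f w = f w"
    proof (cases w rule: rev_cases)
      case (snoc v k)
      have "f (v @ [k]) = 0" if "\<not> k \<le> D"
        by (rule W.supported_0[OF f]) (use that in \<open>auto simp: W.bar_words_def\<close>)
      then show ?thesis unfolding snoc W.rmul_snoc W.sum_unit_right by (auto simp: W.supported_e[OF f])
    qed (use W.supported_0[OF f, of "[]"] in \<open>simp add: W.rmul_def W.bar_words_def\<close>)
    finally show ?thesis by (simp add: W.supported_e[OF f])
  qed
  have "La \<one>\<^bsub>A\<^esub> f w = (\<Sum>j\<le>D. if j = 0 then unit * W.lmul 0 f w else 0)"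
    unfolding La_def by (rule sum.cong) (auto simp: \<alpha>_one)
  also have "\<dots> = unit * W.lmul 0 f w" by simp
  also have "W.lmul 0 f w = f w"
  proof (cases w)
    case (Cons k v)
    have "f (k # v) = 0" if "\<not> k \<le> D"
      by (rule W.supported_0[OF f]) (use that in \<open>auto simp: W.bar_words_def\<close>)
    then show ?thesis unfolding Cons W.lmul_Cons W.sum_unit_left by (auto simp: W.supported_e[OF f])
  qed (use W.supported_0[OF f, of "[]"] in \<open>simp add: W.lmul_def W.bar_words_def\<close>)
  finally have "La \<one>\<^bsub>A\<^esub> f w = f w" by (simp add: W.supported_e[OF f])
  moreover have "Ra \<one>\<^bsub>A\<^esub> f = f" using r by auto
  ultimately show ?thesis unfolding act_pair by simp
qed

lemma left_module_B: "left_module E (B n)"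
proof -
  have "abelian_group (B n)"
  proof (rule abelian_groupI)
    fix f assume f: "f \<in> carrier (B n)"
    show "\<exists>g\<in>carrier (B n). g \<oplus>\<^bsub>B n\<^esub> f = \<zero>\<^bsub>B n\<^esub>"
      using f W.supported_scale[of _ f "\<lambda>_. -1"] by (intro bexI[of _ "\<lambda>u. -1 * f u"]) auto
  qed (auto simp: W.supported_add W.supported_zero add_ac)
  then show ?thesis
    using ring_E unfolding left_module_def left_module_axioms_def
  proof (intro conjI allI impI, simp_all only:)
    fix X Y f assume XY: "X \<in> carrier E" "Y \<in> carrier E" and f: "f \<in> carrier (B n)"
    obtain p q where pq: "X = cl p" "Y = cl q" "p \<in> PC" "q \<in> PC" using XY unfolding carrier_E by blast
    show "(X \<oplus>\<^bsub>E\<^esub> Y) \<odot>\<^bsub>B n\<^esub> f = X \<odot>\<^bsub>B n\<^esub> f \<oplus>\<^bsub>B n\<^esub> Y \<odot>\<^bsub>B n\<^esub> f"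
    proof -
      have "\<psi> (X \<oplus>\<^bsub>E\<^esub> Y) = (\<lambda>i j. \<psi> X i j + \<psi> Y i j)" using \<psi>_add[OF XY] by (intro ext)
      then show ?thesis unfolding B_simps by (intro ext) (simp only: W.act_add_left)
    qed
    have eq: "\<psi> (X \<otimes>\<^bsub>E\<^esub> Y) = \<Psi> (p \<star> q)" using pq by (simp only: E_ops \<psi>_cl)
    show "(X \<otimes>\<^bsub>E\<^esub> Y) \<odot>\<^bsub>B n\<^esub> f = X \<odot>\<^bsub>B n\<^esub> (Y \<odot>\<^bsub>B n\<^esub> f)"
      unfolding B_simps eq by (intro ext) (simp only: act_mult[OF pq(3,4)] pq(1,2) \<psi>_cl)
  next
    fix X f g assume "X \<in> carrier E" "f \<in> carrier (B n)" "g \<in> carrier (B n)"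
    then show "X \<odot>\<^bsub>B n\<^esub> (f \<oplus>\<^bsub>B n\<^esub> g) = X \<odot>\<^bsub>B n\<^esub> f \<oplus>\<^bsub>B n\<^esub> X \<odot>\<^bsub>B n\<^esub> g"
      by (simp add: fun_eq_iff W.act_add)
  next
    fix f assume "f \<in> carrier (B n)"
    then show "\<one>\<^bsub>E\<^esub> \<odot>\<^bsub>B n\<^esub> f = f" by (simp add: E_one \<psi>_cl fun_eq_iff act_one)
  next
    fix X f assume "X \<in> carrier E" "f \<in> carrier (B n)"
    then show "X \<odot>\<^bsub>B n\<^esub> f \<in> carrier (B n)" by (simp add: W.supported_act)
  qed
qed

lemma bar_d_hom: "W.bar_d \<in> lmod_hom E (B (Suc n)) (B n)"
proof (rule lmod_homI)
  fix X f assume "X \<in> carrier E" "f \<in> carrier (B (Suc n))"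
  show "W.bar_d (X \<odot>\<^bsub>B (Suc n)\<^esub> f) = X \<odot>\<^bsub>B n\<^esub> W.bar_d f"
  proof
    fix w
    show "W.bar_d (X \<odot>\<^bsub>B (Suc n)\<^esub> f) w = (X \<odot>\<^bsub>B n\<^esub> W.bar_d f) w"
      by (cases "w = []") (simp_all add: W.bar_d_act, simp add: W.act_def W.lmul_def)
  qed
qed (auto simp: W.supported_bar_words_d W.bar_d_add)

definition U :: "nat \<Rightarrow> nat list set"
  where "U n = {u. length u = n \<and> set u \<subseteq> {1..D}}"

lemma finite_U [simp]: "finite (U n)"
  unfolding U_def by (rule finite_subset[OF _ finite_lists_length_eq[of "{1..D}" n]]) auto

text \<open>The free generator 1 \<otimes> u \<otimes> 1.\<close>

definition \<beta> :: "nat list \<Rightarrow> nat list \<Rightarrow> 'k field_product"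
  where "\<beta> u = W.delta (0 # u @ [0])"

lemma \<beta>_closed: "u \<in> U n \<Longrightarrow> \<beta> u \<in> carrier (B (Suc n))"
  by (simp add: \<beta>_def U_def) (intro W.supported_delta, simp add: W.bar_words_Suc)

text \<open>Multiplying the two outer units writes the coefficients g into the outer letters. So the
  coordinates of a scalar can be read off from its action on a generator.\<close>

lemma act_\<beta>: "W.act g (\<beta> u) (i # v @ [j]) = (if v = u \<and> i \<le> D \<and> j \<le> D then unit * g i j else 0)"
proof -
  have r: "W.rmul q (\<beta> u) (x # v @ [j]) = (if x = 0 \<and> v = u then sc 0 q j * unit else 0)" for q x
  proof -
    have "W.rmul q (\<beta> u) (x # v @ [j]) = (\<Sum>y\<le>D. if y = 0 then (if x = 0 \<and> v = u then sc 0 q j * unit else 0) else 0)"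
      unfolding W.rmul_Cons_snoc by (rule sum.cong) (auto simp: \<beta>_def W.delta_def)
    then show ?thesis by simp
  qed
  have l: "W.lmul p (W.rmul q (\<beta> u)) (i # v @ [j]) = (if v = u then sc p 0 i * (sc 0 q j * unit) else 0)" for p q
  proof -
    have "W.lmul p (W.rmul q (\<beta> u)) (i # v @ [j])
       = (\<Sum>x\<le>D. if x = 0 then (if v = u then sc p 0 i * (sc 0 q j * unit) else 0) else 0)"
      unfolding W.lmul_Cons r by (rule sum.cong) auto
    then show ?thesis by simp
  qed
  show ?thesis
  proof (cases "v = u")
    case True
    have "W.act g (\<beta> u) (i # v @ [j]) = (\<Sum>p\<le>D. \<Sum>q\<le>D. g p q * (sc p 0 i * (sc 0 q j * unit)))"
      unfolding W.act_def l by (simp add: True)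
    also have "\<dots> = (\<Sum>p\<le>D. if p = i then (\<Sum>q\<le>D. if q = j then unit * g i j else 0) else 0)"
    proof (rule sum.cong[OF refl])
      fix p assume p: "p \<in> {..D}"
      show "(\<Sum>q\<le>D. g p q * (sc p 0 i * (sc 0 q j * unit)))
        = (if p = i then (\<Sum>q\<le>D. if q = j then unit * g i j else 0) else 0)"
      proof (cases "p = i \<and> p \<le> D")
        case True
        have "g p q * (sc p 0 i * (sc 0 q j * unit)) = (if q = j then unit * g i j else 0)" if "q \<in> {..D}" for q
          using True that by (cases "q = j") (simp_all add: sc_0 unit_unit W.e_idem mult_ac)
        then have eq: "(\<Sum>q\<le>D. g p q * (sc p 0 i * (sc 0 q j * unit))) = (\<Sum>q\<le>D. if q = j then unit * g i j else 0)"
          by (rule sum.cong[OF refl])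
        show ?thesis unfolding eq using True by simp
      qed (use p in \<open>auto simp: sc_0\<close>)
    qed
    finally show ?thesis using True by auto
  next
    case False
    then show ?thesis unfolding W.act_def l by simp
  qed
qed

lemma act_cong_right:
  assumes "\<And>x y. x \<le> D \<Longrightarrow> y \<le> D \<Longrightarrow> f (x # v @ [y]) = f' (x # v @ [y])"
  shows "W.act g f (i # v @ [j]) = W.act g f' (i # v @ [j])"
  unfolding W.act_def W.lmul_Cons W.rmul_Cons_snoc using assms by (intro sum.cong refl arg_cong2[where f = "(*)"]) auto

text \<open>The coefficient of f at the generator \<beta> u, as a class in the enveloping
  algebra.\<close>

definition co :: "(nat list \<Rightarrow> 'k field_product) \<Rightarrow> nat list \<Rightarrow> ('a \<times> 'a \<Rightarrow>\<^sub>0 int) set"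
  where "co f u = cl (rho (\<lambda>i j. f (i # u @ [j])))"

lemma co_closed: "co f u \<in> carrier E"
  unfolding co_def by (rule cl_closed[OF rho_closed])

lemma \<psi>_co:
  assumes "W.supported S f" "i \<le> D" "j \<le> D"
  shows "\<psi> (co f u) i j = f (i # u @ [j])"
  using assms by (simp add: co_def \<psi>_cl \<Psi>_rho W.supported_e)

lemma \<Psi>_unit: "p \<in> PC \<Longrightarrow> unit * \<Psi> p i j = \<Psi> p i j"
  by (induction p rule: frag_carrier_induct)
    (simp_all add: right_diff_distrib unit_\<alpha> flip: mult.assoc)

lemma co_add:
  assumes "f \<in> carrier (B n)" "g \<in> carrier (B n)"
  shows "co (f \<oplus>\<^bsub>B n\<^esub> g) u = co f u \<oplus>\<^bsub>E\<^esub> co g u"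
proof -
  interpret E: ring E by (rule ring_E)
  show ?thesis
    using assms W.supported_add[of "W.bar_words n" f g]
    by (intro E_eqI) (simp_all add: co_closed \<psi>_add \<psi>_co[of "W.bar_words n"])
qed

text \<open>A product in E is not expanded in coordinates; both sides are compared through the
  action on \<beta> u, where \<open>act_mult\<close> applies.\<close>

lemma co_smult:
  assumes X: "X \<in> carrier E" and f: "f \<in> carrier (B n)"
  shows "co (X \<odot>\<^bsub>B n\<^esub> f) u = X \<otimes>\<^bsub>E\<^esub> co f u"
proof -
  interpret E: ring E by (rule ring_E)
  obtain p where p: "X = cl p" "p \<in> PC" using X unfolding carrier_E by blast
  let ?q = "rho (\<lambda>i j. f (i # u @ [j]))"
  have q: "?q \<in> PC" by (rule rho_closed)
  show ?thesis
  proof (rule E_eqI)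
    fix i j assume ij: "i \<le> D" "j \<le> D"
    have "\<psi> (X \<otimes>\<^bsub>E\<^esub> co f u) i j = \<Psi> (p \<star> ?q) i j"
      by (simp only: p(1) co_def E_ops[OF p(2) q] \<psi>_cl)
    also have "\<dots> = W.act (\<Psi> (p \<star> ?q)) (\<beta> u) (i # u @ [j])"
      using ij \<Psi>_unit[OF pm_closed[OF p(2) q]] by (simp add: act_\<beta>)
    also have "\<dots> = W.act (\<Psi> p) (W.act (\<Psi> ?q) (\<beta> u)) (i # u @ [j])"
      by (rule act_mult[OF p(2) q])
    also have "\<dots> = W.act (\<Psi> p) f (i # u @ [j])"
      using f by (intro act_cong_right) (simp add: act_\<beta> \<Psi>_rho W.supported_e unit_unit)
    also have "\<dots> = \<psi> (co (X \<odot>\<^bsub>B n\<^esub> f) u) i j"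
      using ij f W.supported_act[of n f "\<Psi> p"] \<psi>_co[of "W.bar_words n" "W.act (\<Psi> p) f" i j u] by (simp add: p(1) \<psi>_cl)
    finally show "\<psi> (co (X \<odot>\<^bsub>B n\<^esub> f) u) i j = \<psi> (X \<otimes>\<^bsub>E\<^esub> co f u) i j" ..
  qed (simp_all add: co_closed X)
qed

lemma finsum_B: "finite I \<Longrightarrow> (\<And>i. i \<in> I \<Longrightarrow> F i \<in> carrier (B n)) \<Longrightarrow> (\<Oplus>\<^bsub>B n\<^esub>i\<in>I. F i) w = (\<Sum>i\<in>I. F i w)"
proof (induction I rule: finite_induct)
  interpret B: left_module E "B n" by (rule left_module_B)
  case empty
  then show ?case by simp
next
  interpret B: left_module E "B n" by (rule left_module_B)
  case (insert i I)
  then have "(\<Oplus>\<^bsub>B n\<^esub>i\<in>insert i I. F i) = F i \<oplus>\<^bsub>B n\<^esub> (\<Oplus>\<^bsub>B n\<^esub>i\<in>I. F i)"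
    by (intro B.M.finsum_insert) auto
  with insert show ?case by simp
qed

lemma expand_\<beta>:
  assumes f: "f \<in> carrier (B (Suc n))"
  shows "f = (\<Oplus>\<^bsub>B (Suc n)\<^esub>u\<in>U n. co f u \<odot>\<^bsub>B (Suc n)\<^esub> \<beta> u)"
proof
  interpret B: left_module E "B (Suc n)" by (rule left_module_B)
  have cl: "co f u \<odot>\<^bsub>B (Suc n)\<^esub> \<beta> u \<in> carrier (B (Suc n))" if "u \<in> U n" for u
    by (rule B.smult_closed[OF co_closed \<beta>_closed[OF that]])
  have s: "W.supported (W.bar_words (Suc n)) f" using f by simp
  fix w
  have "(\<Oplus>\<^bsub>B (Suc n)\<^esub>u\<in>U n. co f u \<odot>\<^bsub>B (Suc n)\<^esub> \<beta> u) w = (\<Sum>u\<in>U n. W.act (\<psi> (co f u)) (\<beta> u) w)"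
    using finsum_B[OF finite_U cl] by simp
  also have "\<dots> = f w"
  proof (cases "w \<in> W.bar_words (Suc n)")
    case True
    then obtain i v j where w: "w = i # v @ [j]" "i \<le> D" "j \<le> D" "v \<in> U n"
      by (elim W.bar_words_SucE) (auto simp: U_def)
    have "(\<Sum>u\<in>U n. W.act (\<psi> (co f u)) (\<beta> u) w) = (\<Sum>u\<in>U n. if v = u then f w else 0)"
      unfolding w(1) act_\<beta> using w by (intro sum.cong refl) (auto simp: \<psi>_co[OF s] W.supported_e[OF s])
    then show ?thesis using w by simp
  next
    case False
    have "W.act (\<psi> (co f u)) (\<beta> u) w = 0" if "u \<in> U n" for u
      using W.supported_0[OF _ False] cl[OF that] by simp
    then show ?thesis using W.supported_0[OF s False] by simp
  qed
  finally show "f w = (\<Oplus>\<^bsub>B (Suc n)\<^esub>u\<in>U n. co f u \<odot>\<^bsub>B (Suc n)\<^esub> \<beta> u) w" ..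
qed

text \<open>The universal property of a free module: the generators \<beta> u may be sent to
  arbitrary elements m u.\<close>

lemma free_hom:
  assumes N: "left_module E N" and m: "\<And>u. u \<in> U n \<Longrightarrow> m u \<in> carrier N"
  shows "(\<lambda>f. \<Oplus>\<^bsub>N\<^esub>u\<in>U n. co f u \<odot>\<^bsub>N\<^esub> m u) \<in> lmod_hom E (B (Suc n)) N"
proof -
  interpret N: left_module E N by (rule N)
  have cl: "(\<lambda>u. co f u \<odot>\<^bsub>N\<^esub> m u) \<in> U n \<rightarrow> carrier N" for f
    using m co_closed by (auto intro: N.smult_closed)
  show ?thesis
  proof (rule lmod_homI)
    fix f g assume f: "f \<in> carrier (B (Suc n))" and g: "g \<in> carrier (B (Suc n))"
    have "(\<Oplus>\<^bsub>N\<^esub>u\<in>U n. co (f \<oplus>\<^bsub>B (Suc n)\<^esub> g) u \<odot>\<^bsub>N\<^esub> m u)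
      = (\<Oplus>\<^bsub>N\<^esub>u\<in>U n. co f u \<odot>\<^bsub>N\<^esub> m u \<oplus>\<^bsub>N\<^esub> co g u \<odot>\<^bsub>N\<^esub> m u)"
    proof (rule N.M.finsum_cong')
      show "(\<lambda>u. co f u \<odot>\<^bsub>N\<^esub> m u \<oplus>\<^bsub>N\<^esub> co g u \<odot>\<^bsub>N\<^esub> m u) \<in> U n \<rightarrow> carrier N"
        using cl[of f] cl[of g] by auto
      fix u assume "u \<in> U n"
      then show "co (f \<oplus>\<^bsub>B (Suc n)\<^esub> g) u \<odot>\<^bsub>N\<^esub> m u = co f u \<odot>\<^bsub>N\<^esub> m u \<oplus>\<^bsub>N\<^esub> co g u \<odot>\<^bsub>N\<^esub> m u"
        unfolding co_add[OF f g] by (intro N.smult_l_distr co_closed m)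
    qed simp
    also have "\<dots> = (\<Oplus>\<^bsub>N\<^esub>u\<in>U n. co f u \<odot>\<^bsub>N\<^esub> m u) \<oplus>\<^bsub>N\<^esub> (\<Oplus>\<^bsub>N\<^esub>u\<in>U n. co g u \<odot>\<^bsub>N\<^esub> m u)"
      by (rule N.M.finsum_addf[OF cl cl])
    finally show "(\<Oplus>\<^bsub>N\<^esub>u\<in>U n. co (f \<oplus>\<^bsub>B (Suc n)\<^esub> g) u \<odot>\<^bsub>N\<^esub> m u)
      = (\<Oplus>\<^bsub>N\<^esub>u\<in>U n. co f u \<odot>\<^bsub>N\<^esub> m u) \<oplus>\<^bsub>N\<^esub> (\<Oplus>\<^bsub>N\<^esub>u\<in>U n. co g u \<odot>\<^bsub>N\<^esub> m u)" .
  next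
    fix X f assume X: "X \<in> carrier E" and f: "f \<in> carrier (B (Suc n))"
    have hX: "(\<lambda>x. X \<odot>\<^bsub>N\<^esub> x) \<in> carrier N \<rightarrow> carrier N" using X by (auto intro: N.smult_closed)
    have sumX: "X \<odot>\<^bsub>N\<^esub> (\<Oplus>\<^bsub>N\<^esub>u\<in>I. h u) = (\<Oplus>\<^bsub>N\<^esub>u\<in>I. X \<odot>\<^bsub>N\<^esub> h u)"
      if "finite I" "h \<in> I \<rightarrow> carrier N" for I and h :: "nat list \<Rightarrow> _"
      using that
    proof (induction I rule: finite_induct)
      case (insert i I)
      then have "h i \<in> carrier N" "h \<in> I \<rightarrow> carrier N" by auto
      with insert X show ?case by (simp add: N.smult_r_distr N.smult_closed Pi_iff)
    qed (simp add: N.smult_r_null X)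
    have "(\<Oplus>\<^bsub>N\<^esub>u\<in>U n. co (X \<odot>\<^bsub>B (Suc n)\<^esub> f) u \<odot>\<^bsub>N\<^esub> m u) = (\<Oplus>\<^bsub>N\<^esub>u\<in>U n. X \<odot>\<^bsub>N\<^esub> (co f u \<odot>\<^bsub>N\<^esub> m u))"
    proof (rule N.M.finsum_cong')
      show "(\<lambda>u. X \<odot>\<^bsub>N\<^esub> (co f u \<odot>\<^bsub>N\<^esub> m u)) \<in> U n \<rightarrow> carrier N"
        using cl[of f] hX by auto
      fix u assume "u \<in> U n"
      then show "co (X \<odot>\<^bsub>B (Suc n)\<^esub> f) u \<odot>\<^bsub>N\<^esub> m u = X \<odot>\<^bsub>N\<^esub> (co f u \<odot>\<^bsub>N\<^esub> m u)"
        unfolding co_smult[OF X f] by (intro N.smult_assoc X co_closed m)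
    qed simp
    then show "(\<Oplus>\<^bsub>N\<^esub>u\<in>U n. co (X \<odot>\<^bsub>B (Suc n)\<^esub> f) u \<odot>\<^bsub>N\<^esub> m u) = X \<odot>\<^bsub>N\<^esub> (\<Oplus>\<^bsub>N\<^esub>u\<in>U n. co f u \<odot>\<^bsub>N\<^esub> m u)"
      by (simp add: sumX[OF finite_U cl])
  qed (use cl in \<open>auto intro: N.M.finsum_closed\<close>)
qed

text \<open>A free module lifts along a surjection by lifting the images of its generators.\<close>

lemma projective_B:
  assumes J: "inj_on J (carrier (B (Suc n)))"
  shows "projective_module E (transport_module J (B (Suc n)) :: (_, 'u) module)"
proof -
  let ?P = "transport_module J (B (Suc n)) :: (_, 'u) module"
  let ?i = "inv_into (carrier (B (Suc n))) J"
  note LB = left_module_B[of "Suc n"]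
  note LP = left_module_transport[OF LB J]
  have "\<exists>h \<in> lmod_hom E ?P M. \<forall>x \<in> carrier ?P. g (h x) = f x"
    if M: "left_module E M" and N: "left_module E N" and g: "g \<in> lmod_hom E M N" "g ` carrier M = carrier N"
      and f: "f \<in> lmod_hom E ?P N" for M N :: "(_, 'u) module" and g f
  proof -
    note fJ = lmod_hom_comp[OF transport_hom[OF J] f]
    have "\<forall>u\<in>U n. \<exists>x\<in>carrier M. g x = f (J (\<beta> u))"
      using lmod_homD(1)[OF fJ \<beta>_closed] g(2) by (metis imageE)
    then obtain m where m: "\<And>u. u \<in> U n \<Longrightarrow> m u \<in> carrier M \<and> g (m u) = f (J (\<beta> u))" by metis
    interpret M: left_module E M by (rule M)
    interpret N: left_module E N by (rule N)
    let ?h = "\<lambda>y. \<Oplus>\<^bsub>M\<^esub>u\<in>U n. co y u \<odot>\<^bsub>M\<^esub> m u"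
    have h: "?h \<in> lmod_hom E (B (Suc n)) M" by (rule free_hom[OF M]) (use m in blast)
    have gh: "g (?h y) = f (J y)" if y: "y \<in> carrier (B (Suc n))" for y
    proof -
      have "g (?h y) = (\<Oplus>\<^bsub>N\<^esub>u\<in>U n. g (co y u \<odot>\<^bsub>M\<^esub> m u))"
        by (rule lmod_hom_sum[OF M N g(1) finite_U]) (use m co_closed M.smult_closed in auto)
      also have "\<dots> = (\<Oplus>\<^bsub>N\<^esub>u\<in>U n. f (J (co y u \<odot>\<^bsub>B (Suc n)\<^esub> \<beta> u)))"
      proof (rule N.M.finsum_cong')
        show "(\<lambda>u. f (J (co y u \<odot>\<^bsub>B (Suc n)\<^esub> \<beta> u))) \<in> U n \<rightarrow> carrier N"
          using lmod_homD(1)[OF fJ left_module.smult_closed[OF LB co_closed \<beta>_closed]] by auto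
        fix u assume u: "u \<in> U n"
        show "g (co y u \<odot>\<^bsub>M\<^esub> m u) = f (J (co y u \<odot>\<^bsub>B (Suc n)\<^esub> \<beta> u))"
          using lmod_homD(3)[OF g(1) co_closed[of y u]] lmod_homD(3)[OF fJ co_closed[of y u] \<beta>_closed[OF u]] m[OF u]
          by simp
      qed simp
      also have "\<dots> = f (J (\<Oplus>\<^bsub>B (Suc n)\<^esub>u\<in>U n. co y u \<odot>\<^bsub>B (Suc n)\<^esub> \<beta> u))"
        by (rule lmod_hom_sum[OF LB N fJ finite_U, symmetric])
          (use left_module.smult_closed[OF LB co_closed \<beta>_closed] in auto)
      also have "\<dots> = f (J y)" using expand_\<beta>[OF y] by simp
      finally show ?thesis .
    qed
    show ?thesis
    proof (intro bexI ballI)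
      show "(\<lambda>x. ?h (?i x)) \<in> lmod_hom E ?P M"
        by (rule lmod_hom_comp[OF transport_hom_inv[OF LB J] h])
      fix x assume "x \<in> carrier ?P"
      then obtain y where y: "y \<in> carrier (B (Suc n))" "x = J y" by (auto simp: transport_module_simps)
      then show "g (?h (?i x)) = f x" using gh[OF y(1)] by (simp only: y(2) inv_into_f_f[OF J y(1)])
    qed
  qed
  with LP show ?thesis unfolding projective_module_def by blast
qed

end

section \<open>The Hochschild complex\<close>

lemma sum_swap_22:
  fixes f :: "'x \<Rightarrow> 'y \<Rightarrow> 'r::comm_ring"
  shows "(\<Sum>x'\<in>X. \<Sum>y'\<in>Y. M x' y' * (\<Sum>x\<in>X'. P x x' * (\<Sum>y\<in>Y'. Q y y' * f x y)))
    = (\<Sum>x\<in>X'. \<Sum>y\<in>Y'. (\<Sum>x'\<in>X. \<Sum>y'\<in>Y. P x x' * Q y y' * M x' y') * f x y)"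
proof -
  have "(\<Sum>x'\<in>X. \<Sum>y'\<in>Y. M x' y' * (\<Sum>x\<in>X'. P x x' * (\<Sum>y\<in>Y'. Q y y' * f x y)))
    = (\<Sum>x'\<in>X. \<Sum>y'\<in>Y. \<Sum>x\<in>X'. \<Sum>y\<in>Y'. P x x' * Q y y' * M x' y' * f x y)"
    by (simp add: sum_distrib_left mult_ac)
  also have "\<dots> = (\<Sum>x'\<in>X. \<Sum>x\<in>X'. \<Sum>y\<in>Y'. \<Sum>y'\<in>Y. P x x' * Q y y' * M x' y' * f x y)"
    by (rule sum.cong[OF refl], rule sum_swap_in2)
  also have "\<dots> = (\<Sum>x\<in>X'. \<Sum>y\<in>Y'. \<Sum>x'\<in>X. \<Sum>y'\<in>Y. P x x' * Q y y' * M x' y' * f x y)"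
    by (rule sum_swap_in2)
  finally show ?thesis by (simp add: sum_distrib_right)
qed

context graded_local_algebra
begin

section \<open>The two actions on A in coordinates\<close>

lemma La_Cons:
  assumes "a \<in> carrier A"
  shows "La a f (k # v) = (\<Sum>x\<le>D. \<alpha> (a \<otimes>\<^bsub>A\<^esub> basis x) k * f (x # v))"
proof -
  have "La a f (k # v) = (\<Sum>x\<le>D. (\<Sum>p\<le>D. \<alpha> a p * sc p x k) * f (x # v))"
    unfolding La_def W.lmul_Cons by (rule W.sum_swap_assoc(2))
  also have "\<dots> = (\<Sum>x\<le>D. \<alpha> (a \<otimes>\<^bsub>A\<^esub> basis x) k * f (x # v))"
    using assms by (intro sum.cong refl) (simp add: \<alpha>_expand_left[of a "basis _"] sc_def)
  finally show ?thesis .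
qed

lemma Ra_snoc:
  assumes "b \<in> carrier A"
  shows "Ra b f (v @ [k]) = (\<Sum>y\<le>D. \<alpha> (basis y \<otimes>\<^bsub>A\<^esub> b) k * f (v @ [y]))"
proof -
  have "Ra b f (v @ [k]) = (\<Sum>y\<le>D. (\<Sum>q\<le>D. \<alpha> b q * sc y q k) * f (v @ [y]))"
    unfolding Ra_def W.rmul_snoc by (rule W.sum_swap_assoc(2))
  also have "\<dots> = (\<Sum>y\<le>D. \<alpha> (basis y \<otimes>\<^bsub>A\<^esub> b) k * f (v @ [y]))"
    using assms by (intro sum.cong refl) (simp add: \<alpha>_expand_right[of "basis _" b] sc_def)
  finally show ?thesis .
qed

lemma \<alpha>_int_multiple:
  assumes "x \<in> carrier A"
  shows "[(n::int)] \<cdot>\<^bsub>A\<^esub> x \<in> carrier A" "\<alpha> ([n] \<cdot>\<^bsub>A\<^esub> x) k = of_int n * \<alpha> x k"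
proof -
  have nat: "[m] \<cdot>\<^bsub>A\<^esub> x \<in> carrier A \<and> \<alpha> ([m] \<cdot>\<^bsub>A\<^esub> x) k = of_nat m * \<alpha> x k" for m :: nat
    by (induction m) (simp_all add: assms \<alpha>_zero \<alpha>_add algebra_simps)
  have eq: "[n] \<cdot>\<^bsub>A\<^esub> x = (if n < 0 then \<ominus>\<^bsub>A\<^esub> ([nat (- n)] \<cdot>\<^bsub>A\<^esub> x) else [nat n] \<cdot>\<^bsub>A\<^esub> x)"
    unfolding add_pow_def int_pow_def2 a_inv_def ..
  show "[n] \<cdot>\<^bsub>A\<^esub> x \<in> carrier A" "\<alpha> ([n] \<cdot>\<^bsub>A\<^esub> x) k = of_int n * \<alpha> x k"
    using nat unfolding eq by (auto simp: \<alpha>_minus of_nat_nat)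
qed

text \<open>The sum inside \<open>env_left_module\<close> and \<open>env_right_module\<close>, taken
  at one representative; h tells how a pair acts.\<close>

definition frag_eval :: "('a \<Rightarrow> 'a \<Rightarrow> 'a) \<Rightarrow> ('a \<times> 'a \<Rightarrow>\<^sub>0 int) \<Rightarrow> 'a"
  where "frag_eval h p = finsum A (\<lambda>(a, b). [Poly_Mapping.lookup p (a, b)] \<cdot>\<^bsub>A\<^esub> h a b) (Poly_Mapping.keys p)"

lemma frag_eval:
  assumes p: "p \<in> PC" and h: "\<And>a b. a \<in> carrier A \<Longrightarrow> b \<in> carrier A \<Longrightarrow> h a b \<in> carrier A"
  shows "frag_eval h p \<in> carrier A" "\<alpha> (frag_eval h p) k = frag_lift (\<lambda>(a, b). \<alpha> (h a b) k) p"
proof -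
  have keys: "a \<in> carrier A" "b \<in> carrier A" if "(a, b) \<in> Poly_Mapping.keys p" for a b using p that by auto
  then have cl: "(\<lambda>(a, b). [Poly_Mapping.lookup p (a, b)] \<cdot>\<^bsub>A\<^esub> h a b) \<in> Poly_Mapping.keys p \<rightarrow> carrier A"
    using \<alpha>_int_multiple(1)[OF h] by auto
  show "frag_eval h p \<in> carrier A" unfolding frag_eval_def by (rule A.finsum_closed[OF cl])
  show "\<alpha> (frag_eval h p) k = frag_lift (\<lambda>(a, b). \<alpha> (h a b) k) p"
    unfolding frag_eval_def frag_lift_def \<alpha>_sum[OF finite_keys cl]
    using keys h \<alpha>_int_multiple(2) by (intro sum.cong refl) auto
qed

text \<open>Embeds A as the functions on words with one letter; its image is the bar module
  \<open>B 0\<close>.\<close>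

definition \<phi> :: "'a \<Rightarrow> nat list \<Rightarrow> 'k field_product"
  where "\<phi> x w = (if length w = 1 then \<alpha> x (hd w) else 0)"

lemma La_\<phi>: "a \<in> carrier A \<Longrightarrow> x \<in> carrier A \<Longrightarrow> La a (\<phi> x) = \<phi> (a \<otimes>\<^bsub>A\<^esub> x)"
proof
  fix w assume a: "a \<in> carrier A" "x \<in> carrier A"
  show "La a (\<phi> x) w = \<phi> (a \<otimes>\<^bsub>A\<^esub> x) w"
  proof (cases w)
    case (Cons k v)
    show ?thesis
      unfolding Cons La_Cons[OF a(1)] using \<alpha>_expand_right[OF a, of k]
      by (auto simp: \<phi>_def mult.commute)
  qed (simp add: La_def W.lmul_def \<phi>_def)
qed

lemma Ra_\<phi>: "b \<in> carrier A \<Longrightarrow> x \<in> carrier A \<Longrightarrow> Ra b (\<phi> x) = \<phi> (x \<otimes>\<^bsub>A\<^esub> b)"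
proof
  fix w assume a: "b \<in> carrier A" "x \<in> carrier A"
  show "Ra b (\<phi> x) w = \<phi> (x \<otimes>\<^bsub>A\<^esub> b) w"
  proof (cases w rule: rev_cases)
    case (snoc v k)
    show ?thesis
      unfolding snoc Ra_snoc[OF a(1)] using \<alpha>_expand_left[OF a(2,1), of k]
      by (cases v) (auto simp: \<phi>_def mult.commute)
  qed (simp add: Ra_def W.rmul_def \<phi>_def)
qed

lemma \<phi>_closed: "x \<in> carrier A \<Longrightarrow> \<phi> x \<in> carrier (B 0)"
  by (auto simp: W.supported_def \<phi>_def unit_\<alpha> W.bar_words_0 length_Suc_conv) (auto simp: \<alpha>_def)

lemma \<phi>_single: "\<phi> x [k] = \<alpha> x k"
  by (simp add: \<phi>_def)

lemma \<phi>_inj: "inj_on \<phi> (carrier A)"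
proof (rule inj_onI)
  fix x y assume xy: "x \<in> carrier A" "y \<in> carrier A" "\<phi> x = \<phi> y"
  have "\<alpha> x k = \<alpha> y k" for k using fun_cong[OF xy(3), of "[k]"] by (simp add: \<phi>_def)
  then show "x = y" using xy by (intro \<alpha>_inject)
qed

lemma frag_lift_act:
  assumes "q \<in> PC" "x \<in> carrier A"
  shows "frag_lift (\<lambda>(a, b). \<alpha> (a \<otimes>\<^bsub>A\<^esub> x \<otimes>\<^bsub>A\<^esub> b) k) q = W.act (\<Psi> q) (\<phi> x) [k]"
  using assms(1)
proof (induction q rule: frag_carrier_induct)
  case zero
  have "W.act (\<Psi> 0) (\<phi> x) [k] = W.act (\<lambda>i j. 0) (\<phi> x) [k]" by (rule W.act_cong) simp
  then show ?case by (simp add: W.act_zero_left)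
next
  case (one a b)
  then have "W.act (\<Psi> (frag_of (a, b))) (\<phi> x) [k] = \<phi> (a \<otimes>\<^bsub>A\<^esub> (x \<otimes>\<^bsub>A\<^esub> b)) [k]"
    using assms(2) by (simp only: act_pair Ra_\<phi> La_\<phi> A.m_closed)
  then show ?case using one assms(2) by (simp only: frag_lift_simps(2) prod.case \<phi>_single A.m_assoc)
next
  case (diff p q)
  then show ?case by (simp only: frag_lift_diff act_\<Psi>_diff)
qed

lemma cl_subset: "p \<in> PC \<Longrightarrow> q \<in> cl p \<Longrightarrow> q \<in> PC"
  unfolding cl_eq nullE_def using T.null_carrier[OF left_module_Aop] frag_carrier_add(1)[of _ "carrier A" "carrier A" p]
  by (auto simp: subset_iff simp del: carrier_free_Abelian_group_iff)

abbreviation Aleft where "Aleft \<equiv> env_left_module A"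
abbreviation Aright where "Aright \<equiv> env_right_module A"

lemma env_simps [simp]:
  "carrier Aleft = carrier A" "\<zero>\<^bsub>Aleft\<^esub> = \<zero>\<^bsub>A\<^esub>" "x \<oplus>\<^bsub>Aleft\<^esub> y = x \<oplus>\<^bsub>A\<^esub> y"
  "carrier Aright = carrier A" "\<zero>\<^bsub>Aright\<^esub> = \<zero>\<^bsub>A\<^esub>" "x \<oplus>\<^bsub>Aright\<^esub> y = x \<oplus>\<^bsub>A\<^esub> y"
  by (simp_all add: env_left_module_def env_right_module_def)

text \<open>The value depends only on the coordinates of the representative, and these are constant
  on a class; so \<open>the_elem\<close> is applied to a singleton.\<close>

lemma env_left_smult:
  assumes p: "p \<in> PC" and x: "x \<in> carrier A"
  shows "cl p \<odot>\<^bsub>Aleft\<^esub> x = frag_eval (\<lambda>a b. a \<otimes>\<^bsub>A\<^esub> x \<otimes>\<^bsub>A\<^esub> b) p"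
proof -
  let ?h = "\<lambda>a b. a \<otimes>\<^bsub>A\<^esub> x \<otimes>\<^bsub>A\<^esub> b"
  have "the_elem (frag_eval ?h ` cl p) = frag_eval ?h p"
  proof (rule the_elem_image_unique)
    show "cl p \<noteq> {}" using self_in_cl by blast
    fix q assume q: "q \<in> cl p"
    have "\<Psi> q = \<Psi> p" using \<Psi>_cl[OF q] by (intro ext)
    with cl_subset[OF p q] show "frag_eval ?h q = frag_eval ?h p"
      using p x by (intro \<alpha>_inject) (simp_all add: frag_eval frag_lift_act del: carrier_free_Abelian_group_iff)
  qed
  then show ?thesis by (simp add: env_left_module_def frag_eval_def)
qed

lemma env_left_smult_\<phi>:
  assumes X: "X \<in> carrier E" and x: "x \<in> carrier A"
  shows "X \<odot>\<^bsub>Aleft\<^esub> x \<in> carrier A \<and> \<phi> (X \<odot>\<^bsub>Aleft\<^esub> x) = X \<odot>\<^bsub>B 0\<^esub> \<phi> x"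
proof -
  obtain p where p: "X = cl p" "p \<in> PC" using X unfolding carrier_E by blast
  have xA: "x \<in> carrier A" by (rule x)
  have s: "X \<odot>\<^bsub>Aleft\<^esub> x = frag_eval (\<lambda>a b. a \<otimes>\<^bsub>A\<^esub> x \<otimes>\<^bsub>A\<^esub> b) p"
    unfolding p(1) by (rule env_left_smult[OF p(2) xA])
  have cl: "X \<odot>\<^bsub>Aleft\<^esub> x \<in> carrier A" unfolding s using p(2) xA by (intro frag_eval) auto
  moreover have "\<phi> (X \<odot>\<^bsub>Aleft\<^esub> x) w = W.act (\<psi> X) (\<phi> x) w" for w
  proof (cases "\<exists>k. w = [k]")
    case True
    then obtain k where "w = [k]" by blast
    then show ?thesis
      using p(2) xA unfolding s unfolding p(1) \<psi>_cl
      by (simp add: \<phi>_single frag_eval(2) frag_lift_act del: carrier_free_Abelian_group_iff)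
  next
    case False
    then have "w \<notin> W.bar_words 0" by (auto simp: W.bar_words_0)
    then show ?thesis
      using False W.supported_0[OF W.supported_act[OF \<phi>_closed[OF xA, simplified]]]
      by (auto simp: \<phi>_def length_Suc_conv)
  qed
  ultimately show ?thesis by auto
qed

lemma left_module_Aleft: "left_module E Aleft"
  by (rule left_module_pullback[OF left_module_B[of 0], of \<phi>])
    (use \<phi>_closed \<phi>_inj env_left_smult_\<phi> in \<open>auto simp: \<phi>_def \<alpha>_add \<alpha>_zero fun_eq_iff simp del: B_simps(4)\<close>)

lemma \<phi>_hom: "\<phi> \<in> lmod_hom E Aleft (B 0)"
  by (rule lmod_homI) (use \<phi>_closed env_left_smult_\<phi> in \<open>auto simp: \<phi>_def \<alpha>_add fun_eq_iff simp del: B_simps(1,4)\<close>)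

lemma \<alpha>_sandwich:
  assumes "b \<in> carrier A" "x \<in> carrier A" "a \<in> carrier A"
  shows "\<alpha> (b \<otimes>\<^bsub>A\<^esub> x \<otimes>\<^bsub>A\<^esub> a) k = (\<Sum>i\<le>D. \<Sum>j\<le>D. \<alpha> a i * \<alpha> b j * \<alpha> (basis j \<otimes>\<^bsub>A\<^esub> x \<otimes>\<^bsub>A\<^esub> basis i) k)"
proof -
  have "\<alpha> (b \<otimes>\<^bsub>A\<^esub> x \<otimes>\<^bsub>A\<^esub> a) k = (\<Sum>i\<le>D. \<alpha> a i * \<alpha> (b \<otimes>\<^bsub>A\<^esub> (x \<otimes>\<^bsub>A\<^esub> basis i)) k)"
    using assms by (subst \<alpha>_expand_right) (auto simp: A.m_assoc)
  also have "\<dots> = (\<Sum>i\<le>D. \<alpha> a i * (\<Sum>j\<le>D. \<alpha> b j * \<alpha> (basis j \<otimes>\<^bsub>A\<^esub> (x \<otimes>\<^bsub>A\<^esub> basis i)) k))"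
    using assms by (intro sum.cong refl arg_cong2[where f = "(*)"] \<alpha>_expand_left) auto
  also have "\<dots> = (\<Sum>i\<le>D. \<Sum>j\<le>D. \<alpha> a i * \<alpha> b j * \<alpha> (basis j \<otimes>\<^bsub>A\<^esub> x \<otimes>\<^bsub>A\<^esub> basis i) k)"
    using assms by (intro sum.cong refl) (simp add: sum_distrib_left mult.assoc A.m_assoc)
  finally show ?thesis .
qed

lemma frag_lift_sandwich:
  assumes "q \<in> PC" "x \<in> carrier A"
  shows "frag_lift (\<lambda>(a, b). \<alpha> (b \<otimes>\<^bsub>A\<^esub> x \<otimes>\<^bsub>A\<^esub> a) k) q
    = (\<Sum>i\<le>D. \<Sum>j\<le>D. \<Psi> q i j * \<alpha> (basis j \<otimes>\<^bsub>A\<^esub> x \<otimes>\<^bsub>A\<^esub> basis i) k)"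
  using assms(1)
  by (induction q rule: frag_carrier_induct)
    (simp_all add: \<alpha>_sandwich[OF _ assms(2)] frag_lift_diff left_diff_distrib sum_subtractf)

lemma env_right_smult:
  assumes p: "p \<in> PC" and x: "x \<in> carrier A"
  shows "cl p \<odot>\<^bsub>Aright\<^esub> x = frag_eval (\<lambda>a b. b \<otimes>\<^bsub>A\<^esub> x \<otimes>\<^bsub>A\<^esub> a) p"
proof -
  let ?h = "\<lambda>a b. b \<otimes>\<^bsub>A\<^esub> x \<otimes>\<^bsub>A\<^esub> a"
  have "the_elem (frag_eval ?h ` cl p) = frag_eval ?h p"
  proof (rule the_elem_image_unique)
    show "cl p \<noteq> {}" using self_in_cl by blast
    fix q assume q: "q \<in> cl p"
    have "\<Psi> q = \<Psi> p" using \<Psi>_cl[OF q] by (intro ext)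
    with cl_subset[OF p q] show "frag_eval ?h q = frag_eval ?h p"
      using p x by (intro \<alpha>_inject) (simp_all add: frag_eval frag_lift_sandwich del: carrier_free_Abelian_group_iff)
  qed
  then show ?thesis by (simp add: env_right_module_def frag_eval_def)
qed

lemma env_right_smult_\<alpha>:
  assumes X: "X \<in> carrier E" and x: "x \<in> carrier A"
  shows "X \<odot>\<^bsub>Aright\<^esub> x \<in> carrier A"
    and "\<alpha> (X \<odot>\<^bsub>Aright\<^esub> x) k = (\<Sum>i\<le>D. \<Sum>j\<le>D. \<psi> X i j * \<alpha> (basis j \<otimes>\<^bsub>A\<^esub> x \<otimes>\<^bsub>A\<^esub> basis i) k)"
proof -
  obtain p where p: "X = cl p" "p \<in> PC" using X unfolding carrier_E by blast
  show "X \<odot>\<^bsub>Aright\<^esub> x \<in> carrier A" unfolding p(1) env_right_smult[OF p(2) x]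
    using p(2) x by (intro frag_eval) auto
  show "\<alpha> (X \<odot>\<^bsub>Aright\<^esub> x) k = (\<Sum>i\<le>D. \<Sum>j\<le>D. \<psi> X i j * \<alpha> (basis j \<otimes>\<^bsub>A\<^esub> x \<otimes>\<^bsub>A\<^esub> basis i) k)"
    unfolding p(1) env_right_smult[OF p(2) x] \<psi>_cl frag_lift_sandwich[OF p(2) x, symmetric]
    using p(2) x by (intro frag_eval) auto
qed

sublocale TA: tensor_left E Aright
  by unfold_locales (auto simp: env_right_smult_\<alpha>)

text \<open>The isomorphism \<open>A \<otimes>\<^sub>E (A \<otimes> V \<otimes> A) = A \<otimes> V\<close>, sending \<open>a \<otimes> (x \<otimes> v \<otimes> y)\<close> to \<open>y a x \<otimes> v\<close>.\<close>

definition \<kappa>0 :: "'a \<Rightarrow> (nat list \<Rightarrow> 'k field_product) \<Rightarrow> nat list \<Rightarrow> 'k field_product"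
  where "\<kappa>0 a f w = (case w of [] \<Rightarrow> 0
    | i # v \<Rightarrow> (\<Sum>x\<le>D. \<Sum>y\<le>D. \<alpha> (basis y \<otimes>\<^bsub>A\<^esub> a \<otimes>\<^bsub>A\<^esub> basis x) i * f (x # v @ [y])))"

lemma \<kappa>0_lin:
  "\<kappa>0 a (\<lambda>w. f w + g w) w = \<kappa>0 a f w + \<kappa>0 a g w"
  "\<kappa>0 a (\<lambda>w. f w - g w) w = \<kappa>0 a f w - \<kappa>0 a g w"
  "\<kappa>0 a (\<lambda>w. 0) w = 0"
  by (simp_all add: \<kappa>0_def distrib_left right_diff_distrib sum.distrib sum_subtractf split: list.split)

lemma \<kappa>0_left:
  assumes "a \<in> carrier A"
  shows "\<kappa>0 a f w = (\<Sum>z\<le>D. \<alpha> a z * \<kappa>0 (basis z) f w)"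
proof (cases w)
  case (Cons i v)
  have e: "\<alpha> (basis y \<otimes>\<^bsub>A\<^esub> a \<otimes>\<^bsub>A\<^esub> basis x) i = (\<Sum>z\<le>D. \<alpha> a z * \<alpha> (basis y \<otimes>\<^bsub>A\<^esub> basis z \<otimes>\<^bsub>A\<^esub> basis x) i)"
    if xy: "x \<le> D" "y \<le> D" for x y
  proof -
    have b: "basis x \<in> carrier A" "basis y \<in> carrier A" using xy by auto
    have "\<alpha> (basis y \<otimes>\<^bsub>A\<^esub> a \<otimes>\<^bsub>A\<^esub> basis x) i = (\<Sum>q\<le>D. \<alpha> (basis y \<otimes>\<^bsub>A\<^esub> a) q * \<alpha> (basis q \<otimes>\<^bsub>A\<^esub> basis x) i)"
      using assms b by (intro \<alpha>_expand_left) auto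
    also have "\<dots> = (\<Sum>q\<le>D. \<alpha> (basis q \<otimes>\<^bsub>A\<^esub> basis x) i * (\<Sum>z\<le>D. \<alpha> (basis y \<otimes>\<^bsub>A\<^esub> basis z) q * \<alpha> a z))"
      using assms b by (intro sum.cong refl) (simp add: \<alpha>_expand_right[of "basis y" a] mult.commute)
    also have "\<dots> = (\<Sum>z\<le>D. (\<Sum>q\<le>D. \<alpha> (basis y \<otimes>\<^bsub>A\<^esub> basis z) q * \<alpha> (basis q \<otimes>\<^bsub>A\<^esub> basis x) i) * \<alpha> a z)"
      by (rule W.sum_swap_assoc(1))
    also have "\<dots> = (\<Sum>z\<le>D. \<alpha> a z * \<alpha> (basis y \<otimes>\<^bsub>A\<^esub> basis z \<otimes>\<^bsub>A\<^esub> basis x) i)"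
      using b by (intro sum.cong refl) (simp add: \<alpha>_expand_left[of "basis y \<otimes>\<^bsub>A\<^esub> basis _" "basis x"] mult.commute)
    finally show ?thesis .
  qed
  have "\<kappa>0 a f w = (\<Sum>x\<le>D. \<Sum>y\<le>D. \<Sum>z\<le>D. \<alpha> a z * (\<alpha> (basis y \<otimes>\<^bsub>A\<^esub> basis z \<otimes>\<^bsub>A\<^esub> basis x) i * f (x # v @ [y])))"
    unfolding \<kappa>0_def Cons list.case by (intro sum.cong refl) (simp add: e sum_distrib_right mult.assoc)
  also have "\<dots> = (\<Sum>z\<le>D. \<Sum>x\<le>D. \<Sum>y\<le>D. \<alpha> a z * (\<alpha> (basis y \<otimes>\<^bsub>A\<^esub> basis z \<otimes>\<^bsub>A\<^esub> basis x) i * f (x # v @ [y])))"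
    by (rule sum_swap_in2[symmetric])
  also have "\<dots> = (\<Sum>z\<le>D. \<alpha> a z * \<kappa>0 (basis z) f w)"
    unfolding \<kappa>0_def Cons list.case by (simp add: sum_distrib_left)
  finally show ?thesis .
qed (simp add: \<kappa>0_def)

lemma \<kappa>0_add_left: "a \<in> carrier A \<Longrightarrow> a' \<in> carrier A \<Longrightarrow> \<kappa>0 (a \<oplus>\<^bsub>A\<^esub> a') f w = \<kappa>0 a f w + \<kappa>0 a' f w"
  by (subst (1 2 3) \<kappa>0_left) (simp_all add: \<alpha>_add distrib_right sum.distrib)

lemma \<kappa>0_pair:
  assumes "a \<in> carrier A" "a1 \<in> carrier A" "b1 \<in> carrier A"
  shows "\<kappa>0 (b1 \<otimes>\<^bsub>A\<^esub> a \<otimes>\<^bsub>A\<^esub> a1) f w = \<kappa>0 a (La a1 (Ra b1 f)) w"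
proof (cases w)
  case (Cons i v)
  have F: "La a1 (Ra b1 f) (x' # v @ [y'])
    = (\<Sum>x\<le>D. \<alpha> (a1 \<otimes>\<^bsub>A\<^esub> basis x) x' * (\<Sum>y\<le>D. \<alpha> (basis y \<otimes>\<^bsub>A\<^esub> b1) y' * f (x # v @ [y])))" for x' y'
    unfolding La_Cons[OF assms(2)] using Ra_snoc[OF assms(3), of f "_ # v" y'] by simp
  have "\<kappa>0 a (La a1 (Ra b1 f)) w = (\<Sum>x\<le>D. \<Sum>y\<le>D. (\<Sum>x'\<le>D. \<Sum>y'\<le>D. \<alpha> (a1 \<otimes>\<^bsub>A\<^esub> basis x) x'
      * \<alpha> (basis y \<otimes>\<^bsub>A\<^esub> b1) y' * \<alpha> (basis y' \<otimes>\<^bsub>A\<^esub> a \<otimes>\<^bsub>A\<^esub> basis x') i) * f (x # v @ [y]))"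
    unfolding \<kappa>0_def Cons list.case F by (rule sum_swap_22)
  also have "\<dots> = (\<Sum>x\<le>D. \<Sum>y\<le>D. \<alpha> ((basis y \<otimes>\<^bsub>A\<^esub> b1) \<otimes>\<^bsub>A\<^esub> a \<otimes>\<^bsub>A\<^esub> (a1 \<otimes>\<^bsub>A\<^esub> basis x)) i * f (x # v @ [y]))"
    using assms by (intro sum.cong refl) (simp add: \<alpha>_sandwich)
  also have "\<dots> = \<kappa>0 (b1 \<otimes>\<^bsub>A\<^esub> a \<otimes>\<^bsub>A\<^esub> a1) f w"
    unfolding \<kappa>0_def Cons list.case using assms by (intro sum.cong refl) (simp add: A.m_assoc)
  finally show ?thesis ..
qed (simp add: \<kappa>0_def)

text \<open>For a pair this is \<open>\<kappa>0_pair\<close>, which rebrackets (y b) a (a' x) for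
  the outer letters x and y. General scalars follow by additivity, with linearity in the left
  argument expressed in coordinates.\<close>

lemma \<kappa>0_balanced:
  assumes X: "X \<in> carrier E" and a: "a \<in> carrier A"
  shows "\<kappa>0 (X \<odot>\<^bsub>Aright\<^esub> a) f w = \<kappa>0 a (W.act (\<psi> X) f) w"
proof -
  obtain p where p: "X = cl p" "p \<in> PC" using X unfolding carrier_E by blast
  have "(\<Sum>z\<le>D. frag_lift (\<lambda>(a1, b1). \<alpha> (b1 \<otimes>\<^bsub>A\<^esub> a \<otimes>\<^bsub>A\<^esub> a1) z) p * \<kappa>0 (basis z) f w) = \<kappa>0 a (W.act (\<Psi> p) f) w"
    using p(2)
  proof (induction p rule: frag_carrier_induct)
    case zero
    have "W.act (\<Psi> 0) f = (\<lambda>w. 0)"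
      using W.act_cong[of "\<Psi> 0" "\<lambda>i j. 0" f] by (auto simp: W.act_zero_left)
    then show ?case by (simp only: frag_lift_simps(1) \<kappa>0_lin mult_zero_left sum.neutral_const)
  next
    case (one a1 b1)
    have "W.act (\<Psi> (frag_of (a1, b1))) f = La a1 (Ra b1 f)" by (intro ext) (rule act_pair)
    moreover have "b1 \<otimes>\<^bsub>A\<^esub> a \<otimes>\<^bsub>A\<^esub> a1 \<in> carrier A" using a one by simp
    ultimately show ?case
      unfolding frag_lift_simps prod.case by (simp only: \<kappa>0_pair[OF a one, symmetric] \<kappa>0_left[symmetric])
  next
    case (diff p q)
    have "W.act (\<Psi> (p - q)) f = (\<lambda>w. W.act (\<Psi> p) f w - W.act (\<Psi> q) f w)"
      by (intro ext) (rule act_\<Psi>_diff)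
    then show ?case using diff.IH by (simp only: \<kappa>0_lin frag_lift_diff left_diff_distrib sum_subtractf)
  qed
  moreover have "X \<odot>\<^bsub>Aright\<^esub> a \<in> carrier A" by (rule env_right_smult_\<alpha>(1)[OF X a])
  ultimately show ?thesis
    using p a \<kappa>0_left[of "X \<odot>\<^bsub>Aright\<^esub> a" f w]
    by (simp add: env_right_smult \<psi>_cl frag_eval(2) del: carrier_free_Abelian_group_iff)
qed

end

lemma sum_swap_in3:
  "(\<Sum>x\<in>A. \<Sum>p\<in>B. \<Sum>q\<in>C. \<Sum>y\<in>Y. g x p q y) = (\<Sum>p\<in>B. \<Sum>q\<in>C. \<Sum>y\<in>Y. \<Sum>x\<in>A. g x p q y)"
  by (subst sum.swap, rule sum.cong[OF refl], rule sum_swap_in2)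

context graded_local_algebra
begin

text \<open>Under the isomorphism 1 \<otimes> b' becomes b. The first face stays the first face
  (\<open>T1\<close>), the inner ones are untouched (\<open>T2\<close>), and the last face turns
  into the cyclic one (\<open>T3\<close>), because the right outer factor has been moved round to
  the front.\<close>

lemma \<kappa>0_bar_d: "W.hoch_d (\<kappa>0 a f) w = \<kappa>0 a (W.bar_d f) w" if a: "a \<in> carrier A"
proof (cases w)
  case (Cons k v)
  define M where "M y x i = \<alpha> (basis y \<otimes>\<^bsub>A\<^esub> a \<otimes>\<^bsub>A\<^esub> basis x) i" for y x i
  have \<kappa>: "\<kappa>0 a g (i # u) = (\<Sum>x\<le>D. \<Sum>y\<le>D. M y x i * g (x # u @ [y]))" for g i u
    by (simp add: \<kappa>0_def M_def)
  \<comment> \<open>Associativity for products of four elements: \<open>I1\<close> joins the first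
    inner letter to the left outer one, \<open>I2\<close> the last inner letter to the right outer
    one.\<close>
  have I1: "(\<Sum>x\<le>D. sc x q k * M y p x) = (\<Sum>x\<le>D. M y x k * sc p q x)"
    if b: "p \<le> D" "q \<le> D" "y \<le> D" for p q y
  proof -
    have c: "basis p \<in> carrier A" "basis q \<in> carrier A" "basis y \<in> carrier A" using b by auto
    have "(\<Sum>x\<le>D. sc x q k * M y p x) = \<alpha> ((basis y \<otimes>\<^bsub>A\<^esub> a \<otimes>\<^bsub>A\<^esub> basis p) \<otimes>\<^bsub>A\<^esub> basis q) k"
      using a b c \<alpha>_expand_left[of "basis y \<otimes>\<^bsub>A\<^esub> a \<otimes>\<^bsub>A\<^esub> basis p" "basis q" k] by (simp add: M_def sc_def mult.commute)
    also have "\<dots> = \<alpha> ((basis y \<otimes>\<^bsub>A\<^esub> a) \<otimes>\<^bsub>A\<^esub> (basis p \<otimes>\<^bsub>A\<^esub> basis q)) k"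
      using a c by (simp add: A.m_assoc)
    also have "\<dots> = (\<Sum>x\<le>D. M y x k * sc p q x)"
      using a b c \<alpha>_expand_right[of "basis y \<otimes>\<^bsub>A\<^esub> a" "basis p \<otimes>\<^bsub>A\<^esub> basis q" k] by (simp add: M_def sc_def mult.commute)
    finally show ?thesis .
  qed
  have I2: "(\<Sum>z\<le>D. sc p z k * M q x z) = (\<Sum>y\<le>D. M y x k * sc p q y)"
    if b: "p \<le> D" "q \<le> D" "x \<le> D" for p q x
  proof -
    have c: "basis p \<in> carrier A" "basis q \<in> carrier A" "basis x \<in> carrier A" using b by auto
    have "(\<Sum>z\<le>D. sc p z k * M q x z) = \<alpha> (basis p \<otimes>\<^bsub>A\<^esub> (basis q \<otimes>\<^bsub>A\<^esub> a \<otimes>\<^bsub>A\<^esub> basis x)) k"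
      using a b c \<alpha>_expand_right[of "basis p" "basis q \<otimes>\<^bsub>A\<^esub> a \<otimes>\<^bsub>A\<^esub> basis x" k] by (simp add: M_def sc_def mult.commute)
    also have "\<dots> = \<alpha> ((basis p \<otimes>\<^bsub>A\<^esub> basis q) \<otimes>\<^bsub>A\<^esub> (a \<otimes>\<^bsub>A\<^esub> basis x)) k"
      using a c by (simp add: A.m_assoc)
    also have "\<dots> = (\<Sum>y\<le>D. \<alpha> (basis p \<otimes>\<^bsub>A\<^esub> basis q) y * \<alpha> (basis y \<otimes>\<^bsub>A\<^esub> (a \<otimes>\<^bsub>A\<^esub> basis x)) k)"
      using a c by (intro \<alpha>_expand_left) auto
    also have "\<dots> = (\<Sum>y\<le>D. M y x k * sc p q y)"
      using a b c by (intro sum.cong refl) (simp add: M_def sc_def A.m_assoc mult.commute)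
    finally show ?thesis .
  qed
  have T1: "W.mul0 (\<kappa>0 a f) k v = (\<Sum>x\<le>D. \<Sum>y\<le>D. M y x k * W.mul0 f x (v @ [y]))"
  proof -
    have "W.mul0 (\<kappa>0 a f) k v = (\<Sum>x\<le>D. \<Sum>q\<le>D. \<Sum>p\<le>D. \<Sum>y\<le>D. sc x q k * M y p x * f (p # q # v @ [y]))"
      by (simp add: W.mul0_def \<kappa> sum_distrib_left mult.assoc)
    also have "\<dots> = (\<Sum>x\<le>D. \<Sum>p\<le>D. \<Sum>q\<le>D. \<Sum>y\<le>D. sc x q k * M y p x * f (p # q # v @ [y]))"
      by (rule sum.cong[OF refl], rule sum.swap)
    also have "\<dots> = (\<Sum>p\<le>D. \<Sum>q\<le>D. \<Sum>y\<le>D. \<Sum>x\<le>D. sc x q k * M y p x * f (p # q # v @ [y]))"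
      by (rule sum_swap_in3)
    also have "\<dots> = (\<Sum>p\<le>D. \<Sum>q\<le>D. \<Sum>y\<le>D. \<Sum>x\<le>D. M y x k * sc p q x * f (p # q # v @ [y]))"
      by (rule sum.cong[OF refl], rule sum.cong[OF refl], rule sum.cong[OF refl]) (simp add: I1 flip: sum_distrib_right)
    also have "\<dots> = (\<Sum>x\<le>D. \<Sum>p\<le>D. \<Sum>q\<le>D. \<Sum>y\<le>D. M y x k * sc p q x * f (p # q # v @ [y]))"
      by (rule sum_swap_in3[symmetric])
    also have "\<dots> = (\<Sum>x\<le>D. \<Sum>y\<le>D. \<Sum>p\<le>D. \<Sum>q\<le>D. M y x k * sc p q x * f (p # q # v @ [y]))"
      by (rule sum.cong[OF refl], rule sum_swap_in2[symmetric])
    finally show ?thesis by (simp add: W.mul0_def sum_distrib_left mult.assoc)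
  qed
  have T3: "(\<Sum>p\<le>D. \<Sum>z\<le>D. sc p z k * \<kappa>0 a f (z # v @ [p]))
    = (\<Sum>x\<le>D. \<Sum>y\<le>D. M y x k * (\<Sum>p\<le>D. \<Sum>q\<le>D. sc p q y * f (x # v @ [p, q])))"
  proof -
    have "(\<Sum>p\<le>D. \<Sum>z\<le>D. sc p z k * \<kappa>0 a f (z # v @ [p]))
      = (\<Sum>p\<le>D. \<Sum>z\<le>D. \<Sum>x\<le>D. \<Sum>q\<le>D. sc p z k * M q x z * f (x # v @ [p, q]))"
      by (simp add: \<kappa> sum_distrib_left mult.assoc)
    also have "\<dots> = (\<Sum>p\<le>D. \<Sum>x\<le>D. \<Sum>q\<le>D. \<Sum>z\<le>D. sc p z k * M q x z * f (x # v @ [p, q]))"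
      by (rule sum.cong[OF refl], rule sum_swap_in2)
    also have "\<dots> = (\<Sum>p\<le>D. \<Sum>x\<le>D. \<Sum>q\<le>D. \<Sum>y\<le>D. M y x k * sc p q y * f (x # v @ [p, q]))"
      by (rule sum.cong[OF refl], rule sum.cong[OF refl], rule sum.cong[OF refl]) (simp add: I2 flip: sum_distrib_right)
    also have "\<dots> = (\<Sum>x\<le>D. \<Sum>p\<le>D. \<Sum>q\<le>D. \<Sum>y\<le>D. M y x k * sc p q y * f (x # v @ [p, q]))"
      by (rule sum.swap)
    also have "\<dots> = (\<Sum>x\<le>D. \<Sum>y\<le>D. \<Sum>p\<le>D. \<Sum>q\<le>D. M y x k * sc p q y * f (x # v @ [p, q]))"
      by (rule sum.cong[OF refl], rule sum_swap_in2[symmetric])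
    finally show ?thesis by (simp add: sum_distrib_left mult.assoc)
  qed
  have T2: "W.bar_d (\<lambda>u. \<kappa>0 a f (k # u)) v = (\<Sum>x\<le>D. \<Sum>y\<le>D. M y x k * W.bar_d (\<lambda>u. f (x # u @ [y])) v)"
    by (simp add: \<kappa> W.bar_d_sum W.bar_d_scale)
  have S: "W.bar_d f (x # v @ [y]) = W.mul0 f x (v @ [y]) - W.bar_d (\<lambda>u. f (x # u @ [y])) v
      - (-1) ^ length v * (\<Sum>p\<le>D. \<Sum>q\<le>D. sc p q y * f (x # v @ [p, q]))" for x y
    by (simp add: W.bar_d_snoc)
  have "\<kappa>0 a (W.bar_d f) w = W.mul0 (\<kappa>0 a f) k v - W.bar_d (\<lambda>u. \<kappa>0 a f (k # u)) v
    - (-1) ^ length v * (\<Sum>p\<le>D. \<Sum>z\<le>D. sc p z k * \<kappa>0 a f (z # v @ [p]))"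
    unfolding T1 T2 T3 unfolding Cons \<kappa> S by (rule sum2_linear)
  then show ?thesis by (simp add: Cons W.hoch_d_def)
qed (simp add: \<kappa>0_def W.hoch_d_def)

section \<open>The isomorphism on arbitrary tensors, and its inverse\<close>

definition HW :: "nat \<Rightarrow> nat list set"
  where "HW n = {i # u | i u. i \<le> D \<and> u \<in> U n}"

lemma unit_\<kappa>0: "a \<in> carrier A \<Longrightarrow> unit * \<kappa>0 a f w = \<kappa>0 a f w"
  by (cases w) (simp_all add: \<kappa>0_def sum_distrib_left unit_\<alpha> flip: mult.assoc)

lemma supported_\<kappa>0:
  assumes a: "a \<in> carrier A" and f: "f \<in> carrier (B (Suc n))"
  shows "W.supported (HW n) (\<kappa>0 a f)"
proof -
  have "\<kappa>0 a f w = 0" if w: "w \<notin> HW n" for w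
  proof (cases w)
    case (Cons i v)
    have "\<alpha> (basis y \<otimes>\<^bsub>A\<^esub> a \<otimes>\<^bsub>A\<^esub> basis x) i * f (x # v @ [y]) = 0" for x y
    proof (cases "i \<le> D")
      case True
      then have "x # v @ [y] \<notin> W.bar_words (Suc n)"
        using w unfolding W.bar_words_Suc by (auto simp: Cons HW_def U_def)
      then show ?thesis using W.supported_0[of "W.bar_words (Suc n)" f] f by simp
    qed (simp add: \<alpha>_def)
    then show ?thesis by (simp add: Cons \<kappa>0_def)
  qed (simp add: \<kappa>0_def)
  then show ?thesis using unit_\<kappa>0[OF a] by (simp add: W.supported_def)
qed

lemma \<kappa>0_\<beta>: "a \<in> carrier A \<Longrightarrow> \<kappa>0 a (\<beta> u) (i # v) = (if v = u then \<alpha> a i else 0)"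
proof -
  assume a: "a \<in> carrier A"
  have "\<kappa>0 a (\<beta> u) (i # v) = (\<Sum>x\<le>D. if x = 0 then (\<Sum>y\<le>D. if y = 0 then (if v = u then \<alpha> a i else 0) else 0) else 0)"
    unfolding \<kappa>0_def list.case
  proof (rule sum.cong[OF refl])
    fix x assume "x \<in> {..D}"
    have "\<alpha> (basis y \<otimes>\<^bsub>A\<^esub> a \<otimes>\<^bsub>A\<^esub> basis x) i * \<beta> u (x # v @ [y])
      = (if x = 0 \<and> y = 0 \<and> v = u then \<alpha> a i else 0)" for y
      using a unit_\<alpha>[OF a, of i] by (simp add: \<beta>_def W.delta_def basis(1) mult.commute)
    then show "(\<Sum>y\<le>D. \<alpha> (basis y \<otimes>\<^bsub>A\<^esub> a \<otimes>\<^bsub>A\<^esub> basis x) i * \<beta> u (x # v @ [y]))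
      = (if x = 0 then (\<Sum>y\<le>D. if y = 0 then (if v = u then \<alpha> a i else 0) else 0) else 0)"
      by simp
  qed
  then show ?thesis by simp
qed

text \<open>The additive extension of \<open>\<kappa>0\<close>, for a module that is identified with
  a bar module through j. In the application j undoes the injection into the universe.\<close>

definition \<kappa> :: "('u \<Rightarrow> nat list \<Rightarrow> 'k field_product) \<Rightarrow> ('a \<times> 'u \<Rightarrow>\<^sub>0 int) \<Rightarrow> nat list \<Rightarrow> 'k field_product"
  where "\<kappa> j p w = frag_lift (\<lambda>(a, y). \<kappa>0 a (j y) w) p"

lemma \<kappa>_simps [simp]:
  "\<kappa> j 0 w = 0" "\<kappa> j (frag_of (a, y)) w = \<kappa>0 a (j y) w"
  "\<kappa> j (p + q) w = \<kappa> j p w + \<kappa> j q w" "\<kappa> j (p - q) w = \<kappa> j p w - \<kappa> j q w" "\<kappa> j (- p) w = - \<kappa> j p w"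
  by (simp_all add: \<kappa>_def frag_lift_add frag_lift_diff)

lemma \<kappa>_sum: "\<kappa> j (\<Sum>i\<in>I. p i) w = (\<Sum>i\<in>I. \<kappa> j (p i) w)"
  by (induction I rule: infinite_finite_induct) simp_all

lemma \<kappa>_null:
  assumes N: "left_module E N" and j: "j \<in> lmod_hom E N (B (Suc n))" and p: "p \<in> tensor_null E Aright N"
  shows "\<kappa> j p w = 0"
  using N p
proof (induction rule: TA.null_induct)
  case (rel p)
  note jD = lmod_homD[OF j]
  from rel consider a a' y where "p = frag_of (a \<oplus>\<^bsub>A\<^esub> a', y) - frag_of (a, y) - frag_of (a', y)" "a \<in> carrier A" "a' \<in> carrier A"
    | a y y' where "p = frag_of (a, y \<oplus>\<^bsub>N\<^esub> y') - frag_of (a, y) - frag_of (a, y')" "y \<in> carrier N" "y' \<in> carrier N"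
    | X a y where "p = frag_of (X \<odot>\<^bsub>Aright\<^esub> a, y) - frag_of (a, X \<odot>\<^bsub>N\<^esub> y)" "X \<in> carrier E" "a \<in> carrier A" "y \<in> carrier N"
    unfolding tensor_rels_def by auto
  then show ?case
  proof cases
    case 1
    then show ?thesis by (simp add: \<kappa>0_add_left)
  next
    case 2
    then show ?thesis by (simp add: jD(2) \<kappa>0_lin)
  next
    case 3
    then show ?thesis by (simp add: jD(3) \<kappa>0_balanced)
  qed
qed simp_all

lemma \<kappa>_frag_map:
  assumes p: "p \<in> frag_carrier (carrier A) S" and d: "\<And>y. y \<in> S \<Longrightarrow> j (d y) = W.bar_d (j' y)"
  shows "\<kappa> j (frag_map d p) w = W.hoch_d (\<kappa> j' p) w"
  using p
proof (induction arbitrary: w rule: frag_carrier_induct)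
  case zero
  have "\<kappa> j' 0 = (\<lambda>w. 0)" by (rule ext) simp
  then show ?case by (simp only: frag_map_simps \<kappa>_simps W.hoch_d_zero)
next
  case (one a y)
  have "\<kappa> j' (frag_of (a, y)) = \<kappa>0 a (j' y)" by (rule ext) simp
  then show ?case using one by (simp only: frag_map_simps \<kappa>_simps d \<kappa>0_bar_d)
next
  case (diff p q)
  have "\<kappa> j' (p - q) = (\<lambda>w. \<kappa> j' p w - \<kappa> j' q w)" by (rule ext) simp
  then show ?case using diff.IH by (simp only: frag_map_simps \<kappa>_simps W.hoch_d_diff)
qed

lemma supported_\<kappa>:
  assumes "p \<in> frag_carrier (carrier A) S" "\<And>y. y \<in> S \<Longrightarrow> j y \<in> carrier (B (Suc n))"
  shows "W.supported (HW n) (\<kappa> j p)"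
  using assms(1)
proof (induction rule: frag_carrier_induct)
  case zero
  have "\<kappa> j 0 = (\<lambda>w. 0)" by (rule ext) simp
  then show ?case by (simp only: W.supported_zero)
next
  case (one a y)
  have "\<kappa> j (frag_of (a, y)) = \<kappa>0 a (j y)" by (rule ext) simp
  then show ?case using supported_\<kappa>0[OF one(1) assms(2)[OF one(2)]] by (simp only:)
next
  case (diff p q)
  have "\<kappa> j (p - q) = (\<lambda>w. \<kappa> j p w - \<kappa> j q w)" by (rule ext) simp
  then show ?case using W.supported_diff[OF diff.IH] by (simp only:)
qed

text \<open>The inverse of \<open>\<kappa>\<close> on representatives, with one simple tensor for
  each free generator.\<close>

definition \<zeta> :: "nat \<Rightarrow> ((nat list \<Rightarrow> 'k field_product) \<Rightarrow> 'u) \<Rightarrow> (nat list \<Rightarrow> 'k field_product) \<Rightarrow> 'a \<times> 'u \<Rightarrow>\<^sub>0 int"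
  where "\<zeta> n i g = (\<Sum>u\<in>U n. frag_of (el (\<lambda>k. g (k # u)), i (\<beta> u)))"

lemma el_diff: "el (\<lambda>k. f k - g k) \<oplus>\<^bsub>A\<^esub> el g = el f"
  by (rule \<alpha>_inject) (simp_all add: \<alpha>_add \<alpha>_el right_diff_distrib)

lemma el_zero: "el (\<lambda>k. 0) = \<zero>\<^bsub>A\<^esub>"
  by (rule \<alpha>_inject) (simp_all add: \<alpha>_zero \<alpha>_el)

lemma abelian_group_Aright: "abelian_group Aright"
  by (rule abelian_groupI) (auto simp: A.a_ac intro!: bexI[of _ "\<ominus>\<^bsub>A\<^esub> _"] A.l_neg)

lemma el_\<kappa>0:
  assumes a: "a \<in> carrier A" and f: "f \<in> carrier (B n)"
  shows "el (\<lambda>k. \<kappa>0 a f (k # u)) = co f u \<odot>\<^bsub>Aright\<^esub> a"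
proof (rule \<alpha>_inject)
  fix k assume k: "k \<le> D"
  have "\<alpha> (co f u \<odot>\<^bsub>Aright\<^esub> a) k = \<kappa>0 a f (k # u)"
    unfolding env_right_smult_\<alpha>(2)[OF co_closed a]
    using f by (simp add: \<kappa>0_def \<psi>_co[of "W.bar_words n"] mult.commute)
  then show "\<alpha> (el (\<lambda>k. \<kappa>0 a f (k # u))) k = \<alpha> (co f u \<odot>\<^bsub>Aright\<^esub> a) k"
    using k by (simp add: \<alpha>_el unit_\<kappa>0[OF a])
qed (use env_right_smult_\<alpha>(1)[OF co_closed a] in auto)

text \<open>Expand y in the free generators and move the coefficients across the tensor sign. In
  particular a tensor on which \<open>\<kappa>\<close> vanishes is null.\<close>

lemma \<zeta>_retract:
  assumes N: "left_module E N" and i: "i \<in> lmod_hom E (B (Suc n)) N" and j: "j \<in> lmod_hom E N (B (Suc n))"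
    and ij: "\<And>y. y \<in> carrier N \<Longrightarrow> i (j y) = y"
    and p: "p \<in> frag_carrier (carrier A) (carrier N)"
  shows "p - \<zeta> n i (\<kappa> j p) \<in> tensor_null E Aright N"
  using p
proof (induction rule: frag_carrier_induct)
  case zero
  have "\<zeta> n i (\<kappa> j 0) \<in> tensor_null E Aright N"
    unfolding \<zeta>_def \<kappa>_simps el_zero env_simps(5)[symmetric]
    by (intro TA.null_sum TA.null_zero_left N abelian_group_Aright lmod_homD(1)[OF i] \<beta>_closed)
  then show ?case using TA.null_minus[OF N] by (simp only: diff_0)
next
  case (one a y)
  have jy: "j y \<in> carrier (B (Suc n))" by (rule lmod_homD(1)[OF j one(2)])
  have i\<beta>: "i (\<beta> u) \<in> carrier N" if "u \<in> U n" for u by (rule lmod_homD(1)[OF i \<beta>_closed[OF that]])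
  have cl: "co (j y) u \<odot>\<^bsub>B (Suc n)\<^esub> \<beta> u \<in> carrier (B (Suc n))" if "u \<in> U n" for u
    by (rule left_module.smult_closed[OF left_module_B co_closed \<beta>_closed[OF that]])
  have cN: "co (j y) u \<odot>\<^bsub>N\<^esub> i (\<beta> u) \<in> carrier N" if "u \<in> U n" for u
    by (rule left_module.smult_closed[OF N co_closed i\<beta>[OF that]])
  interpret N: left_module E N by (rule N)
  have "y = i (\<Oplus>\<^bsub>B (Suc n)\<^esub>u\<in>U n. co (j y) u \<odot>\<^bsub>B (Suc n)\<^esub> \<beta> u)"
    using ij[OF one(2)] expand_\<beta>[OF jy] by simp
  also have "\<dots> = (\<Oplus>\<^bsub>N\<^esub>u\<in>U n. i (co (j y) u \<odot>\<^bsub>B (Suc n)\<^esub> \<beta> u))"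
    by (rule lmod_hom_sum[OF left_module_B N i finite_U]) (use cl in blast)
  also have "\<dots> = (\<Oplus>\<^bsub>N\<^esub>u\<in>U n. co (j y) u \<odot>\<^bsub>N\<^esub> i (\<beta> u))"
    by (rule N.M.finsum_cong') (use cN lmod_homD(3)[OF i co_closed \<beta>_closed] in auto)
  finally have y: "y = (\<Oplus>\<^bsub>N\<^esub>u\<in>U n. co (j y) u \<odot>\<^bsub>N\<^esub> i (\<beta> u))" .
  have 1: "frag_of (a, y) - (\<Sum>u\<in>U n. frag_of (a, co (j y) u \<odot>\<^bsub>N\<^esub> i (\<beta> u))) \<in> tensor_null E Aright N"
    using TA.null_sum_right[OF N, of a "U n" "\<lambda>u. co (j y) u \<odot>\<^bsub>N\<^esub> i (\<beta> u)"] one(1) cN unfolding y[symmetric] by auto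
  have "(\<Sum>u\<in>U n. frag_of (co (j y) u \<odot>\<^bsub>Aright\<^esub> a, i (\<beta> u)) - frag_of (a, co (j y) u \<odot>\<^bsub>N\<^esub> i (\<beta> u))) \<in> tensor_null E Aright N"
    by (intro TA.null_sum TA.null_rel_intros(3) co_closed i\<beta>) (use one in auto)
  then have 2: "(\<Sum>u\<in>U n. frag_of (co (j y) u \<odot>\<^bsub>Aright\<^esub> a, i (\<beta> u))) - (\<Sum>u\<in>U n. frag_of (a, co (j y) u \<odot>\<^bsub>N\<^esub> i (\<beta> u))) \<in> tensor_null E Aright N"
    by (simp only: sum_subtractf)
  have "\<zeta> n i (\<kappa> j (frag_of (a, y))) = (\<Sum>u\<in>U n. frag_of (co (j y) u \<odot>\<^bsub>Aright\<^esub> a, i (\<beta> u)))"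
    unfolding \<zeta>_def \<kappa>_simps el_\<kappa>0[OF one(1) jy] ..
  moreover have "frag_of (a, y) - (\<Sum>u\<in>U n. frag_of (co (j y) u \<odot>\<^bsub>Aright\<^esub> a, i (\<beta> u))) \<in> tensor_null E Aright N"
    using TA.null_diff[OF N 1 2] by simp
  ultimately show ?case by (simp only:)
next
  case (diff p q)
  have el: "frag_of (el f, y) - frag_of (el (\<lambda>k. f k - g k), y) - frag_of (el g, y) \<in> tensor_null E Aright N"
    if "y \<in> carrier N" for f g y
    using TA.null_rel_intros(1)[of "el (\<lambda>k. f k - g k)" "el g" y N] that by (simp add: el_diff)
  have "\<zeta> n i (\<kappa> j p) - \<zeta> n i (\<kappa> j (p - q)) - \<zeta> n i (\<kappa> j q) \<in> tensor_null E Aright N"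
    unfolding \<zeta>_def sum_subtractf[symmetric] \<kappa>_simps
    by (intro TA.null_sum el lmod_homD(1)[OF i \<beta>_closed])
  from TA.null_add[OF TA.null_diff[OF N diff.IH] this]
  have "p - \<zeta> n i (\<kappa> j p) - (q - \<zeta> n i (\<kappa> j q)) +
      (\<zeta> n i (\<kappa> j p) - \<zeta> n i (\<kappa> j (p - q)) - \<zeta> n i (\<kappa> j q)) \<in> tensor_null E Aright N" .
  moreover have "x - a - (y - b) + (a - c - b) = x - y - c" for x y a b c :: "'a \<times> 'b \<Rightarrow>\<^sub>0 int"
    by simp
  ultimately show ?case by (simp only:)
qed

lemma \<kappa>_\<zeta>:
  assumes g: "W.supported (HW n) g" and ji: "\<And>u. u \<in> U n \<Longrightarrow> j (i (\<beta> u)) = \<beta> u"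
  shows "\<kappa> j (\<zeta> n i g) = g"
proof
  fix w
  have "\<kappa> j (\<zeta> n i g) w = (\<Sum>u\<in>U n. \<kappa>0 (el (\<lambda>k. g (k # u))) (\<beta> u) w)"
    unfolding \<zeta>_def \<kappa>_sum by (rule sum.cong) (simp_all add: ji)
  also have "\<dots> = g w"
  proof (cases w)
    case Nil
    then show ?thesis using W.supported_0[OF g, of w] by (simp add: \<kappa>0_def HW_def)
  next
    case (Cons k v)
    have "(\<Sum>u\<in>U n. \<kappa>0 (el (\<lambda>k. g (k # u))) (\<beta> u) w) = (\<Sum>u\<in>U n. if v = u then (if k \<le> D then g w else 0) else 0)"
      by (rule sum.cong) (simp_all add: Cons \<kappa>0_\<beta> \<alpha>_el W.supported_e[OF g])
    then show ?thesis using W.supported_0[OF g, of w] by (auto simp: Cons HW_def)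
  qed
  finally show "\<kappa> j (\<zeta> n i g) w = g w" .
qed

lemma \<zeta>_closed: "i \<in> lmod_hom E (B (Suc n)) N \<Longrightarrow> \<zeta> n i g \<in> frag_carrier (carrier A) (carrier N)"
proof -
  assume i: "i \<in> lmod_hom E (B (Suc n)) N"
  have "finite S \<Longrightarrow> S \<subseteq> U n \<Longrightarrow> (\<Sum>u\<in>S. frag_of (el (\<lambda>k. g (k # u)), i (\<beta> u))) \<in> frag_carrier (carrier A) (carrier N)" for S
  proof (induction S rule: finite_induct)
    case (insert u S)
    then have "frag_of (el (\<lambda>k. g (k # u)), i (\<beta> u)) \<in> frag_carrier (carrier A) (carrier N)"
      using lmod_homD(1)[OF i \<beta>_closed, of u] by auto
    then show ?case
      unfolding sum.insert[OF insert.hyps] using insert.prems by (intro frag_carrier_add(1) insert.IH) auto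
  qed (simp only: sum.empty frag_carrier_add)
  from this[OF finite_U subset_refl] show ?thesis unfolding \<zeta>_def .
qed

end

lemma resolution_of_projective_resolution:
  "projective_resolution R X P d e \<Longrightarrow> left_module R X \<Longrightarrow> carrier X \<lesssim> (UNIV :: 'u set)
    \<Longrightarrow> resolution R X (P :: nat \<Rightarrow> ('r, 'u) module) d e"
  by (rule resolution.intro)

context graded_local_algebra
begin

section \<open>Cardinalities, and the bar resolution in the universe\<close>

lemma infinite_K: "infinite (carrier K)"
proof
  assume "finite (carrier K)"
  moreover have "inj (\<lambda>n. pr (of_nat n * unit))"
  proof (rule linorder_injI)
    fix m n :: nat assume mn: "m < n"
    show "pr (of_nat m * unit) \<noteq> pr (of_nat n * unit)"
    proof
      assume "pr (of_nat m * unit) = pr (of_nat n * unit)"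
      then have "unit * (of_nat m * unit) = unit * (of_nat n * unit)" using inj_pr by metis
      then have "of_nat m * unit = of_nat n * unit" by (simp add: W.e_idem mult.left_commute)
      then have "of_nat (n - m) * unit = 0" using mn by (simp add: of_nat_diff left_diff_distrib)
      then show False using unit_of_nat[of "n - m"] mn by simp
    qed
  qed
  ultimately show False using finite_imageD[of "\<lambda>n. pr (of_nat n * unit)" UNIV]
    by (metis finite_subset image_subset_iff infinite_UNIV_nat pr_closed)
qed

lemma lists_K_lepoll: "lists (carrier K) \<lesssim> carrier K"
  using card_of_lists_infinite[OF infinite_K] by (simp add: eqpoll_imp_lepoll eqpoll_iff_card_of_ordIso)

lemma K_lepoll_A: "carrier K \<lesssim> carrier A"
  unfolding lepoll_def
proof (intro exI conjI)
  show "inj_on (\<lambda>c. c \<odot>\<^bsub>A\<^esub> \<one>\<^bsub>A\<^esub>) (carrier K)"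
  proof (rule inj_onI)
    fix c c' assume c: "c \<in> carrier K" "c' \<in> carrier K" "c \<odot>\<^bsub>A\<^esub> \<one>\<^bsub>A\<^esub> = c' \<odot>\<^bsub>A\<^esub> \<one>\<^bsub>A\<^esub>"
    have "\<iota> c * unit = \<iota> c' * unit"
      using \<alpha>_smult[OF A.one_closed c(1), of 0] \<alpha>_smult[OF A.one_closed c(2), of 0] c(3) by (simp add: \<alpha>_one)
    then show "c = c'" using c unit_inj inj_inject by (metis mult.commute)
  qed
qed auto

text \<open>An element of a bar module is coded by its finitely many coefficients, a list of
  scalars, and over an infinite field there are no more lists than scalars.\<close>

lemma B_lepoll: "carrier A \<lesssim> (UNIV :: 'u set) \<Longrightarrow> carrier (B n) \<lesssim> (UNIV :: 'u set)"
proof -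
  assume univ: "carrier A \<lesssim> (UNIV :: 'u set)"
  obtain ws where ws: "set ws = W.bar_words n" using finite_list[OF W.finite_bar_words] by blast
  have "carrier (B n) \<lesssim> lists (carrier K)"
    unfolding lepoll_def
  proof (intro exI conjI)
    show "inj_on (\<lambda>f. map (\<lambda>w. pr (f w)) ws) (carrier (B n))"
    proof (rule inj_onI, rule ext)
      fix f g w assume fg: "f \<in> carrier (B n)" "g \<in> carrier (B n)"
        and eq: "map (\<lambda>w. pr (f w)) ws = map (\<lambda>w. pr (g w)) ws"
      show "f w = g w"
      proof (cases "w \<in> W.bar_words n")
        case True
        then have "\<iota> (pr (f w)) = \<iota> (pr (g w))" using eq ws by simp
        then show ?thesis using fg by (simp add: inj_pr W.supported_e)
      next
        case False
        have "f w = 0" "g w = 0" by (rule W.supported_0[OF _ False], use fg in simp)+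
        then show ?thesis by simp
      qed
    qed
  qed auto
  then show ?thesis using lists_K_lepoll K_lepoll_A univ by (blast intro: lepoll_trans)
qed

definition \<eta> :: "(nat list \<Rightarrow> 'k field_product) \<Rightarrow> 'a"
  where "\<eta> f = el (\<lambda>k. f [k])"

lemma \<phi>_\<eta>: "f \<in> carrier (B 0) \<Longrightarrow> \<phi> (\<eta> f) = f"
proof
  fix w assume f: "f \<in> carrier (B 0)"
  then show "\<phi> (\<eta> f) w = f w"
    using W.supported_0[of "W.bar_words 0" f w] W.supported_e[of "W.bar_words 0" f w]
    by (auto simp: \<eta>_def \<phi>_def \<alpha>_el W.bar_words_0 length_Suc_conv)
qed

lemma \<eta>_\<phi>: "x \<in> carrier A \<Longrightarrow> \<eta> (\<phi> x) = x"
  unfolding \<eta>_def \<phi>_single by (rule el_\<alpha>)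

lemma \<eta>_closed: "\<eta> f \<in> carrier A"
  by (simp add: \<eta>_def)

lemma \<eta>_hom: "\<eta> \<in> lmod_hom E (B 0) Aleft"
proof (rule lmod_homI)
  fix f g assume f: "f \<in> carrier (B 0)" and g: "g \<in> carrier (B 0)"
  have "\<phi> (\<eta> f \<oplus>\<^bsub>Aleft\<^esub> \<eta> g) = f \<oplus>\<^bsub>B 0\<^esub> g"
    using lmod_homD(2)[OF \<phi>_hom, of "\<eta> f" "\<eta> g"] \<phi>_\<eta>[OF f] \<phi>_\<eta>[OF g] \<eta>_closed by simp
  moreover have "\<eta> f \<oplus>\<^bsub>Aleft\<^esub> \<eta> g \<in> carrier A" using \<eta>_closed by simp
  ultimately show "\<eta> (f \<oplus>\<^bsub>B 0\<^esub> g) = \<eta> f \<oplus>\<^bsub>Aleft\<^esub> \<eta> g" using \<eta>_\<phi> by metis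
next
  fix X f assume X: "X \<in> carrier E" and f: "f \<in> carrier (B 0)"
  have "\<phi> (X \<odot>\<^bsub>Aleft\<^esub> \<eta> f) = X \<odot>\<^bsub>B 0\<^esub> f" "X \<odot>\<^bsub>Aleft\<^esub> \<eta> f \<in> carrier A"
    using env_left_smult_\<phi>[OF X \<eta>_closed[of f]] \<phi>_\<eta>[OF f] by simp_all
  then show "\<eta> (X \<odot>\<^bsub>B 0\<^esub> f) = X \<odot>\<^bsub>Aleft\<^esub> \<eta> f" using \<eta>_\<phi> by metis
qed (simp add: \<eta>_closed)

lemma \<eta>_eq_zero: "f \<in> carrier (B 0) \<Longrightarrow> \<eta> f = \<zero>\<^bsub>A\<^esub> \<longleftrightarrow> f = (\<lambda>w. 0)"
proof -
  assume f: "f \<in> carrier (B 0)"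
  have "\<phi> \<zero>\<^bsub>A\<^esub> = (\<lambda>w. 0)" by (auto simp: \<phi>_def \<alpha>_zero)
  then show ?thesis using \<phi>_\<eta>[OF f] \<eta>_\<phi>[OF A.zero_closed] by metis
qed

text \<open>Exactness comes from the contraction \<open>bar_contract\<close>. Each degree has its
  own injection into the universe, and the differentials are conjugated by them.\<close>

lemma bar_resolution:
  fixes J :: "nat \<Rightarrow> (nat list \<Rightarrow> 'k field_product) \<Rightarrow> 'u"
  assumes J: "\<And>n. inj_on (J n) (carrier (B (Suc n)))"
  defines "j \<equiv> \<lambda>n. inv_into (carrier (B (Suc n))) (J n)"
  shows "projective_resolution E Aleft (\<lambda>n. transport_module (J n) (B (Suc n)))
    (\<lambda>n y. J n (W.bar_d (j (Suc n) y))) (\<lambda>y. \<eta> (W.bar_d (j 0 y)))"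
proof -
  let ?P = "\<lambda>n. transport_module (J n) (B (Suc n)) :: (_, 'u) module"
  let ?d = "\<lambda>n y. J n (W.bar_d (j (Suc n) y))"
  have jJ: "j n (J n f) = f" if "f \<in> carrier (B (Suc n))" for n f
    unfolding j_def using inv_into_f_f[OF J that] .
  have d: "W.bar_d f \<in> carrier (B n)" if "f \<in> carrier (B (Suc n))" for f n
    by (rule lmod_homD(1)[OF bar_d_hom that])
  have J0: "J n f = J n (\<lambda>w. 0) \<longleftrightarrow> f = (\<lambda>w. 0)" if "f \<in> carrier (B (Suc n))" for n f
    by (rule inj_on_eq_iff[OF J that]) (simp add: W.supported_zero)
  have dd: "W.bar_d (W.bar_d f) = (\<lambda>w. 0)" for f by (intro ext W.bar_d_bar_d)
  have exact: "W.bar_d ` carrier (B (Suc (Suc n))) = {f \<in> carrier (B (Suc n)). W.bar_d f = (\<lambda>w. 0)}" for n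
  proof
    show "{f \<in> carrier (B (Suc n)). W.bar_d f = (\<lambda>w. 0)} \<subseteq> W.bar_d ` carrier (B (Suc (Suc n)))"
      using W.bar_contract_homotopy W.supported_bar_contract by (auto intro!: image_eqI[OF sym])
  qed (use d dd in auto)
  have car: "carrier (?P n) = J n ` carrier (B (Suc n))" for n by (simp only: transport_module_simps)
  have dJ: "?d n (J (Suc n) f) = J n (W.bar_d f)" if "f \<in> carrier (B (Suc (Suc n)))" for n f
    using jJ[OF that] by simp
  have im: "?d n ` carrier (?P (Suc n)) = J n ` {f \<in> carrier (B (Suc n)). W.bar_d f = (\<lambda>w. 0)}" for n
  proof -
    have "?d n ` carrier (?P (Suc n)) = (\<lambda>f. J n (W.bar_d f)) ` carrier (B (Suc (Suc n)))"
      unfolding car image_image by (rule image_cong[OF refl dJ])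
    then show ?thesis by (simp only: exact[symmetric] image_image)
  qed
  show ?thesis
    unfolding projective_resolution_def
  proof (intro conjI allI)
    show "projective_module E (?P n)" for n by (rule projective_B[OF J])
    show "?d n \<in> lmod_hom E (?P (Suc n)) (?P n)" for n
      unfolding j_def
      by (rule lmod_hom_comp[OF lmod_hom_comp[OF transport_hom_inv[OF left_module_B J] bar_d_hom] transport_hom[OF J]])
    show "(\<lambda>y. \<eta> (W.bar_d (j 0 y))) \<in> lmod_hom E (?P 0) Aleft"
      unfolding j_def
      by (rule lmod_hom_comp[OF lmod_hom_comp[OF transport_hom_inv[OF left_module_B J] bar_d_hom] \<eta>_hom])
    show "(\<lambda>y. \<eta> (W.bar_d (j 0 y))) ` carrier (?P 0) = carrier Aleft"
    proof
      show "carrier Aleft \<subseteq> (\<lambda>y. \<eta> (W.bar_d (j 0 y))) ` carrier (?P 0)"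
      proof
        fix x assume x: "x \<in> carrier Aleft"
        obtain g where g: "g \<in> carrier (B (Suc 0))" "W.bar_d g = \<phi> x"
          using W.bar_d_surj[of "\<phi> x"] \<phi>_closed[of x] x by auto
        then have "x = \<eta> (W.bar_d (j 0 (J 0 g)))" using jJ[OF g(1)] \<eta>_\<phi> x by simp
        moreover have "J 0 g \<in> carrier (?P 0)" unfolding car using g(1) by (rule imageI)
        ultimately show "x \<in> (\<lambda>y. \<eta> (W.bar_d (j 0 y))) ` carrier (?P 0)" by blast
      qed
    qed (auto simp: \<eta>_closed)
    show "?d 0 ` carrier (?P 1) = {y \<in> carrier (?P 0). \<eta> (W.bar_d (j 0 y)) = \<zero>\<^bsub>Aleft\<^esub>}"
    proof -
      have "{y \<in> carrier (?P 0). \<eta> (W.bar_d (j 0 y)) = \<zero>\<^bsub>Aleft\<^esub>}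
        = J 0 ` {f \<in> carrier (B (Suc 0)). \<eta> (W.bar_d (j 0 (J 0 f))) = \<zero>\<^bsub>A\<^esub>}"
        unfolding car by auto
      also have "{f \<in> carrier (B (Suc 0)). \<eta> (W.bar_d (j 0 (J 0 f))) = \<zero>\<^bsub>A\<^esub>}
        = {f \<in> carrier (B (Suc 0)). W.bar_d f = (\<lambda>w. 0)}"
        using jJ \<eta>_eq_zero[OF d] by (intro Collect_cong conj_cong refl) (simp only:)
      finally show ?thesis using im[of 0] by simp
    qed
    show "?d (Suc n) ` carrier (?P (Suc (Suc n))) = {y \<in> carrier (?P (Suc n)). ?d n y = \<zero>\<^bsub>?P n\<^esub>}" for n
    proof -
      have "{y \<in> carrier (?P (Suc n)). ?d n y = \<zero>\<^bsub>?P n\<^esub>}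
        = J (Suc n) ` {f \<in> carrier (B (Suc (Suc n))). ?d n (J (Suc n) f) = J n (\<lambda>w. 0)}"
        unfolding car by (auto simp: transport_module_simps)
      also have "{f \<in> carrier (B (Suc (Suc n))). ?d n (J (Suc n) f) = J n (\<lambda>w. 0)}
        = {f \<in> carrier (B (Suc (Suc n))). W.bar_d f = (\<lambda>w. 0)}"
        using dJ J0[OF d] by (intro Collect_cong conj_cong refl) (simp only:)
      finally show ?thesis using im[of "Suc n"] by simp
    qed
  qed
qed

text \<open>\<open>Tor\<close> uses a resolution of unknown shape. \<open>exact_transfer\<close>
  moves its vanishing to the bar resolution, where \<open>\<kappa>\<close> and
  \<open>\<zeta>\<close> translate between tensors and Hochschild chains.\<close>

lemma hoch_exact:
  assumes univ: "carrier A \<lesssim> (UNIV :: 'u set)" and triv: "trivial_group (HH TYPE('u) K A (Suc n))"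
    and z: "W.supported (HW (Suc n)) z" and dz: "W.hoch_d z = (\<lambda>w. 0)"
  obtains y where "W.supported (HW (Suc (Suc n))) y" "W.hoch_d y = z"
proof -
  have "\<forall>n. \<exists>J :: _ \<Rightarrow> 'u. inj_on J (carrier (B (Suc n)))"
    using B_lepoll[OF univ] unfolding lepoll_def by blast
  then obtain J :: "nat \<Rightarrow> (nat list \<Rightarrow> 'k field_product) \<Rightarrow> 'u"
    where J: "\<And>n. inj_on (J n) (carrier (B (Suc n)))" by metis
  define j where "j n = inv_into (carrier (B (Suc n))) (J n)" for n
  define P where "P n = (transport_module (J n) (B (Suc n)) :: (_, 'u) module)" for n
  define d where "d = (\<lambda>n y. J n (W.bar_d (j (Suc n) y)))"
  define e where "e = (\<lambda>y. \<eta> (W.bar_d (j 0 y)))"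
  have res: "projective_resolution E Aleft P d e"
    using bar_resolution[OF J] unfolding P_def[abs_def] d_def e_def j_def .
  \<comment> \<open>The very resolution picked in the definition of \<open>Tor\<close>. Since the
    bar resolution exists in the universe, the choice does yield a resolution.\<close>
  define t where "t = (SOME (P, d, e). projective_resolution E Aleft
    (P :: nat \<Rightarrow> (_, 'u) module) (d :: nat \<Rightarrow> 'u \<Rightarrow> 'u) e)"
  obtain P' d' e' where t: "t = (P', d', e')" by (cases t)
  have "case t of (P, d, e) \<Rightarrow> projective_resolution E Aleft P d e"
    unfolding t_def by (rule someI[of _ "(P, d, e)"]) (simp add: res)
  then have res': "projective_resolution E Aleft P' d' e'" by (simp add: t)
  have triv': "trivial_group (homology (\<lambda>i. tensor_product E Aright (P' i)) (\<lambda>i. tensor_map E Aright (P' i) (d' i)) (Suc n))"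
    using triv by (simp add: HH_def Tor_def t_def[symmetric] t)
  have R: "resolution E Aleft P d e" "resolution E Aleft P' d' e'"
    using res res' left_module_Aleft univ by (auto intro: resolution_of_projective_resolution)
  have P: "left_module E (P n)" for n
    unfolding P_def by (rule left_module_transport[OF left_module_B J])
  have jh: "j n \<in> lmod_hom E (P n) (B (Suc n))" for n
    unfolding P_def j_def by (rule transport_hom_inv[OF left_module_B J])
  have Jh: "J n \<in> lmod_hom E (B (Suc n)) (P n)" for n
    unfolding P_def by (rule transport_hom[OF J])
  have Jj: "J n (j n y) = y" if "y \<in> carrier (P n)" for n y
    using that f_inv_into_f[of y "J n" "carrier (B (Suc n))"] by (simp only: P_def j_def transport_module_simps)
  have jJ: "j n (J n f) = f" if "f \<in> carrier (B (Suc n))" for n f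
    unfolding j_def using inv_into_f_f[OF J that] .
  have jd: "j n (d n y) = W.bar_d (j (Suc n) y)" if "y \<in> carrier (P (Suc n))" for n y
    unfolding d_def by (intro jJ lmod_homD(1)[OF bar_d_hom] lmod_homD(1)[OF jh that])
  \<comment> \<open>A tensor representing the chain z. Its differential is null because
    \<open>\<kappa>\<close> sends it to b z = 0.\<close>
  let ?p = "\<zeta> (Suc n) (J (Suc n)) z"
  have p: "?p \<in> frag_carrier (carrier Aright) (carrier (P (Suc n)))"
    using \<zeta>_closed[OF Jh] by (simp only: env_simps)
  have \<kappa>p: "\<kappa> (j (Suc n)) ?p = z"
    by (rule \<kappa>_\<zeta>[OF z]) (intro jJ \<beta>_closed)
  have dp: "frag_map (d n) ?p \<in> tensor_null E Aright (P n)"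
  proof -
    have c: "frag_map (d n) ?p \<in> frag_carrier (carrier A) (carrier (P n))"
      by (rule frag_map_carrier[OF p[unfolded env_simps]]) (rule lmod_homD(1)[OF resolution.d_hom[OF R(1)]])
    have "\<kappa> (j n) (frag_map (d n) ?p) = (\<lambda>w. 0)"
    proof
      fix w
      have "\<kappa> (j n) (frag_map (d n) ?p) w = W.hoch_d (\<kappa> (j (Suc n)) ?p) w"
        by (rule \<kappa>_frag_map[OF p[unfolded env_simps]]) (rule jd)
      then show "\<kappa> (j n) (frag_map (d n) ?p) w = 0" by (simp only: \<kappa>p dz)
    qed
    then have "\<zeta> n (J n) (\<kappa> (j n) (frag_map (d n) ?p)) = (\<Sum>u\<in>U n. frag_of (\<zero>\<^bsub>Aright\<^esub>, J n (\<beta> u)))"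
      by (simp only: \<zeta>_def el_zero env_simps)
    moreover have "(\<Sum>u\<in>U n. frag_of (\<zero>\<^bsub>Aright\<^esub>, J n (\<beta> u))) \<in> tensor_null E Aright (P n)"
      by (intro TA.null_sum TA.null_zero_left P abelian_group_Aright lmod_homD(1)[OF Jh] \<beta>_closed)
    moreover have "frag_map (d n) ?p - \<zeta> n (J n) (\<kappa> (j n) (frag_map (d n) ?p)) \<in> tensor_null E Aright (P n)"
      by (rule \<zeta>_retract[OF P Jh jh Jj c])
    ultimately show ?thesis using TA.null_add by fastforce
  qed
  obtain q where q: "q \<in> frag_carrier (carrier Aright) (carrier (P (Suc (Suc n))))"
    "?p - frag_map (d (Suc n)) q \<in> tensor_null E Aright (P (Suc n))"
    using TA.exact_transfer[OF R(2,1) triv' p dp] .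
  show thesis
  proof (rule that)
    show "W.supported (HW (Suc (Suc n))) (\<kappa> (j (Suc (Suc n))) q)"
      by (rule supported_\<kappa>[OF q(1)[unfolded env_simps]]) (rule lmod_homD(1)[OF jh])
    show "W.hoch_d (\<kappa> (j (Suc (Suc n))) q) = z"
    proof
      fix w
      have "\<kappa> (j (Suc n)) (?p - frag_map (d (Suc n)) q) w = 0"
        by (rule \<kappa>_null[OF P jh q(2)])
      then have "z w = \<kappa> (j (Suc n)) (frag_map (d (Suc n)) q) w" by (simp add: \<kappa>p)
      also have "\<dots> = W.hoch_d (\<kappa> (j (Suc (Suc n))) q) w"
        by (rule \<kappa>_frag_map[OF q(1)[unfolded env_simps]]) (rule jd)
      finally show "W.hoch_d (\<kappa> (j (Suc (Suc n))) q) w = z w" ..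
    qed
  qed
qed

text \<open>Truncating to one weight turns exactness in large degrees into acyclicity in large weights:
  a word of weight \<open>W\<close> and length \<open>n\<close> has \<open>W \<le> (n + 1) s\<close>.\<close>

lemma wt_word_le: "set v \<subseteq> {..D} \<Longrightarrow> W.wt_word v \<le> length v * s"
  using gwt_le by (induction v) (auto simp: add_mono)

lemma hoch_acyclic:
  assumes univ: "carrier A \<lesssim> (UNIV :: 'u set)"
    and triv: "\<And>n. N < n \<Longrightarrow> trivial_group (HH TYPE('u) K A n)"
    and w: "(N + 2) * s < w"
  shows "W.hoch_acyclic w"
  unfolding W.hoch_acyclic_def
proof (intro allI impI, elim conjE)
  fix n f assume f: "W.supported (W.hoch_words n w) f" and df: "W.hoch_d f = (\<lambda>_. 0)"
  show "\<exists>g. W.supported (W.hoch_words (Suc n) w) g \<and> W.hoch_d g = f"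
  proof (cases "n \<le> N")
    case True
    have "W.hoch_words n w = {}"
    proof (rule ccontr)
      assume "W.hoch_words n w \<noteq> {}"
      then obtain k v where kv: "k \<le> D" "length v = n" "set v \<subseteq> {1..D}" "gwt k + W.wt_word v = w"
        unfolding W.hoch_words_def by blast
      have "set v \<subseteq> {..D}" using kv(3) by auto
      then have "W.wt_word v \<le> n * s" using wt_word_le[of v] kv(2) by simp
      moreover have "n * s \<le> N * s" using True by (rule mult_right_mono) simp
      moreover have "N * s + 2 * s < w" using w by (simp only: distrib_right)
      ultimately show False using gwt_le[OF kv(1)] kv(4) by linarith
    qed
    then have f0: "f = (\<lambda>_. 0)" using W.supported_0[OF f] by auto
    show ?thesis
      by (rule exI[of _ "\<lambda>_. 0"]) (auto simp: f0 W.supported_zero fun_eq_iff)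
  next
    case False
    then obtain m where m: "n = Suc m" "N < Suc m" by (cases n) auto
    have sub: "W.hoch_words k w \<subseteq> HW k" for k unfolding W.hoch_words_def HW_def U_def by auto
    have "W.supported (HW n) f" using f sub by (auto simp: W.supported_def)
    then obtain y where y: "W.supported (HW (Suc n)) y" "W.hoch_d y = f"
      using hoch_exact[OF univ triv[OF m(2)]] df unfolding m(1) by blast
    \<comment> \<open>The differential preserves weight, so the part of weight w of the preimage y
      is again a preimage of f.\<close>
    define g where "g u = (if W.wt_word u = w then y u else 0)" for u
    have HWw: "u \<in> W.hoch_words k w \<longleftrightarrow> u \<in> HW k \<and> W.wt_word u = w" for u k
      unfolding W.hoch_words_def HW_def U_def by auto
    have "W.supported (W.hoch_words (Suc n) w) g"
      using y(1) unfolding W.supported_def HWw g_def by auto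
    moreover have "W.hoch_d g = f"
    proof
      fix u
      have bar: "W.bar_d h u = 0" if h: "\<And>x. h x \<noteq> 0 \<Longrightarrow> W.wt_word x \<noteq> W.wt_word u" for h
      proof (rule ccontr)
        assume "W.bar_d h u \<noteq> 0"
        from W.bar_d_nonzero[OF this] obtain i x z where i: "i < length u" "sc x z (u ! i) \<noteq> 0"
          "h (take i u @ x # z # drop (Suc i) u) \<noteq> 0" .
        then show False
          using h[OF i(3)] sc_weight[OF i(2)] W.set_split_nth(2)[OF i(1)] by simp
      qed
      have hoch: "W.hoch_d h u = 0" if h: "\<And>x. h x \<noteq> 0 \<Longrightarrow> W.wt_word x \<noteq> W.wt_word u" for h
      proof (rule ccontr)
        assume "W.hoch_d h u \<noteq> 0"
        from W.hoch_d_nonzero[OF this bar[OF h]] obtain k v x z where i: "u = k # v" "sc x z k \<noteq> 0"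
          "h (z # v @ [x]) \<noteq> 0" .
        then show False using h[OF i(3)] sc_weight[OF i(2)] by simp
      qed
      show "W.hoch_d g u = f u"
      proof (cases "W.wt_word u = w")
        case True
        have "W.hoch_d (\<lambda>x. y x - g x) u = 0"
          by (rule hoch) (auto simp: g_def True split: if_splits)
        then show ?thesis using y(2) by (simp add: W.hoch_d_diff)
      next
        case False
        have "W.hoch_d g u = 0" by (rule hoch) (use False in \<open>auto simp: g_def split: if_splits\<close>)
        moreover have "f u = 0" by (rule W.supported_0[OF f]) (use False in \<open>auto simp: HWw\<close>)
        ultimately show ?thesis by simp
      qed
    qed
    ultimately show ?thesis by blast
  qed
qed

end

section \<open>Counting necklaces\<close>

text \<open>If w is at least as long as v, comparing beginnings shows that v is a prefix of w, and
  the rest of w commutes with v again.\<close>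

lemma commute_imp_replicate:
  "v @ w = w @ v \<Longrightarrow> length w = k * length v \<Longrightarrow> w = concat (replicate k v)"
proof (induction k arbitrary: w)
  case (Suc k)
  then have "take (length v) (v @ w) = take (length v) (w @ v)" by simp
  then have "w = v @ drop (length v) w"
    using Suc.prems(2) by (metis append_eq_conv_conj append_take_drop_id take_append
      length_append le_add1 mult_Suc take_all_iff diff_is_0_eq append_Nil2 take0)
  then obtain w' where w: "w = v @ w'" by blast
  with Suc.prems have "v @ w' = w' @ v" "length w' = k * length v" by auto
  from Suc.IH[OF this] w show ?case by simp
qed simp

lemma rotate_mult: "rotate g u = u \<Longrightarrow> rotate (k * g) u = u"
  by (induction k) (simp_all flip: rotate_rotate)

text \<open>By Bezout some multiple of j is the gcd plus a multiple of the length, and rotations by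
  multiples of the length are trivial.\<close>

lemma rotate_gcd_iff:
  assumes "0 < length u"
  shows "rotate j u = u \<longleftrightarrow> rotate (gcd j (length u)) u = u"
proof
  assume j: "rotate j u = u"
  show "rotate (gcd j (length u)) u = u"
  proof (cases "j = 0")
    case True
    then show ?thesis by simp
  next
    case False
    then obtain x y where "j * x = length u * y + gcd j (length u)"
      using bezout_nat by blast
    then have "x * j = gcd j (length u) + y * length u" by (simp add: mult.commute)
    then have "rotate (x * j) u = rotate (gcd j (length u)) (rotate (y * length u) u)"
      by (simp only: rotate_rotate)
    then show ?thesis using rotate_mult[OF j, of x] rotate_mult[of "length u" u y] by simp
  qed
next
  assume "rotate (gcd j (length u)) u = u"
  from rotate_mult[OF this, of "j div gcd j (length u)"] show "rotate j u = u" by simp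
qed

lemma length_concat_replicate: "length (concat (replicate k v)) = k * length v"
  by (induction k) simp_all

lemma concat_replicate_append: "concat (replicate k v) @ v = v @ concat (replicate k v)"
  by (induction k) simp_all

text \<open>Invariance says that the prefix of length g commutes with the rest of the word, so the
  word is a power of that prefix.\<close>

lemma rotate_fixed_iff:
  assumes "length u = k * g" "0 < k"
  shows "rotate g u = u \<longleftrightarrow> u = concat (replicate k (take g u))"
proof
  assume r: "rotate g u = u"
  show "u = concat (replicate k (take g u))"
  proof (cases "k = 1")
    case True
    then show ?thesis using assms by simp
  next
    case False
    define v w where "v = take g u" and "w = drop g u"
    obtain k' where k: "k = Suc k'" using assms by (cases k) auto
    with False assms have g: "g \<le> length u" by simp
    have u: "u = v @ w" by (simp add: v_def w_def)
    have lv: "length v = g" using g by (simp add: v_def)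
    have "rotate g u = w @ v" using rotate_append[of v w] by (simp add: u lv)
    then have "v @ w = w @ v" using r u by simp
    moreover have "length w = k' * length v" using assms k lv by (simp add: w_def)
    ultimately have w: "w = concat (replicate k' v)" by (rule commute_imp_replicate)
    show ?thesis
      unfolding k v_def[symmetric] replicate_Suc concat.simps w[symmetric] by (rule u)
  qed
next
  assume u: "u = concat (replicate k (take g u))"
  obtain k' where k: "k = Suc k'" using assms by (cases k) auto
  define v where "v = take g u"
  have "g \<le> length u" using assms k by simp
  then have lv: "length v = g" by (simp add: v_def)
  have uv: "u = v @ concat (replicate k' v)"
    using u unfolding k v_def[symmetric] replicate_Suc concat.simps .
  have "rotate (length v) (v @ concat (replicate k' v)) = concat (replicate k' v) @ v"
    by (rule rotate_append)
  then show "rotate g u = u"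
    unfolding concat_replicate_append uv[symmetric] lv .
qed

section \<open>Words in weighted letters, their rotations and generating functions\<close>

locale weighted_letters =
  fixes I :: "'i set" and wt :: "'i \<Rightarrow> nat"
  assumes finite_I: "finite I" and wt_pos: "i \<in> I \<Longrightarrow> 0 < wt i"
begin

definition words :: "nat \<Rightarrow> nat \<Rightarrow> 'i list set"
  where "words n m = {u. length u = n \<and> set u \<subseteq> I \<and> sum_list (map wt u) = m}"

lemma finite_words: "finite (words n m)"
  by (rule finite_subset[OF _ finite_lists_length_eq[OF finite_I, of n]]) (auto simp: words_def)

lemma words_length_le: "set u \<subseteq> I \<Longrightarrow> length u \<le> sum_list (map wt u)"
  by (induction u) (auto dest: wt_pos)

lemma words_empty: "m < n \<Longrightarrow> words n m = {}"
  using words_length_le by (fastforce simp: words_def)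

text \<open>A fixed word is the d-th power, d = \<open>n div gcd j n\<close>, of a unique word of
  length \<open>gcd j n\<close>, whose weight is the d-th part. If d does not divide the weight
  there is none.\<close>

lemma card_fixed_words:
  assumes n: "0 < n"
  shows "card {u \<in> words n m. rotate j u = u} =
    (if n div gcd j n dvd m then card (words (gcd j n) (m div (n div gcd j n))) else 0)"
proof -
  define g d where "g = gcd j n" and "d = n div g"
  have ng: "n = d * g" and d: "0 < d" and g: "0 < g" using n by (auto simp: d_def g_def div_greater_zero_iff)
  have fixed: "rotate j u = u \<longleftrightarrow> u = concat (replicate d (take g u))" if "length u = n" for u :: "'i list"
  proof -
    have "rotate j u = u \<longleftrightarrow> rotate g u = u" using rotate_gcd_iff[of u j] that n by (simp add: g_def)
    also have "\<dots> \<longleftrightarrow> u = concat (replicate d (take g u))"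
      by (rule rotate_fixed_iff) (use that ng d in auto)
    finally show ?thesis .
  qed
  have wt_conc: "sum_list (map wt (concat (replicate d v))) = d * sum_list (map wt v)" for v and d :: nat
    by (induction d) simp_all
  have tk: "take g (concat (replicate d v)) = v" if "length v = g" for v :: "'i list"
    using d that by (cases d) auto
  show ?thesis
  proof (cases "d dvd m")
    case True
    then obtain q where q: "m = d * q" by blast
    have "bij_betw (\<lambda>v. concat (replicate d v)) (words g q) {u \<in> words n m. rotate j u = u}"
    proof (rule bij_betwI[where g = "take g"])
      show "(\<lambda>v. concat (replicate d v)) \<in> words g q \<rightarrow> {u \<in> words n m. rotate j u = u}"
        using d by (auto simp: words_def wt_conc length_concat_replicate q ng[symmetric] fixed tk)
      show "take g \<in> {u \<in> words n m. rotate j u = u} \<rightarrow> words g q"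
      proof
        fix u assume u: "u \<in> {u \<in> words n m. rotate j u = u}"
        then have "u = concat (replicate d (take g u))" using fixed by (auto simp: words_def)
        from arg_cong[OF this, of "\<lambda>u. sum_list (map wt u)"] u
        have "d * q = d * sum_list (map wt (take g u))" by (auto simp: wt_conc words_def q)
        moreover have "length (take g u) = g" using u ng d by (auto simp: words_def)
        ultimately show "take g u \<in> words g q"
          using u d by (auto simp: words_def dest: in_set_takeD)
      qed
    qed (auto simp: words_def tk fixed)
    from bij_betw_same_card[OF this] show ?thesis
      using d by (simp add: True[unfolded d_def g_def] d_def[symmetric] g_def[symmetric] q)
  next
    case False
    have "{u \<in> words n m. rotate j u = u} = {}"
    proof safe
      fix u assume u: "u \<in> words n m" "rotate j u = u"
      then have "u = concat (replicate d (take g u))" using fixed by (auto simp: words_def)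
      from arg_cong[OF this, of "\<lambda>u. sum_list (map wt u)"] u
      have "m = d * sum_list (map wt (take g u))" by (auto simp: wt_conc words_def)
      with False show "u \<in> {}" by simp
    qed
    with False show ?thesis by (simp only: d_def g_def if_False card.empty)
  qed
qed

text \<open>The Hilbert polynomial f of the augmentation ideal once the letters are a homogeneous
  basis of it.\<close>

definition letter_fps :: "real fps"
  where "letter_fps = (\<Sum>i\<in>I. fps_X ^ wt i)"

lemma words_Suc: "words (Suc n) m = (\<Union>i\<in>{i \<in> I. wt i \<le> m}. (#) i ` words n (m - wt i))"
  by (auto simp: words_def length_Suc_conv)

lemma letter_fps_power_nth: "fps_nth (letter_fps ^ n) m = real (card (words n m))"
proof (induction n arbitrary: m)
  case 0
  have "words 0 m = (if m = 0 then {[]} else {})" by (auto simp: words_def)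
  then show ?case by simp
next
  case (Suc n)
  have "card (words (Suc n) m) = (\<Sum>i\<in>{i \<in> I. wt i \<le> m}. card ((#) i ` words n (m - wt i)))"
    unfolding words_Suc by (rule card_UN_disjoint) (auto simp: finite_I finite_words)
  also have "\<dots> = (\<Sum>i\<in>{i \<in> I. wt i \<le> m}. card (words n (m - wt i)))"
    by (intro sum.cong refl card_image) simp
  finally have "real (card (words (Suc n) m)) = (\<Sum>i\<in>{i \<in> I. wt i \<le> m}. real (card (words n (m - wt i))))"
    by simp
  also have "\<dots> = (\<Sum>i\<in>I. if m < wt i then 0 else real (card (words n (m - wt i))))"
    by (rule sum.mono_neutral_cong_left) (auto simp: finite_I)
  also have "\<dots> = fps_nth (\<Sum>i\<in>I. fps_X ^ wt i * letter_fps ^ n) m"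
    by (simp add: fps_sum_nth fps_X_power_mult_nth Suc.IH cong: if_cong)
  also have "(\<Sum>i\<in>I. fps_X ^ wt i * letter_fps ^ n) = letter_fps ^ Suc n"
    by (simp add: letter_fps_def flip: sum_distrib_right)
  finally show ?case ..
qed

text \<open>Taken with respect to X d/dX, so that the coefficient of X^m in a series is multiplied
  by m.\<close>

definition log_deriv :: "real fps"
  where "log_deriv = fps_X * fps_deriv letter_fps * inverse (1 + letter_fps)"

lemma letter_fps_nth_0: "fps_nth letter_fps 0 = 0"
  using letter_fps_power_nth[of 1 0] words_empty[of 0 1] by simp

text \<open>X (f^g)' = g f^(g-1) X f', and the geometric series of 1 / (1 + f) may be cut off after
  m terms: f is divisible by X, so the remainder starts beyond X^m.\<close>

lemma log_deriv_nth:
  "fps_nth log_deriv m = (\<Sum>g=1..m. (-1) ^ (g - 1) * (real m / real g) * real (card (words g m)))"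
proof -
  let ?F = letter_fps
  define P where "P = fps_X * fps_deriv ?F"
  have coeff: "(real m / real g) * real (card (words g m)) = fps_nth (?F ^ (g - 1) * P) m" if "g \<ge> 1" for g
  proof -
    have "fps_X * fps_deriv (?F ^ g) = fps_const (real g) * (?F ^ (g - 1) * P)"
      by (simp add: P_def fps_deriv_power mult_ac)
    from arg_cong[OF this, of "\<lambda>x. fps_nth x m"]
    have "real m * fps_nth (?F ^ g) m = real g * fps_nth (?F ^ (g - 1) * P) m"
      by (cases m) simp_all
    with that show ?thesis by (simp add: letter_fps_power_nth field_simps)
  qed
  have inv: "(1 + ?F) * inverse (1 + ?F) = 1"
    by (rule inverse_mult_eq_1') (simp add: letter_fps_nth_0)
  have geo: "(1 + ?F) * (\<Sum>g<m. (- ?F) ^ g) = 1 - (- ?F) ^ m"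
    using one_diff_power_eq[of "- ?F" m] by simp
  have "log_deriv = P * inverse (1 + ?F)" by (simp add: log_deriv_def P_def)
  also have "\<dots> = P * (\<Sum>g<m. (- ?F) ^ g) + P * (- ?F) ^ m * inverse (1 + ?F)"
  proof -
    have "inverse (1 + ?F) = ((1 + ?F) * (\<Sum>g<m. (- ?F) ^ g) + (- ?F) ^ m) * inverse (1 + ?F)"
      by (simp add: geo)
    also have "\<dots> = (\<Sum>g<m. (- ?F) ^ g) * ((1 + ?F) * inverse (1 + ?F)) + (- ?F) ^ m * inverse (1 + ?F)"
      by (simp add: algebra_simps)
    finally have "inverse (1 + ?F) = (\<Sum>g<m. (- ?F) ^ g) + (- ?F) ^ m * inverse (1 + ?F)"
      by (simp add: inv)
    then have "P * inverse (1 + ?F) = P * ((\<Sum>g<m. (- ?F) ^ g) + (- ?F) ^ m * inverse (1 + ?F))"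
      by (rule arg_cong)
    then show ?thesis by (simp only: distrib_left mult.assoc)
  qed
  finally have "fps_nth log_deriv m = fps_nth (P * (\<Sum>g<m. (- ?F) ^ g)) m
      + fps_nth (P * (- ?F) ^ m * inverse (1 + ?F)) m" by simp
  also have "fps_nth (P * (- ?F) ^ m * inverse (1 + ?F)) m = 0"
  proof -
    have "?F = fps_X * fps_shift 1 ?F"
      by (auto simp: fps_eq_iff letter_fps_nth_0)
    then obtain F' where F': "?F = fps_X * F'" by blast
    then have "(- ?F) ^ m = fps_X ^ m * (- F') ^ m"
      by (metis mult_minus_right power_mult_distrib)
    then have "P * (- ?F) ^ m * inverse (1 + ?F)
      = fps_X ^ Suc m * (fps_deriv ?F * (- F') ^ m * inverse (1 + ?F))"
      by (simp add: P_def mult_ac)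
    then show ?thesis by (simp only: fps_X_power_mult_nth) simp
  qed
  also have "P * (\<Sum>g<m. (- ?F) ^ g) = (\<Sum>g<m. (-1) ^ g * (?F ^ g * P))"
    by (simp add: sum_distrib_left power_minus[of ?F] mult_ac)
  also have "fps_nth \<dots> m = (\<Sum>g<m. (-1) ^ g * fps_nth (?F ^ g * P) m)"
    by (simp add: fps_sum_nth) (intro sum.cong refl, metis fps_neg_nth minus_one_power_iff mult_1 mult_minus1)
  also have "\<dots> = (\<Sum>g=1..m. (-1) ^ (g - 1) * fps_nth (?F ^ (g - 1) * P) m)"
    by (rule sum.reindex_bij_witness[of _ "\<lambda>g. g - 1" Suc]) auto
  also have "\<dots> = (\<Sum>g=1..m. (-1) ^ (g - 1) * ((real m / real g) * real (card (words g m))))"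
    by (rule sum.cong[OF refl]) (simp only: coeff atLeastAtMost_iff)
  finally show ?thesis by (simp add: mult.assoc)
qed

text \<open>The trace of N / n on words of length n and weight m: each power of t permutes the words
  up to sign, and every word it fixes contributes that sign.\<close>

definition cyc_trace :: "nat \<Rightarrow> nat \<Rightarrow> real"
  where "cyc_trace n m = (\<Sum>j<n. (-1) ^ ((n - 1) * j) * real (card {u \<in> words n m. rotate j u = u})) / real n"

text \<open>For odd n both exponents are even. For even n the left exponent has the parity of j + 1,
  and \<open>gcd j n\<close> has the parity of j.\<close>

lemma sign_gcd:
  assumes "0 < n" shows "(-1) ^ (n - 1) * (-1) ^ ((n - 1) * j) = ((-1) ^ (gcd j n - 1) :: real)"
proof -
  have "gcd j n > 0" using assms by simp
  then have "even ((n - 1) + (n - 1) * j) = even (gcd j n - 1)"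
    using assms by (auto simp: even_diff_nat)
  then show ?thesis unfolding power_add[symmetric] by (metis neg_one_even_power neg_one_odd_power)
qed

text \<open>Exactly \<open>totient (n div g)\<close> residues j have gcd g with n. The residue 0 is
  represented by n, to match the range in \<open>card_gcd_eq_totient\<close>.\<close>

lemma sum_gcd_totient:
  assumes "0 < n"
  shows "(\<Sum>j<n. h (gcd j n)) = (\<Sum>g | g dvd n. real (totient (n div g)) * h g)"
proof -
  have "(\<Sum>j<n. h (gcd j n)) = (\<Sum>j\<in>{0<..n}. h (gcd j n))"
    by (rule sum.reindex_bij_witness[of _ "\<lambda>j. if j = n then 0 else j" "\<lambda>j. if j = 0 then n else j"])
      (use assms in auto)
  also have "\<dots> = (\<Sum>g | g dvd n. \<Sum>j\<in>{j \<in> {0<..n}. gcd j n = g}. h (gcd j n))"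
    by (rule sum.group[symmetric]) (use assms in \<open>auto simp: finite_divisors_nat\<close>)
  also have "\<dots> = (\<Sum>g | g dvd n. real (totient (n div g)) * h g)"
  proof (rule sum.cong[OF refl])
    fix g assume "g \<in> {g. g dvd n}"
    then have "card {j \<in> {0<..n}. gcd j n = g} = totient (n div g)"
      using assms by (simp only: card_gcd_eq_totient mem_Collect_eq)
    moreover have "(\<Sum>j\<in>{j \<in> {0<..n}. gcd j n = g}. h (gcd j n)) = (\<Sum>j\<in>{j \<in> {0<..n}. gcd j n = g}. h g)"
      by (rule sum.cong) auto
    ultimately show "(\<Sum>j\<in>{j \<in> {0<..n}. gcd j n = g}. h (gcd j n)) = real (totient (n div g)) * h g"
      by (simp only: sum_constant)
  qed
  finally show ?thesis .
qed

text \<open>Burnside counting of signed necklaces. Put n = d g: then W / n = (W / d) / g, and for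
  fixed d the sum over g is the coefficient of the logarithmic derivative at W / d.\<close>

theorem cyc_trace_sum:
  assumes W: "0 < W"
  shows "real W * (\<Sum>n=1..W. (-1) ^ (n - 1) * cyc_trace n W)
    = (\<Sum>d | d dvd W. real (totient d) * fps_nth log_deriv (W div d))"
proof -
  define h where "h n g = (if n div g dvd W then (-1) ^ (g - 1) * real (card (words g (W div (n div g)))) else 0)" for n g
  have "(-1) ^ (n - 1) * cyc_trace n W = (\<Sum>g | g dvd n. real (totient (n div g)) * h n g) / real n" if "1 \<le> n" for n
  proof -
    have "(-1) ^ (n - 1) * cyc_trace n W =
      (\<Sum>j<n. ((-1) ^ (n - 1) * (-1) ^ ((n - 1) * j)) * real (card {u \<in> words n W. rotate j u = u})) / real n"
      by (simp add: cyc_trace_def sum_distrib_left mult.assoc)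
    also have "(\<Sum>j<n. ((-1) ^ (n - 1) * (-1) ^ ((n - 1) * j)) * real (card {u \<in> words n W. rotate j u = u}))
       = (\<Sum>j<n. h n (gcd j n))"
    proof (rule sum.cong[OF refl])
      fix j
      have n: "0 < n" using that by simp
      show "((-1) ^ (n - 1) * (-1) ^ ((n - 1) * j)) * real (card {u \<in> words n W. rotate j u = u})
        = h n (gcd j n)"
        unfolding sign_gcd[OF n] card_fixed_words[OF n] h_def by simp
    qed
    finally show ?thesis using that by (simp add: sum_gcd_totient)
  qed
  then have "real W * (\<Sum>n=1..W. (-1) ^ (n - 1) * cyc_trace n W)
    = (\<Sum>n=1..W. \<Sum>g | g dvd n. real (totient (n div g)) * (real W / real n) * h n g)"
    by (simp add: sum_distrib_left sum_divide_distrib mult_ac)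
  also have "\<dots> = (\<Sum>(n, g)\<in>(SIGMA n:{1..W}. {g. g dvd n}). real (totient (n div g)) * (real W / real n) * h n g)"
    by (rule sum.Sigma) (auto simp: finite_divisors_nat)
  also have "\<dots> = (\<Sum>(n, g)\<in>{(n, g). n \<in> {1..W} \<and> g dvd n \<and> n div g dvd W}.
      real (totient (n div g)) * (real W / real n) * h n g)"
    by (rule sum.mono_neutral_right) (auto simp: h_def finite_divisors_nat split: if_splits)
  also have "\<dots> = (\<Sum>(d, g)\<in>(SIGMA d:{d. d dvd W}. {1..W div d}). real (totient d) *
     ((-1) ^ (g - 1) * (real (W div d) / real g) * real (card (words g (W div d)))))"
  proof (rule sum.reindex_bij_witness[of _ "\<lambda>(d, g). (d * g, g)" "\<lambda>(n, g). (n div g, g)"], goal_cases)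
    case (2 a)
    obtain n g where a: "a = (n, g)" by force
    with 2 obtain k l where "n = g * k" "W = k * l" "g > 0" "k > 0"
      by (auto elim!: dvdE)
    with 2 a show ?case by (auto simp: less_eq_div_iff_mult_less_eq)
  next
    case (4 b)
    obtain d g where b: "b = (d, g)" by force
    with 4 W have d: "d dvd W" "1 \<le> g" "g \<le> W div d" "d > 0" by (auto intro: Nat.gr0I)
    then have "d * g \<le> W" "1 \<le> d * g" by (auto simp: less_eq_div_iff_mult_less_eq mult.commute)
    with d b show ?case by auto
  next
    case (5 a)
    obtain n g where a: "a = (n, g)" by force
    with 5 obtain k l where n: "n = g * k" "W = k * l" "g > 0" "k > 0"
      by (auto elim!: dvdE)
    then show ?case by (simp add: a h_def)
  qed auto
  also have "\<dots> = (\<Sum>d | d dvd W. \<Sum>g=1..W div d. real (totient d) *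
     ((-1) ^ (g - 1) * (real (W div d) / real g) * real (card (words g (W div d)))))"
    by (rule sum.Sigma[symmetric]) (use W in \<open>auto simp: finite_divisors_nat\<close>)
  also have "\<dots> = (\<Sum>d | d dvd W. real (totient d) * fps_nth log_deriv (W div d))"
    by (simp add: log_deriv_nth sum_distrib_left)
  finally show ?thesis .
qed

end

section \<open>A Lambert series\<close>

text \<open>1 / d^3 is at most 1 / (2 (d - 1) d), which telescopes. The value 1/2 is what closes the
  induction in the growth estimate.\<close>

lemma sum_inverse_cubes_le: "(\<Sum>d=2..m. 1 / real d ^ 3) \<le> 1 / 2"
proof -
  have "(\<Sum>d=2..m. 1 / real d ^ 3) \<le> 1 / 2 - 1 / (2 * real m)" if "1 \<le> m" for m
    using that
  proof (induction m rule: dec_induct)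
    case (step n)
    have n: "real n > 0" using step by simp
    have "1 / real (Suc n) ^ 3 \<le> 1 / (2 * real n * real (Suc n))"
    proof (rule divide_left_mono)
      have "2 * real n \<le> real (Suc n) ^ 2" by (simp add: power2_eq_square algebra_simps)
      then have "2 * real n * real (Suc n) \<le> real (Suc n) ^ 2 * real (Suc n)"
        by (rule mult_right_mono) simp
      then show "2 * real n * real (Suc n) \<le> real (Suc n) ^ 3"
        by (simp add: power3_eq_cube power2_eq_square)
    qed (use n in auto)
    also have "\<dots> = 1 / (2 * real n) - 1 / (2 * real (Suc n))" using n by (simp add: field_simps)
    finally show ?case using step by (simp add: numeral_2_eq_2)
  qed simp
  moreover have "0 \<le> 1 / (2 * real m)" by simp
  ultimately show ?thesis by (cases "m = 0") (simp, smt (verit) One_nat_def Suc_leI gr0I)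
qed

text \<open>Solving for the term d = 1 bounds L m by its values at the proper divisors m / d. As the
  totient of d is at most d, a bound C (m / d)^4 there contributes C m^4 / d^3, and these cubes sum
  to at most 1/2. So C = 2 A works, with A a bound for the convolution.\<close>

lemma dirichlet_growth:
  fixes L :: "nat \<Rightarrow> real"
  assumes "\<And>w. M < w \<Longrightarrow> (\<Sum>d | d dvd w. real (totient d) * L (w div d)) = 0"
  obtains C where "0 \<le> C" "\<And>m. 1 \<le> m \<Longrightarrow> \<bar>L m\<bar> \<le> C * real m ^ 4"
proof -
  define a where "a w = (\<Sum>d | d dvd w. real (totient d) * L (w div d))" for w
  define A where "A = (\<Sum>w\<le>M. \<bar>a w\<bar>)"
  have A: "\<bar>a w\<bar> \<le> A" for w
  proof (cases "w \<le> M")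
    case True
    then show ?thesis unfolding A_def by (intro member_le_sum) auto
  next
    case False
    with assms[of w] show ?thesis by (simp add: a_def A_def sum_nonneg)
  qed
  have A0: "0 \<le> A" by (simp add: A_def sum_nonneg)
  have "\<bar>L m\<bar> \<le> 2 * A * real m ^ 4" if "1 \<le> m" for m
    using that
  proof (induction m rule: less_induct)
    case (less m)
    let ?D = "{d. d dvd m} - {1}"
    have m: "0 < m" using less by simp
    then have fin: "finite {d. d dvd m}" by (rule finite_divisors_nat)
    have "a m = real (totient 1) * L (m div 1) + (\<Sum>d\<in>?D. real (totient d) * L (m div d))"
      unfolding a_def by (rule sum.remove) (use fin in auto)
    then have "\<bar>L m\<bar> \<le> A + \<bar>\<Sum>d\<in>?D. real (totient d) * L (m div d)\<bar>"
      using A[of m] by simp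
    also have "\<bar>\<Sum>d\<in>?D. real (totient d) * L (m div d)\<bar> \<le> (\<Sum>d\<in>?D. \<bar>real (totient d) * L (m div d)\<bar>)"
      by (rule sum_abs)
    also have "\<dots> \<le> (\<Sum>d\<in>?D. 2 * A * real m ^ 4 * (1 / real d ^ 3))"
    proof (rule sum_mono)
      fix d assume d: "d \<in> ?D"
      then obtain k where k: "m = d * k" by auto
      with m d have kd: "0 < d" "0 < k" "k < m" by auto
      have "\<bar>real (totient d) * L (m div d)\<bar> \<le> real d * (2 * A * real k ^ 4)"
        unfolding abs_mult using less.IH[of k] kd k by (intro mult_mono) (auto simp: totient_le)
      also have "\<dots> = 2 * A * real m ^ 4 * (1 / real d ^ 3)"
        using kd by (simp add: k field_simps power4_eq_xxxx power3_eq_cube)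
      finally show "\<bar>real (totient d) * L (m div d)\<bar> \<le> 2 * A * real m ^ 4 * (1 / real d ^ 3)" .
    qed
    also have "\<dots> = 2 * A * real m ^ 4 * (\<Sum>d\<in>?D. 1 / real d ^ 3)"
      by (simp only: sum_distrib_left)
    also have "\<dots> \<le> 2 * A * real m ^ 4 * (1 / 2)"
    proof (rule mult_left_mono)
      have "(\<Sum>d\<in>?D. 1 / real d ^ 3) \<le> (\<Sum>d=2..m. 1 / real d ^ 3)"
      proof (rule sum_mono2)
        show "?D \<subseteq> {2..m}"
        proof
          fix d assume "d \<in> ?D"
          then have "d dvd m" "d \<noteq> 1" by auto
          moreover from this m have "d \<noteq> 0" "d \<le> m" by (auto dest: dvd_imp_le)
          ultimately show "d \<in> {2..m}" by auto
        qed
      qed auto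
      then show "(\<Sum>d\<in>?D. 1 / real d ^ 3) \<le> 1 / 2" using sum_inverse_cubes_le[of m] by linarith
    qed (use A0 in simp)
    finally have "\<bar>L m\<bar> \<le> A + A * real m ^ 4" by simp
    moreover have "A * 1 \<le> A * real m ^ 4" using m A0 by (intro mult_left_mono) auto
    ultimately show ?case by simp
  qed
  with A0 that[of "2 * A"] show thesis by simp
qed

text \<open>Write t = s^(k+1). Then m s^m is bounded, and one factor s^m is left over for a
  geometric series.\<close>

lemma summable_power_mult:
  fixes t :: real
  assumes "0 < t" "t < 1"
  shows "summable (\<lambda>m. real m ^ k * t ^ m)"
proof -
  define s where "s = root (Suc k) t"
  have s: "0 < s" "s < 1" using assms by (auto simp: s_def)
  have t: "t = s ^ Suc k" using assms unfolding s_def by (subst real_root_pow_pos2) auto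
  have "(\<lambda>m. real m * s ^ m) \<longlonglongrightarrow> 0" using powser_times_n_limit_0[of s] s by simp
  then have "Bseq (\<lambda>m. real m * s ^ m)" by (intro convergent_imp_Bseq convergentI)
  then obtain B where B: "\<And>m. \<bar>real m * s ^ m\<bar> \<le> B" unfolding Bseq_def real_norm_def by blast
  show ?thesis
  proof (rule summable_comparison_test')
    show "summable (\<lambda>m. B ^ k * s ^ m)" using s by (intro summable_mult summable_geometric) simp
    fix m :: nat assume "m \<ge> 0"
    have "real m ^ k * t ^ m = (real m * s ^ m) ^ k * s ^ m"
      by (simp add: t power_mult_distrib algebra_simps flip: power_mult)
    also have "\<dots> \<le> B ^ k * s ^ m"
      using B[of m] s by (intro mult_right_mono power_mono) auto
    finally show "norm (real m ^ k * t ^ m) \<le> B ^ k * s ^ m" using assms by simp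
  qed
qed

context weighted_letters
begin

text \<open>Coefficients of X^m in L (1 + f) = X f', where L is the logarithmic derivative.\<close>

lemma log_deriv_rec:
  "fps_nth log_deriv m + (\<Sum>i\<in>I. if wt i \<le> m then fps_nth log_deriv (m - wt i) else 0)
    = (\<Sum>i\<in>I. if wt i = m then real (wt i) else 0)"
proof -
  have "inverse (1 + letter_fps) * (1 + letter_fps) = 1"
    by (rule inverse_mult_eq_1) (simp add: letter_fps_nth_0)
  then have "log_deriv * (1 + letter_fps) = fps_X * fps_deriv letter_fps"
    unfolding log_deriv_def by (simp only: mult.assoc mult_1_right)
  moreover have "(\<Sum>i\<in>I. fps_X ^ wt i * log_deriv) = letter_fps * log_deriv"
    by (simp add: letter_fps_def sum_distrib_right)
  ultimately have eq: "log_deriv + (\<Sum>i\<in>I. fps_X ^ wt i * log_deriv) = fps_X * fps_deriv letter_fps"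
    by (simp add: algebra_simps)
  have "fps_nth (fps_X * fps_deriv letter_fps) m = real m * fps_nth letter_fps m"
    by (cases m) simp_all
  also have "\<dots> = (\<Sum>i\<in>I. if wt i = m then real (wt i) else 0)"
    by (auto simp: letter_fps_def fps_sum_nth sum_distrib_left intro!: sum.cong)
  finally have "fps_nth (log_deriv + (\<Sum>i\<in>I. fps_X ^ wt i * log_deriv)) m
    = (\<Sum>i\<in>I. if wt i = m then real (wt i) else 0)" by (simp only: eq)
  moreover have "(\<Sum>i\<in>I. if wt i \<le> m then fps_nth log_deriv (m - wt i) else 0)
    = (\<Sum>i\<in>I. fps_nth (fps_X ^ wt i * log_deriv) m)"
    by (rule sum.cong) (auto simp: fps_X_power_mult_nth)
  ultimately show ?thesis by (simp add: fps_sum_nth)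
qed

text \<open>Summing the coefficient recursion against t^m gives g (1 + f(t)) = t f'(t), and 1 + f(t)
  is positive.\<close>

lemma log_deriv_sums:
  fixes t :: real
  assumes t: "0 < t" and g: "(\<lambda>m. fps_nth log_deriv m * t ^ m) sums g"
  shows "g = (\<Sum>i\<in>I. real (wt i) * t ^ wt i) / (1 + (\<Sum>i\<in>I. t ^ wt i))"
proof -
  let ?L = "fps_nth log_deriv"
  have sh: "(\<lambda>m. (if wt i \<le> m then ?L (m - wt i) else 0) * t ^ m) sums (t ^ wt i * g)" for i
  proof -
    have "(\<lambda>m. (if wt i \<le> m + wt i then ?L (m + wt i - wt i) else 0) * t ^ (m + wt i)) sums (t ^ wt i * g)"
      using sums_mult[OF g, of "t ^ wt i"] by (simp add: power_add mult_ac)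
    then show ?thesis by (subst (asm) sums_iff_shift) simp
  qed
  have s1: "(\<lambda>m. ?L m * t ^ m + (\<Sum>i\<in>I. (if wt i \<le> m then ?L (m - wt i) else 0) * t ^ m))
     sums (g + (\<Sum>i\<in>I. t ^ wt i * g))"
    by (intro sums_add g sums_sum sh)
  have eq: "(\<lambda>m. ?L m * t ^ m + (\<Sum>i\<in>I. (if wt i \<le> m then ?L (m - wt i) else 0) * t ^ m))
     = (\<lambda>m. \<Sum>i\<in>I. if m = wt i then real (wt i) * t ^ m else 0)"
  proof
    fix m
    have "?L m * t ^ m + (\<Sum>i\<in>I. (if wt i \<le> m then ?L (m - wt i) else 0) * t ^ m)
      = (?L m + (\<Sum>i\<in>I. if wt i \<le> m then ?L (m - wt i) else 0)) * t ^ m"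
      by (simp add: distrib_right sum_distrib_right)
    also have "\<dots> = (\<Sum>i\<in>I. if wt i = m then real (wt i) else 0) * t ^ m"
      by (simp only: log_deriv_rec)
    also have "\<dots> = (\<Sum>i\<in>I. if m = wt i then real (wt i) * t ^ m else 0)"
      unfolding sum_distrib_right by (rule sum.cong) auto
    finally show "?L m * t ^ m + (\<Sum>i\<in>I. (if wt i \<le> m then ?L (m - wt i) else 0) * t ^ m)
      = (\<Sum>i\<in>I. if m = wt i then real (wt i) * t ^ m else 0)" .
  qed
  have "(\<lambda>m. \<Sum>i\<in>I. if m = wt i then real (wt i) * t ^ m else 0)
     sums (\<Sum>i\<in>I. real (wt i) * t ^ wt i)"
    by (rule sums_sum) (rule sums_single)
  with s1[unfolded eq] have "g + (\<Sum>i\<in>I. t ^ wt i * g) = (\<Sum>i\<in>I. real (wt i) * t ^ wt i)"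
    by (rule sums_unique2)
  then have "g * (1 + (\<Sum>i\<in>I. t ^ wt i)) = (\<Sum>i\<in>I. real (wt i) * t ^ wt i)"
    by (simp add: distrib_left sum_distrib_left mult.commute)
  moreover have "1 + (\<Sum>i\<in>I. t ^ wt i) > 0"
    using t by (intro add_pos_nonneg sum_nonneg) auto
  ultimately show ?thesis by (simp add: field_simps)
qed

text \<open>The Lambert series \<open>\<Sum>\<^sub>d \<phi>(d) g(t\<^sup>d)\<close> of \<open>g = t F' / (1 + F)\<close> would be a polynomial,
  but its terms are nonnegative and bounded below as \<open>t\<close> tends to \<open>1\<close>.\<close>

theorem no_letters:
  assumes Z: "\<And>w. M < w \<Longrightarrow> (\<Sum>d | d dvd w. real (totient d) * fps_nth log_deriv (w div d)) = 0"
  shows "I = {}"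
proof (rule ccontr)
  assume "I \<noteq> {}"
  then obtain i0 where i0: "i0 \<in> I" by blast
  let ?L = "fps_nth log_deriv"
  define g where "g t = (\<Sum>i\<in>I. real (wt i) * t ^ wt i) / (1 + (\<Sum>i\<in>I. t ^ wt i))" for t :: real
  define a where "a w = (\<Sum>d | d dvd w. real (totient d) * ?L (w div d))" for w
  define Q where "Q = (\<Sum>w=1..M. \<bar>a w\<bar>)"
  obtain C where C: "0 \<le> C" "\<And>m. 1 \<le> m \<Longrightarrow> \<bar>?L m\<bar> \<le> C * real m ^ 4"
    using dirichlet_growth[OF Z] by blast
  have L0: "?L 0 = 0" by (simp add: log_deriv_nth)
  have Ls: "summable (\<lambda>m. norm (?L m * t ^ m))" if t: "0 < t" "t < 1" for t
  proof (rule summable_comparison_test'[of "\<lambda>m. C * (real m ^ 4 * t ^ m)" 1])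
    show "summable (\<lambda>m. C * (real m ^ 4 * t ^ m))"
      by (intro summable_mult summable_power_mult t)
    show "norm (norm (?L m * t ^ m)) \<le> C * (real m ^ 4 * t ^ m)" if "m \<ge> 1" for m
      using C(2)[OF that] t by (simp add: abs_mult mult_right_mono flip: mult.assoc)
  qed
  have g_has_sum: "((\<lambda>m. ?L m * t ^ m) has_sum g t) {1..}" if t: "0 < t" "t < 1" for t
  proof -
    have "(\<lambda>m. ?L m * t ^ m) sums g t"
      using log_deriv_sums[OF t(1)] summable_norm_cancel[OF Ls[OF t]] by (simp add: g_def sums_iff)
    from norm_summable_imp_has_sum[OF Ls[OF t] this] show ?thesis
      by (rule has_sum_cong_neutral[THEN iffD1, rotated -1]) (auto simp: L0 Suc_le_eq)
  qed
  \<comment> \<open>The letter i0 alone bounds the numerator from below, and each power in the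
    denominator is at most 1.\<close>
  have g_low: "t ^ wt i0 / (1 + real (card I)) \<le> g t" "0 \<le> g t" if t: "0 < t" "t < 1" for t
  proof -
    have den: "1 + (\<Sum>i\<in>I. t ^ wt i) \<le> 1 + real (card I)" "0 < 1 + (\<Sum>i\<in>I. t ^ wt i)"
    proof -
      have "(\<Sum>i\<in>I. t ^ wt i) \<le> (\<Sum>i\<in>I. 1)" using t by (intro sum_mono power_le_one) auto
      then show "1 + (\<Sum>i\<in>I. t ^ wt i) \<le> 1 + real (card I)" by simp
      show "0 < 1 + (\<Sum>i\<in>I. t ^ wt i)" using t by (intro add_pos_nonneg sum_nonneg) auto
    qed
    have "1 * t ^ wt i0 \<le> real (wt i0) * t ^ wt i0"
      using wt_pos[OF i0] t by (intro mult_right_mono) auto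
    also have "\<dots> \<le> (\<Sum>i\<in>I. real (wt i) * t ^ wt i)"
      using i0 finite_I t by (intro member_le_sum) auto
    finally have num: "t ^ wt i0 \<le> (\<Sum>i\<in>I. real (wt i) * t ^ wt i)" by simp
    show "t ^ wt i0 / (1 + real (card I)) \<le> g t"
      unfolding g_def using num den t by (intro frac_le) (auto intro!: sum_nonneg)
    then show "0 \<le> g t" using t by (meson divide_nonneg_nonneg order_trans zero_le_power less_imp_le
          add_nonneg_nonneg zero_le_one of_nat_0_le_iff)
  qed
  have key: "(\<Sum>d=1..B. real (totient d) * g (t ^ d)) \<le> Q" if t: "0 < t" "t < 1" for t B
  proof -
    \<comment> \<open>The Lambert series as a double series: its rows sum to the values g (t^d), and
      its hyperbolas d m = w to the coefficients a w.\<close>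
    define f where "f = (\<lambda>(d, m). real (totient d) * (?L m * (t ^ d) ^ m))"
    have td: "0 < t ^ d" "t ^ d < 1" if "1 \<le> d" for d
      using t that by (auto simp: power_less_one_iff)
    have abs: "f abs_summable_on {1..} \<times> {1..}"
    proof (rule abs_summable_on_comparison_test)
      show "(\<lambda>(d, m). (C / t) * (real d * t ^ d) * (real m ^ 4 * t ^ m)) abs_summable_on {1..} \<times> {1..}"
      proof -
        have s4: "(\<lambda>m. real m ^ 4 * t ^ m) summable_on {1..}"
          using summable_power_mult[OF t, of 4] t
          by (intro summable_on_subset_banach[OF norm_summable_imp_summable_on]) auto
        have s1: "(\<lambda>d. real d * t ^ d) summable_on {1..}"
          using summable_power_mult[OF t, of 1] t
          by (intro summable_on_subset_banach[OF norm_summable_imp_summable_on]) auto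
        have nn: "norm ((C / t) * (real d * t ^ d) * (real m ^ 4 * t ^ m))
           = (C / t) * (real d * t ^ d) * (real m ^ 4 * t ^ m)" for d m
          using t C(1) by simp
        show ?thesis
          unfolding abs_summable_on_Sigma_iff case_prod_conv nn
        proof (intro conjI ballI)
          fix d :: nat
          show "(\<lambda>m. (C / t) * (real d * t ^ d) * (real m ^ 4 * t ^ m)) summable_on {1..}"
            by (rule summable_on_cmult_right[OF s4])
        next
          have "(\<lambda>d. (C / t) * (real d * t ^ d) * infsum (\<lambda>m. real m ^ 4 * t ^ m) {1..}) summable_on {1..}"
            by (intro summable_on_cmult_left summable_on_cmult_right s1)
          then have "(\<lambda>d. infsum (\<lambda>m. (C / t) * (real d * t ^ d) * (real m ^ 4 * t ^ m)) {1..}) summable_on {1..}"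
            by (simp only: infsum_cmult_right')
          moreover have "0 \<le> infsum (\<lambda>m. (C / t) * (real d * t ^ d) * (real m ^ 4 * t ^ m)) {1..}" for d
            using t C(1) by (intro infsum_nonneg) auto
          ultimately show "(\<lambda>d. infsum (\<lambda>m. (C / t) * (real d * t ^ d) * (real m ^ 4 * t ^ m)) {1..}) abs_summable_on {1..}"
            by simp
        qed
      qed
      fix x :: "nat \<times> nat" assume "x \<in> {1..} \<times> {1..}"
      then obtain d m where x: "x = (d, m)" and dm: "1 \<le> d" "1 \<le> m" by auto
      \<comment> \<open>This gives t^(d m) \<le> t^d t^m / t and dominates the double series by a
        product of two convergent series.\<close>
      have e: "d + m \<le> d * m + 1"
      proof -
        obtain d' m' where "d = Suc d'" "m = Suc m'" using dm by (metis Suc_le_D One_nat_def)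
        then show ?thesis by simp
      qed
      have "t * (t ^ d) ^ m = t ^ (d * m + 1)" by (simp add: power_mult)
      also have "\<dots> \<le> t ^ (d + m)" using t e by (intro power_decreasing) auto
      finally have pw: "(t ^ d) ^ m \<le> t ^ d * t ^ m / t" using t by (simp add: power_add field_simps)
      have "norm (f x) = real (totient d) * (\<bar>?L m\<bar> * (t ^ d) ^ m)"
        using t by (simp add: f_def x abs_mult)
      also have "\<dots> \<le> real d * ((C * real m ^ 4) * (t ^ d * t ^ m / t))"
        using C dm t pw by (intro mult_mono) (auto simp: totient_le)
      also have "\<dots> = (C / t) * (real d * t ^ d) * (real m ^ 4 * t ^ m)"
        using t by (simp add: field_simps)
      also have "\<dots> = norm ((C / t) * (real d * t ^ d) * (real m ^ 4 * t ^ m))"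
        using t C(1) by simp
      finally show "norm (f x) \<le> norm (case x of (d, m) \<Rightarrow> (C / t) * (real d * t ^ d) * (real m ^ 4 * t ^ m))"
        by (simp add: x)
    qed
    then have sm: "f summable_on {1..} \<times> {1..}" by (rule abs_summable_summable)
    have row: "((\<lambda>m. f (d, m)) has_sum (real (totient d) * g (t ^ d))) {1..}" if "d \<in> {1..}" for d
      using has_sum_cmult_right[OF g_has_sum[OF td], of d "real (totient d)"] that by (simp add: f_def)
    have rows: "((\<lambda>d. real (totient d) * g (t ^ d)) has_sum infsum f ({1..} \<times> {1..})) {1..}"
      by (rule has_sum_Sigma'[OF has_sum_infsum[OF sm]]) (rule row)
    have "(\<Sum>d=1..B. real (totient d) * g (t ^ d)) \<le> infsum (\<lambda>d. real (totient d) * g (t ^ d)) {1..}"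
      using rows g_low(2) td by (intro finite_sum_le_infsum) (auto simp: summable_on_def intro!: mult_nonneg_nonneg)
    also have "\<dots> = infsum f ({1..} \<times> {1..})" using rows by (rule infsumI)
    also have "\<dots> = infsum (\<lambda>(w, d). real (totient d) * ?L (w div d) * t ^ w) (SIGMA w:{1..}. {d. d dvd w})"
    proof (rule infsum_reindex_bij_witness[of _ "\<lambda>(w, d). (d, w div d)" "\<lambda>(d, m). (d * m, d)"], goal_cases)
      case (4 b)
      then show ?case by (auto elim!: dvdE simp: Suc_le_eq intro: Nat.gr0I)
    qed (auto simp: f_def power_mult)
    also have "\<dots> = infsum (\<lambda>w. a w * t ^ w) {1..}"
    proof -
      have "(\<lambda>(w, d). real (totient d) * ?L (w div d) * t ^ w) summable_on (SIGMA w:{1..}. {d. d dvd w}) \<longleftrightarrow>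
        f summable_on ({1..} \<times> {1..})"
      proof (rule summable_on_reindex_bij_witness[of _ "\<lambda>(d, m). (d * m, d)" "\<lambda>(w, d). (d, w div d)"], goal_cases)
        case (2 b)
        then show ?case by (auto elim!: dvdE simp: Suc_le_eq intro: Nat.gr0I)
      qed (auto simp: f_def power_mult elim!: dvdE)
      with sm have s: "(\<lambda>(w, d). real (totient d) * ?L (w div d) * t ^ w) summable_on (SIGMA w:{1..}. {d. d dvd w})"
        by simp
      have "infsum (\<lambda>(w, d). real (totient d) * ?L (w div d) * t ^ w) (SIGMA w:{1..}. {d. d dvd w})
        = infsum (\<lambda>w. infsum (\<lambda>d. real (totient d) * ?L (w div d) * t ^ w) {d. d dvd w}) {1..}"
        using infsum_Sigma_banach[OF s] by simp
      also have "\<dots> = infsum (\<lambda>w. a w * t ^ w) {1..}"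
        by (rule infsum_cong) (auto simp: a_def finite_divisors_nat sum_distrib_right)
      finally show ?thesis .
    qed
    \<comment> \<open>By hypothesis the coefficients stop at M, so the series is a polynomial, and Q
      bounds it for all t in (0, 1).\<close>
    also have "\<dots> = infsum (\<lambda>w. a w * t ^ w) {1..M}"
      by (rule infsum_cong_neutral) (auto simp: a_def Z)
    also have "\<dots> = (\<Sum>w=1..M. a w * t ^ w)" by simp
    also have "\<dots> \<le> Q"
      unfolding Q_def
    proof (rule sum_mono)
      fix w
      have "a w * t ^ w \<le> \<bar>a w\<bar> * 1"
        using t by (intro mult_mono) (auto intro: power_le_one)
      then show "a w * t ^ w \<le> \<bar>a w\<bar>" by simp
    qed
    finally show ?thesis .
  qed
  \<comment> \<open>Each of the first B terms will be at least (1/2) / (1 + |I|), so B is chosen to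
    make their sum exceed Q.\<close>
  define B where "B = nat \<lceil>2 * (1 + real (card I)) * Q\<rceil> + 1"
  have B: "2 * (1 + real (card I)) * Q < real B" unfolding B_def by linarith
  define n where "n = B * wt i0"
  have n: "0 < n" using wt_pos[OF i0] by (simp add: n_def B_def)
  \<comment> \<open>Since t^n = 1/2 with n = B wt i0, the exponent d wt i0 is at most n for all d
    \<le> B, and the corresponding power of t is still at least 1/2.\<close>
  define t where "t = root n (1 / 2)"
  have t: "0 < t" "t < 1" using n by (auto simp: t_def)
  have tn: "t ^ n = 1 / 2" using n by (simp add: t_def)
  have "(\<Sum>d=1..B. (1 / 2) / (1 + real (card I))) \<le> (\<Sum>d=1..B. real (totient d) * g (t ^ d))"
  proof (rule sum_mono)
    fix d assume d: "d \<in> {1..B}"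
    have td: "0 < t ^ d" "t ^ d < 1" using t d by (auto simp: power_less_one_iff)
    have "1 / 2 \<le> t ^ (d * wt i0)"
      unfolding tn[symmetric] using t d by (intro power_decreasing) (auto simp: n_def)
    then have "1 / 2 \<le> (t ^ d) ^ wt i0" by (simp only: power_mult)
    then have "(1 / 2) / (1 + real (card I)) \<le> (t ^ d) ^ wt i0 / (1 + real (card I))"
      by (rule divide_right_mono) simp
    also note g_low(1)[OF td]
    finally have "(1 / 2) / (1 + real (card I)) \<le> g (t ^ d)" .
    moreover have "1 * g (t ^ d) \<le> real (totient d) * g (t ^ d)"
      using d g_low(2)[OF td] by (intro mult_right_mono) (auto simp: Suc_le_eq)
    ultimately show "(1 / 2) / (1 + real (card I)) \<le> real (totient d) * g (t ^ d)" by simp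
  qed
  also have "\<dots> \<le> Q" by (rule key[OF t])
  finally have "real B \<le> 2 * (1 + real (card I)) * Q" by (simp add: field_simps)
  with B show False by simp
qed

end

section \<open>Vanishing of the augmentation ideal\<close>

context graded_local_algebra
begin

sublocale L: weighted_letters "{Suc 0..D}" gwt
proof
  show "0 < gwt i" if "i \<in> {Suc 0..D}" for i using gwt_pos[of i] that by auto
qed simp

text \<open>The Euler characteristic vanishes in the ambient ring, the necklace count lives in the
  reals. Clearing denominators gives one integer \<open>T\<close> on both sides: \<open>T\<close>
  times the idempotent is zero, hence \<open>T\<close> is zero by characteristic zero.\<close>

lemma cyclic_trace_sum_zero:
  assumes acyc: "W.hoch_acyclic w" and w: "0 < w"
  shows "(\<Sum>n=1..w. (-1) ^ (n - 1) * L.cyc_trace n w) = 0"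
proof -
  define Z :: "nat \<Rightarrow> int" where
    "Z n = (\<Sum>j<n. (-1) ^ ((n - 1) * j) * int (card {u \<in> L.words n w. rotate j u = u}))" for n
  \<comment> \<open>Divisible by every word length from 1 to w + 1 that occurs in the sum.\<close>
  define F :: nat where "F = fact (Suc w)"
  have words: "W.pos_words n w = L.words n w" for n
    by (simp add: W.pos_words_def L.words_def W.wt_word_def)
  have tr: "(\<Sum>u\<in>W.pos_words n w. W.cyc_proj (W.delta u) u) = rinv n * (of_int (Z n) * unit)" for n
  proof -
    have "(\<Sum>u\<in>W.pos_words n w. W.cyc_proj (W.delta u) u)
      = (\<Sum>u\<in>L.words n w. rinv n * (\<Sum>j<n. (-1) ^ ((n - 1) * j) * (if rotate j u = u then unit else 0)))"
      unfolding words by (intro sum.cong refl)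
        (simp add: W.cyc_proj_def W.cyc_def W.rot_def W.delta_def L.words_def)
    also have "\<dots> = rinv n * (\<Sum>j<n. (-1) ^ ((n - 1) * j) * (\<Sum>u\<in>L.words n w. if rotate j u = u then unit else 0))"
      by (simp only: sum_distrib_left[symmetric] sum.swap[of _ "{..<n}"])
    also have "(\<lambda>j. \<Sum>u\<in>L.words n w. if rotate j u = u then unit else 0)
      = (\<lambda>j. of_nat (card {u \<in> L.words n w. rotate j u = u}) * unit)"
      by (intro ext) (simp add: sum.If_cases L.finite_words Int_def conj_commute)
    finally show ?thesis
      by (simp add: Z_def sum_distrib_right mult.assoc)
  qed
  have Fn: "of_nat F * rinv (Suc n) = of_nat (F div Suc n)" if "n \<le> w" for n
  proof -
    have "Suc n dvd F" unfolding F_def using that by (intro dvd_fact) auto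
    then have "of_nat F * rinv (Suc n) = of_nat (F div Suc n) * (of_nat (Suc n) * rinv (Suc n))"
      by (metis dvd_div_mult_self mult.assoc of_nat_mult)
    also have "of_nat (Suc n) * rinv (Suc n) = 1" by (rule W.rinv) simp
    finally show ?thesis by simp
  qed
  define T where "T = (\<Sum>n\<le>w. (-1) ^ n * (int (F div Suc n) * Z (Suc n)))"
  have "of_int T * unit = (\<Sum>n\<le>w. (-1) ^ n * (of_nat F * rinv (Suc n)) * (of_int (Z (Suc n)) * unit))"
    unfolding T_def of_int_sum sum_distrib_right
    by (intro sum.cong refl) (simp add: Fn mult.assoc)
  also have "\<dots> = of_nat F * (\<Sum>n\<le>w. (-1) ^ n * (\<Sum>u\<in>W.pos_words (Suc n) w. W.cyc_proj (W.delta u) u))"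
    unfolding tr sum_distrib_left by (intro sum.cong refl) (simp only: mult_ac)
  also have "\<dots> = 0" unfolding W.cyclic_euler[OF acyc w] by simp
  finally have Tu: "of_int T * unit = 0" .
  have "T = 0"
  proof (rule ccontr)
    assume "T \<noteq> 0"
    then have "of_nat (nat \<bar>T\<bar>) * unit \<noteq> 0" by (intro unit_of_nat) simp
    moreover have "of_nat (nat \<bar>T\<bar>) * unit = (if T < 0 then - (of_int T * unit) else of_int T * unit)"
      by (simp add: of_nat_nat)
    ultimately show False using Tu by (auto split: if_splits)
  qed
  have "real F * (\<Sum>n\<le>w. (-1) ^ n * L.cyc_trace (Suc n) w) = real_of_int T"
    unfolding T_def of_int_sum sum_distrib_left
  proof (intro sum.cong refl)
    fix n assume "n \<in> {..w}"
    then have "Suc n dvd F" unfolding F_def by (intro dvd_fact) auto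
    then have "real F = real (F div Suc n) * real (Suc n)" by (metis dvd_div_mult_self of_nat_mult)
    moreover have "L.cyc_trace (Suc n) w = real_of_int (Z (Suc n)) / real (Suc n)"
      by (simp add: L.cyc_trace_def Z_def)
    ultimately show "real F * ((-1) ^ n * L.cyc_trace (Suc n) w) = real_of_int ((-1) ^ n * (int (F div Suc n) * Z (Suc n)))"
      by simp
  qed
  moreover have "real F \<noteq> 0" by (simp add: F_def del: fact_Suc)
  ultimately have "(\<Sum>n\<le>w. (-1) ^ n * L.cyc_trace (Suc n) w) = 0" using \<open>T = 0\<close> by simp
  also have "(\<Sum>n\<le>w. (-1) ^ n * L.cyc_trace (Suc n) w) = (\<Sum>n=1..Suc w. (-1) ^ (n - 1) * L.cyc_trace n w)"
    by (rule sum.reindex_bij_witness[of _ "\<lambda>n. n - 1" Suc]) auto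
  \<comment> \<open>A word of weight w has at most w letters, so the term at w + 1 is zero.\<close>
  also have "\<dots> = (\<Sum>n=1..w. (-1) ^ (n - 1) * L.cyc_trace n w)"
    by (simp add: L.cyc_trace_def L.words_empty)
  finally show ?thesis .
qed

text \<open>Beyond weight (N + 2) s the Hochschild complex is acyclic, so the convolution vanishes
  there, and \<open>no_letters\<close> empties the set of positive letters.\<close>

lemma D_eq_0:
  assumes univ: "carrier A \<lesssim> (UNIV :: 'u set)"
    and triv: "\<And>n. N < n \<Longrightarrow> trivial_group (HH TYPE('u) K A n)"
  shows "D = 0"
proof -
  have "{Suc 0..D} = {}"
  proof (rule L.no_letters)
    fix w assume w: "(N + 2) * s < w"
    then have "0 < w" by simp
    then show "(\<Sum>d | d dvd w. real (totient d) * fps_nth L.log_deriv (w div d)) = 0"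
      using L.cyc_trace_sum[of w] cyclic_trace_sum_zero[OF hoch_acyclic[OF univ triv w]] by simp
  qed
  then show ?thesis by simp
qed

text \<open>Without positive letters every element is a multiple of 1, and the field supplies the
  inverse of its coefficient.\<close>

lemma left_inverse_if_D_eq_0:
  assumes D: "D = 0" and x: "x \<in> carrier A" "x \<noteq> \<zero>\<^bsub>A\<^esub>"
  shows "\<exists>y\<in>carrier A. y \<otimes>\<^bsub>A\<^esub> x = \<one>\<^bsub>A\<^esub>"
proof -
  define c where "c = crd x 0"
  have c: "c \<in> carrier K" using x by (simp add: c_def)
  have eq: "x = c \<odot>\<^bsub>A\<^esub> \<one>\<^bsub>A\<^esub>"
    using crd(2)[OF x(1)] c by (simp add: comb_def D basis(1) c_def)
  have "c \<noteq> \<zero>\<^bsub>K\<^esub>"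
  proof
    assume "c = \<zero>\<^bsub>K\<^esub>"
    then have "x = \<zero>\<^bsub>A\<^esub>" unfolding eq by (simp add: A.smult_l_null)
    with x(2) show False by contradiction
  qed
  then have inv: "inv\<^bsub>K\<^esub> c \<in> carrier K" "inv\<^bsub>K\<^esub> c \<otimes>\<^bsub>K\<^esub> c = \<one>\<^bsub>K\<^esub>"
    using c K.field_Units by auto
  have "(inv\<^bsub>K\<^esub> c \<odot>\<^bsub>A\<^esub> \<one>\<^bsub>A\<^esub>) \<otimes>\<^bsub>A\<^esub> x = (inv\<^bsub>K\<^esub> c \<otimes>\<^bsub>K\<^esub> c) \<odot>\<^bsub>A\<^esub> \<one>\<^bsub>A\<^esub>"
    using c inv(1) unfolding eq by (simp add: A.smult_mult_left A.smult_mult_right K.m_comm flip: A.smult_assoc1)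
  then have "(inv\<^bsub>K\<^esub> c \<odot>\<^bsub>A\<^esub> \<one>\<^bsub>A\<^esub>) \<otimes>\<^bsub>A\<^esub> x = \<one>\<^bsub>A\<^esub>"
    unfolding inv(2) by (simp add: A.smult_one)
  moreover have "inv\<^bsub>K\<^esub> c \<odot>\<^bsub>A\<^esub> \<one>\<^bsub>A\<^esub> \<in> carrier A" using inv(1) by simp
  ultimately show ?thesis by blast
qed

end

section \<open>Global dimension of division rings\<close>

text \<open>Partial lifts of \<open>f\<close> along \<open>g\<close>, as graphs.\<close>

definition partial_lift ::
    "('r, 'x) ring_scheme \<Rightarrow> ('r, 'u) module \<Rightarrow> ('r, 'u) module \<Rightarrow> ('u \<Rightarrow> 'u) \<Rightarrow> ('u \<Rightarrow> 'u) \<Rightarrow> ('u \<times> 'u) set \<Rightarrow> bool"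
  where "partial_lift R P M g f \<Gamma> \<longleftrightarrow> \<Gamma> \<subseteq> carrier P \<times> carrier M \<and> (\<zero>\<^bsub>P\<^esub>, \<zero>\<^bsub>M\<^esub>) \<in> \<Gamma> \<and>
    (\<forall>x y x' y'. (x, y) \<in> \<Gamma> \<longrightarrow> (x', y') \<in> \<Gamma> \<longrightarrow> (x \<oplus>\<^bsub>P\<^esub> x', y \<oplus>\<^bsub>M\<^esub> y') \<in> \<Gamma>) \<and>
    (\<forall>r x y. r \<in> carrier R \<longrightarrow> (x, y) \<in> \<Gamma> \<longrightarrow> (r \<odot>\<^bsub>P\<^esub> x, r \<odot>\<^bsub>M\<^esub> y) \<in> \<Gamma>) \<and>
    (\<forall>y. (\<zero>\<^bsub>P\<^esub>, y) \<in> \<Gamma> \<longrightarrow> y = \<zero>\<^bsub>M\<^esub>) \<and> (\<forall>x y. (x, y) \<in> \<Gamma> \<longrightarrow> g y = f x)"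

lemma partial_liftD:
  assumes "partial_lift R P M g f \<Gamma>"
  shows "\<Gamma> \<subseteq> carrier P \<times> carrier M" "(\<zero>\<^bsub>P\<^esub>, \<zero>\<^bsub>M\<^esub>) \<in> \<Gamma>"
    and "(x, y) \<in> \<Gamma> \<Longrightarrow> (x', y') \<in> \<Gamma> \<Longrightarrow> (x \<oplus>\<^bsub>P\<^esub> x', y \<oplus>\<^bsub>M\<^esub> y') \<in> \<Gamma>"
    and "r \<in> carrier R \<Longrightarrow> (x, y) \<in> \<Gamma> \<Longrightarrow> (r \<odot>\<^bsub>P\<^esub> x, r \<odot>\<^bsub>M\<^esub> y) \<in> \<Gamma>"
    and "(\<zero>\<^bsub>P\<^esub>, y) \<in> \<Gamma> \<Longrightarrow> y = \<zero>\<^bsub>M\<^esub>" "(x, y) \<in> \<Gamma> \<Longrightarrow> g y = f x"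
proof -
  note c = assms[unfolded partial_lift_def]
  note c1 = conjunct2[OF c] and c2 = conjunct2[OF conjunct2[OF c]]
  note c3 = conjunct2[OF c2] and c4 = conjunct2[OF conjunct2[OF c2]]
  show "\<Gamma> \<subseteq> carrier P \<times> carrier M" "(\<zero>\<^bsub>P\<^esub>, \<zero>\<^bsub>M\<^esub>) \<in> \<Gamma>"
    by (rule conjunct1[OF c], rule conjunct1[OF c1])
  show "(x, y) \<in> \<Gamma> \<Longrightarrow> (x', y') \<in> \<Gamma> \<Longrightarrow> (x \<oplus>\<^bsub>P\<^esub> x', y \<oplus>\<^bsub>M\<^esub> y') \<in> \<Gamma>"
    by (rule conjunct1[OF c2, rule_format])
  show "r \<in> carrier R \<Longrightarrow> (x, y) \<in> \<Gamma> \<Longrightarrow> (r \<odot>\<^bsub>P\<^esub> x, r \<odot>\<^bsub>M\<^esub> y) \<in> \<Gamma>"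
    by (rule conjunct1[OF c3, rule_format])
  show "(\<zero>\<^bsub>P\<^esub>, y) \<in> \<Gamma> \<Longrightarrow> y = \<zero>\<^bsub>M\<^esub>" "(x, y) \<in> \<Gamma> \<Longrightarrow> g y = f x"
    by (rule conjunct1[OF c4, rule_format], assumption, rule conjunct2[OF c4, rule_format], assumption)
qed

text \<open>Zorn's lemma for partial lifts takes the place of a choice of basis. A maximal partial
  lift is total: an element x outside its domain could be sent to any m with g m = f x, and left
  inverses of scalars keep this extension single-valued.\<close>

lemma projective_over_division_ring:
  fixes P :: "('r, 'u) module"
  assumes P: "left_module R P"
    and inverse: "\<And>r. r \<in> carrier R \<Longrightarrow> r \<noteq> \<zero>\<^bsub>R\<^esub> \<Longrightarrow> \<exists>r'\<in>carrier R. r' \<otimes>\<^bsub>R\<^esub> r = \<one>\<^bsub>R\<^esub>"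
  shows "projective_module R P"
proof -
  interpret P: left_module R P by (rule P)
  have "\<exists>h\<in>lmod_hom R P M. \<forall>x\<in>carrier P. g (h x) = f x"
    if M: "left_module R M" and N: "left_module R N"
      and g: "g \<in> lmod_hom R M N" "g ` carrier M = carrier N" and f: "f \<in> lmod_hom R P N"
    for M N :: "('r, 'u) module" and g f
  proof -
    interpret M: left_module R M by (rule M)
    interpret N: left_module R N by (rule N)
    let ?A = "Collect (partial_lift R P M g f)"
    have "partial_lift R P M g f {(\<zero>\<^bsub>P\<^esub>, \<zero>\<^bsub>M\<^esub>)}"
      by (auto simp: partial_lift_def P.smult_r_null M.smult_r_null lmod_hom_zero[OF M N g(1)] lmod_hom_zero[OF P N f])
    then have "?A \<noteq> {}" by blast
    moreover have "\<Union>C \<in> ?A" if C: "C \<noteq> {}" "subset.chain ?A C" for C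
    proof -
      have lift: "partial_lift R P M g f \<Gamma>" if "\<Gamma> \<in> C" for \<Gamma>
        using C(2) that by (auto simp: subset.chain_def)
      have common: "\<exists>\<Gamma>\<in>C. p \<in> \<Gamma> \<and> q \<in> \<Gamma>" if pq: "p \<in> \<Union>C" "q \<in> \<Union>C" for p q
      proof -
        obtain X Y where XY: "X \<in> C" "Y \<in> C" "p \<in> X" "q \<in> Y" using pq by blast
        then have "X \<subseteq> Y \<or> Y \<subseteq> X" using C(2) unfolding subset_chain_def by blast
        with XY show ?thesis by blast
      qed
      show ?thesis
        unfolding mem_Collect_eq partial_lift_def
      proof (intro conjI allI impI)
        show "\<Union>C \<subseteq> carrier P \<times> carrier M" using partial_liftD(1)[OF lift] by blast
        show "(\<zero>\<^bsub>P\<^esub>, \<zero>\<^bsub>M\<^esub>) \<in> \<Union>C" using partial_liftD(2)[OF lift] C(1) by blast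
        fix x y x' y' assume xy: "(x, y) \<in> \<Union>C" "(x', y') \<in> \<Union>C"
        obtain \<Gamma> where \<Gamma>: "\<Gamma> \<in> C" "(x, y) \<in> \<Gamma>" "(x', y') \<in> \<Gamma>" using common[OF xy] by blast
        show "(x \<oplus>\<^bsub>P\<^esub> x', y \<oplus>\<^bsub>M\<^esub> y') \<in> \<Union>C" by (rule UnionI[OF \<Gamma>(1) partial_liftD(3)[OF lift[OF \<Gamma>(1)] \<Gamma>(2,3)]])
      next
        fix r x y assume r: "r \<in> carrier R" and "(x, y) \<in> \<Union>C"
        then obtain \<Gamma> where \<Gamma>: "\<Gamma> \<in> C" "(x, y) \<in> \<Gamma>" by blast
        show "(r \<odot>\<^bsub>P\<^esub> x, r \<odot>\<^bsub>M\<^esub> y) \<in> \<Union>C" by (rule UnionI[OF \<Gamma>(1) partial_liftD(4)[OF lift[OF \<Gamma>(1)] r \<Gamma>(2)]])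
      next
        fix y assume "(\<zero>\<^bsub>P\<^esub>, y) \<in> \<Union>C"
        then obtain \<Gamma> where \<Gamma>: "\<Gamma> \<in> C" "(\<zero>\<^bsub>P\<^esub>, y) \<in> \<Gamma>" by blast
        show "y = \<zero>\<^bsub>M\<^esub>" by (rule partial_liftD(5)[OF lift[OF \<Gamma>(1)] \<Gamma>(2)])
      next
        fix x y assume "(x, y) \<in> \<Union>C"
        then obtain \<Gamma> where \<Gamma>: "\<Gamma> \<in> C" "(x, y) \<in> \<Gamma>" by blast
        show "g y = f x" by (rule partial_liftD(6)[OF lift[OF \<Gamma>(1)] \<Gamma>(2)])
      qed
    qed
    ultimately obtain \<Gamma> where "\<Gamma> \<in> ?A" and max: "\<And>\<Delta>. \<Delta> \<in> ?A \<Longrightarrow> \<Gamma> \<subseteq> \<Delta> \<Longrightarrow> \<Delta> = \<Gamma>"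
      using subset_Zorn_nonempty[of ?A] by blast
    then have \<Gamma>: "partial_lift R P M g f \<Gamma>" by simp
    note \<Gamma>D = partial_liftD[OF \<Gamma>]
    have sub: "x \<in> carrier P \<and> y \<in> carrier M" if "(x, y) \<in> \<Gamma>" for x y using \<Gamma>D(1) that by blast
    note zero = \<Gamma>D(2) and add = \<Gamma>D(3) and smult = \<Gamma>D(4) and single = \<Gamma>D(5) and lift = \<Gamma>D(6)
    have unique: "y = y'" if xy: "(x, y) \<in> \<Gamma>" "(x, y') \<in> \<Gamma>" for x y y'
    proof -
      have "(x \<oplus>\<^bsub>P\<^esub> (\<ominus>\<^bsub>R\<^esub> \<one>\<^bsub>R\<^esub>) \<odot>\<^bsub>P\<^esub> x, y \<oplus>\<^bsub>M\<^esub> (\<ominus>\<^bsub>R\<^esub> \<one>\<^bsub>R\<^esub>) \<odot>\<^bsub>M\<^esub> y') \<in> \<Gamma>"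
        using xy by (intro add smult) auto
      then have "y \<oplus>\<^bsub>M\<^esub> \<ominus>\<^bsub>M\<^esub> y' = \<zero>\<^bsub>M\<^esub>"
        using single sub[OF xy(1)] sub[OF xy(2)] by (simp add: P.smult_minus_one M.smult_minus_one P.M.r_neg)
      then show ?thesis using sub[OF xy(1)] sub[OF xy(2)] by (metis M.M.add.inv_closed M.M.minus_equality M.M.minus_minus)
    qed
    have total: "\<exists>y. (x, y) \<in> \<Gamma>" if x: "x \<in> carrier P" for x
    proof (rule ccontr)
      assume nx: "\<nexists>y. (x, y) \<in> \<Gamma>"
      have "f x \<in> g ` carrier M" unfolding g(2) by (rule lmod_homD(1)[OF f x])
      then obtain m where m: "m \<in> carrier M" "g m = f x" by auto
      \<comment> \<open>The graph of the extension to the submodule generated by the old domain and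
        x, with x sent to m.\<close>
      define \<Delta> where "\<Delta> = {(p \<oplus>\<^bsub>P\<^esub> r \<odot>\<^bsub>P\<^esub> x, y \<oplus>\<^bsub>M\<^esub> r \<odot>\<^bsub>M\<^esub> m) | p y r. (p, y) \<in> \<Gamma> \<and> r \<in> carrier R}"
      have \<Delta>I: "(u, v) \<in> \<Delta>" if "(p, y) \<in> \<Gamma>" "r \<in> carrier R" "u = p \<oplus>\<^bsub>P\<^esub> r \<odot>\<^bsub>P\<^esub> x" "v = y \<oplus>\<^bsub>M\<^esub> r \<odot>\<^bsub>M\<^esub> m" for p y r u v
        unfolding \<Delta>_def using that by blast
      have "partial_lift R P M g f \<Delta>"
        unfolding partial_lift_def
      proof (intro conjI allI impI)
        show "\<Delta> \<subseteq> carrier P \<times> carrier M"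
          unfolding \<Delta>_def using sub x m(1) by (auto simp: P.smult_closed M.smult_closed)
        show "(\<zero>\<^bsub>P\<^esub>, \<zero>\<^bsub>M\<^esub>) \<in> \<Delta>"
          by (rule \<Delta>I[OF zero P.R.zero_closed]) (simp_all add: P.smult_l_null[OF x] M.smult_l_null[OF m(1)])
      next
        fix u v u' v' assume "(u, v) \<in> \<Delta>" "(u', v') \<in> \<Delta>"
        then obtain p y r p' y' r' where
          p: "(p, y) \<in> \<Gamma>" "r \<in> carrier R" "u = p \<oplus>\<^bsub>P\<^esub> r \<odot>\<^bsub>P\<^esub> x" "v = y \<oplus>\<^bsub>M\<^esub> r \<odot>\<^bsub>M\<^esub> m" and
          p': "(p', y') \<in> \<Gamma>" "r' \<in> carrier R" "u' = p' \<oplus>\<^bsub>P\<^esub> r' \<odot>\<^bsub>P\<^esub> x" "v' = y' \<oplus>\<^bsub>M\<^esub> r' \<odot>\<^bsub>M\<^esub> m"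
          unfolding \<Delta>_def by blast
        show "(u \<oplus>\<^bsub>P\<^esub> u', v \<oplus>\<^bsub>M\<^esub> v') \<in> \<Delta>"
          by (rule \<Delta>I[OF add[OF p(1) p'(1)] P.R.a_closed[OF p(2) p'(2)]])
            (use p(2-4) p'(2-4) sub[OF p(1)] sub[OF p'(1)] x m(1) in
              \<open>simp_all add: P.smult_closed M.smult_closed P.smult_l_distr M.smult_l_distr P.M.a_ac M.M.a_ac\<close>)
      next
        fix t u v assume t: "t \<in> carrier R" and "(u, v) \<in> \<Delta>"
        then obtain p y r where
          p: "(p, y) \<in> \<Gamma>" "r \<in> carrier R" "u = p \<oplus>\<^bsub>P\<^esub> r \<odot>\<^bsub>P\<^esub> x" "v = y \<oplus>\<^bsub>M\<^esub> r \<odot>\<^bsub>M\<^esub> m"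
          unfolding \<Delta>_def by blast
        show "(t \<odot>\<^bsub>P\<^esub> u, t \<odot>\<^bsub>M\<^esub> v) \<in> \<Delta>"
          by (rule \<Delta>I[OF smult[OF t p(1)] P.R.m_closed[OF t p(2)]])
            (use t p(2-4) sub[OF p(1)] x m(1) in
              \<open>simp_all add: P.smult_closed M.smult_closed P.smult_r_distr M.smult_r_distr P.smult_assoc M.smult_assoc\<close>)
      next
        fix v assume "(\<zero>\<^bsub>P\<^esub>, v) \<in> \<Delta>"
        then obtain p y r where
          p: "(p, y) \<in> \<Gamma>" "r \<in> carrier R" "\<zero>\<^bsub>P\<^esub> = p \<oplus>\<^bsub>P\<^esub> r \<odot>\<^bsub>P\<^esub> x" "v = y \<oplus>\<^bsub>M\<^esub> r \<odot>\<^bsub>M\<^esub> m"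
          unfolding \<Delta>_def by blast
        have rx: "r \<odot>\<^bsub>P\<^esub> x \<in> carrier P" by (rule P.smult_closed[OF p(2) x])
        \<comment> \<open>Otherwise r x lies in the old domain, and multiplying by a left inverse of
          r would put x there too.\<close>
        have "r = \<zero>\<^bsub>R\<^esub>"
        proof (rule ccontr)
          assume "r \<noteq> \<zero>\<^bsub>R\<^esub>"
          then obtain r' where r': "r' \<in> carrier R" "r' \<otimes>\<^bsub>R\<^esub> r = \<one>\<^bsub>R\<^esub>" using inverse p(2) by blast
          have "r \<odot>\<^bsub>P\<^esub> x = \<ominus>\<^bsub>P\<^esub> p"
            using p(3) rx sub[OF p(1)] by (metis P.M.minus_equality P.M.add.m_comm)
          then have "r \<odot>\<^bsub>P\<^esub> x = (\<ominus>\<^bsub>R\<^esub> \<one>\<^bsub>R\<^esub>) \<odot>\<^bsub>P\<^esub> p" using sub[OF p(1)] by (simp add: P.smult_minus_one)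
          then have "(r \<odot>\<^bsub>P\<^esub> x, (\<ominus>\<^bsub>R\<^esub> \<one>\<^bsub>R\<^esub>) \<odot>\<^bsub>M\<^esub> y) \<in> \<Gamma>" using smult[OF _ p(1), of "\<ominus>\<^bsub>R\<^esub> \<one>\<^bsub>R\<^esub>"] by simp
          from smult[OF r'(1) this] show False
            using nx r' p(2) x by (simp flip: P.smult_assoc add: P.smult_one)
        qed
        then have "p = \<zero>\<^bsub>P\<^esub>" "v = y"
          using p(3,4) sub[OF p(1)] by (simp_all add: P.smult_l_null[OF x] M.smult_l_null[OF m(1)])
        then show "v = \<zero>\<^bsub>M\<^esub>" using p(1) single by simp
      next
        fix u v assume "(u, v) \<in> \<Delta>"
        then obtain p y r where
          p: "(p, y) \<in> \<Gamma>" "r \<in> carrier R" "u = p \<oplus>\<^bsub>P\<^esub> r \<odot>\<^bsub>P\<^esub> x" "v = y \<oplus>\<^bsub>M\<^esub> r \<odot>\<^bsub>M\<^esub> m"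
          unfolding \<Delta>_def by blast
        then show "g v = f u"
          using sub[OF p(1)] x m lift[OF p(1)]
          by (simp add: lmod_homD(2,3)[OF g(1)] lmod_homD(2,3)[OF f] P.smult_closed M.smult_closed)
      qed
      moreover have "\<Gamma> \<subseteq> \<Delta>"
      proof (rule subrelI)
        fix p y assume p: "(p, y) \<in> \<Gamma>"
        show "(p, y) \<in> \<Delta>"
          by (rule \<Delta>I[OF p P.R.zero_closed]) (use sub[OF p] in \<open>simp_all add: P.smult_l_null[OF x] M.smult_l_null[OF m(1)]\<close>)
      qed
      moreover have "(x, m) \<in> \<Delta>"
        by (rule \<Delta>I[OF zero P.R.one_closed]) (simp_all add: P.smult_one M.smult_one x m(1))
      ultimately show False using max[of \<Delta>] nx by blast
    qed
    then obtain h where h: "\<And>x. x \<in> carrier P \<Longrightarrow> (x, h x) \<in> \<Gamma>" by metis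
    show ?thesis
    proof (intro bexI ballI)
      show "h \<in> lmod_hom R P M"
      proof (rule lmod_homI)
        fix x y assume xy: "x \<in> carrier P" "y \<in> carrier P"
        show "h (x \<oplus>\<^bsub>P\<^esub> y) = h x \<oplus>\<^bsub>M\<^esub> h y"
          by (rule unique[OF h add[OF h h]]) (use xy in auto)
      next
        fix r x assume rx: "r \<in> carrier R" "x \<in> carrier P"
        show "h (r \<odot>\<^bsub>P\<^esub> x) = r \<odot>\<^bsub>M\<^esub> h x"
          by (rule unique[OF h smult[OF rx(1) h]]) (use rx in \<open>auto simp: P.smult_closed\<close>)
      qed (use sub h in blast)
      show "g (h x) = f x" if "x \<in> carrier P" for x by (rule lift[OF h[OF that]])
    qed
  qed
  with P show ?thesis unfolding projective_module_def by blast
qed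

text \<open>Every module is projective and hence a resolution of itself, of length 0.\<close>

lemma gldim_division_ring:
  fixes R :: "('r, 'x) ring_scheme"
  assumes inverse: "\<And>r. r \<in> carrier R \<Longrightarrow> r \<noteq> \<zero>\<^bsub>R\<^esub> \<Longrightarrow> \<exists>r'\<in>carrier R. r' \<otimes>\<^bsub>R\<^esub> r = \<one>\<^bsub>R\<^esub>"
  shows "gldim TYPE('u) R = 0"
proof -
  have "projdim R M \<le> 0" if M: "left_module R M" for M :: "('r, 'u) module"
  proof -
    interpret M: left_module R M by (rule M)
    \<comment> \<open>The zero module for positive degrees keeps the operations of M, so all zeros
      in the resolution are literally the same element.\<close>
    let ?Z = "M\<lparr>carrier := {\<zero>\<^bsub>M\<^esub>}\<rparr>"
    let ?P = "\<lambda>n. if n = 0 then M else ?Z"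
    have Z: "left_module R ?Z"
      by (rule left_module_sub[OF M]) (auto simp: M.smult_r_null)
    have "projective_resolution R M ?P (\<lambda>n x. \<zero>\<^bsub>M\<^esub>) (\<lambda>x. x)"
      unfolding projective_resolution_def
      by (auto simp: projective_over_division_ring[OF M inverse] projective_over_division_ring[OF Z inverse]
          M.smult_r_null intro!: lmod_homI)
    then have "enat 0 \<in> {enat n | n. \<exists>(P :: nat \<Rightarrow> ('r, 'u) module) d e.
        projective_resolution R M P d e \<and> (\<forall>i > n. carrier (P i) = {\<zero>\<^bsub>P i\<^esub>})}"
      by (intro CollectI exI[of _ 0] conjI exI[of _ ?P]) auto
    then show ?thesis unfolding projdim_def zero_enat_def by (rule Inf_lower)
  qed
  then have "gldim TYPE('u) R \<le> 0" unfolding gldim_def by (intro Sup_least) auto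
  then show ?thesis by simp
qed

theorem theorem4p5:
  fixes K :: "'k ring" and A :: "('k, 'a) module"
    and G :: "nat \<Rightarrow> 'a set" and s :: nat
  assumes "field K" and "char_zero K"
    and "assoc_algebra K A" and "finitely_spanned K A"
    and "graded_algebra K A G s"
    and A0: "G 0 = {c \<odot>\<^bsub>A\<^esub> \<one>\<^bsub>A\<^esub> | c. c \<in> carrier K}" and "\<one>\<^bsub>A\<^esub> \<noteq> \<zero>\<^bsub>A\<^esub>"
    and universe: "carrier A \<lesssim> (UNIV :: 'u set)"
    and "gldim TYPE('u) A = \<infinity>"
  shows "hhdim TYPE('u) K A = \<infinity>"
proof (rule ccontr)
  interpret graded_local_algebra K A G s
    using assms by (intro graded_local_algebra.intro)
  assume "hhdim TYPE('u) K A \<noteq> \<infinity>"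
  then obtain N where N: "hhdim TYPE('u) K A = enat N" by blast
  have "trivial_group (HH TYPE('u) K A n)" if n: "N < n" for n
  proof (rule ccontr)
    assume "\<not> trivial_group (HH TYPE('u) K A n)"
    then have "enat n \<le> hhdim TYPE('u) K A"
      unfolding hhdim_def by (intro Sup_upper) blast
    then show False using n by (simp add: N)
  qed
  from D_eq_0[OF universe this] have "D = 0" .
  then have "gldim TYPE('u) A = 0"
    by (intro gldim_division_ring left_inverse_if_D_eq_0)
  with \<open>gldim TYPE('u) A = \<infinity>\<close> show False by simp
qed

end
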